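(* The categorical localization $\mathbf{HDTS}[\underline{\mathrm{Cub}}^{-1}]$ of the category $\mathbf{HDTS}$ of higher dimensional transition systems by the maps $f$ such that $\underline{\mathrm{Cub}}(f)$ is an isomorphism is equivalent to a full reflective locally finitely presentable subcategory of the category $\square_S^{op}\mathbf{Set}\downarrow{!^S\Sigma}$ of labelled symmetric precubical sets.
   Context: $\Sigma$ is a fixed nonempty set of labels. A weak higher dimensional transition system is a triple $(S,\mu:L\to\Sigma,T=\bigcup_{n\ge1}T_n)$ with $S$ a set (states), $L$ a set (actions), $\mu$ a set map (labelling map) and $T_n\subset S\times L^n\times S$ ($n$-transitions) such that: - (Multiset axiom) for every permutation $\sigma$ of $\{1,\dots,n\}$, $n\ge2$, if $(\alpha,u_1,\dots,u_n,\beta)\in T$ then $(\alpha,u_{\sigma(1)},\dots,u_{\sigma(n)},\beta)\in T$; - (Coherence axiom) for $n\ge3$, $p,q\ge1$ with $p+q<n$, if $(\alpha,u_1,\dots,u_n,\beta)$, $(\alpha,u_1,\dots,u_p,\nu_1)$, $(\nu_1,u_{p+1},\dots,u_n,\beta)$, $(\alpha,u_1,\dots,u_{p+q},\nu_2)$, $(\nu_2,u_{p+q+1},\dots,u_n,\beta)$ are transitions, then $(\nu_1,u_{p+1},\dots,u_{p+q},\nu_2)$ is a transition. A morphism $f$ consists of a map $f_0$ on states and a map $\widetilde f$ on actions commuting with the labelling maps, such that $(f_0(\alpha),\widetilde f(u_1),\dots,\widetilde f(u_n),f_0(\beta))$ is a transition whenever $(\alpha,u_1,\dots,u_n,\beta)$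 is. The category is $\mathbf{WHDTS}$. A higher dimensional transition system is a triple $(S,\mu:L\to\Sigma,T=\bigcup_{n\ge 1}T_n)$ with $T_n\subset S\times L^n\times S$ satisfying the Multiset axiom and: - (CSA1) if $(\alpha,u,\beta)$ and $(\alpha,u',\beta)$ are transitions and $\mu(u)=\mu(u')$ then $u=u'$; - (CSA2) for every $n\ge2$, $1\le p<n$ and transition $(\alpha,u_1,\dots,u_n,\beta)$, there exist a unique state $\nu_1$ and a unique state $\nu_2$ such that $(\alpha,u_1,\dots,u_p,\nu_1)$, $(\nu_1,u_{p+1},\dots,u_n,\beta)$, $(\alpha,u_{p+1},\dots,u_n,\nu_2)$, $(\nu_2,u_1,\dots,u_p,\beta)$ are transitions; - (CSA3) for all states $\alpha,\beta,\nu_1,\nu_2,\nu_1',\nu_2'$, actions $u_1,\dots,u_n$ and $p,q\ge1$ with $p+q<n$, if $(\alpha,u_1,\dots,u_n,\beta)$, $(\alpha,u_1,\dots,u_p,\nu_1)$, $(\nu_1,u_{p+1},\dots,u_n,\beta)$, $(\nu_1,u_{p+1},\dots,u_{p+q},\nu_2)$, $(\nu_2,u_{p+q+1},\dots,u_n,\beta)$, $(\alpha,u_1,\dots,u_{p+q},\nu_2')$, $(\nu_2',u_{p+q+1},\dots,u_n,\beta)$, $(\alpha,u_1,\dots,u_p,\nu_1')$, $(\nu_1',u_{p+1},\dots,u_{p+q},\nu_2')$ are transitions, then $\nu_1=\nu_1'$ and $\nu_2=\nu_2'$. Every higher dimensional transition system is a weak one; $\mathbf{HDTS}$ is the full subcategory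 of $\mathbf{WHDTS}$ of higher dimensional transition systems. For $n\ge0$ and $a_1,\dots,a_n\in\Sigma$, the cube $C_n[a_1,\dots,a_n]$ has set of states $\{0,1\}^n$ (a singleton for $n=0$), set of actions $\{(a_1,1),\dots,(a_n,n)\}$, labelling $\mu(a_i,i)=a_i$, and its $d$-transitions ($d\ge1$) are the tuples $((\epsilon_1,\dots,\epsilon_n),(a_{i_1},i_1),\dots,(a_{i_d},i_d),(\epsilon_1',\dots,\epsilon_n'))$ with $i_1,\dots,i_d$ pairwise distinct, $\epsilon_i\le\epsilon_i'$ for all $i$, and $\epsilon_i\ne\epsilon_i'$ iff $i\in\{i_1,\dots,i_d\}$. The cubification of $X\in\mathbf{WHDTS}$ is $\underline{\mathrm{Cub}}(X)=\varinjlim_{C_n[a_1,\dots,a_n]\to X}C_n[a_1,\dots,a_n]$, the colimit being taken in $\mathbf{WHDTS}$ over the category of all cubes $C_n[a_1,\dots,a_n]\to X$ over $X$ ($n\ge0$, $a_i\in\Sigma$); this is functorial in $X$. $\square_S$ is the category with objects $[n]=\{0,1\}^n$, $n\ge0$, whose morphisms are the set maps generated by the face maps $\delta_i^\alpha(\epsilon_1,\dots,\epsilon_{n-1})=(\epsilon_1,\dots,\epsilon_{i-1},\alpha,\epsilon_i,\dots,\epsilon_{n-1})$ ($\alpha\in\{0,1\}$) and the symmetry maps $\sigma_i:[n]\to[n]$ exchanging coordinates $i$ and $i+1$. A symmetric precubical set is a presheaf on $\square_S$. The symmetric precubical set $!^S\Sigma$ has $(!^S\Sigma)_n=\Sigma^n$,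 where $(\delta_i^0)^*=(\delta_i^1)^*$ removes the $i$-th letter and $\sigma_i^*$ exchanges letters $i$ and $i+1$. A labelled symmetric precubical set is an object of the comma category $\square_S^{op}\mathbf{Set}\downarrow{!^S\Sigma}$. *)

theory Defs
  imports "HOL-Library.FuncSet" "HOL-Combinatorics.Permutations"
begin

unbundle cardinal_syntax

section \<open>Universe of small sets\<close>

text \<open>
  Sets are the subsets of a fixed type \<open>'u\<close> whose cardinality is smaller than that of \<open>'u\<close>, where
  the cardinality \<open>\<kappa>\<close> of \<open>'u\<close> is uncountable and regular. If \<open>\<kappa>\<close> is moreover a strong limit, these
  are, up to bijection, the elements of a Grothendieck universe; that is not required here.
\<close>

definition universe :: "'u itself \<Rightarrow> bool" where
  "universe _ \<longleftrightarrow> natLeq <o |UNIV :: 'u set| \<and> regularCard |UNIV :: 'u set|"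

definition small :: "'u itself \<Rightarrow> 'b set \<Rightarrow> bool" where
  "small _ A \<longleftrightarrow> |A| <o |UNIV :: 'u set|"

text \<open>
  Concrete sets such as \<open>{0,1}\<^sup>n\<close> or \<open>\<Sigma>\<^sup>n\<close> are transported into \<open>'u\<close> along a fixed injection. It
  is used for \<open>'b\<close> among \<^typ>\<open>bool list\<close>, \<^typ>\<open>'u \<times> nat\<close> and \<^typ>\<open>'u list\<close>, for which an
  injection exists as soon as \<open>'u\<close> is infinite.
\<close>

definition code :: "'b \<Rightarrow> 'u" where
  "code = (SOME f. inj f)"


section \<open>Categories\<close>

text \<open>\<open>Comp C g f\<close> is the composite of \<open>f\<close> followed by \<open>g\<close>, meaningful when \<open>Cod C f = Dom C g\<close>.\<close>

record ('o, 'm) cat =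
  Ob :: "'o set"
  Ar :: "'m set"
  Dom :: "'m \<Rightarrow> 'o"
  Cod :: "'m \<Rightarrow> 'o"
  Id :: "'o \<Rightarrow> 'm"
  Comp :: "'m \<Rightarrow> 'm \<Rightarrow> 'm"

definition is_category :: "('o, 'm) cat \<Rightarrow> bool" where
  "is_category C \<longleftrightarrow>
     (\<forall>f\<in>Ar C. Dom C f \<in> Ob C \<and> Cod C f \<in> Ob C) \<and>
     (\<forall>X\<in>Ob C. Id C X \<in> Ar C \<and> Dom C (Id C X) = X \<and> Cod C (Id C X) = X) \<and>
     (\<forall>f\<in>Ar C. \<forall>g\<in>Ar C. Cod C f = Dom C g \<longrightarrow>
        Comp C g f \<in> Ar C \<and> Dom C (Comp C g f) = Dom C f \<and> Cod C (Comp C g f) = Cod C g) \<and>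
     (\<forall>f\<in>Ar C. Comp C f (Id C (Dom C f)) = f \<and> Comp C (Id C (Cod C f)) f = f) \<and>
     (\<forall>f\<in>Ar C. \<forall>g\<in>Ar C. \<forall>h\<in>Ar C. Cod C f = Dom C g \<longrightarrow> Cod C g = Dom C h \<longrightarrow>
        Comp C h (Comp C g f) = Comp C (Comp C h g) f)"

definition hom :: "('o, 'm) cat \<Rightarrow> 'o \<Rightarrow> 'o \<Rightarrow> 'm set" where
  "hom C X Y = {f \<in> Ar C. Dom C f = X \<and> Cod C f = Y}"

definition is_iso :: "('o, 'm) cat \<Rightarrow> 'm \<Rightarrow> bool" where
  "is_iso C f \<longleftrightarrow> f \<in> Ar C \<and>
     (\<exists>g\<in>hom C (Cod C f) (Dom C f). Comp C g f = Id C (Dom C f) \<and> Comp C f g = Id C (Cod C f))"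

definition full_subcat :: "('o, 'm) cat \<Rightarrow> 'o set \<Rightarrow> ('o, 'm) cat" where
  "full_subcat C P = C\<lparr>Ob := Ob C \<inter> P, Ar := {f \<in> Ar C. Dom C f \<in> P \<and> Cod C f \<in> P}\<rparr>"

definition opposite :: "('o, 'm) cat \<Rightarrow> ('o, 'm) cat" where
  "opposite C = C\<lparr>Dom := Cod C, Cod := Dom C, Comp := (\<lambda>g f. Comp C f g)\<rparr>"

text \<open>The slice over \<open>X\<close>: an arrow \<open>(f, u, g)\<close> is a commutative triangle \<open>f = g \<circ> u\<close>.\<close>

definition slice :: "('o, 'm) cat \<Rightarrow> 'o \<Rightarrow> ('m, 'm \<times> 'm \<times> 'm) cat" where
  "slice C X =
     \<lparr>Ob = {f \<in> Ar C. Cod C f = X},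
      Ar = {(f, u, g). f \<in> Ar C \<and> Cod C f = X \<and> g \<in> Ar C \<and> Cod C g = X \<and>
                       u \<in> hom C (Dom C f) (Dom C g) \<and> Comp C g u = f},
      Dom = (\<lambda>(f, u, g). f),
      Cod = (\<lambda>(f, u, g). g),
      Id = (\<lambda>f. (f, Id C (Dom C f), f)),
      Comp = (\<lambda>(f', v, g') (f, u, g). (f, Comp C v u, g'))\<rparr>"


section \<open>Functors, equivalences, reflections\<close>

type_synonym ('o, 'm, 'p, 'n) fctr = "('o \<Rightarrow> 'p) \<times> ('m \<Rightarrow> 'n)"

definition is_functor ::
    "('o, 'm) cat \<Rightarrow> ('p, 'n) cat \<Rightarrow> ('o, 'm, 'p, 'n) fctr \<Rightarrow> bool" where
  "is_functor C D F \<longleftrightarrow> is_category C \<and> is_category D \<and>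
     (\<forall>X\<in>Ob C. fst F X \<in> Ob D) \<and>
     (\<forall>f\<in>Ar C. snd F f \<in> hom D (fst F (Dom C f)) (fst F (Cod C f))) \<and>
     (\<forall>X\<in>Ob C. snd F (Id C X) = Id D (fst F X)) \<and>
     (\<forall>f\<in>Ar C. \<forall>g\<in>Ar C. Cod C f = Dom C g \<longrightarrow>
        snd F (Comp C g f) = Comp D (snd F g) (snd F f))"

definition id_functor :: "('o, 'm, 'o, 'm) fctr" where
  "id_functor = (\<lambda>X. X, \<lambda>f. f)"

definition comp_functor ::
    "('p, 'n, 'q, 'k) fctr \<Rightarrow> ('o, 'm, 'p, 'n) fctr \<Rightarrow> ('o, 'm, 'q, 'k) fctr" where
  "comp_functor G F = (fst G \<circ> fst F, snd G \<circ> snd F)"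

definition is_nat_trans :: "('o, 'm) cat \<Rightarrow> ('p, 'n) cat \<Rightarrow>
    ('o, 'm, 'p, 'n) fctr \<Rightarrow> ('o, 'm, 'p, 'n) fctr \<Rightarrow> ('o \<Rightarrow> 'n) \<Rightarrow> bool" where
  "is_nat_trans C D F G \<eta> \<longleftrightarrow> is_functor C D F \<and> is_functor C D G \<and>
     (\<forall>X\<in>Ob C. \<eta> X \<in> hom D (fst F X) (fst G X)) \<and>
     (\<forall>f\<in>Ar C. Comp D (\<eta> (Cod C f)) (snd F f) = Comp D (snd G f) (\<eta> (Dom C f)))"

definition naturally_isomorphic :: "('o, 'm) cat \<Rightarrow> ('p, 'n) cat \<Rightarrow>
    ('o, 'm, 'p, 'n) fctr \<Rightarrow> ('o, 'm, 'p, 'n) fctr \<Rightarrow> bool" where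
  "naturally_isomorphic C D F G \<longleftrightarrow>
     (\<exists>\<eta>. is_nat_trans C D F G \<eta> \<and> (\<forall>X\<in>Ob C. is_iso D (\<eta> X)))"

definition equivalent_categories :: "('o, 'm) cat \<Rightarrow> ('p, 'n) cat \<Rightarrow> bool" where
  "equivalent_categories C D \<longleftrightarrow>
     (\<exists>F G. is_functor C D F \<and> is_functor D C G \<and>
        naturally_isomorphic C C id_functor (comp_functor G F) \<and>
        naturally_isomorphic D D (comp_functor F G) id_functor)"

text \<open>\<open>F : C \<rightarrow> D\<close> is left adjoint to \<open>G : D \<rightarrow> C\<close>, with unit \<open>\<eta>\<close>.\<close>

definition is_adjunction :: "('o, 'm) cat \<Rightarrow> ('p, 'n) cat \<Rightarrow>
    ('o, 'm, 'p, 'n) fctr \<Rightarrow> ('p, 'n, 'o, 'm) fctr \<Rightarrow> ('o \<Rightarrow> 'm) \<Rightarrow> bool" where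
  "is_adjunction C D F G \<eta> \<longleftrightarrow> is_functor C D F \<and> is_functor D C G \<and>
     is_nat_trans C C id_functor (comp_functor G F) \<eta> \<and>
     (\<forall>X\<in>Ob C. \<forall>Y\<in>Ob D. \<forall>f\<in>hom C X (fst G Y).
        \<exists>!g. g \<in> hom D (fst F X) Y \<and> Comp C (snd G g) (\<eta> X) = f)"

definition reflective_full_subcat :: "('o, 'm) cat \<Rightarrow> 'o set \<Rightarrow> bool" where
  "reflective_full_subcat C P \<longleftrightarrow> P \<subseteq> Ob C \<and>
     (\<exists>R \<eta>. is_adjunction C (full_subcat C P) R id_functor \<eta>)"

text \<open>
  Functors are made extensional, so that objects and arrows of a functor category are equal iff they
  agree on the relevant domains.
\<close>

definition functor_cat :: "('o, 'm) cat \<Rightarrow> ('p, 'n) cat \<Rightarrow>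
    (('o, 'm, 'p, 'n) fctr,
     ('o, 'm, 'p, 'n) fctr \<times> ('o \<Rightarrow> 'n) \<times> ('o, 'm, 'p, 'n) fctr) cat" where
  "functor_cat C D =
     (let obs = {F. is_functor C D F \<and> fst F \<in> extensional (Ob C) \<and> snd F \<in> extensional (Ar C)} in
     \<lparr>Ob = obs,
      Ar = {(F, \<eta>, G). F \<in> obs \<and> G \<in> obs \<and> is_nat_trans C D F G \<eta> \<and> \<eta> \<in> extensional (Ob C)},
      Dom = (\<lambda>(F, \<eta>, G). F),
      Cod = (\<lambda>(F, \<eta>, G). G),
      Id = (\<lambda>F. (F, (\<lambda>X\<in>Ob C. Id D (fst F X)), F)),
      Comp = (\<lambda>(G', \<theta>, H) (F, \<eta>, G). (F, (\<lambda>X\<in>Ob C. Comp D (\<theta> X) (\<eta> X)), H))\<rparr>)"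


section \<open>Sets\<close>

definition set_cat :: "('x set, 'x set \<times> ('x \<Rightarrow> 'x) \<times> 'x set) cat" where
  "set_cat =
     \<lparr>Ob = UNIV,
      Ar = {(A, f, B). f \<in> A \<rightarrow>\<^sub>E B},
      Dom = (\<lambda>(A, f, B). A),
      Cod = (\<lambda>(A, f, B). B),
      Id = (\<lambda>A. (A, (\<lambda>x\<in>A. x), A)),
      Comp = (\<lambda>(B', g, D) (A, f, B). (A, compose A g f, D))\<rparr>"

definition small_set_cat :: "('u set, 'u set \<times> ('u \<Rightarrow> 'u) \<times> 'u set) cat" where
  "small_set_cat = full_subcat set_cat {A. small TYPE('u) A}"

definition hom_functor :: "('o, 'm) cat \<Rightarrow> 'o \<Rightarrow>
    ('o, 'm, 'm set, 'm set \<times> ('m \<Rightarrow> 'm) \<times> 'm set) fctr" where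
  "hom_functor C K =
     (\<lambda>X. hom C K X,
      \<lambda>f. (hom C K (Dom C f), (\<lambda>h\<in>hom C K (Dom C f). Comp C f h), hom C K (Cod C f)))"


section \<open>Colimits and locally finitely presentable categories\<close>

definition is_cocone :: "('i, 'j) cat \<Rightarrow> ('o, 'm) cat \<Rightarrow> ('i, 'j, 'o, 'm) fctr \<Rightarrow>
    'o \<Rightarrow> ('i \<Rightarrow> 'm) \<Rightarrow> bool" where
  "is_cocone J C F Z c \<longleftrightarrow> is_functor J C F \<and> Z \<in> Ob C \<and>
     (\<forall>i\<in>Ob J. c i \<in> hom C (fst F i) Z) \<and>
     (\<forall>a\<in>Ar J. Comp C (c (Cod J a)) (snd F a) = c (Dom J a))"

definition is_colimit :: "('i, 'j) cat \<Rightarrow> ('o, 'm) cat \<Rightarrow> ('i, 'j, 'o, 'm) fctr \<Rightarrow>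
    'o \<Rightarrow> ('i \<Rightarrow> 'm) \<Rightarrow> bool" where
  "is_colimit J C F Z c \<longleftrightarrow> is_cocone J C F Z c \<and>
     (\<forall>Z' c'. is_cocone J C F Z' c' \<longrightarrow>
        (\<exists>!h. h \<in> hom C Z Z' \<and> (\<forall>i\<in>Ob J. Comp C h (c i) = c' i)))"

text \<open>Every small category is isomorphic to one whose objects and arrows are elements of \<open>'u\<close>.\<close>

definition cocomplete :: "'u itself \<Rightarrow> ('o, 'm) cat \<Rightarrow> bool" where
  "cocomplete U C \<longleftrightarrow> is_category C \<and>
     (\<forall>(J :: ('u, 'u) cat) F. small U (Ob J) \<longrightarrow> small U (Ar J) \<longrightarrow> is_functor J C F \<longrightarrow>
        (\<exists>Z c. is_colimit J C F Z c))"

definition poset_cat :: "'i set \<Rightarrow> 'i rel \<Rightarrow> ('i, 'i \<times> 'i) cat" where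
  "poset_cat I r =
     \<lparr>Ob = I, Ar = r \<inter> I \<times> I, Dom = fst, Cod = snd, Id = (\<lambda>i. (i, i)),
      Comp = (\<lambda>b a. (fst a, snd b))\<rparr>"

definition directed_poset :: "'i set \<Rightarrow> 'i rel \<Rightarrow> bool" where
  "directed_poset I r \<longleftrightarrow> partial_order_on I r \<and> I \<noteq> {} \<and>
     (\<forall>i\<in>I. \<forall>j\<in>I. \<exists>k\<in>I. (i, k) \<in> r \<and> (j, k) \<in> r)"

text \<open>
  \<open>K\<close> is finitely presentable if \<open>hom(K, -)\<close> preserves small directed colimits. Colimits of hom-sets
  are taken among all sets of arrows of \<open>C\<close>; this is the colimit in sets provided the
  type \<open>'m\<close> is infinite and has at least the cardinality of \<open>'u\<close>, as is the case below.
\<close>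

definition finitely_presentable :: "'u itself \<Rightarrow> ('o, 'm) cat \<Rightarrow> 'o \<Rightarrow> bool" where
  "finitely_presentable U C K \<longleftrightarrow> K \<in> Ob C \<and>
     (\<forall>(I :: 'u set) r F Z c. small U I \<longrightarrow> directed_poset I r \<longrightarrow>
        is_colimit (poset_cat I r) C F Z c \<longrightarrow>
        is_colimit (poset_cat I r) set_cat (comp_functor (hom_functor C K) F)
          (fst (hom_functor C K) Z) (\<lambda>i. snd (hom_functor C K) (c i)))"

text \<open>
  Local smallness is not part of the definition: it passes to full subcategories, and it holds for
  all categories of structured small sets as soon as the cardinality of \<open>'u\<close> is a strong limit.
\<close>

definition locally_finitely_presentable :: "'u itself \<Rightarrow> ('o, 'm) cat \<Rightarrow> bool" where
  "locally_finitely_presentable U C \<longleftrightarrow> cocomplete U C \<and>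
     (\<exists>A. A \<subseteq> Ob C \<and> small U A \<and> (\<forall>K\<in>A. finitely_presentable U C K) \<and>
        (\<forall>X\<in>Ob C. \<exists>(I :: 'u set) r F c. small U I \<and> directed_poset I r \<and>
           (\<forall>i\<in>I. fst F i \<in> A) \<and> is_colimit (poset_cat I r) C F X c))"


section \<open>Localization of a category\<close>

text \<open>
  The Gabriel--Zisman construction: arrows of \<open>C[W\<^sup>-\<^sup>1]\<close> are zigzags of arrows of \<open>C\<close> and formal
  inverses of arrows in \<open>W\<close>, modulo the congruence generated by the identities and composites of \<open>C\<close>
  and by the relations making \<open>Bwd w\<close> inverse to \<open>Fwd w\<close>.
  Zigzags are written in diagrammatic order.
\<close>

datatype 'm step = Fwd 'm | Bwd 'm

fun is_step :: "('o, 'm) cat \<Rightarrow> 'm set \<Rightarrow> 'o \<Rightarrow> 'm step \<Rightarrow> 'o \<Rightarrow> bool" where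
  "is_step C W X (Fwd f) Y \<longleftrightarrow> f \<in> hom C X Y"
| "is_step C W X (Bwd w) Y \<longleftrightarrow> w \<in> W \<and> w \<in> hom C Y X"

inductive zigzag :: "('o, 'm) cat \<Rightarrow> 'm set \<Rightarrow> 'o \<Rightarrow> 'm step list \<Rightarrow> 'o \<Rightarrow> bool"
  for C W where
  nil: "X \<in> Ob C \<Longrightarrow> zigzag C W X [] X"
| cons: "is_step C W X s Y \<Longrightarrow> zigzag C W Y p Z \<Longrightarrow> zigzag C W X (s # p) Z"

inductive zigzag_eq ::
    "('o, 'm) cat \<Rightarrow> 'm set \<Rightarrow> 'o \<Rightarrow> 'o \<Rightarrow> 'm step list \<Rightarrow> 'm step list \<Rightarrow> bool"
  for C W where
  refl: "zigzag C W X p Y \<Longrightarrow> zigzag_eq C W X Y p p"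
| sym: "zigzag_eq C W X Y p q \<Longrightarrow> zigzag_eq C W X Y q p"
| trans: "zigzag_eq C W X Y p q \<Longrightarrow> zigzag_eq C W X Y q r \<Longrightarrow> zigzag_eq C W X Y p r"
| append: "zigzag_eq C W X Y p p' \<Longrightarrow> zigzag_eq C W Y Z q q' \<Longrightarrow>
           zigzag_eq C W X Z (p @ q) (p' @ q')"
| ident: "X \<in> Ob C \<Longrightarrow> zigzag_eq C W X X [Fwd (Id C X)] []"
| compos: "f \<in> hom C X Y \<Longrightarrow> g \<in> hom C Y Z \<Longrightarrow>
           zigzag_eq C W X Z [Fwd f, Fwd g] [Fwd (Comp C g f)]"
| inv_right: "w \<in> W \<Longrightarrow> w \<in> hom C X Y \<Longrightarrow> zigzag_eq C W X X [Fwd w, Bwd w] []"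
| inv_left: "w \<in> W \<Longrightarrow> w \<in> hom C X Y \<Longrightarrow> zigzag_eq C W Y Y [Bwd w, Fwd w] []"

definition localization :: "('o, 'm) cat \<Rightarrow> 'm set \<Rightarrow> ('o, 'o \<times> 'm step list set \<times> 'o) cat" where
  "localization C W =
     \<lparr>Ob = Ob C,
      Ar = {(X, {q. zigzag_eq C W X Y p q}, Y) | X p Y. zigzag C W X p Y},
      Dom = (\<lambda>(X, a, Y). X),
      Cod = (\<lambda>(X, a, Y). Y),
      Id = (\<lambda>X. (X, {q. zigzag_eq C W X X [] q}, X)),
      Comp = (\<lambda>(Y', b, Z) (X, a, Y).
                (X, {r. \<exists>p\<in>a. \<exists>q\<in>b. zigzag_eq C W X Z (p @ q) r}, Z))\<rparr>"


section \<open>Higher dimensional transition systems\<close>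

text \<open>An \<open>n\<close>-transition is a triple \<open>(\<alpha>, us, \<beta>)\<close> with \<open>length us = n\<close>.\<close>

record 'u tsys =
  states :: "'u set"
  actions :: "'u set"
  lab :: "'u \<Rightarrow> 'u"
  transitions :: "('u \<times> 'u list \<times> 'u) set"

definition is_tsys :: "'u set \<Rightarrow> 'u tsys \<Rightarrow> bool" where
  "is_tsys \<Sigma> X \<longleftrightarrow>
     small TYPE('u) (states X) \<and> small TYPE('u) (actions X) \<and>
     lab X \<in> actions X \<rightarrow>\<^sub>E \<Sigma> \<and>
     transitions X \<subseteq> states X \<times> {us. us \<noteq> [] \<and> set us \<subseteq> actions X} \<times> states X"

definition multiset_axiom :: "'u tsys \<Rightarrow> bool" where
  "multiset_axiom X \<longleftrightarrow>
     (\<forall>\<alpha> us \<beta> \<sigma>. (\<alpha>, us, \<beta>) \<in> transitions X \<longrightarrow> \<sigma> permutes {..<length us} \<longrightarrow>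
        (\<alpha>, permute_list \<sigma> us, \<beta>) \<in> transitions X)"

text \<open>
  In the following axioms a sequence of actions is split into consecutive nonempty blocks, e.g.
  \<open>u = (u\<^sub>1,\<dots>,u\<^sub>p)\<close>, \<open>v = (u\<^bsub>p+1\<^esub>,\<dots>,u\<^bsub>p+q\<^esub>)\<close>, \<open>w = (u\<^bsub>p+q+1\<^esub>,\<dots>,u\<^sub>n)\<close>.
\<close>

definition coherence_axiom :: "'u tsys \<Rightarrow> bool" where
  "coherence_axiom X \<longleftrightarrow>
     (\<forall>\<alpha> \<beta> \<nu>1 \<nu>2 u v w. u \<noteq> [] \<longrightarrow> v \<noteq> [] \<longrightarrow> w \<noteq> [] \<longrightarrow>
        {(\<alpha>, u @ v @ w, \<beta>), (\<alpha>, u, \<nu>1), (\<nu>1, v @ w, \<beta>), (\<alpha>, u @ v, \<nu>2), (\<nu>2, w, \<beta>)}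
          \<subseteq> transitions X \<longrightarrow>
        (\<nu>1, v, \<nu>2) \<in> transitions X)"

definition is_whdts :: "'u set \<Rightarrow> 'u tsys \<Rightarrow> bool" where
  "is_whdts \<Sigma> X \<longleftrightarrow> is_tsys \<Sigma> X \<and> multiset_axiom X \<and> coherence_axiom X"

definition CSA1 :: "'u tsys \<Rightarrow> bool" where
  "CSA1 X \<longleftrightarrow>
     (\<forall>\<alpha> \<beta> u u'. (\<alpha>, [u], \<beta>) \<in> transitions X \<longrightarrow> (\<alpha>, [u'], \<beta>) \<in> transitions X \<longrightarrow>
        lab X u = lab X u' \<longrightarrow> u = u')"

definition CSA2 :: "'u tsys \<Rightarrow> bool" where
  "CSA2 X \<longleftrightarrow>
     (\<forall>\<alpha> \<beta> u v. u \<noteq> [] \<longrightarrow> v \<noteq> [] \<longrightarrow> (\<alpha>, u @ v, \<beta>) \<in> transitions X \<longrightarrow>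
        (\<exists>!\<nu>1. \<nu>1 \<in> states X \<and> (\<alpha>, u, \<nu>1) \<in> transitions X \<and> (\<nu>1, v, \<beta>) \<in> transitions X) \<and>
        (\<exists>!\<nu>2. \<nu>2 \<in> states X \<and> (\<alpha>, v, \<nu>2) \<in> transitions X \<and> (\<nu>2, u, \<beta>) \<in> transitions X))"

definition CSA3 :: "'u tsys \<Rightarrow> bool" where
  "CSA3 X \<longleftrightarrow>
     (\<forall>\<alpha> \<beta> \<nu>1 \<nu>2 \<nu>1' \<nu>2' u v w. u \<noteq> [] \<longrightarrow> v \<noteq> [] \<longrightarrow> w \<noteq> [] \<longrightarrow>
        {(\<alpha>, u @ v @ w, \<beta>),
         (\<alpha>, u, \<nu>1), (\<nu>1, v @ w, \<beta>), (\<nu>1, v, \<nu>2), (\<nu>2, w, \<beta>),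
         (\<alpha>, u @ v, \<nu>2'), (\<nu>2', w, \<beta>), (\<alpha>, u, \<nu>1'), (\<nu>1', v, \<nu>2')} \<subseteq> transitions X \<longrightarrow>
        \<nu>1 = \<nu>1' \<and> \<nu>2 = \<nu>2')"

definition is_hdts :: "'u set \<Rightarrow> 'u tsys \<Rightarrow> bool" where
  "is_hdts \<Sigma> X \<longleftrightarrow> is_tsys \<Sigma> X \<and> multiset_axiom X \<and> CSA1 X \<and> CSA2 X \<and> CSA3 X"

definition is_tsys_map :: "'u tsys \<Rightarrow> 'u tsys \<Rightarrow> ('u \<Rightarrow> 'u) \<times> ('u \<Rightarrow> 'u) \<Rightarrow> bool" where
  "is_tsys_map X Y f \<longleftrightarrow>
     fst f \<in> states X \<rightarrow>\<^sub>E states Y \<and> snd f \<in> actions X \<rightarrow>\<^sub>E actions Y \<and>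
     (\<forall>u\<in>actions X. lab Y (snd f u) = lab X u) \<and>
     (\<forall>(\<alpha>, us, \<beta>)\<in>transitions X. (fst f \<alpha>, map (snd f) us, fst f \<beta>) \<in> transitions Y)"

type_synonym 'u tsys_arrow = "'u tsys \<times> (('u \<Rightarrow> 'u) \<times> ('u \<Rightarrow> 'u)) \<times> 'u tsys"

definition WHDTS :: "'u set \<Rightarrow> ('u tsys, 'u tsys_arrow) cat" where
  "WHDTS \<Sigma> =
     \<lparr>Ob = {X. is_whdts \<Sigma> X},
      Ar = {(X, f, Y). is_whdts \<Sigma> X \<and> is_whdts \<Sigma> Y \<and> is_tsys_map X Y f},
      Dom = (\<lambda>(X, f, Y). X),
      Cod = (\<lambda>(X, f, Y). Y),
      Id = (\<lambda>X. (X, ((\<lambda>s\<in>states X. s), (\<lambda>u\<in>actions X. u)), X)),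
      Comp = (\<lambda>(Y', g, Z) (X, f, Y).
                (X, (compose (states X) (fst g) (fst f), compose (actions X) (snd g) (snd f)), Z))\<rparr>"

definition HDTS :: "'u set \<Rightarrow> ('u tsys, 'u tsys_arrow) cat" where
  "HDTS \<Sigma> = full_subcat (WHDTS \<Sigma>) {X. is_hdts \<Sigma> X}"


section \<open>Cubes and cubification\<close>

definition bits :: "nat \<Rightarrow> bool list set" where
  "bits n = {\<epsilon>. length \<epsilon> = n}"

text \<open>The cube \<open>C\<^sub>n[a\<^sub>1,\<dots>,a\<^sub>n]\<close> of a word of length \<open>n\<close>; coordinates are numbered from \<open>0\<close>.\<close>

definition cube :: "'u list \<Rightarrow> 'u tsys" where
  "cube a =
     \<lparr>states = code ` bits (length a),
      actions = {code (a ! i, i) | i. i < length a},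
      lab = (\<lambda>u\<in>{code (a ! i, i) | i. i < length a}. fst (inv (code :: 'u \<times> nat \<Rightarrow> 'u) u)),
      transitions =
        {(code \<epsilon>, map (\<lambda>i. code (a ! i, i)) is, code \<epsilon>') | \<epsilon> is \<epsilon>'.
           \<epsilon> \<in> bits (length a) \<and> \<epsilon>' \<in> bits (length a) \<and>
           is \<noteq> [] \<and> distinct is \<and> set is \<subseteq> {..<length a} \<and>
           (\<forall>i<length a. \<epsilon> ! i \<le> \<epsilon>' ! i) \<and> (\<forall>i<length a. \<epsilon> ! i \<noteq> \<epsilon>' ! i \<longleftrightarrow> i \<in> set is)}\<rparr>"

definition cubes_over :: "'u set \<Rightarrow> 'u tsys \<Rightarrow>
    ('u tsys_arrow, 'u tsys_arrow \<times> 'u tsys_arrow \<times> 'u tsys_arrow) cat" where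
  "cubes_over \<Sigma> X = full_subcat (slice (WHDTS \<Sigma>) X) {f. \<exists>a\<in>lists \<Sigma>. Dom (WHDTS \<Sigma>) f = cube a}"

definition cubes_diagram :: "'u set \<Rightarrow>
    ('u tsys_arrow, 'u tsys_arrow \<times> 'u tsys_arrow \<times> 'u tsys_arrow, 'u tsys, 'u tsys_arrow) fctr" where
  "cubes_diagram \<Sigma> = (Dom (WHDTS \<Sigma>), \<lambda>(f, u, g). u)"

text \<open>A chosen colimit of the cubes over \<open>X\<close>, together with its colimit cocone.\<close>

definition Cub :: "'u set \<Rightarrow> 'u tsys \<Rightarrow> 'u tsys \<times> ('u tsys_arrow \<Rightarrow> 'u tsys_arrow)" where
  "Cub \<Sigma> X = (SOME (Z, c). is_colimit (cubes_over \<Sigma> X) (WHDTS \<Sigma>) (cubes_diagram \<Sigma>) Z c)"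

definition Cub_map :: "'u set \<Rightarrow> 'u tsys_arrow \<Rightarrow> 'u tsys_arrow" where
  "Cub_map \<Sigma> f =
     (let W = WHDTS \<Sigma>; X = Dom W f; Y = Cod W f in
      THE h. h \<in> hom W (fst (Cub \<Sigma> X)) (fst (Cub \<Sigma> Y)) \<and>
        (\<forall>x\<in>Ob (cubes_over \<Sigma> X). Comp W h (snd (Cub \<Sigma> X) x) = snd (Cub \<Sigma> Y) (Comp W f x)))"

definition Cub_equivalences :: "'u set \<Rightarrow> 'u tsys_arrow set" where
  "Cub_equivalences \<Sigma> = {f \<in> Ar (HDTS \<Sigma>). is_iso (WHDTS \<Sigma>) (Cub_map \<Sigma> f)}"


section \<open>Labelled symmetric precubical sets\<close>

definition face :: "nat \<Rightarrow> nat \<Rightarrow> bool \<Rightarrow> nat \<times> (bool list \<Rightarrow> bool list) \<times> nat" where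
  "face n i \<alpha> = (n, (\<lambda>\<epsilon>\<in>bits n. take i \<epsilon> @ \<alpha> # drop i \<epsilon>), Suc n)"

definition swap :: "nat \<Rightarrow> 'b list \<Rightarrow> 'b list" where
  "swap i x = x[i := x ! Suc i, Suc i := x ! i]"

definition symmetry :: "nat \<Rightarrow> nat \<Rightarrow> nat \<times> (bool list \<Rightarrow> bool list) \<times> nat" where
  "symmetry n i = (n, (\<lambda>\<epsilon>\<in>bits n. swap i \<epsilon>), n)"

inductive_set box_maps :: "(nat \<times> (bool list \<Rightarrow> bool list) \<times> nat) set" where
  "(n, (\<lambda>\<epsilon>\<in>bits n. \<epsilon>), n) \<in> box_maps"
| "i \<le> n \<Longrightarrow> face n i \<alpha> \<in> box_maps"
| "Suc i < n \<Longrightarrow> symmetry n i \<in> box_maps"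
| "(l, f, m) \<in> box_maps \<Longrightarrow> (m, g, n) \<in> box_maps \<Longrightarrow> (l, compose (bits l) g f, n) \<in> box_maps"

text \<open>The object \<open>[n]\<close> of \<open>\<box>\<^sub>S\<close> is represented by the number \<open>n\<close>.\<close>

definition box_cat :: "(nat, nat \<times> (bool list \<Rightarrow> bool list) \<times> nat) cat" where
  "box_cat =
     \<lparr>Ob = UNIV,
      Ar = box_maps,
      Dom = (\<lambda>(m, f, n). m),
      Cod = (\<lambda>(m, f, n). n),
      Id = (\<lambda>n. (n, (\<lambda>\<epsilon>\<in>bits n. \<epsilon>), n)),
      Comp = (\<lambda>(m', g, n) (l, f, m). (l, compose (bits l) g f, n))\<rparr>"

type_synonym 'u precub = "(nat, nat \<times> (bool list \<Rightarrow> bool list) \<times> nat,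
    'u set, 'u set \<times> ('u \<Rightarrow> 'u) \<times> 'u set) fctr"

type_synonym 'u precub_arrow =
  "'u precub \<times> (nat \<Rightarrow> 'u set \<times> ('u \<Rightarrow> 'u) \<times> 'u set) \<times> 'u precub"

definition sym_precubical_sets :: "('u precub, 'u precub_arrow) cat" where
  "sym_precubical_sets = functor_cat (opposite box_cat) small_set_cat"

definition words :: "'u set \<Rightarrow> nat \<Rightarrow> 'u list set" where
  "words \<Sigma> n = {w. set w \<subseteq> \<Sigma> \<and> length w = n}"

definition coded_map ::
    "'u list set \<Rightarrow> ('u list \<Rightarrow> 'u list) \<Rightarrow> 'u list set \<Rightarrow> 'u set \<times> ('u \<Rightarrow> 'u) \<times> 'u set" where
  "coded_map A h B =
     (code ` A, (\<lambda>x\<in>code ` A. code (h (inv (code :: 'u list \<Rightarrow> 'u) x))), code ` B)"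

text \<open>
  \<open>!\<^sup>S\<Sigma>\<close> is the presheaf with \<open>(!\<^sup>S\<Sigma>)\<^sub>n = \<Sigma>\<^sup>n\<close> and the following action of the generators, which
  determines it.
\<close>

definition label_presheaf :: "'u set \<Rightarrow> 'u precub" where
  "label_presheaf \<Sigma> = (THE K. K \<in> Ob sym_precubical_sets \<and>
     (\<forall>n. fst K n = code ` words \<Sigma> n) \<and>
     (\<forall>n i \<alpha>. i \<le> n \<longrightarrow> snd K (face n i \<alpha>) =
        coded_map (words \<Sigma> (Suc n)) (\<lambda>w. take i w @ drop (Suc i) w) (words \<Sigma> n)) \<and>
     (\<forall>n i. Suc i < n \<longrightarrow> snd K (symmetry n i) =
        coded_map (words \<Sigma> n) (swap i) (words \<Sigma> n)))"

definition labelled_precubical_sets ::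
    "'u set \<Rightarrow> ('u precub_arrow, 'u precub_arrow \<times> 'u precub_arrow \<times> 'u precub_arrow) cat" where
  "labelled_precubical_sets \<Sigma> = slice sym_precubical_sets (label_presheaf \<Sigma>)"

end

theory Submission
 imports Defs "HOL-Library.Countable_Set"
begin

text \<open>
 The full subcategory is that of the labelled symmetric precubical sets satisfying the paradigm of higher
 dimensional automata (\<open>paradigm\<close>): a cube and its intermediate states are determined by its source, its
 actions and its target, and two edges with the same ends and the same label are equal.

 Such a precubical set \<open>x\<close> has a transition system \<open>G x\<close> (\<open>Gob\<close>): its states are the points, its actions are
 the classes of parallel edges, and every cube of positive dimension gives a transition. Conversely, a higher
 dimensional transition system \<open>X\<close> has a precubical set \<open>N X\<close> of cubes (\<open>Nob\<close>). The existence and uniqueness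
 of intermediate states in \<open>X\<close> on one side and the paradigm on the other side correspond to each other
 (\<open>Gob_hdts\<close>, \<open>Nob_paradigm\<close>). A cube of \<open>x\<close> is the same as a cube of \<open>G x\<close>, so \<open>N (G x)\<close> is naturally
 isomorphic to \<open>x\<close> (\<open>trn_iso\<close>). In the other direction there is a natural map \<open>G (N X) \<rightarrow> X\<close>. It need not be
 invertible, because \<open>G (N X)\<close> only identifies the actions of two edges when cubes force it to, but \<open>N\<close> inverts
 it (\<open>eps_triangle\<close>).

 Now \<open>G (N X)\<close> is the colimit of the cubes over \<open>X\<close> (\<open>cc_colimit\<close>), so that a map is inverted by cubification
 iff it is inverted by \<open>N\<close> (\<open>Cub_equivalences_eq\<close>). Inverting these maps turns \<open>G (N X) \<rightarrow> X\<close> into an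
 isomorphism, and \<open>N\<close> and \<open>G\<close> into inverse equivalences (\<open>localization_equivalence\<close>).

 It remains to study the subcategory. The paradigm only asks for equalities between elements that are
 given, never for new elements. Therefore any generators and relations present an object, the quotient of
 the terms by the equations that hold under all interpretations (\<open>pres\<close>); all elements of a diagram, with all
 relations between them, give its colimit and the reflection (\<open>universal_cocone\<close>). Moreover the hypotheses of
 the paradigm are finitary, since two edges are parallel when a finite chain links them. Hence elements of a
 directed colimit are equal iff they are equal at some stage (\<open>directed_colimit\<close>), objects with finitely many
 generators and relations are finitely presentable (\<open>finitely_presentable_presented\<close>), and every object is the
 directed colimit of its finite partial presentations (\<open>directed_colimit_of_finite_presentations\<close>).
\<close>

section \<open>Small sets\<close>

locale small_labels =
 fixes \<Sigma> :: "'u set"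
 assumes univ: "universe TYPE('u)" and small_labels: "small TYPE('u) \<Sigma>" and labels_ne: "\<Sigma> \<noteq> {}"
begin

lemma infinite_univ: "infinite (UNIV :: 'u set)"
 using univ unfolding universe_def
 by (meson card_of_ordLeq_infinite infinite_iff_natLeq_ordLeq ordLess_imp_ordLeq)

lemma small_inj:
 assumes "inj_on f A" "f ` A \<subseteq> B" "small TYPE('u) B" shows "small TYPE('u) A"
proof -
 have "|A| \<le>o |B|" using assms(1,2) card_of_ordLeq by blast
 then show ?thesis using assms(3) unfolding small_def by (rule ordLeq_ordLess_trans)
qed

lemma small_subset: "A \<subseteq> B ==> small TYPE('u) B ==> small TYPE('u) A"
 by (rule small_inj[of "\<lambda>x. x"]) auto

lemma small_image: "small TYPE('u) A ==> small TYPE('u) (f ` A)"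
 unfolding small_def using card_of_image ordLeq_ordLess_trans by blast

lemma small_countable: "countable A ==> small TYPE('u) A"
proof -
 assume "countable A"
 then have "|A| \<le>o |UNIV :: nat set|" unfolding countable_def card_of_ordLeq[symmetric] by blast
 then show ?thesis
  using univ card_of_nat unfolding small_def universe_def
  by (meson ordLeq_ordIso_trans ordLeq_ordLess_trans)
qed

lemma small_finite: "finite A ==> small TYPE('u) A"
 by (simp add: small_countable countable_finite)

text \<open>Regularity of the cardinal enters through its stability under small sums.\<close>

lemma small_Sigma:
 assumes "small TYPE('u) A" "\<And>a. a \<in> A ==> small TYPE('u) (B a)" shows "small TYPE('u) (Sigma A B)"
proof -
 have "stable |UNIV :: 'u set|"
  using univ infinite_univ unfolding universe_def
  by (intro regularCard_stable) (auto simp: cinfinite_def Field_card_of card_of_card_order_on)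
 then show ?thesis
  using assms stable_elim unfolding small_def by blast
qed

lemma small_UN:
 assumes "small TYPE('u) A" "\<And>a. a \<in> A ==> small TYPE('u) (B a)" shows "small TYPE('u) (\<Union>a\<in>A. B a)"
proof -
 have "(\<Union>a\<in>A. B a) = snd ` Sigma A B" by force
 then show ?thesis by (simp add: small_image small_Sigma assms)
qed

lemma small_lists: assumes "small TYPE('u) A" shows "small TYPE('u) (lists A)"
proof -
 have *: "small TYPE('u) {xs. set xs \<subseteq> A \<and> length xs = n}" for n
 proof (induction n)
  case 0
  have "{xs. set xs \<subseteq> A \<and> length xs = 0} = {[]}" by auto
  then show ?case using small_finite[of "{[]}"] by (simp del: length_0_conv)
 next
  case (Suc n)
  have "{xs. set xs \<subseteq> A \<and> length xs = Suc n} =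
   (\<lambda>(x, xs). x # xs) ` (A \<times> {xs. set xs \<subseteq> A \<and> length xs = n})"
   by (auto simp: length_Suc_conv image_iff)
  then show ?case using small_image[OF small_Sigma[OF assms Suc]] by simp
 qed
 have "lists A = (\<Union>n\<in>UNIV. {xs. set xs \<subseteq> A \<and> length xs = n})"
  by (auto simp: in_listsI subset_iff)
 then show ?thesis using small_UN[OF small_countable[of "UNIV :: nat set"] *] by simp
qed

lemma small_PiE: assumes "finite D" "small TYPE('u) A" shows "small TYPE('u) (D \<rightarrow>\<^sub>E A)"
proof -
 obtain ds where ds: "set ds = D" using finite_list assms(1) by blast
 show ?thesis
 proof (rule small_inj[OF _ _ small_lists[OF assms(2)]])
  show "inj_on (\<lambda>f. map f ds) (D \<rightarrow>\<^sub>E A)"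
   using ds by (intro inj_onI PiE_ext) (auto simp: map_eq_conv)
  show "(\<lambda>f. map f ds) ` (D \<rightarrow>\<^sub>E A) \<subseteq> lists A" using ds by auto
 qed
qed

lemma inj_code: assumes "|UNIV :: 'b set| \<le>o |UNIV :: 'u set|" shows "inj (code :: 'b \<Rightarrow> 'u)"
 unfolding code_def using assms card_of_ordLeq[of UNIV "UNIV :: 'u set"]
 by (metis someI_ex)

lemma inj_code_bits: "inj (code :: bool list \<Rightarrow> 'u)"
proof (rule inj_code)
 show "|UNIV :: bool list set| \<le>o |UNIV :: 'u set|"
  using small_countable[of "UNIV :: bool list set"] unfolding small_def
  by (simp add: ordLess_imp_ordLeq)
qed

lemma inj_code_pair: "inj (code :: 'u \<times> nat \<Rightarrow> 'u)"
proof (rule inj_code)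
 have "|UNIV :: nat set| \<le>o |UNIV :: 'u set|"
  using infinite_univ infinite_iff_card_of_nat by blast
 then show "|UNIV :: ('u \<times> nat) set| \<le>o |UNIV :: 'u set|"
  using card_of_Times_infinite[OF infinite_univ, of "UNIV :: nat set"]
  by (simp add: ordIso_iff_ordLeq)
qed

lemma inj_code_list: "inj (code :: 'u list \<Rightarrow> 'u)"
proof (rule inj_code)
 have *: "|{xs :: 'u list. length xs = n}| \<le>o |UNIV :: 'u set|" for n
 proof (induction n)
  case 0
  have "{xs :: 'u list. length xs = 0} = {[]}" by auto
  then show ?case by (metis UNIV_not_empty card_of_singl_ordLeq)
 next
  case (Suc n)
  have "{xs :: 'u list. length xs = Suc n} = (\<lambda>(x, xs). x # xs) ` (UNIV \<times> {xs. length xs = n})"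
   by (auto simp: length_Suc_conv image_iff)
  moreover have "|(UNIV :: 'u set) \<times> {xs :: 'u list. length xs = n}| \<le>o |UNIV :: 'u set|"
   using Suc infinite_univ by (intro card_of_Times_ordLeq_infinite_Field[where r="|UNIV :: 'u set|"]) (auto simp: ordIso_imp_ordLeq[OF card_of_refl] Field_card_of card_of_card_order_on)
  ultimately show ?case by (metis card_of_image ordLeq_transitive)
 qed
 have "(UNIV :: 'u list set) = (\<Union>n\<in>UNIV. {xs. length xs = n})" by auto
 moreover have "|\<Union>n\<in>(UNIV::nat set). {xs :: 'u list. length xs = n}| \<le>o |UNIV :: 'u set|"
  using infinite_univ infinite_iff_card_of_nat *
  by (intro card_of_UNION_ordLeq_infinite) auto
 ultimately show "|UNIV :: 'u list set| \<le>o |UNIV :: 'u set|" by simp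
qed

lemma small_ex_inj: assumes "small TYPE('u) A" shows "\<exists>f :: 'b \<Rightarrow> 'u. inj_on f A"
 using assms unfolding small_def
 by (meson card_of_ordLeq ordLess_imp_ordLeq)

text \<open>Any small set, of whatever type, can be moved into the universe.\<close>

definition enc :: "'b set \<Rightarrow> 'b \<Rightarrow> 'u" where "enc A = (SOME f. inj_on f A)"

lemma inj_on_enc: "small TYPE('u) A ==> inj_on (enc A) A"
 unfolding enc_def using small_ex_inj by (rule someI_ex)

end

section \<open>Maps of cubes as coordinate patterns\<close>

type_synonym bmap = "nat \<times> (bool list \<Rightarrow> bool list) \<times> nat"

abbreviation zeros :: "nat \<Rightarrow> bool list" where "zeros n \<equiv> replicate n False"
abbreviation ones :: "nat \<Rightarrow> bool list" where "ones n \<equiv> replicate n True"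

text \<open>
 A map of cubes copies its inputs, without repetition, to a list \<open>ds\<close> of output coordinates, and
 is constant on the remaining coordinates.
\<close>

definition shape :: "nat \<Rightarrow> (bool list \<Rightarrow> bool list) \<Rightarrow> nat \<Rightarrow> nat list \<Rightarrow> bool" where
 "shape m f n ds \<longleftrightarrow> length ds = m \<and> distinct ds \<and> set ds \<subseteq> {..<n} \<and> f \<in> extensional (bits m) \<and>
   (\<forall>\<xi>\<in>bits m. f \<xi> \<in> bits n \<and> (\<forall>i<m. f \<xi> ! (ds ! i) = \<xi> ! i) \<and>
    (\<forall>j<n. j \<notin> set ds \<longrightarrow> f \<xi> ! j = f (zeros m) ! j))"

definition dirs :: "bmap \<Rightarrow> nat list" where
 "dirs F = (case F of (m, f, n) \<Rightarrow>
   map (\<lambda>i. THE j. j < n \<and> f (zeros m) ! j \<noteq> f ((zeros m)[i := True]) ! j) [0..<m])"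

definition pull :: "bmap \<Rightarrow> 'a list \<Rightarrow> 'a list" where "pull F w = map (nth w) (dirs F)"

abbreviation bid :: "nat \<Rightarrow> bmap" where "bid n \<equiv> Id box_cat n"
abbreviation bcomp :: "bmap \<Rightarrow> bmap \<Rightarrow> bmap" where "bcomp \<equiv> Comp box_cat"
abbreviation bsrc :: "bmap \<Rightarrow> nat" where "bsrc F \<equiv> fst F"
abbreviation btgt :: "bmap \<Rightarrow> nat" where "btgt F \<equiv> snd (snd F)"
abbreviation bfun :: "bmap \<Rightarrow> bool list \<Rightarrow> bool list" where "bfun F \<equiv> fst (snd F)"

lemma zeros_bits [simp]: "zeros n \<in> bits n" "ones n \<in> bits n" by (auto simp: bits_def)

lemma bits_0 [simp]: "bits 0 = {[]}" by (auto simp: bits_def)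

lemma finite_bits [simp]: "finite (bits n)"
 using finite_lists_length_eq[of "UNIV :: bool set" n] by (simp add: bits_def)

lemma shapeD:
 assumes "shape m f n ds"
 shows "length ds = m" "distinct ds" "set ds \<subseteq> {..<n}" "f \<in> extensional (bits m)"
  "\<xi> \<in> bits m ==> f \<xi> \<in> bits n"
  "\<xi> \<in> bits m ==> i < m ==> f \<xi> ! (ds ! i) = \<xi> ! i"
  "\<xi> \<in> bits m ==> j < n ==> j \<notin> set ds ==> f \<xi> ! j = f (zeros m) ! j"
 using assms unfolding shape_def by blast+

lemma shape_nth_less: "shape m f n ds ==> i < m ==> ds ! i < n"
 unfolding shape_def by (metis lessThan_iff nth_mem subsetD)

lemma shape_dirs: assumes "shape m f n ds" shows "dirs (m, f, n) = ds"
proof (rule nth_equalityI)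
 show "length (dirs (m, f, n)) = length ds" using assms by (simp add: dirs_def shape_def)
 fix i assume "i < length (dirs (m, f, n))"
 then have i: "i < m" by (simp add: dirs_def)
 have "(THE j. j < n \<and> f (zeros m) ! j \<noteq> f ((zeros m)[i := True]) ! j) = ds ! i"
 proof (rule the_equality)
  have 1: "(zeros m)[i := True] \<in> bits m" "zeros m \<in> bits m" by (auto simp: bits_def)
  show "ds ! i < n \<and> f (zeros m) ! (ds ! i) \<noteq> f ((zeros m)[i := True]) ! (ds ! i)"
   using assms i 1 shape_nth_less[OF assms i] unfolding shape_def by auto
  fix j assume j: "j < n \<and> f (zeros m) ! j \<noteq> f ((zeros m)[i := True]) ! j"
  then have "j \<in> set ds" using assms 1 unfolding shape_def by metis
  then obtain k where k: "k < m" "j = ds ! k" using assms by (auto simp: in_set_conv_nth shape_def)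
  then have "zeros m ! k \<noteq> (zeros m)[i := True] ! k" using j 1 assms unfolding shape_def by metis
  then have "k = i" using k by (metis nth_list_update_neq)
  then show "j = ds ! i" using k by simp
 qed
 then show "dirs (m, f, n) ! i = ds ! i" using i by (simp add: dirs_def)
qed

lemma shape_comp:
 assumes "shape l f m ds" "shape m g n es"
 shows "shape l (compose (bits l) g f) n (map (nth es) ds)"
proof -
 have len: "length ds = l" "length es = m" "\<And>i. i < l ==> ds ! i < m"
  using assms shape_nth_less[OF assms(1)] by (simp_all add: shape_def)
 have fb: "f \<xi> \<in> bits m" if "\<xi> \<in> bits l" for \<xi> using that assms(1) by (auto simp: shape_def)
 have "distinct es" "set ds \<subseteq> {..<m}" using assms by (simp_all add: shape_def)
 then have "inj_on (nth es) (set ds)" using len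
  by (intro inj_onI) (simp add: nth_eq_iff_index_eq subset_iff)
 then have d: "distinct (map (nth es) ds)" using assms(1) by (simp add: distinct_map shape_def)
 have s: "set (map (nth es) ds) \<subseteq> {..<n}"
  using len shape_nth_less[OF assms(2)] by (auto simp: in_set_conv_nth)
 have c: "g (f \<xi>) ! j = g (f (zeros l)) ! j"
  if "\<xi> \<in> bits l" "j < n" "j \<notin> set (map (nth es) ds)" for \<xi> j
 proof (cases "j \<in> set es")
  case True
  then obtain k where k: "k < m" "j = es ! k" using len by (auto simp: in_set_conv_nth)
  then have "k \<notin> set ds" using that by auto
  then have "f \<xi> ! k = f (zeros l) ! k" using assms(1) that k unfolding shape_def by metis
  then show ?thesis
   using k assms(2) fb[OF that(1)] fb[OF zeros_bits(1)] unfolding shape_def by metis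
 next
  case False
  then show ?thesis using assms(2) fb[OF that(1)] fb[OF zeros_bits(1)] that unfolding shape_def by metis
 qed
 show ?thesis unfolding shape_def
 proof (intro conjI ballI allI impI)
  fix \<xi> assume e: "\<xi> \<in> bits l"
  show "compose (bits l) g f \<xi> \<in> bits n"
   using e fb[OF e] assms(2) by (simp add: compose_def shape_def)
  show "compose (bits l) g f \<xi> ! (map (nth es) ds ! i) = \<xi> ! i" if "i < l" for i
   using e that fb[OF e] assms len by (simp add: compose_def shape_def)
  show "compose (bits l) g f \<xi> ! j = compose (bits l) g f (zeros l) ! j"
   if "j < n" "j \<notin> set (map (nth es) ds)" for j
   using e c[OF e that] by (simp add: compose_def)
 qed (use len d s in \<open>simp_all add: compose_def\<close>)
qed

lemma shape_id: "shape n (\<lambda>\<xi>\<in>bits n. \<xi>) n [0..<n]"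
 by (auto simp: shape_def)

lemma shape_face: assumes "i \<le> n"
 shows "shape n (\<lambda>\<xi>\<in>bits n. take i \<xi> @ \<alpha> # drop i \<xi>) (Suc n) ([0..<i] @ [Suc i..<Suc n])"
proof -
 have "([0..<i] @ [Suc i..<Suc n]) ! k = (if k < i then k else Suc k)" if "k < n" for k
  using that assms by (auto simp: nth_append simp del: upt_Suc)
 moreover have "set ([0..<i] @ [Suc i..<Suc n]) = {..<Suc n} - {i}"
  using assms by (auto simp del: upt_Suc)
 ultimately show ?thesis using assms
  by (auto simp: shape_def bits_def nth_append nth_Cons' min_def simp del: upt_Suc set_append)
qed

lemma swap_nth: "Suc i < length x ==> k < length x ==> swap i x ! k = x ! Transposition.transpose i (Suc i) k"
 by (auto simp: swap_def nth_list_update Transposition.transpose_def)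

lemma shape_symmetry: assumes "Suc i < n"
 shows "shape n (\<lambda>\<xi>\<in>bits n. swap i \<xi>) n (map (Transposition.transpose i (Suc i)) [0..<n])"
proof -
 let ?t = "Transposition.transpose i (Suc i)"
 have s: "set (map ?t [0..<n]) = {..<n}"
  using assms transpose_image_eq[of i "{..<n}" "Suc i"] by (simp add: lessThan_atLeast0)
 have d: "distinct (map ?t [0..<n])"
  by (simp add: distinct_map inj_on_def) (metis transpose_involutory)
 have l: "length (swap i \<xi>) = length \<xi>" for \<xi> :: "bool list" by (simp add: swap_def)
 have t: "?t k < n" if "k < n" for k using that assms by (simp add: Transposition.transpose_def)
 have e: "swap i \<xi> ! (?t k) = \<xi> ! k" if "length \<xi> = n" "k < n" for \<xi> :: "bool list" and k
  using that assms t[OF that(2)] by (subst swap_nth) auto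
 show ?thesis unfolding shape_def
  using s d l e by (simp add: bits_def del: set_map)
qed

lemma box_maps_shape: "F \<in> box_maps ==> \<exists>ds. shape (bsrc F) (bfun F) (btgt F) ds"
proof (induction rule: box_maps.induct)
 case (4 l f m g n)
 then show ?case using shape_comp by fastforce
next
 case (1 n) show ?case using shape_id[of n] by (simp only: fst_conv snd_conv) (rule exI)
next
 case (2 i n \<alpha>) then show ?case using shape_face[OF 2, of \<alpha>] by (simp only: face_def fst_conv snd_conv) (rule exI)
next
 case (3 i n) then show ?case using shape_symmetry[OF 3] by (simp only: symmetry_def fst_conv snd_conv) (rule exI)
qed

lemma box_shape: "F \<in> box_maps ==> shape (bsrc F) (bfun F) (btgt F) (dirs F)"
proof -
 assume "F \<in> box_maps"
 then obtain ds where ds: "shape (bsrc F) (bfun F) (btgt F) ds" using box_maps_shape by blast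
 then have "dirs F = ds" using shape_dirs[OF ds] by simp
 then show ?thesis using ds by simp
qed

lemma box_dirs:
 assumes "F \<in> box_maps"
 shows "length (dirs F) = bsrc F" "distinct (dirs F)" "set (dirs F) \<subseteq> {..<btgt F}"
  "bfun F \<in> extensional (bits (bsrc F))"
  "\<xi> \<in> bits (bsrc F) ==> bfun F \<xi> \<in> bits (btgt F)"
  "\<xi> \<in> bits (bsrc F) ==> i < bsrc F ==> bfun F \<xi> ! (dirs F ! i) = \<xi> ! i"
  "\<xi> \<in> bits (bsrc F) ==> j < btgt F ==> j \<notin> set (dirs F) ==>
    bfun F \<xi> ! j = bfun F (zeros (bsrc F)) ! j"
 using box_shape[OF assms] unfolding shape_def by blast+

lemma dirs_nth_less: "F \<in> box_maps ==> i < bsrc F ==> dirs F ! i < btgt F"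
 using shape_nth_less[OF box_shape] .

lemma shape_eqI:
 assumes "shape m f n ds" "shape m g n ds" "f (zeros m) = g (zeros m)" shows "f = g"
proof (rule extensionalityI[of _ "bits m"])
 note f = shapeD[OF assms(1)] and g = shapeD[OF assms(2)]
 fix \<xi> assume e: "\<xi> \<in> bits m"
 have l: "length (f \<xi>) = n" "length (g \<xi>) = n" using f(5)[OF e] g(5)[OF e] by (simp_all add: bits_def)
 show "f \<xi> = g \<xi>"
 proof (rule nth_equalityI)
  show "length (f \<xi>) = length (g \<xi>)" using l by simp
  fix j assume "j < length (f \<xi>)"
  then have j: "j < n" using l by simp
  show "f \<xi> ! j = g \<xi> ! j"
  proof (cases "j \<in> set ds")
   case True
   then obtain i where i: "i < m" "j = ds ! i" using f(1) by (metis in_set_conv_nth)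
   then show ?thesis using f(6)[OF e i(1)] g(6)[OF e i(1)] by simp
  next
   case False
   then show ?thesis using f(7)[OF e j False] g(7)[OF e j False] assms(3) by simp
  qed
 qed
qed (use shapeD(4) assms in blast)+

lemma box_eqI:
 assumes "F \<in> box_maps" "G \<in> box_maps" "bsrc F = bsrc G" "btgt F = btgt G" "dirs F = dirs G"
  "bfun F (zeros (bsrc F)) = bfun G (zeros (bsrc F))"
 shows "F = G"
 using shape_eqI[of "bsrc F" "bfun F" "btgt F" "dirs F" "bfun G"] box_shape[of F] box_shape[of G] assms
 by (simp add: prod_eq_iff)

lemma bcomp_simps [simp]: "bcomp G F = (bsrc F, compose (bits (bsrc F)) (bfun G) (bfun F), btgt G)"
 by (auto simp: box_cat_def split: prod.splits)

lemma bid_simps [simp]: "bid n = (n, (\<lambda>\<xi>\<in>bits n. \<xi>), n)"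
 by (simp add: box_cat_def)

lemma box_id: "bid n \<in> box_maps" by (simp add: box_maps.intros)

lemma box_comp: "F \<in> box_maps ==> G \<in> box_maps ==> btgt F = bsrc G ==> bcomp G F \<in> box_maps"
 using box_maps.intros(4)[of "bsrc F" "bfun F" "btgt F" "bfun G" "btgt G"] by (cases G) auto

lemma dirs_id [simp]: "dirs (bid n) = [0..<n]" using shape_dirs[OF shape_id] by simp

lemma dirs_comp:
 assumes "F \<in> box_maps" "G \<in> box_maps" "btgt F = bsrc G"
 shows "dirs (bcomp G F) = map (nth (dirs G)) (dirs F)"
 using shape_dirs[OF shape_comp[OF box_shape[OF assms(1)]]] box_shape[OF assms(2)] assms(3) by simp

lemma pull_id: "length w = n ==> pull (bid n) w = w"
 using map_nth by (auto simp: pull_def simp del: bid_simps)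

lemma pull_comp:
 assumes "F \<in> box_maps" "G \<in> box_maps" "btgt F = bsrc G"
 shows "pull (bcomp G F) w = pull F (pull G w)"
 using dirs_comp[OF assms] box_dirs(1)[OF assms(1)] box_dirs(1)[OF assms(2)] dirs_nth_less[OF assms(1)] assms(3)
 by (simp add: pull_def list_eq_iff_nth_eq del: bcomp_simps)

lemma length_pull: "F \<in> box_maps ==> length (pull F w) = bsrc F"
 by (simp add: pull_def box_dirs(1))

lemma set_pull: "F \<in> box_maps ==> length w = btgt F ==> set (pull F w) \<subseteq> set w"
 using box_dirs(3) by (fastforce simp: pull_def)

lemma map_pull: "F \<in> box_maps ==> length w = btgt F ==> map h (pull F w) = pull F (map h w)"
 using box_dirs(3) by (fastforce simp: pull_def)

subsection \<open>Every coordinate pattern is a map of cubes\<close>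

lemma box_times_id: "F \<in> box_maps ==>
 (Suc (bsrc F), (\<lambda>\<xi>\<in>bits (Suc (bsrc F)). bfun F (butlast \<xi>) @ [last \<xi>]), Suc (btgt F)) \<in> box_maps"
proof (induction rule: box_maps.induct)
 case (1 n)
 have "(\<lambda>\<xi>\<in>bits (Suc n). (\<lambda>\<xi>\<in>bits n. \<xi>) (butlast \<xi>) @ [last \<xi>]) = (\<lambda>\<xi>\<in>bits (Suc n). \<xi>)"
  by (rule restrict_ext) (auto simp: bits_def length_Suc_conv_rev)
 then show ?case using box_maps.intros(1)[of "Suc n"] by (simp only: fst_conv snd_conv)
next
 case (2 i n \<alpha>)
 have "(\<lambda>\<xi>\<in>bits (Suc n). (\<lambda>\<xi>\<in>bits n. take i \<xi> @ \<alpha> # drop i \<xi>) (butlast \<xi>) @ [last \<xi>]) =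
  (\<lambda>\<xi>\<in>bits (Suc n). take i \<xi> @ \<alpha> # drop i \<xi>)"
  using 2 by (intro restrict_ext) (auto simp: bits_def length_Suc_conv_rev)
 then show ?case using box_maps.intros(2)[of i "Suc n" \<alpha>] 2 by (simp only: face_def fst_conv snd_conv)
next
 case (3 i n)
 have "(\<lambda>\<xi>\<in>bits (Suc n). (\<lambda>\<xi>\<in>bits n. swap i \<xi>) (butlast \<xi>) @ [last \<xi>]) =
  (\<lambda>\<xi>\<in>bits (Suc n). swap i \<xi>)"
  using 3 by (intro restrict_ext)
   (auto simp: bits_def length_Suc_conv_rev swap_def nth_append list_update_append)
 then show ?case using box_maps.intros(3)[of i "Suc n"] 3 by (simp only: symmetry_def fst_conv snd_conv)
next
 case (4 l f m g n)
 have f: "f \<xi> \<in> bits m" if "\<xi> \<in> bits l" for \<xi> using box_dirs(5)[OF 4(1)] that by simp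
 have "compose (bits (Suc l)) (\<lambda>\<xi>\<in>bits (Suc m). g (butlast \<xi>) @ [last \<xi>])
   (\<lambda>\<xi>\<in>bits (Suc l). f (butlast \<xi>) @ [last \<xi>]) =
  (\<lambda>\<xi>\<in>bits (Suc l). compose (bits l) g f (butlast \<xi>) @ [last \<xi>])"
  unfolding compose_def
 proof (rule restrict_ext)
  fix \<xi> assume "\<xi> \<in> bits (Suc l)"
  then have "butlast \<xi> \<in> bits l" "f (butlast \<xi>) @ [last \<xi>] \<in> bits (Suc m)" "\<xi> \<in> bits (Suc l)"
   using f[of "butlast \<xi>"] by (auto simp: bits_def)
  then show "(\<lambda>\<xi>\<in>bits (Suc m). g (butlast \<xi>) @ [last \<xi>])
    ((\<lambda>\<xi>\<in>bits (Suc l). f (butlast \<xi>) @ [last \<xi>]) \<xi>) =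
   (\<lambda>x\<in>bits l. g (f x)) (butlast \<xi>) @ [last \<xi>]" by simp
 qed
 then show ?case using box_maps.intros(4)[OF 4(3,4)[unfolded fst_conv snd_conv]] by (simp only: fst_conv snd_conv)
qed

text \<open>Moving the last coordinate to its place is a chain of exchanges of neighbours.\<close>

lemma box_insert_last: "d < n ==>
 (n, (\<lambda>\<xi>\<in>bits n. take d \<xi> @ last \<xi> # drop d (butlast \<xi>)), n) \<in> box_maps"
proof (induction "n - d" arbitrary: d)
 case (Suc k)
 show ?case
 proof (cases "Suc d = n")
  case True
  have "(\<lambda>\<xi>\<in>bits n. take d \<xi> @ last \<xi> # drop d (butlast \<xi>)) = (\<lambda>\<xi>\<in>bits n. \<xi>)"
   using True by (intro restrict_ext) (auto simp: bits_def length_Suc_conv_rev)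
  then show ?thesis by (simp add: box_maps.intros)
 next
  case False
  then have d: "Suc d < n" using Suc by simp
  then have 1: "(n, (\<lambda>\<xi>\<in>bits n. take (Suc d) \<xi> @ last \<xi> # drop (Suc d) (butlast \<xi>)), n) \<in> box_maps"
   using Suc.hyps(1)[of "Suc d"] Suc.hyps(2) by simp
  have "compose (bits n) (\<lambda>\<xi>\<in>bits n. swap d \<xi>)
    (\<lambda>\<xi>\<in>bits n. take (Suc d) \<xi> @ last \<xi> # drop (Suc d) (butlast \<xi>)) =
   (\<lambda>\<xi>\<in>bits n. take d \<xi> @ last \<xi> # drop d (butlast \<xi>))"
   unfolding compose_def
  proof (rule restrict_ext)
   fix \<xi> :: "bool list" assume "\<xi> \<in> bits n"
   then obtain z b where z: "\<xi> = z @ [b]" "d < length z" "length \<xi> = n"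
    using d by (cases \<xi> rule: rev_cases) (auto simp: bits_def)
   then obtain x y c where "\<xi> = x @ c # y @ [b]" "length x = d" "length \<xi> = n"
    using id_take_nth_drop[OF z(2)] that[of "take d z" "z ! d" "drop (Suc d) z"] by simp
   then show "(\<lambda>\<xi>\<in>bits n. swap d \<xi>)
     ((\<lambda>\<xi>\<in>bits n. take (Suc d) \<xi> @ last \<xi> # drop (Suc d) (butlast \<xi>)) \<xi>) =
    take d \<xi> @ last \<xi> # drop d (butlast \<xi>)"
    by (auto simp: bits_def swap_def nth_append list_update_append butlast_append)
  qed
  then show ?thesis
   using box_maps.intros(4)[OF 1 box_maps.intros(3)[OF d, unfolded symmetry_def]] by simp
 qed
qed simp

lemma box_const: "(0, (\<lambda>\<xi>\<in>bits 0. \<beta>), length \<beta>) \<in> box_maps"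
proof (induction \<beta>)
 case Nil
 have "(\<lambda>\<xi>\<in>bits 0. []) = (\<lambda>\<xi>\<in>bits 0. \<xi>)" by (rule restrict_ext) auto
 then show ?case using box_maps.intros(1)[of 0] by (simp only: list.size)
next
 case (Cons b \<beta>)
 have "compose (bits 0) (\<lambda>\<xi>\<in>bits (length \<beta>). take 0 \<xi> @ b # drop 0 \<xi>) (\<lambda>\<xi>\<in>bits 0. \<beta>) =
  (\<lambda>\<xi>\<in>bits 0. b # \<beta>)"
  unfolding compose_def by (rule restrict_ext) (simp add: bits_def)
 then show ?case
  using box_maps.intros(4)[OF Cons box_maps.intros(2)[of 0 "length \<beta>" b, unfolded face_def]] by (simp only: list.size add_0_right add_Suc_right)
qed

text \<open>
 By induction on the number of inputs: removing the last input, and the coordinate to which it is copied,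
 leaves a smaller pattern. The coordinate is restored by adding it at the end and moving it into place.
\<close>

lemma shape_box: "shape m f n ds ==> (m, f, n) \<in> box_maps"
proof (induction m arbitrary: f n ds)
 case 0
 have "f = (\<lambda>\<xi>\<in>bits 0. f [])" "length (f []) = n"
  using shapeD(4)[OF 0] shapeD(5)[OF 0, of "[]"] by (auto simp: bits_def extensional_def fun_eq_iff)
 then show ?case using box_const[of "f []"] by metis
next
 case (Suc m)
 note sh = shapeD[OF Suc.prems]
 obtain ds' d where ds: "ds = ds' @ [d]" "length ds' = m"
  using sh(1) by (metis length_Suc_conv_rev)
 obtain n' where n: "n = Suc n'" "d < n" using sh(3) ds by (cases n) auto
 define del where "del = (\<lambda>y :: bool list. take d y @ drop (Suc d) y)"
 define f' where "f' = (\<lambda>\<xi>\<in>bits m. del (f (\<xi> @ [False])))"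
 define ds'' where "ds'' = map (\<lambda>j. if j < d then j else j - 1) ds'"
 have dd: "d \<notin> set ds'" "distinct ds'" "set ds' \<subseteq> {..<n}" using sh(2,3) ds by auto
 have b: "\<xi> @ [x] \<in> bits (Suc m)" if "\<xi> \<in> bits m" for \<xi> x using that by (simp add: bits_def)
 have fb: "length (f \<xi>) = n" if "\<xi> \<in> bits (Suc m)" for \<xi> using sh(5) that by (simp add: bits_def)
 have del_nth: "del y ! j = y ! (if j < d then j else Suc j)" if "length y = n" "j < n'" for y j
  using that n by (auto simp: del_def nth_append min_def)
 have del_len: "length (del y) = n'" if "length y = n" for y using that n by (auto simp: del_def)
 have z: "zeros (Suc m) = zeros m @ [False]" by (simp add: replicate_append_same)
 have nthds: "f (\<xi> @ [x]) ! (ds' ! i) = \<xi> ! i" if "\<xi> \<in> bits m" "i < m" for \<xi> x i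
 proof -
  have "f (\<xi> @ [x]) ! (ds ! i) = (\<xi> @ [x]) ! i" using sh(6)[OF b[OF that(1)]] that(2) by simp
  then show ?thesis using that ds by (auto simp: nth_append bits_def)
 qed
 have off: "f (\<xi> @ [x]) ! j = f (zeros m @ [False]) ! j"
  if "\<xi> \<in> bits m" "j < n" "j \<notin> set ds'" "j \<noteq> d" for \<xi> x j
  using sh(7)[OF b[OF that(1)] that(2)] that ds z by simp
 have ds'': "ds' ! i = (if ds'' ! i < d then ds'' ! i else Suc (ds'' ! i)) \<and> ds'' ! i < n'"
  if "i < m" for i
 proof -
  have "ds' ! i \<noteq> d" "ds' ! i < n" using dd ds that nth_mem[of i ds'] by (blast, blast)
  then show ?thesis using n that ds by (cases "ds' ! i < d") (auto simp: ds''_def)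
 qed
 have "shape m f' n' ds''" unfolding shape_def
 proof (intro conjI ballI allI impI)
  show "length ds'' = m" using ds by (simp add: ds''_def)
  have "inj_on (\<lambda>j. if j < d then j else j - 1) (set ds')"
  proof (rule inj_onI)
   fix x y assume "x \<in> set ds'" "y \<in> set ds'"
   then have "x \<noteq> d" "y \<noteq> d" using dd(1) by blast+
   moreover assume "(if x < d then x else x - 1) = (if y < d then y else y - 1)"
   ultimately show "x = y" by (auto split: if_splits)
  qed
  then show "distinct ds''" using dd by (simp add: ds''_def distinct_map)
  show "set ds'' \<subseteq> {..<n'}" using ds'' ds by (auto simp: in_set_conv_nth) (simp add: ds''_def)
  show "f' \<in> extensional (bits m)" by (simp add: f'_def)
 next
  fix \<xi> assume e: "\<xi> \<in> bits m"
  show "f' \<xi> \<in> bits n'" using e fb[OF b[OF e]] del_len by (simp add: f'_def bits_def)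
  show "f' \<xi> ! (ds'' ! i) = \<xi> ! i" if "i < m" for i
   using e that ds''[OF that] nthds[OF e that] del_nth fb[OF b[OF e]] by (simp add: f'_def)
  fix j assume j: "j < n'" "j \<notin> set ds''"
  let ?k = "if j < d then j else Suc j"
  have "?k \<notin> set ds'"
  proof
   assume "?k \<in> set ds'"
   then have "(if ?k < d then ?k else ?k - 1) \<in> set ds''" unfolding ds''_def set_map by (rule imageI)
   moreover have "(if ?k < d then ?k else ?k - 1) = j" by simp
   ultimately show False using j(2) by simp
  qed
  then show "f' \<xi> ! j = f' (zeros m) ! j"
   using e j n off[OF e, of ?k False] fb[OF b[OF e]] fb[OF b[of "zeros m"]]
   by (simp add: f'_def del_nth)
 qed
 note 1 = box_times_id[OF Suc.IH[OF this], simplified fst_conv snd_conv]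
 have f'b: "f' \<xi> \<in> bits n'" if "\<xi> \<in> bits m" for \<xi>
  using that fb[OF b[OF that]] del_len by (simp add: f'_def bits_def)
 have eq: "compose (bits (Suc m)) (\<lambda>\<xi>\<in>bits n. take d \<xi> @ last \<xi> # drop d (butlast \<xi>))
   (\<lambda>\<xi>\<in>bits (Suc m). f' (butlast \<xi>) @ [last \<xi>]) = f"
 proof (rule extensionalityI[of _ "bits (Suc m)"])
  fix \<xi> assume e: "\<xi> \<in> bits (Suc m)"
  then obtain \<xi>' x where ee: "\<xi> = \<xi>' @ [x]" "\<xi>' \<in> bits m"
   by (auto simp: bits_def length_Suc_conv_rev)
  let ?y = "f (\<xi>' @ [False])"
  have l: "length ?y = n" using fb b ee by simp
  have "f \<xi> = ?y[d := x]"
  proof (rule nth_equalityI)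
   show "length (f \<xi>) = length (?y[d := x])" using l fb[OF e] by simp
   fix j assume "j < length (f \<xi>)"
   then have j: "j < n" using fb[OF e] by simp
   consider "j = d" | i where "i < m" "j = ds' ! i" "j \<noteq> d" | "j \<notin> set ds'" "j \<noteq> d"
    using ds by (metis in_set_conv_nth)
   then show "f \<xi> ! j = ?y[d := x] ! j"
   proof cases
    case 1
    have "f \<xi> ! (ds ! m) = \<xi> ! m" using sh(6)[OF e] by simp
    then show ?thesis using 1 ds l n ee by (simp add: nth_append bits_def)
   next
    case 2
    then show ?thesis using nthds ee by simp
   next
    case 3
    then show ?thesis using off[OF ee(2) j, of x] off[OF ee(2) j, of False] ee by simp
   qed
  qed
  moreover have "?y[d := x] = take d ?y @ x # drop (Suc d) ?y"
   using l n by (simp add: upd_conv_take_nth_drop)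
  ultimately show "compose (bits (Suc m)) (\<lambda>\<xi>\<in>bits n. take d \<xi> @ last \<xi> # drop d (butlast \<xi>))
   (\<lambda>\<xi>\<in>bits (Suc m). f' (butlast \<xi>) @ [last \<xi>]) \<xi> = f \<xi>"
   using e ee f'b[OF ee(2)] n l by (simp add: compose_def bits_def) (simp add: f'_def del_def bits_def)
 qed (use sh(4) in simp_all)
 have "(Suc n', (\<lambda>\<xi>\<in>bits n. take d \<xi> @ last \<xi> # drop d (butlast \<xi>)), n) \<in> box_maps"
  using box_insert_last[OF n(2)] by (simp only: n(1))
 from box_maps.intros(4)[OF 1 this] show ?case unfolding eq .
qed

text \<open>The map of cubes with input coordinates \<open>ds\<close>, passing through the vertex \<open>\<beta>\<close>.\<close>

definition bx :: "bool list \<Rightarrow> nat list \<Rightarrow> bmap" where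
 "bx \<beta> ds = (length ds,
   (\<lambda>\<xi>\<in>bits (length ds). map (\<lambda>j. if j \<in> set ds then \<xi> ! (THE i. i < length ds \<and> ds ! i = j) else \<beta> ! j)
    [0..<length \<beta>]), length \<beta>)"

lemma bx_nth:
 assumes "distinct ds" "set ds \<subseteq> {..<length \<beta>}" "\<xi> \<in> bits (length ds)"
 shows "i < length ds ==> bfun (bx \<beta> ds) \<xi> ! (ds ! i) = \<xi> ! i"
  "j < length \<beta> ==> j \<notin> set ds ==> bfun (bx \<beta> ds) \<xi> ! j = \<beta> ! j"
  "length (bfun (bx \<beta> ds) \<xi>) = length \<beta>"
proof -
 assume i: "i < length ds"
 have "(THE k. k < length ds \<and> ds ! k = ds ! i) = i"
  using assms(1) i by (auto simp: nth_eq_iff_index_eq)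
 moreover have "ds ! i < length \<beta>" using assms(2) i nth_mem[of i ds] by blast
 ultimately show "bfun (bx \<beta> ds) \<xi> ! (ds ! i) = \<xi> ! i" using assms i by (simp add: bx_def)
qed (use assms in \<open>auto simp: bx_def\<close>)

lemma bx_src_tgt [simp]: "bsrc (bx \<beta> ds) = length ds" "btgt (bx \<beta> ds) = length \<beta>"
 by (simp_all add: bx_def)

lemma shape_bx:
 assumes "distinct ds" "set ds \<subseteq> {..<length \<beta>}"
 shows "shape (length ds) (bfun (bx \<beta> ds)) (length \<beta>) ds"
proof -
 have "bfun (bx \<beta> ds) \<in> extensional (bits (length ds))" by (simp add: bx_def)
 then show ?thesis using bx_nth[OF assms] assms by (auto simp: shape_def bits_def)
qed

lemma bx_box:
 assumes "distinct ds" "set ds \<subseteq> {..<length \<beta>}"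
 shows "bx \<beta> ds \<in> box_maps" "dirs (bx \<beta> ds) = ds"
 using shape_box[OF shape_bx[OF assms]] shape_dirs[OF shape_bx[OF assms]]
 by (simp_all add: bx_def)

lemma bsrc_bid [simp]: "bsrc (bid n) = n" and btgt_bid [simp]: "btgt (bid n) = n"
 and bsrc_bcomp [simp]: "bsrc (bcomp G F) = bsrc F" and btgt_bcomp [simp]: "btgt (bcomp G F) = btgt G"
 and bfun_bid: "\<xi> \<in> bits n ==> bfun (bid n) \<xi> = \<xi>"
 and bfun_bcomp: "\<xi> \<in> bits (bsrc F) ==> bfun (bcomp G F) \<xi> = bfun G (bfun F \<xi>)"
 by (simp_all add: compose_def)

declare bcomp_simps [simp del] bid_simps [simp del]

section \<open>Categories of presheaves and slices\<close>

lemma catD: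
 assumes "is_category C"
 shows "f \<in> Ar C ==> Dom C f \<in> Ob C" "f \<in> Ar C ==> Cod C f \<in> Ob C"
  "X \<in> Ob C ==> Id C X \<in> hom C X X"
  "f \<in> hom C X Y ==> g \<in> hom C Y Z ==> Comp C g f \<in> hom C X Z"
  "f \<in> hom C X Y ==> Comp C f (Id C X) = f" "f \<in> hom C X Y ==> Comp C (Id C Y) f = f"
  "f \<in> hom C X Y ==> g \<in> hom C Y Z ==> h \<in> hom C Z V ==>
    Comp C h (Comp C g f) = Comp C (Comp C h g) f"
  "f \<in> hom C X Y ==> X \<in> Ob C" "f \<in> hom C X Y ==> Y \<in> Ob C"
 using assms unfolding is_category_def hom_def by auto

lemma is_categoryI:
 assumes "\<And>f. f \<in> Ar C ==> Dom C f \<in> Ob C \<and> Cod C f \<in> Ob C"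
  "\<And>X. X \<in> Ob C ==> Id C X \<in> hom C X X"
  "\<And>f g X Y Z. f \<in> hom C X Y ==> g \<in> hom C Y Z ==> Comp C g f \<in> hom C X Z"
  "\<And>f X Y. f \<in> hom C X Y ==> Comp C f (Id C X) = f \<and> Comp C (Id C Y) f = f"
  "\<And>f g h X Y Z V. f \<in> hom C X Y ==> g \<in> hom C Y Z ==> h \<in> hom C Z V ==>
    Comp C h (Comp C g f) = Comp C (Comp C h g) f"
 shows "is_category C"
 using assms unfolding is_category_def hom_def by simp

lemma hom_Ar: "f \<in> hom C X Y ==> f \<in> Ar C \<and> Dom C f = X \<and> Cod C f = Y" by (simp add: hom_def)

lemma Ar_hom: "f \<in> Ar C ==> f \<in> hom C (Dom C f) (Cod C f)" by (simp add: hom_def)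

lemma functorD:
 assumes "is_functor C D F"
 shows "is_category C" "is_category D" "X \<in> Ob C ==> fst F X \<in> Ob D"
  "f \<in> hom C X Y ==> snd F f \<in> hom D (fst F X) (fst F Y)"
  "X \<in> Ob C ==> snd F (Id C X) = Id D (fst F X)"
  "f \<in> hom C X Y ==> g \<in> hom C Y Z ==> snd F (Comp C g f) = Comp D (snd F g) (snd F f)"
 using assms unfolding is_functor_def hom_def by auto

lemma is_functorI:
 assumes "is_category C" "is_category D" "\<And>X. X \<in> Ob C ==> fst F X \<in> Ob D"
  "\<And>f X Y. f \<in> hom C X Y ==> snd F f \<in> hom D (fst F X) (fst F Y)"
  "\<And>X. X \<in> Ob C ==> snd F (Id C X) = Id D (fst F X)"
  "\<And>f g X Y Z. f \<in> hom C X Y ==> g \<in> hom C Y Z ==> snd F (Comp C g f) = Comp D (snd F g) (snd F f)"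
 shows "is_functor C D F"
 unfolding is_functor_def
proof (intro conjI ballI impI)
 fix f g assume "f \<in> Ar C" "g \<in> Ar C" "Cod C f = Dom C g"
 then show "snd F (Comp C g f) = Comp D (snd F g) (snd F f)"
  using assms(6)[of f "Dom C f" "Cod C f" g] by (simp add: hom_def)
next
 show "snd F f \<in> hom D (fst F (Dom C f)) (fst F (Cod C f))" if "f \<in> Ar C" for f
  by (rule assms(4)[OF Ar_hom[OF that]])
qed (rule assms; assumption)+

lemma nat_transD:
 assumes "is_nat_trans C D F G \<eta>"
 shows "is_functor C D F" "is_functor C D G" "X \<in> Ob C ==> \<eta> X \<in> hom D (fst F X) (fst G X)"
  "f \<in> hom C X Y ==> Comp D (\<eta> Y) (snd F f) = Comp D (snd G f) (\<eta> X)"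
 using assms unfolding is_nat_trans_def hom_def by auto

lemma is_nat_transI:
 assumes "is_functor C D F" "is_functor C D G" "\<And>X. X \<in> Ob C ==> \<eta> X \<in> hom D (fst F X) (fst G X)"
  "\<And>f X Y. f \<in> hom C X Y ==> Comp D (\<eta> Y) (snd F f) = Comp D (snd G f) (\<eta> X)"
 shows "is_nat_trans C D F G \<eta>"
 unfolding is_nat_trans_def
proof (intro conjI ballI)
 show "Comp D (\<eta> (Cod C f)) (snd F f) = Comp D (snd G f) (\<eta> (Dom C f))" if "f \<in> Ar C" for f
  by (rule assms(4)[OF Ar_hom[OF that]])
qed (rule assms; assumption)+

lemma full_simps [simp]:
 "Ob (full_subcat C P) = Ob C \<inter> P" "Dom (full_subcat C P) = Dom C" "Cod (full_subcat C P) = Cod C"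
 "Id (full_subcat C P) = Id C" "Comp (full_subcat C P) = Comp C"
 by (simp_all add: full_subcat_def)

lemma full_hom: "X \<in> P ==> Y \<in> P ==> hom (full_subcat C P) X Y = hom C X Y"
 by (auto simp: hom_def full_subcat_def)

lemma full_homD: "f \<in> hom (full_subcat C P) X Y ==> f \<in> hom C X Y \<and> X \<in> P \<and> Y \<in> P"
 by (auto simp: hom_def full_subcat_def)

lemma is_category_full: assumes "is_category C" shows "is_category (full_subcat C P)"
proof (rule is_categoryI)
 fix f assume "f \<in> Ar (full_subcat C P)"
 then show "Dom (full_subcat C P) f \<in> Ob (full_subcat C P) \<and> Cod (full_subcat C P) f \<in> Ob (full_subcat C P)"
  using catD(1,2)[OF assms] by (auto simp: full_subcat_def)
next
 fix X assume "X \<in> Ob (full_subcat C P)"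
 then show "Id (full_subcat C P) X \<in> hom (full_subcat C P) X X"
  using catD(3)[OF assms] by (simp add: full_hom)
qed (use catD[OF assms] in \<open>auto dest!: full_homD simp: full_hom\<close>)

lemma slice_simps [simp]:
 "Ob (slice C X) = {f \<in> Ar C. Cod C f = X}"
 "Dom (slice C X) t = fst t" "Cod (slice C X) t = snd (snd t)"
 "Id (slice C X) f = (f, Id C (Dom C f), f)"
 "Comp (slice C X) s t = (fst t, Comp C (fst (snd s)) (fst (snd t)), snd (snd s))"
 by (auto simp: slice_def split: prod.splits)

lemma slice_hom: "t \<in> hom (slice C X) f g \<longleftrightarrow>
 (\<exists>u. t = (f, u, g) \<and> f \<in> Ar C \<and> Cod C f = X \<and> g \<in> Ar C \<and> Cod C g = X \<and>
  u \<in> hom C (Dom C f) (Dom C g) \<and> Comp C g u = f)"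
 by (cases t) (auto simp: hom_def slice_def)

lemma is_category_slice: assumes C: "is_category C" shows "is_category (slice C X)"
proof (rule is_categoryI)
 fix f assume "f \<in> Ar (slice C X)"
 then show "Dom (slice C X) f \<in> Ob (slice C X) \<and> Cod (slice C X) f \<in> Ob (slice C X)"
  by (auto simp: slice_def)
next
 fix f assume "f \<in> Ob (slice C X)"
 then show "Id (slice C X) f \<in> hom (slice C X) f f"
  using catD(1)[OF C, of f] catD(3)[OF C, of "Dom C f"] catD(5)[OF C Ar_hom[of f C]]
  by (auto simp: slice_hom)
next
 fix s t f g h assume "s \<in> hom (slice C X) f g" "t \<in> hom (slice C X) g h"
 then show "Comp (slice C X) t s \<in> hom (slice C X) f h"
  using catD(4)[OF C, of "fst (snd s)" "Dom C f" "Dom C g" "fst (snd t)" "Dom C h"]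
   catD(7)[OF C, of "fst (snd s)" "Dom C f" "Dom C g" "fst (snd t)" "Dom C h" h "Cod C h"] Ar_hom[of h C]
  by (auto simp: slice_hom)
next
 fix s f g assume "s \<in> hom (slice C X) f g"
 then show "Comp (slice C X) s (Id (slice C X) f) = s \<and> Comp (slice C X) (Id (slice C X) g) s = s"
  using catD(5,6)[OF C] by (auto simp: slice_hom)
next
 fix s t r f g h k
 assume "s \<in> hom (slice C X) f g" "t \<in> hom (slice C X) g h" "r \<in> hom (slice C X) h k"
 then show "Comp (slice C X) r (Comp (slice C X) t s) = Comp (slice C X) (Comp (slice C X) r t) s"
  using catD(7)[OF C] by (auto simp: slice_hom)
qed

lemma opposite_simps [simp]:
 "Ob (opposite C) = Ob C" "Ar (opposite C) = Ar C" "Dom (opposite C) = Cod C"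
 "Cod (opposite C) = Dom C" "Id (opposite C) = Id C" "Comp (opposite C) g f = Comp C f g"
 by (simp_all add: opposite_def)

lemma opposite_hom: "hom (opposite C) X Y = hom C Y X" by (auto simp: hom_def)

lemma is_category_opposite: assumes "is_category C" shows "is_category (opposite C)"
 by (rule is_categoryI) (use catD[OF assms] in \<open>auto simp: opposite_hom\<close>)

lemma functor_cat_simps:
 "Ob (functor_cat C D) = {F. is_functor C D F \<and> fst F \<in> extensional (Ob C) \<and> snd F \<in> extensional (Ar C)}"
 "Dom (functor_cat C D) t = fst t" "Cod (functor_cat C D) t = snd (snd t)"
 "Id (functor_cat C D) F = (F, (\<lambda>X\<in>Ob C. Id D (fst F X)), F)"
 "Comp (functor_cat C D) s t =
   (fst t, (\<lambda>X\<in>Ob C. Comp D (fst (snd s) X) (fst (snd t) X)), snd (snd s))"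
 by (auto simp: functor_cat_def Let_def split: prod.splits)

lemma functor_cat_hom: "t \<in> hom (functor_cat C D) F G \<longleftrightarrow>
 (\<exists>\<eta>. t = (F, \<eta>, G) \<and> F \<in> Ob (functor_cat C D) \<and> G \<in> Ob (functor_cat C D) \<and>
   is_nat_trans C D F G \<eta> \<and> \<eta> \<in> extensional (Ob C))"
 by (cases t) (auto simp: hom_def functor_cat_def Let_def)

lemma is_category_functor_cat:
 assumes C: "is_category C" and D: "is_category D" shows "is_category (functor_cat C D)"
proof (rule is_categoryI)
 fix f assume "f \<in> Ar (functor_cat C D)"
 then show "Dom (functor_cat C D) f \<in> Ob (functor_cat C D) \<and> Cod (functor_cat C D) f \<in> Ob (functor_cat C D)"
  by (auto simp: functor_cat_def Let_def)
next
 fix F assume F: "F \<in> Ob (functor_cat C D)"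
 then have f: "is_functor C D F" by (simp add: functor_cat_simps)
 have "is_nat_trans C D F F (\<lambda>X\<in>Ob C. Id D (fst F X))"
 proof (rule is_nat_transI)
  fix f X Y assume h: "f \<in> hom C X Y"
  then have "X \<in> Ob C" "Y \<in> Ob C" using catD(8,9)[OF C] by blast+
  then show "Comp D ((\<lambda>X\<in>Ob C. Id D (fst F X)) Y) (snd F f) = Comp D (snd F f) ((\<lambda>X\<in>Ob C. Id D (fst F X)) X)"
   using catD(5,6)[OF D functorD(4)[OF f h]] by simp
 qed (use f functorD(3)[OF f] catD(3)[OF D] in auto)
 then show "Id (functor_cat C D) F \<in> hom (functor_cat C D) F F"
  using F by (simp add: functor_cat_hom functor_cat_simps(4))
next
 fix s t F G H assume "s \<in> hom (functor_cat C D) F G" "t \<in> hom (functor_cat C D) G H"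
 then obtain \<eta> \<theta> where *: "s = (F, \<eta>, G)" "t = (G, \<theta>, H)" "F \<in> Ob (functor_cat C D)"
  "H \<in> Ob (functor_cat C D)" and n: "is_nat_trans C D F G \<eta>" "is_nat_trans C D G H \<theta>"
  by (auto simp: functor_cat_hom)
 have "is_nat_trans C D F H (\<lambda>X\<in>Ob C. Comp D (\<theta> X) (\<eta> X))"
 proof (rule is_nat_transI)
  fix f X Y assume h: "f \<in> hom C X Y"
  then have o: "X \<in> Ob C" "Y \<in> Ob C" using catD(8,9)[OF C] by blast+
  note FF = functorD(4)[OF nat_transD(1)[OF n(1)] h]
   and GG = functorD(4)[OF nat_transD(1)[OF n(2)] h]
   and HH = functorD(4)[OF nat_transD(2)[OF n(2)] h]
  note e = nat_transD(3)[OF n(1) o(1)] nat_transD(3)[OF n(1) o(2)]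
   nat_transD(3)[OF n(2) o(1)] nat_transD(3)[OF n(2) o(2)]
  show "Comp D ((\<lambda>X\<in>Ob C. Comp D (\<theta> X) (\<eta> X)) Y) (snd F f) =
    Comp D (snd H f) ((\<lambda>X\<in>Ob C. Comp D (\<theta> X) (\<eta> X)) X)"
   using o nat_transD(4)[OF n(1) h] nat_transD(4)[OF n(2) h]
    catD(7)[OF D FF e(2) e(4)] catD(7)[OF D e(1) GG e(4)] catD(7)[OF D e(1) e(3) HH] by simp
 qed (use nat_transD(1)[OF n(1)] nat_transD(2)[OF n(2)]
   catD(4)[OF D nat_transD(3)[OF n(1)] nat_transD(3)[OF n(2)]] in auto)
 then show "Comp (functor_cat C D) t s \<in> hom (functor_cat C D) F H"
  using * by (simp add: functor_cat_hom functor_cat_simps(5))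
next
 fix t F G assume "t \<in> hom (functor_cat C D) F G"
 then obtain \<eta> where *: "t = (F, \<eta>, G)" "\<eta> \<in> extensional (Ob C)" and n: "is_nat_trans C D F G \<eta>"
  by (auto simp: functor_cat_hom)
 have "(\<lambda>X\<in>Ob C. Comp D (\<eta> X) (Id D (fst F X))) = \<eta>" "(\<lambda>X\<in>Ob C. Comp D (Id D (fst G X)) (\<eta> X)) = \<eta>"
  using * catD(5,6)[OF D nat_transD(3)[OF n]] by (auto intro!: extensionalityI[of _ "Ob C"])
 moreover have "(\<lambda>X\<in>Ob C. Comp D (\<eta> X) ((\<lambda>X\<in>Ob C. Id D (fst F X)) X)) = (\<lambda>X\<in>Ob C. Comp D (\<eta> X) (Id D (fst F X)))"
  "(\<lambda>X\<in>Ob C. Comp D ((\<lambda>X\<in>Ob C. Id D (fst G X)) X) (\<eta> X)) = (\<lambda>X\<in>Ob C. Comp D (Id D (fst G X)) (\<eta> X))"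
  by (auto intro!: restrict_ext)
 ultimately show "Comp (functor_cat C D) t (Id (functor_cat C D) F) = t \<and>
   Comp (functor_cat C D) (Id (functor_cat C D) G) t = t"
  using * by (simp only: functor_cat_simps(4,5) fst_conv snd_conv)
next
 fix s t r F G H K
 assume "s \<in> hom (functor_cat C D) F G" "t \<in> hom (functor_cat C D) G H" "r \<in> hom (functor_cat C D) H K"
 then obtain \<eta> \<theta> \<kappa> where *: "s = (F, \<eta>, G)" "t = (G, \<theta>, H)" "r = (H, \<kappa>, K)"
  and n: "is_nat_trans C D F G \<eta>" "is_nat_trans C D G H \<theta>" "is_nat_trans C D H K \<kappa>"
  by (auto simp: functor_cat_hom)
 have "(\<lambda>X\<in>Ob C. Comp D (\<kappa> X) ((\<lambda>X\<in>Ob C. Comp D (\<theta> X) (\<eta> X)) X)) =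
  (\<lambda>X\<in>Ob C. Comp D ((\<lambda>X\<in>Ob C. Comp D (\<kappa> X) (\<theta> X)) X) (\<eta> X))"
  using catD(7)[OF D nat_transD(3)[OF n(1)] nat_transD(3)[OF n(2)] nat_transD(3)[OF n(3)]]
  by (auto intro!: restrict_ext)
 then show "Comp (functor_cat C D) r (Comp (functor_cat C D) t s) =
   Comp (functor_cat C D) (Comp (functor_cat C D) r t) s"
  using * by (simp only: functor_cat_simps(5) fst_conv snd_conv)
qed

lemma box_cat_simps [simp]: "Ob box_cat = UNIV" "Ar box_cat = box_maps" "Dom box_cat F = bsrc F" "Cod box_cat F = btgt F"
 by (auto simp: box_cat_def split: prod.splits)

lemma is_category_box: "is_category box_cat"
proof (rule is_categoryI)
 fix F X Y assume F: "F \<in> hom box_cat X Y"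
 then have F': "F \<in> box_maps" "bsrc F = X" "btgt F = Y" by (simp_all add: hom_def)
 have "bfun F \<in> bits X \<rightarrow> bits Y" "bfun F \<in> extensional (bits X)"
  using box_dirs(4,5)[OF F'(1)] F' by auto
 then show "Comp box_cat F (Id box_cat X) = F \<and> Comp box_cat (Id box_cat Y) F = F"
  using F' by (cases F) (auto simp: bcomp_simps bid_simps compose_Id Id_compose)
next
 fix F G H X Y Z V assume "F \<in> hom box_cat X Y" "G \<in> hom box_cat Y Z" "H \<in> hom box_cat Z V"
 then have F': "F \<in> box_maps" "bsrc F = X" "btgt F = Y" "bsrc G = Y" by (simp_all add: hom_def)
 have "bfun F \<in> bits X \<rightarrow> bits Y" using box_dirs(5)[OF F'(1)] F' by auto
 from compose_assoc[OF this] show "Comp box_cat H (Comp box_cat G F) = Comp box_cat (Comp box_cat H G) F"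
  using F' by (simp add: bcomp_simps)
qed (use box_id box_comp in \<open>auto simp: hom_def\<close>)

lemma set_cat_simps [simp]:
 "Ob set_cat = UNIV" "Dom set_cat t = fst t" "Cod set_cat t = snd (snd t)"
 "Id set_cat A = (A, (\<lambda>x\<in>A. x), A)"
 "Comp set_cat s t = (fst t, compose (fst t) (fst (snd s)) (fst (snd t)), snd (snd s))"
 by (auto simp: set_cat_def split: prod.splits)

lemma set_cat_hom: "t \<in> hom set_cat A B \<longleftrightarrow> (\<exists>f. t = (A, f, B) \<and> f \<in> A \<rightarrow>\<^sub>E B)"
 by (cases t) (auto simp: hom_def set_cat_def)

lemma is_category_set: "is_category set_cat"
proof (rule is_categoryI)
 fix f assume "f \<in> Ar set_cat"
 then show "Dom set_cat f \<in> Ob set_cat \<and> Cod set_cat f \<in> Ob set_cat" by simp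
next
 fix s A B assume "s \<in> hom set_cat A B"
 then show "Comp set_cat s (Id set_cat A) = s \<and> Comp set_cat (Id set_cat B) s = s"
  by (auto simp: set_cat_hom PiE_iff intro!: compose_Id Id_compose)
next
 fix r s t A B C' D assume "r \<in> hom set_cat A B" "s \<in> hom set_cat B C'" "t \<in> hom set_cat C' D"
 then show "Comp set_cat t (Comp set_cat s r) = Comp set_cat (Comp set_cat t s) r"
  by (auto simp: set_cat_hom PiE_iff intro!: compose_assoc)
qed (auto simp: set_cat_hom compose_def)

lemma small_set_hom: "t \<in> hom (small_set_cat :: ('u set, _) cat) A B \<longleftrightarrow>
  small TYPE('u) A \<and> small TYPE('u) B \<and> (\<exists>f. t = (A, f, B) \<and> f \<in> A \<rightarrow>\<^sub>E B)"
 unfolding small_set_cat_def using full_homD[of t set_cat] full_hom[of A _ B set_cat]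
 by (auto simp: set_cat_hom)

lemma is_category_small_set: "is_category small_set_cat"
 unfolding small_set_cat_def by (rule is_category_full[OF is_category_set])

lemma small_set_simps [simp]:
 "Ob (small_set_cat :: ('u set, _) cat) = {A. small TYPE('u) A}" "Id small_set_cat A = (A, (\<lambda>x\<in>A. x), A)"
 "Comp small_set_cat s t = (fst t, compose (fst t) (fst (snd s)) (fst (snd t)), snd (snd s))"
 unfolding small_set_cat_def by auto

abbreviation pel :: "'u precub \<Rightarrow> nat \<Rightarrow> 'u set" where "pel K \<equiv> fst K"
abbreviation pact :: "'u precub \<Rightarrow> bmap \<Rightarrow> 'u \<Rightarrow> 'u" where "pact K F \<equiv> fst (snd (snd K F))"

lemma precub_iff:
 fixes K :: "'u precub"
 shows "K \<in> Ob sym_precubical_sets \<longleftrightarrow> (\<forall>n. small TYPE('u) (pel K n)) \<and> snd K \<in> extensional box_maps \<and>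
  (\<forall>F\<in>box_maps. fst (snd K F) = pel K (btgt F) \<and> snd (snd (snd K F)) = pel K (bsrc F) \<and>
    pact K F \<in> pel K (btgt F) \<rightarrow>\<^sub>E pel K (bsrc F)) \<and>
  (\<forall>n. pact K (bid n) = (\<lambda>x\<in>pel K n. x)) \<and>
  (\<forall>F\<in>box_maps. \<forall>G\<in>box_maps. btgt F = bsrc G \<longrightarrow>
    pact K (bcomp G F) = compose (pel K (btgt G)) (pact K F) (pact K G))"
  (is "?l \<longleftrightarrow> ?r")
proof
 assume ?l
 then have f: "is_functor (opposite box_cat) small_set_cat K" and e: "snd K \<in> extensional box_maps"
  by (auto simp: sym_precubical_sets_def functor_cat_simps)
 note F = functorD(3-)[OF f]
 have a: "fst (snd K F) = pel K (btgt F) \<and> snd (snd (snd K F)) = pel K (bsrc F) \<and>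
    pact K F \<in> pel K (btgt F) \<rightarrow>\<^sub>E pel K (bsrc F)" if "F \<in> box_maps" for F
 proof -
  have "F \<in> hom (opposite box_cat) (btgt F) (bsrc F)" using that by (simp add: hom_def)
  from F(2)[OF this] show ?thesis by (auto simp: small_set_hom)
 qed
 have i: "pact K (bid n) = (\<lambda>x\<in>pel K n. x)" for n using F(3)[of n] by simp
 have c: "pact K (bcomp G H) = compose (pel K (btgt G)) (pact K H) (pact K G)"
  if "H \<in> box_maps" "G \<in> box_maps" "btgt H = bsrc G" for G H
  using F(4)[of G "btgt G" "bsrc G" H "bsrc H"] that a[of G] a[of H]
  by (simp add: opposite_hom hom_def)
 show ?r using e a i c F(1) by auto
next
 assume r: ?r
 have "is_functor (opposite box_cat) small_set_cat K"
 proof (rule is_functorI[OF is_category_opposite[OF is_category_box] is_category_small_set])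
  fix f X Y assume "f \<in> hom (opposite box_cat) X Y"
  then show "snd K f \<in> hom small_set_cat (pel K X) (pel K Y)"
   using r unfolding opposite_hom small_set_hom
   by (intro conjI exI[of _ "pact K f"]) (auto simp: hom_def prod_eq_iff)
 next
  fix X show "snd K (Id (opposite box_cat) X) = Id small_set_cat (fst K X)"
   using r box_id[of X] by (simp add: prod_eq_iff)
 next
  fix G H X Y Z assume "G \<in> hom (opposite box_cat) X Y" "H \<in> hom (opposite box_cat) Y Z"
  then have *: "G \<in> box_maps" "H \<in> box_maps" "btgt H = bsrc G" by (auto simp: opposite_hom hom_def)
  then have "bcomp G H \<in> box_maps" using box_comp by blast
  then show "snd K (Comp (opposite box_cat) H G) = Comp small_set_cat (snd K H) (snd K G)"
   using r * by (simp add: prod_eq_iff)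
 qed (use r in simp_all)
 then show ?l using r by (simp add: sym_precubical_sets_def functor_cat_simps extensional_def)
qed

lemma precub_hom:
 fixes K L :: "'u precub"
 shows "t \<in> hom sym_precubical_sets K L \<longleftrightarrow> K \<in> Ob sym_precubical_sets \<and> L \<in> Ob sym_precubical_sets \<and>
  (\<exists>h. t = (K, (\<lambda>n. (pel K n, h n, pel L n)), L) \<and> (\<forall>n. h n \<in> pel K n \<rightarrow>\<^sub>E pel L n) \<and>
   (\<forall>F\<in>box_maps. \<forall>x\<in>pel K (btgt F). h (bsrc F) (pact K F x) = pact L F (h (btgt F) x)))"
  (is "?l \<longleftrightarrow> ?r")
proof
 assume ?l
 then obtain \<eta> where t: "t = (K, \<eta>, L)" and o: "K \<in> Ob sym_precubical_sets" "L \<in> Ob sym_precubical_sets"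
  and n: "is_nat_trans (opposite box_cat) small_set_cat K L \<eta>"
  unfolding sym_precubical_sets_def functor_cat_hom by blast
 define h where "h = (\<lambda>n. fst (snd (\<eta> n)))"
 have h: "\<eta> n = (pel K n, h n, pel L n) \<and> h n \<in> pel K n \<rightarrow>\<^sub>E pel L n" for n
  using nat_transD(3)[OF n, of n] by (auto simp: small_set_hom h_def)
 then have eq: "\<eta> = (\<lambda>n. (pel K n, h n, pel L n))" by blast
 have nat: "h (bsrc F) (pact K F x) = pact L F (h (btgt F) x)"
  if F: "F \<in> box_maps" and x: "x \<in> pel K (btgt F)" for F x
 proof -
  have "fst (snd K F) = pel K (btgt F)" using o F by (simp add: precub_iff)
  then have "compose (pel K (btgt F)) (h (bsrc F)) (pact K F) = compose (pel K (btgt F)) (pact L F) (h (btgt F))"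
   using nat_transD(4)[OF n, of F "btgt F" "bsrc F"] F h[of "btgt F"] h[of "bsrc F"]
   by (auto simp: opposite_hom hom_def)
  from fun_cong[OF this, of x] show ?thesis using x by (simp add: compose_eq)
 qed
 show ?r
  using t o nat conjunct2[OF h] unfolding eq by (intro conjI exI[of _ h] ballI allI)
next
 assume ?r
 then obtain h where t: "t = (K, (\<lambda>n. (pel K n, h n, pel L n)), L)"
  and o: "K \<in> Ob sym_precubical_sets" "L \<in> Ob sym_precubical_sets"
  and h: "\<And>n. h n \<in> pel K n \<rightarrow>\<^sub>E pel L n"
  and c: "\<And>F x. F \<in> box_maps ==> x \<in> pel K (btgt F) ==> h (bsrc F) (pact K F x) = pact L F (h (btgt F) x)"
  by blast
 have fs: "is_functor (opposite box_cat) small_set_cat K" "is_functor (opposite box_cat) small_set_cat L"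
  using o by (auto simp: sym_precubical_sets_def functor_cat_simps)
 have "is_nat_trans (opposite box_cat) small_set_cat K L (\<lambda>n. (pel K n, h n, pel L n))"
 proof (rule is_nat_transI[OF fs])
  fix n show "(pel K n, h n, pel L n) \<in> hom small_set_cat (pel K n) (pel L n)"
   using o h by (simp add: small_set_hom precub_iff)
 next
  fix F X Y assume "F \<in> hom (opposite box_cat) X Y"
  then have F: "F \<in> box_maps" "X = btgt F" "Y = bsrc F" by (auto simp: opposite_hom hom_def)
  then have "fst (snd K F) = pel K (btgt F) \<and> snd (snd (snd L F)) = pel L (bsrc F)"
   using o by (simp add: precub_iff)
  moreover have "compose (pel K (btgt F)) (h (bsrc F)) (pact K F) = compose (pel K (btgt F)) (pact L F) (h (btgt F))"
   unfolding compose_def using c F by (intro restrict_ext) simp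
  ultimately show "Comp small_set_cat (pel K Y, h Y, pel L Y) (snd K F) =
    Comp small_set_cat (snd L F) (pel K X, h X, pel L X)" using F by simp
 qed
 then show ?l using o t unfolding sym_precubical_sets_def functor_cat_hom by (auto simp: extensional_def)
qed

lemma is_category_precub: "is_category sym_precubical_sets"
 unfolding sym_precubical_sets_def
 by (rule is_category_functor_cat[OF is_category_opposite[OF is_category_box] is_category_small_set])

section \<open>Labelled symmetric precubical sets by elements\<close>

lemma pull_face:
 assumes "i \<le> n" "length w = Suc n"
 shows "pull (face n i \<alpha>) w = take i w @ drop (Suc i) w"
proof -
 have d: "dirs (face n i \<alpha>) = [0..<i] @ [Suc i..<Suc n]"
  using shape_dirs[OF shape_face[OF assms(1)]] by (simp only: face_def)
 have "map (nth w) [0..<i] = take i w" "map (nth w) [Suc i..<Suc n] = drop (Suc i) w"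
  using assms by (auto intro!: nth_equalityI simp del: upt_Suc)
 then show ?thesis unfolding pull_def d by simp
qed

lemma pull_symmetry:
 assumes "Suc i < n" "length w = n"
 shows "pull (symmetry n i) w = swap i w"
proof -
 have d: "dirs (symmetry n i) = map (Transposition.transpose i (Suc i)) [0..<n]"
  using shape_dirs[OF shape_symmetry[OF assms(1)]] by (simp only: symmetry_def)
 have "length (swap i w) = n" using assms(2) by (simp add: swap_def)
 then show ?thesis unfolding pull_def d using assms by (auto intro!: nth_equalityI simp: swap_nth)
qed

definition el :: "'u precub_arrow \<Rightarrow> nat \<Rightarrow> 'u set" where "el x n = pel (fst x) n"
definition act :: "'u precub_arrow \<Rightarrow> bmap \<Rightarrow> 'u \<Rightarrow> 'u" where "act x F = pact (fst x) F"
definition wd :: "'u precub_arrow \<Rightarrow> nat \<Rightarrow> 'u \<Rightarrow> 'u list" where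
 "wd x n e = inv code (fst (snd (fst (snd x) n)) e)"

type_synonym 'u lps_arrow = "'u precub_arrow \<times> 'u precub_arrow \<times> 'u precub_arrow"

definition ap :: "'u lps_arrow \<Rightarrow> nat \<Rightarrow> 'u \<Rightarrow> 'u" where
 "ap h n = fst (snd (fst (snd (fst (snd h))) n))"

definition mk_arr :: "'u precub_arrow \<Rightarrow> (nat \<Rightarrow> 'u \<Rightarrow> 'u) \<Rightarrow> 'u precub_arrow \<Rightarrow> 'u lps_arrow" where
 "mk_arr x f y = (x, (fst x, (\<lambda>n. (el x n, restrict (f n) (el x n), el y n)), fst y), y)"

context small_labels
begin

abbreviation "LPS \<equiv> labelled_precubical_sets \<Sigma>"

lemma inv_code_list [simp]: "inv (code :: 'u list \<Rightarrow> 'u) (code w) = w"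
 by (rule inv_f_f[OF inj_code_list])

text \<open>
 The presheaf \<open>!\<^sup>S\<Sigma>\<close>, with the action of all maps of cubes in place of that of the generators.
\<close>

definition LK :: "'u precub" where
 "LK = (\<lambda>n. code ` words \<Sigma> n,
     \<lambda>F\<in>box_maps. coded_map (words \<Sigma> (btgt F)) (pull F) (words \<Sigma> (bsrc F)))"

lemma pull_words: "F \<in> box_maps ==> w \<in> words \<Sigma> (btgt F) ==> pull F w \<in> words \<Sigma> (bsrc F)"
 using set_pull[of F w] length_pull[of F w] by (auto simp: words_def)

lemma words_small: "small TYPE('u) (code ` words \<Sigma> n)"
proof (rule small_image)
 show "small TYPE('u) (words \<Sigma> n)"
  by (rule small_subset[OF _ small_lists[OF small_labels]]) (auto simp: words_def)
qed

lemma LK_act: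
 assumes "F \<in> box_maps" "w \<in> words \<Sigma> (btgt F)"
 shows "pact LK F (code w) = code (pull F w)"
 using assms by (simp add: LK_def coded_map_def)

lemma LK_precub: "LK \<in> Ob sym_precubical_sets"
 unfolding precub_iff
proof (intro conjI allI ballI impI)
 show "small TYPE('u) (pel LK n)" for n using words_small by (simp add: LK_def)
 show "snd LK \<in> extensional box_maps" by (simp add: LK_def)
next
 fix F assume F: "F \<in> box_maps"
 then show "fst (snd LK F) = pel LK (btgt F)" "snd (snd (snd LK F)) = pel LK (bsrc F)"
  by (simp_all add: LK_def coded_map_def)
 show "pact LK F \<in> pel LK (btgt F) \<rightarrow>\<^sub>E pel LK (bsrc F)"
  using F pull_words[OF F] by (auto simp: LK_def coded_map_def)
next
 fix n
 have "pact LK (bid n) x = (\<lambda>x\<in>pel LK n. x) x" for x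
 proof (cases "x \<in> pel LK n")
  case True
  then obtain w where "x = code w" "w \<in> words \<Sigma> n" by (auto simp: LK_def)
  then show ?thesis using LK_act[OF box_id, of w n] True pull_id[of w n] by (simp add: words_def)
 next
  case False
  then show ?thesis using box_id[of n] by (simp add: LK_def coded_map_def)
 qed
 then show "pact LK (bid n) = (\<lambda>x\<in>pel LK n. x)" by blast
next
 fix F G assume *: "F \<in> box_maps" "G \<in> box_maps" "btgt F = bsrc G"
 have "pact LK (bcomp G F) x = compose (pel LK (btgt G)) (pact LK F) (pact LK G) x" for x
 proof (cases "x \<in> pel LK (btgt G)")
  case True
  then obtain w where w: "x = code w" "w \<in> words \<Sigma> (btgt G)" by (auto simp: LK_def)
  then have "pact LK (bcomp G F) x = code (pull F (pull G w))"
   using LK_act[OF box_comp[OF *], of w] pull_comp[OF *, of w] by simp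
  moreover have "pact LK F (pact LK G x) = code (pull F (pull G w))"
   using LK_act[OF *(2)] LK_act[OF *(1)] pull_words[OF *(2)] w *(3) by simp
  ultimately show ?thesis using True by (simp add: compose_eq)
 next
  case False
  then show ?thesis using box_comp[OF *] by (simp add: LK_def coded_map_def compose_def)
 qed
 then show "pact LK (bcomp G F) = compose (pel LK (btgt G)) (pact LK F) (pact LK G)" by blast
qed

lemma label_presheaf_eq: "label_presheaf \<Sigma> = LK"
 unfolding label_presheaf_def
proof (rule the_equality)
 have "coded_map (words \<Sigma> (Suc n)) (pull (face n i \<alpha>)) (words \<Sigma> n) =
   coded_map (words \<Sigma> (Suc n)) (\<lambda>w. take i w @ drop (Suc i) w) (words \<Sigma> n)" if "i \<le> n" for n i \<alpha>
  unfolding coded_map_def using pull_face[OF that, of "_ :: 'u list" \<alpha>] by (auto simp: words_def intro!: restrict_ext)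
 moreover have "coded_map (words \<Sigma> n) (pull (symmetry n i)) (words \<Sigma> n) =
   coded_map (words \<Sigma> n) (swap i) (words \<Sigma> n)" if "Suc i < n" for n i
  unfolding coded_map_def using pull_symmetry[OF that, of "_ :: 'u list"] by (auto simp: words_def intro!: restrict_ext)
 moreover have "bsrc (face n i \<alpha>) = n" "btgt (face n i \<alpha>) = Suc n"
   "bsrc (symmetry n i) = n" "btgt (symmetry n i) = n" for n i \<alpha> by (simp_all add: face_def symmetry_def)
 ultimately show LK: "LK \<in> Ob sym_precubical_sets \<and> (\<forall>n. fst LK n = code ` words \<Sigma> n) \<and>
   (\<forall>n i \<alpha>. i \<le> n \<longrightarrow> snd LK (face n i \<alpha>) =
    coded_map (words \<Sigma> (Suc n)) (\<lambda>w. take i w @ drop (Suc i) w) (words \<Sigma> n)) \<and>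
   (\<forall>n i. Suc i < n \<longrightarrow> snd LK (symmetry n i) = coded_map (words \<Sigma> n) (swap i) (words \<Sigma> n))"
  using LK_precub by (simp add: LK_def box_maps.intros)
 fix K :: "'u precub"
 assume K: "K \<in> Ob sym_precubical_sets \<and> (\<forall>n. fst K n = code ` words \<Sigma> n) \<and>
   (\<forall>n i \<alpha>. i \<le> n \<longrightarrow> snd K (face n i \<alpha>) =
    coded_map (words \<Sigma> (Suc n)) (\<lambda>w. take i w @ drop (Suc i) w) (words \<Sigma> n)) \<and>
   (\<forall>n i. Suc i < n \<longrightarrow> snd K (symmetry n i) = coded_map (words \<Sigma> n) (swap i) (words \<Sigma> n))"
 have pel: "pel K = pel LK" using K LK by auto
 note Kp = K[THEN conjunct1, unfolded precub_iff] and Lp = LK_precub[unfolded precub_iff]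
 have p: "pact K F = pact LK F" if "F \<in> box_maps" for F using that
 proof (induction rule: box_maps.induct)
  case (1 n)
  have "pact K (bid n) = pact LK (bid n)" using Kp Lp pel by simp
  then show ?case by (simp add: bid_simps)
 next
  case (4 l f m g n)
  have "pact K (bcomp (m, g, n) (l, f, m)) = pact LK (bcomp (m, g, n) (l, f, m))"
   using Kp Lp pel 4 by simp
  then show ?case by (simp add: bcomp_simps)
 qed (use K LK in simp_all)
 have "snd K F = snd LK F" for F
 proof (cases "F \<in> box_maps")
  case True
  then have "fst (snd K F) = fst (snd LK F)" "snd (snd (snd K F)) = snd (snd (snd LK F))"
   using Kp Lp pel by simp_all
  then show ?thesis using p[OF True] by (simp add: prod_eq_iff)
 next
  case False
  moreover have "snd K \<in> extensional box_maps" "snd LK \<in> extensional box_maps" using Kp Lp by blast+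
  ultimately show ?thesis using extensional_arb by metis
 qed
 then show "K = LK" using pel by (auto simp: prod_eq_iff)
qed

text \<open>The data of a labelled precubical set with elements in an arbitrary type, which quotients and cubes provide.\<close>

definition presheaf :: "(nat \<Rightarrow> 'b set) \<Rightarrow> (bmap \<Rightarrow> 'b \<Rightarrow> 'b) \<Rightarrow> (nat \<Rightarrow> 'b \<Rightarrow> 'u list) \<Rightarrow> bool" where
 "presheaf E A w \<longleftrightarrow> (\<forall>n. small TYPE('u) (E n)) \<and>
   (\<forall>F\<in>box_maps. \<forall>e\<in>E (btgt F). A F e \<in> E (bsrc F) \<and> w (bsrc F) (A F e) = pull F (w (btgt F) e)) \<and>
   (\<forall>n. \<forall>e\<in>E n. A (bid n) e = e \<and> w n e \<in> words \<Sigma> n) \<and>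
   (\<forall>F\<in>box_maps. \<forall>G\<in>box_maps. btgt F = bsrc G \<longrightarrow> (\<forall>e\<in>E (btgt G). A (bcomp G F) e = A F (A G e)))"

lemma presheafD:
 assumes "presheaf E A w"
 shows "small TYPE('u) (E n)"
  "F \<in> box_maps ==> e \<in> E (btgt F) ==> A F e \<in> E (bsrc F)"
  "F \<in> box_maps ==> e \<in> E (btgt F) ==> w (bsrc F) (A F e) = pull F (w (btgt F) e)"
  "e \<in> E n ==> A (bid n) e = e" "e \<in> E n ==> w n e \<in> words \<Sigma> n"
  "F \<in> box_maps ==> G \<in> box_maps ==> btgt F = bsrc G ==> e \<in> E (btgt G) ==>
    A (bcomp G F) e = A F (A G e)"
 using assms unfolding presheaf_def by blast+

lemma lps_iff: "x \<in> Ob LPS \<longleftrightarrow> x \<in> hom sym_precubical_sets (fst x) LK"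
proof -
 have "Cod sym_precubical_sets x = snd (snd x)" "Dom sym_precubical_sets x = fst x"
  by (simp_all add: sym_precubical_sets_def functor_cat_simps)
 then show ?thesis by (auto simp: labelled_precubical_sets_def hom_def label_presheaf_eq)
qed

lemma lpsE:
 assumes "x \<in> Ob LPS"
 obtains h where "x = (fst x, (\<lambda>n. (el x n, h n, code ` words \<Sigma> n)), LK)"
  "\<And>n. h n \<in> el x n \<rightarrow>\<^sub>E code ` words \<Sigma> n"
  "\<And>F e. F \<in> box_maps ==> e \<in> el x (btgt F) ==> h (bsrc F) (act x F e) = pact LK F (h (btgt F) e)"
  "fst x \<in> Ob sym_precubical_sets" "\<And>n e. wd x n e = inv code (h n e)"
proof -
 from assms obtain h where h: "x = (fst x, (\<lambda>n. (pel (fst x) n, h n, pel LK n)), LK)"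
  "\<And>n. h n \<in> pel (fst x) n \<rightarrow>\<^sub>E pel LK n"
  "\<And>F e. F \<in> box_maps ==> e \<in> pel (fst x) (btgt F) ==>
    h (bsrc F) (pact (fst x) F e) = pact LK F (h (btgt F) e)" "fst x \<in> Ob sym_precubical_sets"
  unfolding lps_iff precub_hom by blast
 have "wd x n e = inv code (h n e)" for n e unfolding wd_def by (subst h(1)) simp
 then show thesis using that[of h] h by (simp add: el_def act_def LK_def)
qed

lemma precubD:
 fixes K :: "'u precub"
 assumes "K \<in> Ob sym_precubical_sets"
 shows "small TYPE('u) (pel K n)"
  "F \<in> box_maps ==> pact K F \<in> pel K (btgt F) \<rightarrow>\<^sub>E pel K (bsrc F)"
  "pact K (bid n) = (\<lambda>x\<in>pel K n. x)"
  "F \<in> box_maps ==> G \<in> box_maps ==> btgt F = bsrc G ==>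
    pact K (bcomp G F) = compose (pel K (btgt G)) (pact K F) (pact K G)"
 using assms unfolding precub_iff by blast+

lemma lps_presheaf: assumes "x \<in> Ob LPS" shows "presheaf (el x) (act x) (wd x)"
proof -
 obtain h where "x = (fst x, (\<lambda>n. (el x n, h n, code ` words \<Sigma> n)), LK)"
  and h: "\<And>n. h n \<in> el x n \<rightarrow>\<^sub>E code ` words \<Sigma> n"
  "\<And>F e. F \<in> box_maps ==> e \<in> el x (btgt F) ==> h (bsrc F) (act x F e) = pact LK F (h (btgt F) e)"
  and K: "fst x \<in> Ob sym_precubical_sets" and w: "\<And>n e. wd x n e = inv code (h n e)"
  by (rule lpsE[OF assms]) (rule that)
 note K' = precubD[OF K, folded el_def, folded act_def]
 have c: "wd x n e \<in> words \<Sigma> n \<and> h n e = code (wd x n e)" if "e \<in> el x n" for n e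
  using PiE_mem[OF h(1) that] by (auto simp: w)
 show ?thesis unfolding presheaf_def
 proof (intro conjI allI ballI impI)
  fix F e assume F: "F \<in> box_maps" and e: "e \<in> el x (btgt F)"
  show ae: "act x F e \<in> el x (bsrc F)" using PiE_mem[OF K'(2)[OF F] e] .
  show "wd x (bsrc F) (act x F e) = pull F (wd x (btgt F) e)"
  proof -
   have "code (wd x (bsrc F) (act x F e)) = (code (pull F (wd x (btgt F) e)) :: 'u)"
    using h(2)[OF F e] c[OF e] c[OF ae] LK_act[OF F] by metis
   then show ?thesis using inj_code_list by (simp add: inj_eq)
  qed
 next
  fix F G e assume "F \<in> box_maps" "G \<in> box_maps" "btgt F = bsrc G" "e \<in> el x (btgt G)"
  then show "act x (bcomp G F) e = act x F (act x G e)" using K'(4)[of F G] by (simp add: compose_eq)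
 next
  fix n e assume "e \<in> el x n"
  then show "act x (bid n) e = e" "wd x n e \<in> words \<Sigma> n" using K'(3)[of n] c by simp_all
 qed (rule K'(1))
qed

definition pmap :: "'u precub_arrow \<Rightarrow> 'u precub_arrow \<Rightarrow> (nat \<Rightarrow> 'u \<Rightarrow> 'u) \<Rightarrow> bool" where
 "pmap x y f \<longleftrightarrow> (\<forall>n. \<forall>e\<in>el x n. f n e \<in> el y n \<and> wd y n (f n e) = wd x n e) \<and>
   (\<forall>F\<in>box_maps. \<forall>e\<in>el x (btgt F). f (bsrc F) (act x F e) = act y F (f (btgt F) e))"

lemma pmapD:
 assumes "pmap x y f"
 shows "e \<in> el x n ==> f n e \<in> el y n" "e \<in> el x n ==> wd y n (f n e) = wd x n e"
  "F \<in> box_maps ==> e \<in> el x (btgt F) ==> f (bsrc F) (act x F e) = act y F (f (btgt F) e)"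
 using assms unfolding pmap_def by blast+

lemma ap_mk_arr [simp]: "e \<in> el x n ==> ap (mk_arr x f y) n e = f n e"
 by (simp add: ap_def mk_arr_def)

lemma mk_arr_cong: "(\<And>n e. e \<in> el x n ==> f n e = g n e) ==> mk_arr x f y = mk_arr x g y"
 by (auto simp: mk_arr_def fun_eq_iff)

lemma lps_hom_iff:
 "h \<in> hom LPS x y \<longleftrightarrow> x \<in> Ob LPS \<and> y \<in> Ob LPS \<and> (\<exists>f. pmap x y f \<and> h = mk_arr x f y)"
proof (cases "x \<in> Ob LPS \<and> y \<in> Ob LPS")
 case False
 then show ?thesis
  by (auto simp: labelled_precubical_sets_def slice_hom)
next
 case True
 obtain k where k: "x = (fst x, (\<lambda>n. (el x n, k n, code ` words \<Sigma> n)), LK)"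
  "\<And>n. k n \<in> el x n \<rightarrow>\<^sub>E code ` words \<Sigma> n"
  "\<And>F e. F \<in> box_maps ==> e \<in> el x (btgt F) ==> k (bsrc F) (act x F e) = pact LK F (k (btgt F) e)"
  "fst x \<in> Ob sym_precubical_sets"
  and wx: "\<And>n e. wd x n e = inv code (k n e)"
  by (rule lpsE[OF conjunct1[OF True]]) (rule that)
 obtain l where l: "y = (fst y, (\<lambda>n. (el y n, l n, code ` words \<Sigma> n)), LK)"
  "\<And>n. l n \<in> el y n \<rightarrow>\<^sub>E code ` words \<Sigma> n"
  "\<And>F e. F \<in> box_maps ==> e \<in> el y (btgt F) ==> l (bsrc F) (act y F e) = pact LK F (l (btgt F) e)"
  "fst y \<in> Ob sym_precubical_sets"
  and wy: "\<And>n e. wd y n e = inv code (l n e)"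
  by (rule lpsE[OF conjunct2[OF True]]) (rule that)
 have c: "k n e = code (wd x n e)" if "e \<in> el x n" for n e using PiE_mem[OF k(2) that] by (auto simp: wx)
 have d: "l n e = code (wd y n e)" if "e \<in> el y n" for n e using PiE_mem[OF l(2) that] by (auto simp: wy)
 have Dom: "Dom sym_precubical_sets x = fst x" "Dom sym_precubical_sets y = fst y"
  by (simp_all add: sym_precubical_sets_def functor_cat_simps)
 have Co: "Comp sym_precubical_sets y u = x \<longleftrightarrow> (\<forall>n. compose (el x n) (l n) (g n) = k n)"
  if "u = (fst x, (\<lambda>n. (el x n, g n, el y n)), fst y)" for u g
 proof -
  have "fst (snd y) = (\<lambda>n. (el y n, l n, code ` words \<Sigma> n))" "snd (snd y) = LK"
   "fst (snd x) = (\<lambda>n. (el x n, k n, code ` words \<Sigma> n))" "snd (snd x) = LK"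
   using arg_cong[OF l(1), of "\<lambda>t. fst (snd t)"] arg_cong[OF l(1), of "\<lambda>t. snd (snd t)"]
    arg_cong[OF k(1), of "\<lambda>t. fst (snd t)"] arg_cong[OF k(1), of "\<lambda>t. snd (snd t)"]
   by (simp_all only: fst_conv snd_conv)
  then show ?thesis unfolding that
   by (simp add: sym_precubical_sets_def functor_cat_simps prod_eq_iff[of _ x] prod_eq_iff[of _ "snd x"])
    (auto simp: fun_eq_iff)
 qed
 have xy: "x \<in> Ar sym_precubical_sets" "Cod sym_precubical_sets x = LK"
   "y \<in> Ar sym_precubical_sets" "Cod sym_precubical_sets y = LK"
  using hom_Ar[OF conjunct1[OF True, unfolded lps_iff]] hom_Ar[OF conjunct2[OF True, unfolded lps_iff]]
  by simp_all
 have word: "compose (el x n) (l n) g = k n \<longleftrightarrow> (\<forall>e\<in>el x n. wd y n (g e) = wd x n e)"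
  if g: "g \<in> el x n \<rightarrow>\<^sub>E el y n" for g n
 proof -
  have "compose (el x n) (l n) g = k n \<longleftrightarrow> (\<forall>e\<in>el x n. l n (g e) = k n e)"
   using k(2)[of n] by (auto simp: compose_def fun_eq_iff PiE_def extensional_def)
  also have "\<dots> \<longleftrightarrow> (\<forall>e\<in>el x n. wd y n (g e) = wd x n e)"
   using c d PiE_mem[OF g] inv_code_list by (metis (no_types, lifting))
  finally show ?thesis .
 qed
 have "h \<in> hom LPS x y \<longleftrightarrow> (\<exists>u. h = (x, u, y) \<and>
   u \<in> hom sym_precubical_sets (fst x) (fst y) \<and> Comp sym_precubical_sets y u = x)"
  unfolding labelled_precubical_sets_def label_presheaf_eq slice_hom Dom using xy by blast
 also have "\<dots> \<longleftrightarrow> (\<exists>f. pmap x y f \<and> h = mk_arr x f y)" (is "?l \<longleftrightarrow> ?r")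
 proof
  assume ?l
  then obtain u where u: "h = (x, u, y)" "Comp sym_precubical_sets y u = x"
   and uh: "u \<in> hom sym_precubical_sets (fst x) (fst y)" by blast
  obtain g where g: "u = (fst x, (\<lambda>n. (el x n, g n, el y n)), fst y)" "\<And>n. g n \<in> el x n \<rightarrow>\<^sub>E el y n"
   "\<And>F e. F \<in> box_maps ==> e \<in> el x (btgt F) ==> g (bsrc F) (act x F e) = act y F (g (btgt F) e)"
   using uh unfolding precub_hom el_def[symmetric] act_def[symmetric] by blast
  have "\<forall>e\<in>el x n. wd y n (g n e) = wd x n e" for n using Co[OF g(1)] u(2) word[OF g(2)] by blast
  then have "pmap x y g" unfolding pmap_def using g(2,3) PiE_mem[OF g(2)] by blast
  moreover have "h = mk_arr x g y"
   unfolding mk_arr_def u g(1) using PiE_restrict[OF g(2)] by simp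
  ultimately show ?r by blast
 next
  assume ?r
  then obtain f where f: "pmap x y f" "h = mk_arr x f y" by blast
  define g where "g = (\<lambda>n. restrict (f n) (el x n))"
  define u where "u = (fst x, (\<lambda>n. (el x n, g n, el y n)), fst y)"
  have g: "g n \<in> el x n \<rightarrow>\<^sub>E el y n" for n using pmapD(1)[OF f(1)] by (auto simp: g_def)
  have "\<forall>e\<in>el x n. wd y n (g n e) = wd x n e" for n using pmapD(2)[OF f(1)] by (simp add: g_def)
  then have "Comp sym_precubical_sets y u = x" using Co[OF u_def] word[OF g] by blast
  moreover have "u \<in> hom sym_precubical_sets (fst x) (fst y)"
   unfolding precub_hom u_def el_def[symmetric] act_def[symmetric]
  proof (intro conjI exI[of _ g] allI ballI)
   fix F e assume "F \<in> box_maps" "e \<in> el x (btgt F)"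
   then show "g (bsrc F) (act x F e) = act y F (g (btgt F) e)"
    using pmapD(3)[OF f(1)] presheafD(2)[OF lps_presheaf] True by (simp add: g_def)
  qed (use k(4) l(4) g in simp_all)
  moreover have "h = (x, u, y)" using f(2) by (simp add: mk_arr_def u_def g_def)
  ultimately show ?l by blast
 qed
 finally show ?thesis using True by blast
qed

lemma is_category_LPS: "is_category LPS"
 unfolding labelled_precubical_sets_def by (rule is_category_slice[OF is_category_precub])

lemma mk_arr_hom: "x \<in> Ob LPS ==> y \<in> Ob LPS ==> pmap x y f ==> mk_arr x f y \<in> hom LPS x y"
 using lps_hom_iff by blast

lemma pmap_cong:
 assumes "x \<in> Ob LPS" "pmap x y f" "\<And>n e. e \<in> el x n ==> f n e = g n e" shows "pmap x y g"
 unfolding pmap_def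
proof (intro conjI allI ballI)
 fix F e assume F: "F \<in> box_maps" "e \<in> el x (btgt F)"
 then have "act x F e \<in> el x (bsrc F)" using presheafD(2)[OF lps_presheaf[OF assms(1)]] by blast
 then show "g (bsrc F) (act x F e) = act y F (g (btgt F) e)"
  using pmapD(3)[OF assms(2) F] assms(3) F by simp
qed (use pmapD(1,2)[OF assms(2)] assms(3) in auto)

lemma hom_ap: assumes "h \<in> hom LPS x y" shows "pmap x y (ap h)" "h = mk_arr x (ap h) y"
proof -
 obtain f where f: "pmap x y f" "h = mk_arr x f y" and x: "x \<in> Ob LPS" using assms lps_hom_iff by blast
 have *: "ap h n e = f n e" if "e \<in> el x n" for n e using that f by simp
 show "pmap x y (ap h)" using pmap_cong[OF x f(1)] * by simp
 show "h = mk_arr x (ap h) y" using mk_arr_cong[of x f "ap h" y] * f(2) by simp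
qed

lemma lps_hom_eqI:
 assumes "h \<in> hom LPS x y" "k \<in> hom LPS x y" "\<And>n e. e \<in> el x n ==> ap h n e = ap k n e"
 shows "h = k"
 using hom_ap(2)[OF assms(1)] hom_ap(2)[OF assms(2)] mk_arr_cong[of x "ap h" "ap k" y] assms(3) by simp

lemma LPS_comp:
 assumes "h \<in> hom LPS x y" "k \<in> hom LPS y z" "e \<in> el x n"
 shows "ap (Comp LPS k h) n e = ap k n (ap h n e)"
proof -
 have k: "fst (snd (snd (mk_arr y (ap k) z))) = fst z" by (simp add: mk_arr_def)
 have "ap (Comp LPS (mk_arr y (ap k) z) (mk_arr x (ap h) y)) n e = ap k n (ap h n e)"
  using assms(3) pmapD(1)[OF hom_ap(1)[OF assms(1)]]
  by (simp add: labelled_precubical_sets_def sym_precubical_sets_def functor_cat_simps mk_arr_def ap_def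
    compose_eq)
 then show ?thesis using hom_ap(2)[OF assms(1)] hom_ap(2)[OF assms(2)] by simp
qed

lemma LPS_id: "x \<in> Ob LPS ==> e \<in> el x n ==> ap (Id LPS x) n e = e"
 by (simp add: labelled_precubical_sets_def sym_precubical_sets_def functor_cat_simps ap_def el_def)

lemma lps_bij_iso:
 assumes h: "h \<in> hom LPS x y" and bij: "\<And>n. bij_betw (ap h n) (el x n) (el y n)"
 shows "is_iso LPS h"
proof -
 have x: "x \<in> Ob LPS" and y: "y \<in> Ob LPS" using h lps_hom_iff by blast+
 note p = pmapD[OF hom_ap(1)[OF h]]
 define g where "g = (\<lambda>n. inv_into (el x n) (ap h n))"
 have g: "g n e \<in> el x n \<and> ap h n (g n e) = e" if "e \<in> el y n" for n e
  using that bij[of n] unfolding g_def by (metis bij_betw_imp_surj_on f_inv_into_f inv_into_into)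
 have gi: "g n (ap h n e) = e" if "e \<in> el x n" for n e
  using that bij[of n] unfolding g_def by (metis bij_betw_def inv_into_f_f)
 have "pmap y x g" unfolding pmap_def
 proof (intro conjI allI ballI)
  fix F e assume F: "F \<in> box_maps" "e \<in> el y (btgt F)"
  have "act y F e = ap h (bsrc F) (act x F (g (btgt F) e))" using p(3)[OF F(1)] g[OF F(2)] by simp
  moreover have "act x F (g (btgt F) e) \<in> el x (bsrc F)"
   using presheafD(2)[OF lps_presheaf[OF x] F(1)] g[OF F(2)] by blast
  ultimately show "g (bsrc F) (act y F e) = act x F (g (btgt F) e)" using gi by simp
 next
  fix n e assume e: "e \<in> el y n"
  show "wd x n (g n e) = wd y n e" using p(2)[of "g n e" n] g[OF e] by simp
 qed (use g in blast)
 then have k: "mk_arr y g x \<in> hom LPS y x" using mk_arr_hom x y by blast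
 have "Comp LPS (mk_arr y g x) h = Id LPS x"
  by (rule lps_hom_eqI[OF catD(4)[OF is_category_LPS h k] catD(3)[OF is_category_LPS x]])
   (simp add: LPS_comp[OF h k] LPS_id[OF x] gi p(1))
 moreover have "Comp LPS h (mk_arr y g x) = Id LPS y"
  by (rule lps_hom_eqI[OF catD(4)[OF is_category_LPS k h] catD(3)[OF is_category_LPS y]])
   (simp add: LPS_comp[OF k h] LPS_id[OF y] g)
 ultimately show ?thesis unfolding is_iso_def using h k hom_Ar[OF h] by auto
qed

text \<open>Every small presheaf by elements is carried by an object of the category.\<close>

definition realize :: "(nat \<Rightarrow> 'b set) \<Rightarrow> (bmap \<Rightarrow> 'b \<Rightarrow> 'b) \<Rightarrow> (nat \<Rightarrow> 'b \<Rightarrow> 'u list) \<Rightarrow> 'u precub_arrow" where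
 "realize E A w = (let r = \<lambda>n. enc (E n); K =
   (\<lambda>n. r n ` E n, \<lambda>F\<in>box_maps. (r (btgt F) ` E (btgt F),
    (\<lambda>x\<in>r (btgt F) ` E (btgt F). r (bsrc F) (A F (inv_into (E (btgt F)) (r (btgt F)) x))),
    r (bsrc F) ` E (bsrc F))) in
   (K, (\<lambda>n. (r n ` E n, (\<lambda>x\<in>r n ` E n. code (w n (inv_into (E n) (r n) x))), code ` words \<Sigma> n)), LK))"

lemma realize:
 assumes "presheaf E A w"
 shows "el (realize E A w) n = enc (E n) ` E n"
  "F \<in> box_maps ==> e \<in> E (btgt F) ==>
    act (realize E A w) F (enc (E (btgt F)) e) = enc (E (bsrc F)) (A F e)"
  "e \<in> E n ==> wd (realize E A w) n (enc (E n) e) = w n e"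
  "realize E A w \<in> Ob LPS"
proof -
 note p = presheafD[OF assms]
 define x where "x = realize E A w"
 have inv: "inv_into (E n) (enc (E n)) (enc (E n) e) = e" if "e \<in> E n" for n e
  by (rule inv_into_f_f[OF inj_on_enc[OF p(1)] that])
 have 1: "el (realize E A w) n = enc (E n) ` E n" for n by (simp add: realize_def Let_def el_def)
 have a: "act x F (enc (E (btgt F)) e) = enc (E (bsrc F)) (A F e)" if "F \<in> box_maps" "e \<in> E (btgt F)" for F e
  using that inv by (simp add: x_def realize_def Let_def act_def)
 have wd: "e \<in> E n ==> wd (realize E A w) n (enc (E n) e) = w n e" for n e
  using inv by (simp add: realize_def Let_def wd_def)
 define h where "h = (\<lambda>n. \<lambda>x\<in>enc (E n) ` E n. (code :: 'u list \<Rightarrow> 'u) (w n (inv_into (E n) (enc (E n)) x)))"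
 have h: "h n (enc (E n) e) = code (w n e)" if "e \<in> E n" for n e using that inv by (simp add: h_def)
 have ext: "act x F \<in> extensional (el x (btgt F))" if "F \<in> box_maps" for F
  using that by (simp add: x_def realize_def Let_def act_def el_def)
 have el: "el x n = enc (E n) ` E n" for n using 1 by (simp add: x_def)
 have st: "fst (snd (fst x) F) = el x (btgt F)" "snd (snd (snd (fst x) F)) = el x (bsrc F)" if "F \<in> box_maps" for F
  using that by (simp_all add: x_def realize_def Let_def el_def)
 have se: "snd (fst x) \<in> extensional box_maps" by (simp add: x_def realize_def Let_def)
 have "fst x \<in> Ob sym_precubical_sets"
  unfolding precub_iff el_def[symmetric] act_def[symmetric] snd_conv
 proof (intro conjI allI ballI impI)
  show "small TYPE('u) (el x n)" for n unfolding el using small_image[OF p(1)] .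
 next
  show "act x (bid n) = (\<lambda>x\<in>el x n. x)" for n
   using ext[OF box_id, of n] a[OF box_id, of _ n] p(4)
   by (intro extensionalityI[of _ "el x n"]) (auto simp: el)
 next
  fix F assume F: "F \<in> box_maps"
  show "act x F \<in> el x (btgt F) \<rightarrow>\<^sub>E el x (bsrc F)"
   using ext[OF F] a[OF F] p(2)[OF F] unfolding PiE_def by (auto simp: el)
 next
  fix F G assume *: "F \<in> box_maps" "G \<in> box_maps" "btgt F = bsrc G"
  have "act x (bcomp G F) e = compose (el x (btgt G)) (act x F) (act x G) e" if e: "e \<in> el x (btgt G)" for e
  proof -
   obtain b where b: "b \<in> E (btgt G)" "e = enc (E (btgt G)) b" using e by (auto simp: el)
   have "A G b \<in> E (btgt F)" using p(2)[OF *(2) b(1)] *(3) by simp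
   then show ?thesis
    using e b a[OF box_comp[OF *], of b] a[OF *(2) b(1)] a[OF *(1), of "A G b"] p(6)[OF * b(1)] *(3)
    by (simp add: compose_eq)
  qed
  then show "act x (bcomp G F) = compose (el x (btgt G)) (act x F) (act x G)"
   using ext[OF box_comp[OF *]] by (intro extensionalityI[of _ "el x (btgt G)"]) (auto simp: compose_def)
 qed (use st se in simp_all)
 moreover have "x = (fst x, (\<lambda>n. (el x n, h n, pel LK n)), LK)"
  by (simp add: x_def realize_def Let_def el_def h_def LK_def)
 moreover have "h n \<in> el x n \<rightarrow>\<^sub>E pel LK n" for n
  using p(5) inv by (auto simp: h_def el LK_def)
 moreover have "h (bsrc F) (act x F e) = pact LK F (h (btgt F) e)" if F: "F \<in> box_maps" "e \<in> el x (btgt F)" for F e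
 proof -
  obtain b where b: "b \<in> E (btgt F)" "e = enc (E (btgt F)) b" using F(2) by (auto simp: el)
  then show ?thesis using h a[OF F(1)] p(2,3,5) F(1) LK_act[OF F(1)] by simp
 qed
 ultimately have "x \<in> hom sym_precubical_sets (fst x) LK"
  unfolding precub_hom el_def[symmetric] act_def[symmetric] using LK_precub by blast
 then show "realize E A w \<in> Ob LPS" using lps_iff x_def by blast
 show "el (realize E A w) n = enc (E n) ` E n" by (rule 1)
 show "act (realize E A w) F (enc (E (btgt F)) e) = enc (E (bsrc F)) (A F e)"
  if "F \<in> box_maps" "e \<in> E (btgt F)" using a[OF that] by (simp add: x_def)
 show "wd (realize E A w) n (enc (E n) e) = w n e" if "e \<in> E n" by (rule wd[OF that])
qed

end

section \<open>Precubical sets satisfying the paradigm of higher dimensional automata\<close>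

lemma bfun_point [simp]: "bfun (bx \<beta> []) [] = \<beta>"
 using bx_nth(2,3)[of "[]" \<beta> "[]"] by (auto intro!: nth_equalityI)

lemma point_box: "bx \<beta> [] \<in> box_maps" "dirs (bx \<beta> []) = []"
 by (simp_all add: bx_box)

lemma bcomp_point:
 assumes "F \<in> box_maps" "\<xi> \<in> bits (bsrc F)" shows "bcomp F (bx \<xi> []) = bx (bfun F \<xi>) []"
proof (rule box_eqI)
 have l: "length \<xi> = bsrc F" "length (bfun F \<xi>) = btgt F"
  using assms box_dirs(5)[OF assms] by (simp_all add: bits_def)
 then show "bcomp F (bx \<xi> []) \<in> box_maps" "bx (bfun F \<xi>) [] \<in> box_maps"
  "bsrc (bcomp F (bx \<xi> [])) = bsrc (bx (bfun F \<xi>) [])" "btgt (bcomp F (bx \<xi> [])) = btgt (bx (bfun F \<xi>) [])"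
  using box_comp[OF point_box(1) assms(1), of \<xi>] point_box by simp_all
 show "dirs (bcomp F (bx \<xi> [])) = dirs (bx (bfun F \<xi>) [])"
  using dirs_comp[OF point_box(1) assms(1), of \<xi>] l by (simp add: point_box)
 show "bfun (bcomp F (bx \<xi> [])) (zeros (bsrc (bcomp F (bx \<xi> [])))) =
   bfun (bx (bfun F \<xi>) []) (zeros (bsrc (bcomp F (bx \<xi> []))))"
  by (simp add: bfun_bcomp)
qed

abbreviation edge :: "nat \<Rightarrow> nat \<Rightarrow> bmap" where "edge n i \<equiv> bx (zeros n) [i]"
abbreviation front :: "nat \<Rightarrow> nat \<Rightarrow> bmap" where "front p q \<equiv> bx (zeros (p + q)) [0..<p]"
abbreviation rear :: "nat \<Rightarrow> nat \<Rightarrow> bmap" where "rear p q \<equiv> bx (ones p @ zeros q) [p..<p + q]"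

lemma edge_box: "i < n ==> edge n i \<in> box_maps \<and> dirs (edge n i) = [i]"
 using bx_box[of "[i]" "zeros n"] by simp

lemma front_subset [simp]: "{0..<p} \<subseteq> {..<p + q}" and rear_subset [simp]: "{p..<p + q} \<subseteq> {..<p + q}" for p q :: nat
 by auto

lemma map_nth_blocks:
 "map (nth (u @ v)) [0..<length u] = u" "map (nth (u @ v)) [length u..<length u + length v] = v"
 by (auto intro!: nth_equalityI simp: nth_append)

lemma front_box: "front p q \<in> box_maps" "dirs (front p q) = [0..<p]"
 using bx_box[of "[0..<p]" "zeros (p + q)"] by auto

lemma rear_box: "rear p q \<in> box_maps" "dirs (rear p q) = [p..<p + q]"
 using bx_box[of "[p..<p + q]" "ones p @ zeros q"] by auto

lemma bfun_front: assumes "length \<xi> = p" shows "bfun (front p q) \<xi> = \<xi> @ zeros q"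
proof (rule nth_equalityI)
 note b = bx_nth[of "[0..<p]" "zeros (p + q)" \<xi>]
 have e: "\<xi> \<in> bits (length [0..<p])" using assms by (simp add: bits_def)
 show "length (bfun (front p q) \<xi>) = length (\<xi> @ zeros q)" using b(3)[OF _ _ e] assms by simp
 fix j assume "j < length (bfun (front p q) \<xi>)"
 then have j: "j < p + q" using b(3)[OF _ _ e] by simp
 show "bfun (front p q) \<xi> ! j = (\<xi> @ zeros q) ! j"
  using b(1)[OF _ _ e, of j] b(2)[OF _ _ e, of j] j assms by (cases "j < p") (auto simp: nth_append)
qed

lemma bfun_rear: assumes "length \<xi> = q" shows "bfun (rear p q) \<xi> = ones p @ \<xi>"
proof (rule nth_equalityI)
 note b = bx_nth[of "[p..<p + q]" "ones p @ zeros q" \<xi>]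
 have e: "\<xi> \<in> bits (length [p..<p + q])" using assms by (simp add: bits_def)
 show "length (bfun (rear p q) \<xi>) = length (ones p @ \<xi>)" using b(3)[OF _ _ e] assms by auto
 fix j assume "j < length (bfun (rear p q) \<xi>)"
 then have j: "j < p + q" using b(3)[OF _ _ e] by auto
 show "bfun (rear p q) \<xi> ! j = (ones p @ \<xi>) ! j"
  using b(1)[OF _ _ e, of "j - p"] b(2)[OF _ _ e, of j] j assms by (cases "j < p") (auto simp: nth_append)
qed

lemma bfun_perm:
 assumes "distinct ds" "set ds = {..<n}"
 shows "length ds = n" "bfun (bx (zeros n) ds) (zeros n) = zeros n" "bfun (bx (zeros n) ds) (ones n) = ones n"
proof -
 show l: "length ds = n" using distinct_card[OF assms(1)] assms(2) by simp
 have "bfun (bx (zeros n) ds) (replicate n b) = replicate n b" for b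
 proof (rule nth_equalityI)
  note r = bx_nth[OF assms(1), of "zeros n" "replicate n b"]
  have e: "replicate n b \<in> bits (length ds)" using l by (simp add: bits_def)
  show "length (bfun (bx (zeros n) ds) (replicate n b)) = length (replicate n b)"
   using r(3)[OF _ e] assms(2) by simp
  fix j assume "j < length (bfun (bx (zeros n) ds) (replicate n b))"
  then have j: "j < n" using r(3)[OF _ e] assms(2) by simp
  then have "j \<in> set ds" using assms(2) by simp
  then obtain i where "i < n" "j = ds ! i" using l by (metis in_set_conv_nth)
  then show "bfun (bx (zeros n) ds) (replicate n b) ! j = replicate n b ! j"
   using r(1)[OF _ e, of i] assms(2) l j by simp
 qed
 then show "bfun (bx (zeros n) ds) (zeros n) = zeros n" "bfun (bx (zeros n) ds) (ones n) = ones n" by blast+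
qed

lemma front_full: "front n 0 = bid n"
proof (rule box_eqI)
 show "dirs (front n 0) = dirs (bid n)" using front_box(2)[of n 0] by simp
 show "bfun (front n 0) (zeros (bsrc (front n 0))) = bfun (bid n) (zeros (bsrc (front n 0)))"
  using bfun_front[of "zeros n" n 0] by (simp add: bfun_bid)
qed (use front_box(1)[of n 0] box_id in simp_all)

lemma point_id: "bx [] [] = bid 0" using front_full[of 0] by simp

definition vtx :: "'u precub_arrow \<Rightarrow> bool list \<Rightarrow> 'u \<Rightarrow> 'u" where "vtx x \<xi> c = act x (bx \<xi> []) c"
abbreviation src :: "'u precub_arrow \<Rightarrow> nat \<Rightarrow> 'u \<Rightarrow> 'u" where "src x n c \<equiv> vtx x (zeros n) c"
abbreviation tgt :: "'u precub_arrow \<Rightarrow> nat \<Rightarrow> 'u \<Rightarrow> 'u" where "tgt x n c \<equiv> vtx x (ones n) c"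

text \<open>
 Two edges carry the same action when they are linked by a chain of pairs of parallel edges of
 common cubes. An action is a chosen representative of such a class.
\<close>

definition par1 :: "'u precub_arrow \<Rightarrow> 'u \<Rightarrow> 'u \<Rightarrow> bool" where
 "par1 x e e' \<longleftrightarrow> (\<exists>F F' c. F \<in> box_maps \<and> F' \<in> box_maps \<and> bsrc F = 1 \<and> bsrc F' = 1 \<and>
   btgt F = btgt F' \<and> dirs F = dirs F' \<and> c \<in> el x (btgt F) \<and> e = act x F c \<and> e' = act x F' c)"

abbreviation par :: "'u precub_arrow \<Rightarrow> 'u \<Rightarrow> 'u \<Rightarrow> bool" where "par x \<equiv> (par1 x)\<^sup>*\<^sup>*"

definition rep :: "'u precub_arrow \<Rightarrow> 'u \<Rightarrow> 'u" where "rep x e = (SOME e'. par x e e')"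

definition acts :: "'u precub_arrow \<Rightarrow> nat \<Rightarrow> 'u \<Rightarrow> 'u list" where
 "acts x n c = map (\<lambda>i. rep x (act x (edge n i) c)) [0..<n]"

lemma par1_sym: "par1 x e e' ==> par1 x e' e" unfolding par1_def by metis

lemma par_sym: "par x e e' ==> par x e' e"
 by (induction rule: rtranclp_induct) (auto intro: converse_rtranclp_into_rtranclp par1_sym)

lemma par_rep: "par x e (rep x e)" unfolding rep_def by (rule someI[of _ e]) simp

lemma rep_eq: "rep x e = rep x e' \<longleftrightarrow> par x e e'"
proof
 assume "rep x e = rep x e'"
 then show "par x e e'" using par_rep[of x e] par_sym[OF par_rep[of x e']] by (metis rtranclp_trans)
next
 assume *: "par x e e'"
 have "par x e = par x e'" using rtranclp_trans[OF *] rtranclp_trans[OF par_sym[OF *]] by blast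
 then show "rep x e = rep x e'" by (simp add: rep_def)
qed

lemma rep_rep [simp]: "rep x (rep x e) = rep x e" using rep_eq par_sym[OF par_rep] by metis

lemma length_acts [simp]: "length (acts x n c) = n" by (simp add: acts_def)

context small_labels
begin

lemma par1_el:
 assumes "x \<in> Ob LPS" "par1 x e e'" shows "e \<in> el x 1 \<and> e' \<in> el x 1 \<and> wd x 1 e' = wd x 1 e"
proof -
 note p = presheafD[OF lps_presheaf[OF assms(1)]]
 obtain F F' c where *: "F \<in> box_maps" "F' \<in> box_maps" "bsrc F = 1" "bsrc F' = 1"
   "btgt F = btgt F'" "dirs F = dirs F'" "c \<in> el x (btgt F)" "e = act x F c" "e' = act x F' c"
  using assms(2) unfolding par1_def by blast
 then show ?thesis using p(2,3)[of F c] p(2,3)[of F' c] by (simp add: pull_def)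
qed

lemma par_el:
 assumes "x \<in> Ob LPS" "par x e e'" "e \<in> el x 1" shows "e' \<in> el x 1 \<and> wd x 1 e' = wd x 1 e"
 using assms(2)
proof induction
 case (step e' e'')
 then show ?case using par1_el[OF assms(1) step(2)] by simp
qed (use assms(3) in blast)

lemma rep_el: "x \<in> Ob LPS ==> e \<in> el x 1 ==> rep x e \<in> el x 1 \<and> wd x 1 (rep x e) = wd x 1 e"
 using par_el[OF _ par_rep] .

lemma el_edge: "x \<in> Ob LPS ==> c \<in> el x n ==> i < n ==> act x (edge n i) c \<in> el x 1"
 using presheafD(2)[OF lps_presheaf, of x "edge n i" c] edge_box[of i n] by simp

lemma vtx_el: "x \<in> Ob LPS ==> c \<in> el x (length \<xi>) ==> vtx x \<xi> c \<in> el x 0"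
 using presheafD(2)[OF lps_presheaf, of x "bx \<xi> []" c] point_box[of \<xi>] by (simp add: vtx_def)

lemma vtx_point: "x \<in> Ob LPS ==> s \<in> el x 0 ==> vtx x [] s = s"
 using presheafD(4)[OF lps_presheaf, of x s 0] by (simp add: vtx_def point_id)

lemma vtx_act:
 assumes "x \<in> Ob LPS" "F \<in> box_maps" "c \<in> el x (btgt F)" "length \<xi> = bsrc F"
 shows "vtx x \<xi> (act x F c) = vtx x (bfun F \<xi>) c"
 using presheafD(6)[OF lps_presheaf[OF assms(1)] point_box(1) assms(2), of \<xi> c]
  bcomp_point[OF assms(2), of \<xi>] assms(3,4)
 by (simp add: vtx_def bits_def)

lemma set_acts: "x \<in> Ob LPS ==> c \<in> el x n ==> set (acts x n c) \<subseteq> rep x ` el x 1"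
 using el_edge[of x c n] by (auto simp: acts_def)

lemma rep_act_edge:
 assumes x: "x \<in> Ob LPS" and F: "F \<in> box_maps" "bsrc F = 1" and c: "c \<in> el x (btgt F)"
 shows "rep x (act x F c) = acts x (btgt F) c ! (dirs F ! 0)"
proof -
 have d: "dirs F ! 0 < btgt F" "dirs F = [dirs F ! 0]"
  using dirs_nth_less[OF F(1)] box_dirs(1)[OF F(1)] F(2) by (auto simp: length_Suc_conv)
 have "par1 x (act x F c) (act x (edge (btgt F) (dirs F ! 0)) c)"
  unfolding par1_def using edge_box[OF d(1)] F c d(2)
  by (rule_tac exI[of _ F], rule_tac exI[of _ "edge (btgt F) (dirs F ! 0)"], rule_tac exI[of _ c])
   (simp add: box_dirs(1))
 then show ?thesis using d(1) rep_eq[of x "act x F c"] by (simp add: acts_def r_into_rtranclp)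
qed

lemma acts_act:
 assumes x: "x \<in> Ob LPS" and F: "F \<in> box_maps" and c: "c \<in> el x (btgt F)"
 shows "acts x (bsrc F) (act x F c) = pull F (acts x (btgt F) c)"
proof (rule nth_equalityI)
 show "length (acts x (bsrc F) (act x F c)) = length (pull F (acts x (btgt F) c))"
  using length_pull[OF F, of "acts x (btgt F) c"] by simp
 fix i assume "i < length (acts x (bsrc F) (act x F c))"
 then have i: "i < bsrc F" by simp
 then have e: "edge (bsrc F) i \<in> box_maps" "dirs (edge (bsrc F) i) = [i]" using edge_box by blast+
 have "act x (edge (bsrc F) i) (act x F c) = act x (bcomp F (edge (bsrc F) i)) c"
  using presheafD(6)[OF lps_presheaf[OF x] e(1) F] c by simp
 then show "acts x (bsrc F) (act x F c) ! i = pull F (acts x (btgt F) c) ! i"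
  using rep_act_edge[OF x box_comp[OF e(1) F], of c] dirs_comp[OF e(1) F] e i c box_dirs(1)[OF F]
  by (simp add: pull_def) (simp add: acts_def)
qed

lemma wd_acts:
 assumes x: "x \<in> Ob LPS" and c: "c \<in> el x n"
 shows "wd x n c = map (\<lambda>u. hd (wd x 1 u)) (acts x n c)"
proof (rule nth_equalityI)
 note p = presheafD[OF lps_presheaf[OF x]]
 show l: "length (wd x n c) = length (map (\<lambda>u. hd (wd x 1 u)) (acts x n c))"
  using p(5)[OF c] by (simp add: words_def)
 fix i assume "i < length (wd x n c)"
 then have i: "i < n" using l by simp
 have "wd x 1 (act x (edge n i) c) = [wd x n c ! i]"
  using p(3)[of "edge n i" c] edge_box[OF i] c by (simp add: pull_def)
 then show "wd x n c ! i = map (\<lambda>u. hd (wd x 1 u)) (acts x n c) ! i"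
  using rep_el[OF x el_edge[OF x c i]] i by (simp add: acts_def)
qed

subsection \<open>Functoriality\<close>

lemma pmap_par:
 assumes "x \<in> Ob LPS" "pmap x y f" "par x e e'" shows "par y (f 1 e) (f 1 e')"
 using assms(3)
proof induction
 case (step e' e'')
 obtain F F' c where *: "F \<in> box_maps" "F' \<in> box_maps" "bsrc F = 1" "bsrc F' = 1"
   "btgt F = btgt F'" "dirs F = dirs F'" "c \<in> el x (btgt F)" "e' = act x F c" "e'' = act x F' c"
  using step(2) unfolding par1_def by blast
 have "par1 y (f 1 e') (f 1 e'')" unfolding par1_def
  using * pmapD(3)[OF assms(2), of F c] pmapD(3)[OF assms(2), of F' c] pmapD(1)[OF assms(2) *(7)]
  by (rule_tac exI[of _ F], rule_tac exI[of _ F'], rule_tac exI[of _ "f (btgt F) c"]) simp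
 then show ?case using step(3) by auto
qed simp

lemma pmap_vtx:
 assumes "pmap x y f" "c \<in> el x (length \<xi>)" shows "f 0 (vtx x \<xi> c) = vtx y \<xi> (f (length \<xi>) c)"
 using pmapD(3)[OF assms(1) point_box(1), of c \<xi>] assms(2) by (simp add: vtx_def)

lemma pmap_acts:
 assumes "x \<in> Ob LPS" "pmap x y f" "c \<in> el x n"
 shows "acts y n (f n c) = map (\<lambda>u. rep y (f 1 u)) (acts x n c)"
proof -
 have "rep y (act y (edge n i) (f n c)) = rep y (f 1 (rep x (act x (edge n i) c)))" if "i < n" for i
  using pmapD(3)[OF assms(2), of "edge n i" c] edge_box[OF that] assms(3)
   pmap_par[OF assms(1,2) par_rep[of x "act x (edge n i) c"]] by (simp add: rep_eq)
 then show ?thesis by (simp add: acts_def)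
qed

subsection \<open>The paradigm\<close>

text \<open>
 The first condition says that a cube is determined by its source, its actions and its target,
 and that its intermediate states are determined as well; the second says that parallel edges
 with the same label are equal. Both only ask for equalities between given elements, so they pass
 to subobjects and to products.
\<close>

definition paradigm :: "'u precub_arrow \<Rightarrow> bool" where
 "paradigm x \<longleftrightarrow> x \<in> Ob LPS \<and>
   (\<forall>p q. \<forall>c\<in>el x (p + q). \<forall>d\<in>el x p. \<forall>d'\<in>el x q.
    src x p d = src x (p + q) c \<longrightarrow> tgt x p d = src x q d' \<longrightarrow> tgt x q d' = tgt x (p + q) c \<longrightarrow>
    acts x (p + q) c = acts x p d @ acts x q d' \<longrightarrow> d = act x (front p q) c) \<and>
   (\<forall>e\<in>el x 1. \<forall>e'\<in>el x 1. src x 1 e = src x 1 e' \<longrightarrow> tgt x 1 e = tgt x 1 e' \<longrightarrow>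
    wd x 1 e = wd x 1 e' \<longrightarrow> e = e')"

lemma paradigmD:
 assumes "paradigm x"
 shows "x \<in> Ob LPS"
  "c \<in> el x (p + q) ==> d \<in> el x p ==> d' \<in> el x q ==> src x p d = src x (p + q) c ==>
    tgt x p d = src x q d' ==> tgt x q d' = tgt x (p + q) c ==>
    acts x (p + q) c = acts x p d @ acts x q d' ==> d = act x (front p q) c"
  "e \<in> el x 1 ==> e' \<in> el x 1 ==> src x 1 e = src x 1 e' ==> tgt x 1 e = tgt x 1 e' ==>
    wd x 1 e = wd x 1 e' ==> e = e'"
 using assms unfolding paradigm_def by blast+

lemma paradigm_cube_eq:
 assumes P: "paradigm x" and c: "c \<in> el x n" "c' \<in> el x n"
  and "src x n c = src x n c'" "acts x n c = acts x n c'" "tgt x n c = tgt x n c'"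
 shows "c = c'"
proof -
 note x = paradigmD(1)[OF P]
 have t: "tgt x n c \<in> el x 0" using vtx_el[OF x, of c "ones n"] c by simp
 have "c' = act x (front n 0) c"
 proof (rule paradigmD(2)[OF P])
  show "src x n c' = src x (n + 0) c" "acts x (n + 0) c = acts x n c' @ acts x 0 (tgt x n c)"
   using assms(4,5) by (simp_all add: acts_def[of x 0])
  show "tgt x n c' = src x 0 (tgt x n c)" "tgt x 0 (tgt x n c) = tgt x (n + 0) c"
   using assms(6) vtx_point[OF x t] by simp_all
 qed (use c t in simp_all)
 then show ?thesis using presheafD(4)[OF lps_presheaf[OF x] c(1)] by (simp add: front_full[simplified])
qed

text \<open>
 Since the paradigm only asks for equalities, an object satisfies it as soon as its
 elements are separated by maps into objects that do.
\<close>

lemma paradigm_separated: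
 assumes x: "x \<in> Ob LPS"
  and sep: "\<And>n c c'. c \<in> el x n ==> c' \<in> el x n ==> wd x n c = wd x n c' ==>
   (\<And>z f. paradigm z ==> pmap x z f ==> f n c = f n c') ==> c = c'"
 shows "paradigm x"
 unfolding paradigm_def
proof (intro conjI allI ballI impI x)
 note pr = presheafD[OF lps_presheaf[OF x]]
 fix p q c d d'
 assume c: "c \<in> el x (p + q)" and d: "d \<in> el x p" and d': "d' \<in> el x q"
  and e: "src x p d = src x (p + q) c" "tgt x p d = src x q d'" "tgt x q d' = tgt x (p + q) c"
   "acts x (p + q) c = acts x p d @ acts x q d'"
 let ?d = "act x (front p q) c"
 have fc: "?d \<in> el x p" using pr(2)[OF front_box(1)[of p q], of c] c by simp
 have "acts x p ?d = pull (front p q) (acts x (p + q) c)"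
  using acts_act[OF x front_box(1)[of p q], of c] c by simp
 also have "\<dots> = acts x p d"
  unfolding e(4) pull_def front_box using map_nth_blocks(1)[of "acts x p d" "acts x q d'"] by simp
 finally have "wd x p d = wd x p ?d" by (simp only: wd_acts[OF x d] wd_acts[OF x fc])
 then show "d = ?d"
 proof (rule sep[OF d fc])
  fix z f assume z: "paradigm z" and f: "pmap x z f"
  note v = pmap_vtx[OF f, symmetric]
  have "f p d = act z (front p q) (f (p + q) c)"
  proof (rule paradigmD(2)[OF z])
   show "acts z (p + q) (f (p + q) c) = acts z p (f p d) @ acts z q (f q d')"
    unfolding pmap_acts[OF x f c] pmap_acts[OF x f d] pmap_acts[OF x f d'] e(4) by simp
   show "src z p (f p d) = src z (p + q) (f (p + q) c)"
    using v[of d "zeros p"] v[of c "zeros (p + q)"] c d e(1) by simp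
   show "tgt z p (f p d) = src z q (f q d')" using v[of d "ones p"] v[of d' "zeros q"] d d' e(2) by simp
   show "tgt z q (f q d') = tgt z (p + q) (f (p + q) c)"
    using v[of d' "ones q"] v[of c "ones (p + q)"] c d' e(3) by simp
  qed (rule pmapD(1)[OF f], rule c d d')+
  then show "f p d = f p ?d" using pmapD(3)[OF f front_box(1)[of p q], of c] c by simp
 qed
next
 fix e e' assume *: "e \<in> el x 1" "e' \<in> el x 1" "src x 1 e = src x 1 e'" "tgt x 1 e = tgt x 1 e'"
  "wd x 1 e = wd x 1 e'"
 show "e = e'"
 proof (rule sep[OF *(1,2,5)])
  fix z f assume z: "paradigm z" and f: "pmap x z f"
  note v = pmap_vtx[OF f, symmetric]
  show "f 1 e = f 1 e'"
   using paradigmD(3)[OF z, of "f 1 e" "f 1 e'"] pmapD(1,2)[OF f] *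
    v[of e "zeros 1"] v[of e' "zeros 1"] v[of e "ones 1"] v[of e' "ones 1"] by simp
 qed
qed

subsection \<open>The transition system of a precubical set\<close>

text \<open>A cube of positive dimension is only remembered as a transition from its source to its target.\<close>

definition Gob :: "'u precub_arrow \<Rightarrow> 'u tsys" where
 "Gob x = \<lparr>states = el x 0, actions = rep x ` el x 1, lab = (\<lambda>u\<in>rep x ` el x 1. hd (wd x 1 u)),
   transitions = {(src x n c, acts x n c, tgt x n c) | n c. 0 < n \<and> c \<in> el x n}\<rparr>"

lemma Gob_simps [simp]:
 "states (Gob x) = el x 0" "actions (Gob x) = rep x ` el x 1"
 "u \<in> rep x ` el x 1 ==> lab (Gob x) u = hd (wd x 1 u)"
 by (simp_all add: Gob_def)

lemma Gob_trans: "(\<alpha>, us, \<beta>) \<in> transitions (Gob x) \<longleftrightarrow> us \<noteq> [] \<and>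
  (\<exists>c\<in>el x (length us). \<alpha> = src x (length us) c \<and> us = acts x (length us) c \<and> \<beta> = tgt x (length us) c)"
 (is "?l \<longleftrightarrow> ?r")
proof
 assume ?l
 then obtain n c where *: "0 < n" "c \<in> el x n" "\<alpha> = src x n c" "us = acts x n c" "\<beta> = tgt x n c"
  unfolding Gob_def by auto
 then have "length us = n" by simp
 then show ?r using * by (metis length_0_conv less_numeral_extra(3))
next
 assume ?r then show ?l unfolding Gob_def by auto
qed

lemma Gob_transI: "0 < n ==> c \<in> el x n ==> (src x n c, acts x n c, tgt x n c) \<in> transitions (Gob x)"
 unfolding Gob_def by auto

lemma Gob_tsys: assumes x: "x \<in> Ob LPS" shows "is_tsys \<Sigma> (Gob x)"
 unfolding is_tsys_def
proof (intro conjI)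
 note p = presheafD[OF lps_presheaf[OF x]]
 show "small TYPE('u) (states (Gob x))" using p(1) by simp
 show "small TYPE('u) (actions (Gob x))" unfolding Gob_simps by (rule small_image[OF p(1)])
 have "hd (wd x 1 u) \<in> \<Sigma>" if "u \<in> el x 1" for u
  using p(5)[OF that] by (auto simp: words_def length_Suc_conv)
 then have "hd (wd x 1 u) \<in> \<Sigma>" if "u \<in> rep x ` el x 1" for u using that rep_el[OF x] by blast
 then show "lab (Gob x) \<in> actions (Gob x) \<rightarrow>\<^sub>E \<Sigma>" by (auto simp: Gob_def)
 show "transitions (Gob x) \<subseteq> states (Gob x) \<times> {us. us \<noteq> [] \<and> set us \<subseteq> actions (Gob x)} \<times> states (Gob x)"
 proof
  fix t assume "t \<in> transitions (Gob x)"
  then obtain n c where t: "t = (src x n c, acts x n c, tgt x n c)" and c: "0 < n" "c \<in> el x n"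
   unfolding Gob_def by auto
  have "acts x n c \<noteq> []" using c(1) length_acts[of x n c] by (metis length_0_conv less_numeral_extra(3))
  then show "t \<in> states (Gob x) \<times> {us. us \<noteq> [] \<and> set us \<subseteq> actions (Gob x)} \<times> states (Gob x)"
   using vtx_el[OF x, of c "zeros n"] vtx_el[OF x, of c "ones n"] set_acts[OF x c(2)] c(2) by (simp add: t)
 qed
qed

lemma Gob_face:
 assumes x: "x \<in> Ob LPS" and F: "F \<in> box_maps" "0 < bsrc F" and c: "c \<in> el x (btgt F)"
 shows "(vtx x (bfun F (zeros (bsrc F))) c, pull F (acts x (btgt F) c), vtx x (bfun F (ones (bsrc F))) c)
  \<in> transitions (Gob x)"
proof -
 have "act x F c \<in> el x (bsrc F)" using presheafD(2)[OF lps_presheaf[OF x] F(1) c] .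
 then show ?thesis
  using acts_act[OF x F(1) c] vtx_act[OF x F(1) c, of "zeros (bsrc F)"] vtx_act[OF x F(1) c, of "ones (bsrc F)"] F(2)
  unfolding Gob_def by force
qed

lemma Gob_perm:
 assumes x: "x \<in> Ob LPS" and t: "(\<alpha>, us, \<beta>) \<in> transitions (Gob x)"
  and ds: "distinct ds" "set ds = {..<length us}"
 shows "(\<alpha>, map (nth us) ds, \<beta>) \<in> transitions (Gob x)"
proof -
 obtain c where c: "us \<noteq> []" "c \<in> el x (length us)" "\<alpha> = src x (length us) c"
   "us = acts x (length us) c" "\<beta> = tgt x (length us) c" using t Gob_trans by blast
 let ?F = "bx (zeros (length us)) ds"
 have F: "?F \<in> box_maps" "dirs ?F = ds" using bx_box[OF ds(1), of "zeros (length us)"] ds(2) by simp_all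
 show ?thesis
  using Gob_face[OF x F(1), of c] bfun_perm[OF ds] c F(2) by (simp add: pull_def)
qed

lemma Gob_swap_blocks:
 assumes x: "x \<in> Ob LPS" and t: "(\<alpha>, u @ v, \<beta>) \<in> transitions (Gob x)"
 shows "(\<alpha>, v @ u, \<beta>) \<in> transitions (Gob x)"
proof -
 have "map (nth (u @ v)) ([length u..<length u + length v] @ [0..<length u]) = v @ u"
  by (auto intro!: nth_equalityI simp: nth_append)
 moreover have "set ([length u..<length u + length v] @ [0..<length u]) = {..<length (u @ v)}" by auto
 ultimately show ?thesis
  using Gob_perm[OF x t, of "[length u..<length u + length v] @ [0..<length u]"] by simp
qed

lemma Gob_split:
 assumes x: "x \<in> Ob LPS" and c: "c \<in> el x (p + q)" "0 < p" "0 < q" and a: "acts x (p + q) c = u @ v" "length u = p"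
 shows "act x (front p q) c \<in> el x p" "act x (rear p q) c \<in> el x q"
  "acts x p (act x (front p q) c) = u" "acts x q (act x (rear p q) c) = v"
  "\<And>\<xi>. length \<xi> = p ==> vtx x \<xi> (act x (front p q) c) = vtx x (\<xi> @ zeros q) c"
  "\<And>\<xi>. length \<xi> = q ==> vtx x \<xi> (act x (rear p q) c) = vtx x (ones p @ \<xi>) c"
  "(src x (p + q) c, u, vtx x (ones p @ zeros q) c) \<in> transitions (Gob x)"
  "(vtx x (ones p @ zeros q) c, v, tgt x (p + q) c) \<in> transitions (Gob x)"
proof -
 note pr = presheafD[OF lps_presheaf[OF x]]
 have l: "length v = q" using arg_cong[OF a(1), of length] a(2) by simp
 show fe: "act x (front p q) c \<in> el x p" and be: "act x (rear p q) c \<in> el x q"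
  using pr(2)[OF front_box(1)[of p q], of c] pr(2)[OF rear_box(1)[of p q], of c] c by simp_all
 show fa: "acts x p (act x (front p q) c) = u"
  using acts_act[OF x front_box(1)[of p q], of c] c a map_nth_blocks(1)[of u v]
  by (simp add: pull_def front_box)
 show ba: "acts x q (act x (rear p q) c) = v"
  using acts_act[OF x rear_box(1)[of p q], of c] c a l
  by (auto simp: pull_def rear_box intro!: nth_equalityI)
 show fv: "vtx x \<xi> (act x (front p q) c) = vtx x (\<xi> @ zeros q) c" if "length \<xi> = p" for \<xi>
  using vtx_act[OF x front_box(1)[of p q], of c \<xi>] c that bfun_front[OF that] by simp
 show bv: "vtx x \<xi> (act x (rear p q) c) = vtx x (ones p @ \<xi>) c" if "length \<xi> = q" for \<xi>
  using vtx_act[OF x rear_box(1)[of p q], of c \<xi>] c that bfun_rear[OF that] by simp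
 show "(src x (p + q) c, u, vtx x (ones p @ zeros q) c) \<in> transitions (Gob x)"
  using Gob_transI[OF c(2) fe] fa fv[of "zeros p"] fv[of "ones p"] by (simp add: replicate_add)
 show "(vtx x (ones p @ zeros q) c, v, tgt x (p + q) c) \<in> transitions (Gob x)"
  using Gob_transI[OF c(3) be] ba bv[of "zeros q"] bv[of "ones q"] by (simp add: replicate_add)
qed

lemma Gob_mid_unique:
 assumes P: "paradigm x" and c: "c \<in> el x (p + q)" and a: "acts x (p + q) c = u @ v" "length u = p" "length v = q"
  and t: "(src x (p + q) c, u, \<nu>) \<in> transitions (Gob x)" "(\<nu>, v, tgt x (p + q) c) \<in> transitions (Gob x)"
 shows "\<nu> = vtx x (ones p @ zeros q) c"
proof -
 note x = paradigmD(1)[OF P]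
 obtain d where d: "u \<noteq> []" "d \<in> el x p" "src x (p + q) c = src x p d" "u = acts x p d" "\<nu> = tgt x p d"
  using t(1) a(2) Gob_trans by auto
 obtain d' where d': "v \<noteq> []" "d' \<in> el x q" "\<nu> = src x q d'" "v = acts x q d'" "tgt x (p + q) c = tgt x q d'"
  using t(2) a(3) Gob_trans by auto
 have "d = act x (front p q) c"
  using paradigmD(2)[OF P c d(2) d'(2)] d d' a(1) by simp
 moreover have "0 < p" "0 < q" using a(2,3) d(1) d'(1) by auto
 ultimately show ?thesis using Gob_split(5)[OF x c _ _ a(1,2), of "ones p"] d(5) by simp
qed

text \<open>A cube of the precubical set provides the unique intermediate states that the axioms ask for.\<close>

lemma Gob_hdts: assumes P: "paradigm x" shows "is_hdts \<Sigma> (Gob x)"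
 unfolding is_hdts_def
proof (intro conjI)
 note x = paradigmD(1)[OF P]
 let ?T = "transitions (Gob x)"
 show "is_tsys \<Sigma> (Gob x)" by (rule Gob_tsys[OF x])
 show "multiset_axiom (Gob x)" unfolding multiset_axiom_def
 proof (intro allI impI)
  fix \<alpha> us \<beta> \<sigma> assume t: "(\<alpha>, us, \<beta>) \<in> ?T" and \<sigma>: "\<sigma> permutes {..<length us}"
  have "distinct (map \<sigma> [0..<length us])" using permutes_inj[OF \<sigma>] by (simp add: distinct_map inj_on_def)
  moreover have "set (map \<sigma> [0..<length us]) = {..<length us}"
   using permutes_image[OF \<sigma>] by (simp add: lessThan_atLeast0)
  ultimately have "(\<alpha>, map (nth us) (map \<sigma> [0..<length us]), \<beta>) \<in> ?T" using Gob_perm[OF x t] by blast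
  then show "(\<alpha>, permute_list \<sigma> us, \<beta>) \<in> ?T" by (simp add: permute_list_def comp_def)
 qed
 show "CSA1 (Gob x)" unfolding CSA1_def
 proof (intro allI impI)
  fix \<alpha> \<beta> u u' assume "(\<alpha>, [u], \<beta>) \<in> ?T" "(\<alpha>, [u'], \<beta>) \<in> ?T" and l: "lab (Gob x) u = lab (Gob x) u'"
  then obtain e e' where e: "e \<in> el x 1" "\<alpha> = src x 1 e" "[u] = acts x 1 e" "\<beta> = tgt x 1 e"
   and e': "e' \<in> el x 1" "\<alpha> = src x 1 e'" "[u'] = acts x 1 e'" "\<beta> = tgt x 1 e'" by (auto simp: Gob_trans)
  have "u \<in> rep x ` el x 1" "u' \<in> rep x ` el x 1"
   using set_acts[OF x e(1)] set_acts[OF x e'(1)] unfolding e(3)[symmetric] e'(3)[symmetric] by simp_all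
  then have "hd (wd x 1 u) = hd (wd x 1 u')" using l by simp
  then have "wd x 1 e = wd x 1 e'"
   using wd_acts[OF x e(1)] wd_acts[OF x e'(1)] unfolding e(3)[symmetric] e'(3)[symmetric] by simp
  then have "e = e'" using paradigmD(3)[OF P e(1) e'(1)] e e' by simp
  then show "u = u'" using e(3) e'(3) by (metis list.inject)
 qed
 have C: "\<exists>!\<nu>. \<nu> \<in> states (Gob x) \<and> (\<alpha>, u, \<nu>) \<in> ?T \<and> (\<nu>, v, \<beta>) \<in> ?T"
  if uv: "u \<noteq> []" "v \<noteq> []" and t: "(\<alpha>, u @ v, \<beta>) \<in> ?T" for \<alpha> \<beta> u v
 proof -
  let ?p = "length u" and ?q = "length v"
  obtain c where c: "c \<in> el x (?p + ?q)" "\<alpha> = src x (?p + ?q) c" "acts x (?p + ?q) c = u @ v"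
   "\<beta> = tgt x (?p + ?q) c" using t unfolding Gob_trans by auto
  let ?m = "vtx x (ones ?p @ zeros ?q) c"
  have 1: "?m \<in> states (Gob x)" using vtx_el[OF x, of c "ones ?p @ zeros ?q"] c(1) by simp
  have 2: "(\<alpha>, u, ?m) \<in> ?T" "(?m, v, \<beta>) \<in> ?T"
   using Gob_split(7,8)[OF x c(1) _ _ c(3)] uv c by simp_all
  have 3: "\<nu> = ?m" if "(\<alpha>, u, \<nu>) \<in> ?T" "(\<nu>, v, \<beta>) \<in> ?T" for \<nu>
   by (rule Gob_mid_unique[OF P c(1) c(3) HOL.refl HOL.refl that(1)[unfolded c(2)] that(2)[unfolded c(4)]])
  show ?thesis
  proof (rule ex1I)
   show "?m \<in> states (Gob x) \<and> (\<alpha>, u, ?m) \<in> ?T \<and> (?m, v, \<beta>) \<in> ?T" by (intro conjI 1 2)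
   show "\<nu> = ?m" if "\<nu> \<in> states (Gob x) \<and> (\<alpha>, u, \<nu>) \<in> ?T \<and> (\<nu>, v, \<beta>) \<in> ?T" for \<nu>
    by (rule 3[OF conjunct1[OF conjunct2[OF that]] conjunct2[OF conjunct2[OF that]]])
  qed
 qed
 show "CSA2 (Gob x)" unfolding CSA2_def
 proof (intro allI impI conjI)
  fix \<alpha> \<beta> u v assume uv: "u \<noteq> []" "v \<noteq> []" and t: "(\<alpha>, u @ v, \<beta>) \<in> ?T"
  show "\<exists>!\<nu>1. \<nu>1 \<in> states (Gob x) \<and> (\<alpha>, u, \<nu>1) \<in> ?T \<and> (\<nu>1, v, \<beta>) \<in> ?T" by (rule C[OF uv t])
  show "\<exists>!\<nu>2. \<nu>2 \<in> states (Gob x) \<and> (\<alpha>, v, \<nu>2) \<in> ?T \<and> (\<nu>2, u, \<beta>) \<in> ?T"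
   by (rule C[OF uv(2,1) Gob_swap_blocks[OF x t]])
 qed
 show "CSA3 (Gob x)" unfolding CSA3_def
 proof (intro allI impI)
  fix \<alpha> \<beta> \<nu>1 \<nu>2 \<nu>1' \<nu>2' u v w
  assume ne: "u \<noteq> []" "v \<noteq> []" "w \<noteq> []"
   and T: "{(\<alpha>, u @ v @ w, \<beta>), (\<alpha>, u, \<nu>1), (\<nu>1, v @ w, \<beta>), (\<nu>1, v, \<nu>2), (\<nu>2, w, \<beta>),
     (\<alpha>, u @ v, \<nu>2'), (\<nu>2', w, \<beta>), (\<alpha>, u, \<nu>1'), (\<nu>1', v, \<nu>2')} \<subseteq> ?T"
  define p q r where "p = length u" and "q = length v" and "r = length w"
  have pqr: "0 < p" "0 < q" "0 < r" using ne by (simp_all add: p_def q_def r_def)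
  have t: "(\<alpha>, u @ v @ w, \<beta>) \<in> ?T" "(\<alpha>, u, \<nu>1) \<in> ?T" "(\<nu>1, v @ w, \<beta>) \<in> ?T" "(\<nu>1, v, \<nu>2) \<in> ?T"
   "(\<nu>2, w, \<beta>) \<in> ?T" "(\<alpha>, u @ v, \<nu>2') \<in> ?T" "(\<nu>2', w, \<beta>) \<in> ?T" "(\<alpha>, u, \<nu>1') \<in> ?T" "(\<nu>1', v, \<nu>2') \<in> ?T"
   using T by simp_all
  have len: "length (u @ v @ w) = p + (q + r)" "length u = p" "length v = q" "length w = r"
   "length (v @ w) = q + r" "length (u @ v) = p + q" by (simp_all add: p_def q_def r_def)
  obtain c where c: "c \<in> el x (p + (q + r))" "\<alpha> = src x (p + (q + r)) c" "acts x (p + (q + r)) c = u @ (v @ w)"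
   "\<beta> = tgt x (p + (q + r)) c" using t(1)[unfolded Gob_trans len] by metis
  have c2: "c \<in> el x ((p + q) + r)" "\<alpha> = src x ((p + q) + r) c" "acts x ((p + q) + r) c = (u @ v) @ w"
   "\<beta> = tgt x ((p + q) + r) c" using c by (simp_all only: add.assoc append_assoc)
  have 1: "\<nu>1 = vtx x (ones p @ zeros (q + r)) c"
   by (rule Gob_mid_unique[OF P c(1) c(3) len(2,5) t(2)[unfolded c(2)] t(3)[unfolded c(4)]])
  have 2: "\<nu>2' = vtx x (ones (p + q) @ zeros r) c"
   by (rule Gob_mid_unique[OF P c2(1) c2(3) len(6,4) t(6)[unfolded c2(2)] t(7)[unfolded c2(4)]])
  note s1 = Gob_split[OF x c(1) pqr(1) add_pos_pos[OF pqr(2,3)] c(3) len(2)]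
  note s2 = Gob_split[OF x c2(1) add_pos_pos[OF pqr(1,2)] pqr(3) c2(3) len(6)]
  have e2: "src x (p + q) (act x (front (p + q) r) c) = \<alpha>" "tgt x (p + q) (act x (front (p + q) r) c) = \<nu>2'"
   using s2(5)[of "zeros (p + q)"] s2(5)[of "ones (p + q)"] c2(2) 2 by (simp_all add: replicate_add)
  have e1: "src x (q + r) (act x (rear p (q + r)) c) = \<nu>1" "tgt x (q + r) (act x (rear p (q + r)) c) = \<beta>"
   using s1(6)[of "zeros (q + r)"] s1(6)[of "ones (q + r)"] c(4) 1 by (simp_all add: replicate_add)
  have "\<nu>1' = vtx x (ones p @ zeros q) (act x (front (p + q) r) c)"
   by (rule Gob_mid_unique[OF P s2(1) s2(3) len(2,3), unfolded e2, OF t(8,9)])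
  then have "\<nu>1' = \<nu>1" using s2(5)[of "ones p @ zeros q"] 1 by (simp add: replicate_add)
  moreover have "\<nu>2 = vtx x (ones q @ zeros r) (act x (rear p (q + r)) c)"
   by (rule Gob_mid_unique[OF P s1(2) s1(4) len(3,4), unfolded e1, OF t(4,5)])
  then have "\<nu>2 = \<nu>2'" using s1(6)[of "ones q @ zeros r"] 2 by (simp add: replicate_add)
  ultimately show "\<nu>1 = \<nu>1' \<and> \<nu>2 = \<nu>2'" by simp
 qed
qed

lemma hdts_whdts: assumes "is_hdts \<Sigma> X" shows "is_whdts \<Sigma> X"
proof -
 have c2: "CSA2 X" and c3: "CSA3 X" using assms by (auto simp: is_hdts_def)
 have "coherence_axiom X" unfolding coherence_axiom_def
 proof (intro allI impI)
  fix \<alpha> \<beta> \<nu>1 \<nu>2 u v w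
  assume ne: "u \<noteq> []" "v \<noteq> []" "w \<noteq> []"
   and T: "{(\<alpha>, u @ v @ w, \<beta>), (\<alpha>, u, \<nu>1), (\<nu>1, v @ w, \<beta>), (\<alpha>, u @ v, \<nu>2), (\<nu>2, w, \<beta>)} \<subseteq> transitions X"
  obtain \<nu>2' where a: "(\<nu>1, v, \<nu>2') \<in> transitions X" "(\<nu>2', w, \<beta>) \<in> transitions X"
   using c2[unfolded CSA2_def, rule_format, OF ne(2,3), of \<nu>1 \<beta>] T by auto
  obtain \<nu>1' where b: "(\<alpha>, u, \<nu>1') \<in> transitions X" "(\<nu>1', v, \<nu>2) \<in> transitions X"
   using c2[unfolded CSA2_def, rule_format, OF ne(1,2), of \<alpha> \<nu>2] T by auto
  have "\<nu>1 = \<nu>1' \<and> \<nu>2' = \<nu>2"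
   by (rule c3[unfolded CSA3_def, rule_format, OF ne]) (use T a b in auto)
  then show "(\<nu>1, v, \<nu>2) \<in> transitions X" using b by simp
 qed
 then show ?thesis using assms by (simp add: is_whdts_def is_hdts_def)
qed

end

section \<open>Transition systems and their cubes\<close>

type_synonym 'u tmap = "('u \<Rightarrow> 'u) \<times> ('u \<Rightarrow> 'u)"

abbreviation tm :: "'u tsys_arrow \<Rightarrow> 'u tmap" where "tm f \<equiv> fst (snd f)"

lemma tsysD:
 assumes "is_tsys \<Sigma> X" "(\<alpha>, us, \<beta>) \<in> transitions X"
 shows "\<alpha> \<in> states X" "\<beta> \<in> states X" "set us \<subseteq> actions X" "us \<noteq> []"
 using assms unfolding is_tsys_def by blast+

lemma tmapD:
 assumes "is_tsys_map X Y f"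
 shows "s \<in> states X ==> fst f s \<in> states Y" "u \<in> actions X ==> snd f u \<in> actions Y"
  "u \<in> actions X ==> lab Y (snd f u) = lab X u"
  "(\<alpha>, us, \<beta>) \<in> transitions X ==> (fst f \<alpha>, map (snd f) us, fst f \<beta>) \<in> transitions Y"
  "fst f \<in> states X \<rightarrow>\<^sub>E states Y" "snd f \<in> actions X \<rightarrow>\<^sub>E actions Y"
 using assms unfolding is_tsys_map_def by blast+

lemma tmapI:
 assumes "fst f \<in> states X \<rightarrow>\<^sub>E states Y" "snd f \<in> actions X \<rightarrow>\<^sub>E actions Y"
  "\<And>u. u \<in> actions X ==> lab Y (snd f u) = lab X u"
  "\<And>\<alpha> us \<beta>. (\<alpha>, us, \<beta>) \<in> transitions X ==> (fst f \<alpha>, map (snd f) us, fst f \<beta>) \<in> transitions Y"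
 shows "is_tsys_map X Y f"
 using assms unfolding is_tsys_map_def by auto

lemma tmap_eqI:
 assumes "is_tsys_map X Y f" "is_tsys_map X Y g" "\<And>s. s \<in> states X ==> fst f s = fst g s"
  "\<And>u. u \<in> actions X ==> snd f u = snd g u"
 shows "f = g"
 using PiE_ext[OF tmapD(5)[OF assms(1)] tmapD(5)[OF assms(2)] assms(3)]
  PiE_ext[OF tmapD(6)[OF assms(1)] tmapD(6)[OF assms(2)] assms(4)] by (simp add: prod_eq_iff)

abbreviation tcomp :: "'u tsys \<Rightarrow> 'u tmap \<Rightarrow> 'u tmap \<Rightarrow> 'u tmap" where
 "tcomp X g f \<equiv> (compose (states X) (fst g) (fst f), compose (actions X) (snd g) (snd f))"

lemma tmap_comp:
 assumes X: "is_tsys \<Sigma> X" and f: "is_tsys_map X Y f" and g: "is_tsys_map Y Z g"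
 shows "is_tsys_map X Z (tcomp X g f)"
proof (rule tmapI)
 fix \<alpha> us \<beta> assume t: "(\<alpha>, us, \<beta>) \<in> transitions X"
 have m: "map (compose (actions X) (snd g) (snd f)) us = map (snd g) (map (snd f) us)"
  using tsysD(3)[OF X t] by (auto simp: compose_def)
 show "(fst (tcomp X g f) \<alpha>, map (snd (tcomp X g f)) us, fst (tcomp X g f) \<beta>) \<in> transitions Z"
  unfolding fst_conv snd_conv m
  using tmapD(4)[OF g tmapD(4)[OF f t]] tsysD(1,2)[OF X t] by (simp add: compose_eq)
qed (use tmapD[OF f] tmapD[OF g] in \<open>auto simp: compose_def\<close>)

lemma tmap_id: assumes "is_tsys \<Sigma> X" shows "is_tsys_map X X ((\<lambda>s\<in>states X. s), (\<lambda>u\<in>actions X. u))"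
proof (rule tmapI)
 fix \<alpha> us \<beta> assume t: "(\<alpha>, us, \<beta>) \<in> transitions X"
 have "map (\<lambda>u\<in>actions X. u) us = us" using tsysD(3)[OF assms t] by (auto intro!: map_idI)
 then show "(fst ((\<lambda>s\<in>states X. s), (\<lambda>u\<in>actions X. u)) \<alpha>, map (snd ((\<lambda>s\<in>states X. s), (\<lambda>u\<in>actions X. u))) us,
   fst ((\<lambda>s\<in>states X. s), (\<lambda>u\<in>actions X. u)) \<beta>) \<in> transitions X"
  using t tsysD(1,2)[OF assms t] by simp
qed auto

lemma WHDTS_simps:
 "Ob (WHDTS \<Sigma>) = {X. is_whdts \<Sigma> X}" "Dom (WHDTS \<Sigma>) t = fst t" "Cod (WHDTS \<Sigma>) t = snd (snd t)"
 "Id (WHDTS \<Sigma>) X = (X, ((\<lambda>s\<in>states X. s), (\<lambda>u\<in>actions X. u)), X)"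
 "Comp (WHDTS \<Sigma>) s t = (fst t, tcomp (fst t) (tm s) (tm t), snd (snd s))"
 by (auto simp: WHDTS_def split: prod.splits)

lemma WHDTS_hom: "t \<in> hom (WHDTS \<Sigma>) X Y \<longleftrightarrow>
  is_whdts \<Sigma> X \<and> is_whdts \<Sigma> Y \<and> is_tsys_map X Y (tm t) \<and> t = (X, tm t, Y)"
 by (cases t) (auto simp: hom_def WHDTS_def)

lemma is_category_WHDTS: "is_category (WHDTS \<Sigma>)"
proof (rule is_categoryI)
 fix f assume "f \<in> Ar (WHDTS \<Sigma>)"
 then show "Dom (WHDTS \<Sigma>) f \<in> Ob (WHDTS \<Sigma>) \<and> Cod (WHDTS \<Sigma>) f \<in> Ob (WHDTS \<Sigma>)"
  by (auto simp: WHDTS_def)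
next
 fix X assume "X \<in> Ob (WHDTS \<Sigma>)"
 then show "Id (WHDTS \<Sigma>) X \<in> hom (WHDTS \<Sigma>) X X"
  using tmap_id[of \<Sigma> X] by (simp add: WHDTS_hom WHDTS_simps is_whdts_def)
next
 fix f g X Y Z assume "f \<in> hom (WHDTS \<Sigma>) X Y" "g \<in> hom (WHDTS \<Sigma>) Y Z"
 then show "Comp (WHDTS \<Sigma>) g f \<in> hom (WHDTS \<Sigma>) X Z"
  using tmap_comp[of \<Sigma> X Y "tm f" Z "tm g"] by (auto simp: WHDTS_hom WHDTS_simps is_whdts_def prod_eq_iff)
next
 fix f X Y assume f: "f \<in> hom (WHDTS \<Sigma>) X Y"
 then have "fst (tm f) \<in> states X \<rightarrow>\<^sub>E states Y" "snd (tm f) \<in> actions X \<rightarrow>\<^sub>E actions Y"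
  using tmapD(5,6)[of X Y "tm f"] unfolding WHDTS_hom by blast+
 then show "Comp (WHDTS \<Sigma>) f (Id (WHDTS \<Sigma>) X) = f \<and> Comp (WHDTS \<Sigma>) (Id (WHDTS \<Sigma>) Y) f = f"
  using f by (auto simp: WHDTS_hom WHDTS_simps prod_eq_iff PiE_iff intro!: compose_Id Id_compose)
next
 fix f g h X Y Z V
 assume f: "f \<in> hom (WHDTS \<Sigma>) X Y" "g \<in> hom (WHDTS \<Sigma>) Y Z" "h \<in> hom (WHDTS \<Sigma>) Z V"
 then have *: "fst f = X" "fst g = Y" "fst (tm f) \<in> states X \<rightarrow> states Y" "snd (tm f) \<in> actions X \<rightarrow> actions Y"
  using tmapD(5,6)[of X Y "tm f"] by (auto simp: WHDTS_hom prod_eq_iff PiE_iff)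
 show "Comp (WHDTS \<Sigma>) h (Comp (WHDTS \<Sigma>) g f) = Comp (WHDTS \<Sigma>) (Comp (WHDTS \<Sigma>) h g) f"
  using compose_assoc[OF *(3), where h="fst (tm h)" and g="fst (tm g)"]
   compose_assoc[OF *(4), where h="snd (tm h)" and g="snd (tm g)"] *(1,2) by (simp add: WHDTS_simps)
qed

context small_labels
begin

abbreviation "HD \<equiv> HDTS \<Sigma>"
abbreviation "over \<equiv> cubes_over \<Sigma>"

lemma HDTS_simps:
 "Ob HD = {X. is_hdts \<Sigma> X}" "Dom HD = Dom (WHDTS \<Sigma>)" "Cod HD = Cod (WHDTS \<Sigma>)"
 "Id HD = Id (WHDTS \<Sigma>)" "Comp HD = Comp (WHDTS \<Sigma>)"
 using hdts_whdts by (auto simp: HDTS_def WHDTS_simps(1))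

lemma HDTS_hom: "t \<in> hom HD X Y \<longleftrightarrow>
  is_hdts \<Sigma> X \<and> is_hdts \<Sigma> Y \<and> is_tsys_map X Y (tm t) \<and> t = (X, tm t, Y)"
proof (cases "is_hdts \<Sigma> X \<and> is_hdts \<Sigma> Y")
 case True
 then show ?thesis using hdts_whdts by (simp add: HDTS_def full_hom WHDTS_hom)
next
 case False
 then show ?thesis using full_homD[of t "WHDTS \<Sigma>"] unfolding HDTS_def by blast
qed

lemma is_category_HDTS: "is_category HD"
 unfolding HDTS_def by (rule is_category_full[OF is_category_WHDTS])

lemma hdts_tsys: "is_hdts \<Sigma> X ==> is_tsys \<Sigma> X" by (simp add: is_hdts_def)

text \<open>The category that turns out to be the localization.\<close>

definition DD :: "('u precub_arrow, 'u lps_arrow) cat" where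
 "DD = full_subcat LPS {x. paradigm x}"

lemma DD_simps:
 "Ob DD = {x. paradigm x}" "Dom DD = Dom LPS" "Cod DD = Cod LPS" "Id DD = Id LPS" "Comp DD = Comp LPS"
 using paradigmD(1) by (auto simp: DD_def)

lemma DD_hom: "t \<in> hom DD x y \<longleftrightarrow> paradigm x \<and> paradigm y \<and> t \<in> hom LPS x y"
 unfolding DD_def using full_homD[of t LPS] full_hom[of x _ y LPS] by blast

lemma is_category_DD: "is_category DD"
 unfolding DD_def by (rule is_category_full[OF is_category_LPS])

definition Gmap :: "'u precub_arrow \<Rightarrow> (nat \<Rightarrow> 'u \<Rightarrow> 'u) \<Rightarrow> 'u precub_arrow \<Rightarrow> 'u tmap" where
 "Gmap x f y = ((\<lambda>s\<in>el x 0. f 0 s), (\<lambda>u\<in>rep x ` el x 1. rep y (f 1 u)))"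

lemma Gmap_tsys_map:
 assumes x: "x \<in> Ob LPS" and y: "y \<in> Ob LPS" and f: "pmap x y f"
 shows "is_tsys_map (Gob x) (Gob y) (Gmap x f y)"
proof (rule tmapI)
 note p = pmapD[OF f]
 show "fst (Gmap x f y) \<in> states (Gob x) \<rightarrow>\<^sub>E states (Gob y)" using p(1) by (auto simp: Gmap_def)
 have r: "u \<in> el x 1" if "u \<in> rep x ` el x 1" for u using that rep_el[OF x] by blast
 have "rep y (f 1 u) \<in> rep y ` el y 1" if "u \<in> rep x ` el x 1" for u
  by (rule imageI[OF p(1)[OF r[OF that]]])
 then show "snd (Gmap x f y) \<in> actions (Gob x) \<rightarrow>\<^sub>E actions (Gob y)"
  unfolding Gmap_def Gob_simps snd_conv by (intro PiE_I) simp_all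
 show "lab (Gob y) (snd (Gmap x f y) u) = lab (Gob x) u" if "u \<in> actions (Gob x)" for u
 proof -
  have u: "u \<in> rep x ` el x 1" using that by simp
  have "rep y (f 1 u) \<in> rep y ` el y 1" by (rule imageI[OF p(1)[OF r[OF u]]])
  then show ?thesis using u rep_el[OF y p(1)[OF r[OF u]]] p(2)[OF r[OF u]] by (simp add: Gmap_def)
 qed
 fix \<alpha> us \<beta> assume "(\<alpha>, us, \<beta>) \<in> transitions (Gob x)"
 then obtain n c where t: "(\<alpha>, us, \<beta>) = (src x n c, acts x n c, tgt x n c)" and c: "0 < n" "c \<in> el x n"
  unfolding Gob_def by auto
 have "map (snd (Gmap x f y)) (acts x n c) = acts y n (f n c)"
  unfolding pmap_acts[OF x f c(2)] Gmap_def snd_conv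
  by (rule map_cong[OF HOL.refl]) (rule restrict_apply', rule subsetD[OF set_acts[OF x c(2)]])
 moreover have "fst (Gmap x f y) (vtx x \<xi> c) = vtx y \<xi> (f n c)" if "length \<xi> = n" for \<xi>
  using pmap_vtx[OF f, of c \<xi>] vtx_el[OF x, of c \<xi>] c(2) that by (simp add: Gmap_def)
 ultimately show "(fst (Gmap x f y) \<alpha>, map (snd (Gmap x f y)) us, fst (Gmap x f y) \<beta>) \<in> transitions (Gob y)"
  using t Gob_transI[OF c(1) p(1)[OF c(2)]] by simp
qed

definition Gfun :: "('u precub_arrow, 'u lps_arrow, 'u tsys, 'u tsys_arrow) fctr" where
 "Gfun = (Gob, \<lambda>h. (Gob (fst h), Gmap (fst h) (ap h) (snd (snd h)), Gob (snd (snd h))))"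

lemma fst_Gfun [simp]: "fst Gfun = Gob" by (simp add: Gfun_def)

lemma hom_ends: "h \<in> hom LPS x y ==> fst h = x \<and> snd (snd h) = y"
 using hom_Ar[of h LPS] by (simp add: labelled_precubical_sets_def)

lemma Gfun_hom: "h \<in> hom DD x y ==> snd Gfun h \<in> hom HD (Gob x) (Gob y)"
 using Gmap_tsys_map[of x y "ap h"] hom_ap(1)[of h x y] hom_ends[of h x y] paradigmD(1) Gob_hdts
 by (simp add: DD_hom HDTS_hom Gfun_def)

lemma Gfun_functor: "is_functor DD HD Gfun"
proof (rule is_functorI[OF is_category_DD is_category_HDTS])
 fix x assume "x \<in> Ob DD"
 then have P: "paradigm x" by (simp add: DD_simps)
 show "fst Gfun x \<in> Ob HD" using Gob_hdts[OF P] by (simp add: HDTS_simps Gfun_def)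
 note x = paradigmD(1)[OF P]
 have i: "Id LPS x \<in> hom DD x x" using catD(3)[OF is_category_LPS x] P by (simp add: DD_hom)
 have r: "ap (Id LPS x) 1 u = u" if "u \<in> rep x ` el x 1" for u using that rep_el[OF x] LPS_id[OF x] by blast
 have "Gmap x (ap (Id LPS x)) x = ((\<lambda>s\<in>states (Gob x). s), (\<lambda>u\<in>actions (Gob x). u))"
  unfolding Gmap_def using r LPS_id[OF x] by (auto intro!: restrict_ext)
 then show "snd Gfun (Id DD x) = Id HD (fst Gfun x)"
  using hom_ends[of "Id LPS x" x x] i by (simp add: DD_simps HDTS_simps WHDTS_simps Gfun_def DD_hom)
next
 fix h k x y z assume h: "h \<in> hom DD x y" and k: "k \<in> hom DD y z"
 have hk: "Comp DD k h \<in> hom DD x z" using catD(4)[OF is_category_DD h k] .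
 have L: "h \<in> hom LPS x y" "k \<in> hom LPS y z" "Comp LPS k h \<in> hom LPS x z" and P: "x \<in> Ob LPS" "y \<in> Ob LPS"
  using h k hk paradigmD(1) by (auto simp: DD_hom DD_simps)
 note pm = pmapD[OF hom_ap(1)[OF L(1)]]
 have "rep z (ap (Comp LPS k h) 1 u) = rep z (ap k 1 (rep y (ap h 1 u)))" if "u \<in> el x 1" for u
  using LPS_comp[OF L(1,2) that] pmap_par[OF P(2) hom_ap(1)[OF L(2)] par_rep[of y "ap h 1 u"]] by (simp add: rep_eq)
 then have "Gmap x (ap (Comp LPS k h)) z = tcomp (Gob x) (Gmap y (ap k) z) (Gmap x (ap h) y)"
  using LPS_comp[OF L(1,2)] pm(1) rep_el[OF P(1)]
  by (auto simp: Gmap_def compose_def intro!: restrict_ext)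
 then show "snd Gfun (Comp DD k h) = Comp HD (snd Gfun k) (snd Gfun h)"
  using hom_ends[OF L(1)] hom_ends[OF L(2)] hom_ends[OF L(3)]
  by (simp add: DD_simps HDTS_simps WHDTS_simps Gfun_def)
qed (simp add: Gfun_hom)

subsection \<open>The precubical set of cubes of a transition system\<close>

text \<open>
 A map from a standard cube to \<open>X\<close>, given by the images of the vertices and of the coordinates. Since each
 transition of a cube runs through a face from one end to the other, one test for each face suffices.
\<close>

definition cubes :: "'u tsys \<Rightarrow> nat \<Rightarrow> ((bool list \<Rightarrow> 'u) \<times> 'u list) set" where
 "cubes X n = {(v, us). v \<in> bits n \<rightarrow>\<^sub>E states X \<and> us \<in> lists (actions X) \<and> length us = n \<and>
   (\<forall>F\<in>box_maps. btgt F = n \<longrightarrow> 0 < bsrc F \<longrightarrow>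
    (v (bfun F (zeros (bsrc F))), pull F us, v (bfun F (ones (bsrc F)))) \<in> transitions X)}"

definition cact :: "bmap \<Rightarrow> (bool list \<Rightarrow> 'u) \<times> 'u list \<Rightarrow> (bool list \<Rightarrow> 'u) \<times> 'u list" where
 "cact F c = ((\<lambda>\<xi>\<in>bits (bsrc F). fst c (bfun F \<xi>)), pull F (snd c))"

lemma cubesD:
 assumes "c \<in> cubes X n"
 shows "fst c \<in> bits n \<rightarrow>\<^sub>E states X" "set (snd c) \<subseteq> actions X" "length (snd c) = n"
  "F \<in> box_maps ==> btgt F = n ==> 0 < bsrc F ==>
   (fst c (bfun F (zeros (bsrc F))), pull F (snd c), fst c (bfun F (ones (bsrc F)))) \<in> transitions X"
 using assms unfolding cubes_def by auto

lemma cubesI: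
 assumes "v \<in> bits n \<rightarrow>\<^sub>E states X" "set us \<subseteq> actions X" "length us = n"
  "\<And>F. F \<in> box_maps ==> btgt F = n ==> 0 < bsrc F ==>
   (v (bfun F (zeros (bsrc F))), pull F us, v (bfun F (ones (bsrc F)))) \<in> transitions X"
 shows "(v, us) \<in> cubes X n"
 using assms unfolding cubes_def by auto

lemma cact_cubes: assumes c: "c \<in> cubes X (btgt F)" and F: "F \<in> box_maps" shows "cact F c \<in> cubes X (bsrc F)"
 unfolding cact_def
proof (rule cubesI)
 note d = cubesD[OF c]
 show "(\<lambda>\<xi>\<in>bits (bsrc F). fst c (bfun F \<xi>)) \<in> bits (bsrc F) \<rightarrow>\<^sub>E states X"
  using d(1) box_dirs(5)[OF F] by auto
 show "set (pull F (snd c)) \<subseteq> actions X" using set_pull[OF F d(3)] d(2) by blast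
 show "length (pull F (snd c)) = bsrc F" by (rule length_pull[OF F])
 fix H assume H: "H \<in> box_maps" "btgt H = bsrc F" "0 < bsrc H"
 have b: "bfun H (zeros (bsrc H)) \<in> bits (bsrc F)" "bfun H (ones (bsrc H)) \<in> bits (bsrc F)"
  using box_dirs(5)[OF H(1)] H(2) by simp_all
 show "((\<lambda>\<xi>\<in>bits (bsrc F). fst c (bfun F \<xi>)) (bfun H (zeros (bsrc H))), pull H (pull F (snd c)),
   (\<lambda>\<xi>\<in>bits (bsrc F). fst c (bfun F \<xi>)) (bfun H (ones (bsrc H)))) \<in> transitions X"
  using d(4)[OF box_comp[OF H(1) F H(2)]] H b pull_comp[OF H(1) F H(2), of "snd c"] by (simp add: bfun_bcomp)
qed

lemma cubes_presheaf:
 assumes X: "is_tsys \<Sigma> X" shows "presheaf (cubes X) cact (\<lambda>n c. map (lab X) (snd c))"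
 unfolding presheaf_def
proof (intro conjI allI ballI impI)
 fix n
 have "cubes X n \<subseteq> (bits n \<rightarrow>\<^sub>E states X) \<times> lists (actions X)" by (auto simp: cubes_def)
 moreover have "small TYPE('u) ((bits n \<rightarrow>\<^sub>E states X) \<times> lists (actions X))"
  using X by (intro small_Sigma small_PiE small_lists) (auto simp: is_tsys_def)
 ultimately show "small TYPE('u) (cubes X n)" by (rule small_subset)
next
 fix F c assume F: "F \<in> box_maps" and c: "c \<in> cubes X (btgt F)"
 show "cact F c \<in> cubes X (bsrc F)" by (rule cact_cubes[OF c F])
 show "map (lab X) (snd (cact F c)) = pull F (map (lab X) (snd c))"
  using map_pull[OF F cubesD(3)[OF c]] by (simp add: cact_def)
next
 fix n c assume c: "c \<in> cubes X n"
 have "(\<lambda>\<xi>\<in>bits n. fst c (bfun (bid n) \<xi>)) = fst c"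
  using cubesD(1)[OF c] by (intro extensionalityI[of _ "bits n"]) (auto simp: bfun_bid PiE_def)
 then show "cact (bid n) c = c" using pull_id[OF cubesD(3)[OF c]] by (simp add: cact_def prod_eq_iff)
 have "lab X \<in> actions X \<rightarrow> \<Sigma>" using X by (auto simp: is_tsys_def)
 then show "map (lab X) (snd c) \<in> words \<Sigma> n" using cubesD(2,3)[OF c] by (auto simp: words_def)
next
 fix F G c assume *: "F \<in> box_maps" "G \<in> box_maps" "btgt F = bsrc G" "c \<in> cubes X (btgt G)"
 show "cact (bcomp G F) c = cact F (cact G c)"
  using pull_comp[OF *(1-3), of "snd c"] box_dirs(5)[OF *(1)] *(3)
  by (auto simp: cact_def bfun_bcomp intro!: restrict_ext)
qed

definition Nob :: "'u tsys \<Rightarrow> 'u precub_arrow" where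
 "Nob X = realize (cubes X) cact (\<lambda>n c. map (lab X) (snd c))"

abbreviation cenc :: "'u tsys \<Rightarrow> nat \<Rightarrow> (bool list \<Rightarrow> 'u) \<times> 'u list \<Rightarrow> 'u" where
 "cenc X n \<equiv> enc (cubes X n)"

definition cdec :: "'u tsys \<Rightarrow> nat \<Rightarrow> 'u \<Rightarrow> (bool list \<Rightarrow> 'u) \<times> 'u list" where
 "cdec X n = inv_into (cubes X n) (cenc X n)"

lemma Nob:
 assumes "is_tsys \<Sigma> X"
 shows "Nob X \<in> Ob LPS" "el (Nob X) n = cenc X n ` cubes X n"
  "F \<in> box_maps ==> c \<in> cubes X (btgt F) ==> act (Nob X) F (cenc X (btgt F) c) = cenc X (bsrc F) (cact F c)"
  "c \<in> cubes X n ==> wd (Nob X) n (cenc X n c) = map (lab X) (snd c)"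
  "c \<in> cubes X n ==> cdec X n (cenc X n c) = c"
 using realize[OF cubes_presheaf[OF assms]] inj_on_enc[OF presheafD(1)[OF cubes_presheaf[OF assms]]]
 unfolding Nob_def cdec_def by (auto intro: inv_into_f_f)

lemma NobE:
 assumes "is_tsys \<Sigma> X" "e \<in> el (Nob X) n"
 obtains c where "c \<in> cubes X n" "e = cenc X n c" "cdec X n e = c"
proof -
 from assms(2) obtain c where "c \<in> cubes X n" "e = cenc X n c" unfolding Nob(2)[OF assms(1)] by blast
 then show thesis using that Nob(5)[OF assms(1), of c n] by simp
qed

definition cmap :: "'u tmap \<Rightarrow> nat \<Rightarrow> (bool list \<Rightarrow> 'u) \<times> 'u list \<Rightarrow> (bool list \<Rightarrow> 'u) \<times> 'u list" where
 "cmap f n c = ((\<lambda>\<xi>\<in>bits n. fst f (fst c \<xi>)), map (snd f) (snd c))"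

lemma cmap_cubes:
 assumes f: "is_tsys_map X Y f" and c: "c \<in> cubes X n" shows "cmap f n c \<in> cubes Y n"
 unfolding cmap_def
proof (rule cubesI)
 note d = cubesD[OF c] and t = tmapD[OF f]
 show "(\<lambda>\<xi>\<in>bits n. fst f (fst c \<xi>)) \<in> bits n \<rightarrow>\<^sub>E states Y" using d(1) t(1) by auto
 show "set (map (snd f) (snd c)) \<subseteq> actions Y" using d(2) t(2) by auto
 show "length (map (snd f) (snd c)) = n" using d(3) by simp
 fix F assume F: "F \<in> box_maps" "btgt F = n" "0 < bsrc F"
 then show "((\<lambda>\<xi>\<in>bits n. fst f (fst c \<xi>)) (bfun F (zeros (bsrc F))), pull F (map (snd f) (snd c)),
   (\<lambda>\<xi>\<in>bits n. fst f (fst c \<xi>)) (bfun F (ones (bsrc F)))) \<in> transitions Y"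
  using t(4)[OF d(4)[OF F]] map_pull[OF F(1), of "snd c" "snd f"] d(3) box_dirs(5)[OF F(1)] by simp
qed

definition Nmap :: "'u tsys \<Rightarrow> 'u tmap \<Rightarrow> 'u tsys \<Rightarrow> nat \<Rightarrow> 'u \<Rightarrow> 'u" where
 "Nmap X f Y n e = cenc Y n (cmap f n (cdec X n e))"

lemma Nmap_cenc: "is_tsys \<Sigma> X ==> c \<in> cubes X n ==> Nmap X f Y n (cenc X n c) = cenc Y n (cmap f n c)"
 by (simp add: Nmap_def Nob(5))

lemma Nmap_pmap:
 assumes X: "is_tsys \<Sigma> X" and Y: "is_tsys \<Sigma> Y" and f: "is_tsys_map X Y f"
 shows "pmap (Nob X) (Nob Y) (Nmap X f Y)"
 unfolding pmap_def
proof (intro conjI allI ballI)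
 fix n e assume "e \<in> el (Nob X) n"
 then obtain c where c: "c \<in> cubes X n" "e = cenc X n c" by (rule NobE[OF X])
 note d = cmap_cubes[OF f c(1)]
 show "Nmap X f Y n e \<in> el (Nob Y) n" using d Nob(2)[OF Y] Nmap_cenc[OF X c(1)] c(2) by simp
 have "map (lab Y) (snd (cmap f n c)) = map (lab X) (snd c)"
  using tmapD(3)[OF f] cubesD(2)[OF c(1)] by (auto simp: cmap_def)
 then show "wd (Nob Y) n (Nmap X f Y n e) = wd (Nob X) n e"
  using Nob(4)[OF Y d] Nob(4)[OF X c(1)] Nmap_cenc[OF X c(1)] c(2) by simp
next
 fix F e assume F: "F \<in> box_maps" and "e \<in> el (Nob X) (btgt F)"
 then obtain c where c: "c \<in> cubes X (btgt F)" "e = cenc X (btgt F) c" by (auto elim: NobE[OF X])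
 have "cmap f (bsrc F) (cact F c) = cact F (cmap f (btgt F) c)"
  using map_pull[OF F cubesD(3)[OF c(1)]] box_dirs(5)[OF F]
  by (auto simp: cmap_def cact_def intro!: restrict_ext)
 then show "Nmap X f Y (bsrc F) (act (Nob X) F e) = act (Nob Y) F (Nmap X f Y (btgt F) e)"
  using Nob(3)[OF X F c(1)] Nob(3)[OF Y F cmap_cubes[OF f c(1)]] Nmap_cenc[OF X c(1)]
   Nmap_cenc[OF X cact_cubes[OF c(1) F]] c(2) by simp
qed

subsection \<open>Cubes are determined by their source, their actions and their target\<close>

text \<open>
 A vertex separates the coordinates that have been executed from those that are still to come, and is thereby
 an intermediate state of the transition from the source to the target of the cube.
\<close>

definition on_dirs :: "bool list \<Rightarrow> nat list" where "on_dirs \<xi> = filter (\<lambda>i. \<xi> ! i) [0..<length \<xi>]"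
definition off_dirs :: "bool list \<Rightarrow> nat list" where "off_dirs \<xi> = filter (\<lambda>i. \<not> \<xi> ! i) [0..<length \<xi>]"

lemma bx_const_nth:
 assumes "distinct ds" "set ds \<subseteq> {..<length \<beta>}" "j < length \<beta>"
 shows "bfun (bx \<beta> ds) (replicate (length ds) b) ! j = (if j \<in> set ds then b else \<beta> ! j)"
proof -
 have e: "replicate (length ds) b \<in> bits (length ds)" by (simp add: bits_def)
 show ?thesis
 proof (cases "j \<in> set ds")
  case True
  then obtain i where i: "i < length ds" "j = ds ! i" by (metis in_set_conv_nth)
  then show ?thesis using bx_nth(1)[OF assms(1,2) e i(1)] by simp
 next
  case False
  then show ?thesis using bx_nth(2)[OF assms(1,2) e assms(3)] by simp
 qed
qed

lemma bx_const:
 assumes "distinct ds" "set ds \<subseteq> {..<length \<beta>}" "length \<gamma> = length \<beta>"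
  "\<And>j. j < length \<beta> ==> \<gamma> ! j = (if j \<in> set ds then b else \<beta> ! j)"
 shows "bfun (bx \<beta> ds) (replicate (length ds) b) = \<gamma>"
proof (rule nth_equalityI)
 show l: "length (bfun (bx \<beta> ds) (replicate (length ds) b)) = length \<gamma>"
  using bx_nth(3)[OF assms(1,2), of "replicate (length ds) b"] assms(3) by (simp add: bits_def)
 fix j assume "j < length (bfun (bx \<beta> ds) (replicate (length ds) b))"
 then have j: "j < length \<beta>" using l assms(3) by simp
 then show "bfun (bx \<beta> ds) (replicate (length ds) b) ! j = \<gamma> ! j"
  using bx_const_nth[OF assms(1,2) j] assms(4)[OF j] by simp
qed

lemma on_off:
 "distinct (on_dirs \<xi>)" "distinct (off_dirs \<xi>)" "distinct (on_dirs \<xi> @ off_dirs \<xi>)"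
 "set (on_dirs \<xi>) \<subseteq> {..<length \<xi>}" "set (off_dirs \<xi>) \<subseteq> {..<length \<xi>}"
 "set (on_dirs \<xi> @ off_dirs \<xi>) = {..<length \<xi>}"
 "j < length \<xi> ==> j \<in> set (on_dirs \<xi>) \<longleftrightarrow> \<xi> ! j" "j < length \<xi> ==> j \<in> set (off_dirs \<xi>) \<longleftrightarrow> \<not> \<xi> ! j"
 by (auto simp: on_dirs_def off_dirs_def)

lemma on_dirs_Nil: "on_dirs \<xi> = [] ==> \<xi> = zeros (length \<xi>)"
 using on_off(7)[of _ \<xi>] by (intro nth_equalityI) auto

lemma off_dirs_Nil: "off_dirs \<xi> = [] ==> \<xi> = ones (length \<xi>)"
 using on_off(8)[of _ \<xi>] by (intro nth_equalityI) auto

lemma on_off_bx: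
 assumes "length \<xi> = n"
 shows "bfun (bx (zeros n) (on_dirs \<xi>)) (zeros (length (on_dirs \<xi>))) = zeros n"
  "bfun (bx (zeros n) (on_dirs \<xi>)) (ones (length (on_dirs \<xi>))) = \<xi>"
  "bfun (bx \<xi> (off_dirs \<xi>)) (zeros (length (off_dirs \<xi>))) = \<xi>"
  "bfun (bx \<xi> (off_dirs \<xi>)) (ones (length (off_dirs \<xi>))) = ones n"
  "bfun (bx (zeros n) (on_dirs \<xi> @ off_dirs \<xi>)) (ones (length (on_dirs \<xi>)) @ zeros (length (off_dirs \<xi>))) = \<xi>"
proof -
 note o = on_off(1-6)[of \<xi>, unfolded assms] on_off(7,8)[where \<xi>=\<xi>, unfolded assms]
 show "bfun (bx (zeros n) (on_dirs \<xi>)) (zeros (length (on_dirs \<xi>))) = zeros n"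
  using o(4) by (intro bx_const on_off) auto
 show "bfun (bx (zeros n) (on_dirs \<xi>)) (ones (length (on_dirs \<xi>))) = \<xi>"
  using o(4) o(7) assms by (intro bx_const on_off) auto
 show "bfun (bx \<xi> (off_dirs \<xi>)) (zeros (length (off_dirs \<xi>))) = \<xi>"
  using o(8) assms by (intro bx_const on_off) auto
 show "bfun (bx \<xi> (off_dirs \<xi>)) (ones (length (off_dirs \<xi>))) = ones n"
  using o(8) assms by (intro bx_const on_off) auto
 let ?p = "length (on_dirs \<xi>)" and ?q = "length (off_dirs \<xi>)" and ?ds = "on_dirs \<xi> @ off_dirs \<xi>"
 show "bfun (bx (zeros n) ?ds) (ones ?p @ zeros ?q) = \<xi>"
 proof (rule nth_equalityI)
  have s: "set ?ds \<subseteq> {..<length (zeros n)}" using o(6) by simp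
  have e: "ones ?p @ zeros ?q \<in> bits (length ?ds)" by (simp add: bits_def)
  show l: "length (bfun (bx (zeros n) ?ds) (ones ?p @ zeros ?q)) = length \<xi>"
   using bx_nth(3)[OF o(3) s e] assms by simp
  fix j assume "j < length (bfun (bx (zeros n) ?ds) (ones ?p @ zeros ?q))"
  then have j: "j < n" using l assms by simp
  then have "j \<in> set ?ds" using o(6) by simp
  then obtain i where i: "i < length ?ds" "j = ?ds ! i" by (metis in_set_conv_nth)
  have v: "bfun (bx (zeros n) ?ds) (ones ?p @ zeros ?q) ! j = (ones ?p @ zeros ?q) ! i"
   using bx_nth(1)[OF o(3) s e i(1)] i(2) by simp
  show "bfun (bx (zeros n) ?ds) (ones ?p @ zeros ?q) ! j = \<xi> ! j"
  proof (cases "i < ?p")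
   case True
   then have "j \<in> set (on_dirs \<xi>)" using i by (simp add: nth_append)
   then show ?thesis using v True o(7)[OF j] by (simp add: nth_append)
  next
   case False
   then have "j \<in> set (off_dirs \<xi>)" using i by (simp add: nth_append)
   then show ?thesis using v False o(8)[OF j] i(1) by (simp add: nth_append)
  qed
 qed
qed

lemma on_off_box:
 assumes "length \<xi> = n"
 shows "bx (zeros n) (on_dirs \<xi>) \<in> box_maps" "dirs (bx (zeros n) (on_dirs \<xi>)) = on_dirs \<xi>"
  "bx \<xi> (off_dirs \<xi>) \<in> box_maps" "dirs (bx \<xi> (off_dirs \<xi>)) = off_dirs \<xi>"
  "bx (zeros n) (on_dirs \<xi> @ off_dirs \<xi>) \<in> box_maps"
  "dirs (bx (zeros n) (on_dirs \<xi> @ off_dirs \<xi>)) = on_dirs \<xi> @ off_dirs \<xi>"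
 using bx_box[OF on_off(1), of \<xi> "zeros n"] bx_box[OF on_off(2,5), of \<xi>]
  bx_box[OF on_off(3), of \<xi> "zeros n"] on_off(4-6)[of \<xi>] assms by simp_all

lemma cube_split:
 assumes c: "c \<in> cubes X n" and e: "length \<xi> = n" "on_dirs \<xi> \<noteq> []" "off_dirs \<xi> \<noteq> []"
 defines "u \<equiv> map (nth (snd c)) (on_dirs \<xi>)" and "v \<equiv> map (nth (snd c)) (off_dirs \<xi>)"
 shows "(fst c (zeros n), u, fst c \<xi>) \<in> transitions X" "(fst c \<xi>, v, fst c (ones n)) \<in> transitions X"
  "(fst c (zeros n), u @ v, fst c (ones n)) \<in> transitions X" "u \<noteq> []" "v \<noteq> []"
proof -
 note d = cubesD(4)[OF c] and b = on_off_box[OF e(1)] and o = on_off_bx[OF e(1)]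
 show "(fst c (zeros n), u, fst c \<xi>) \<in> transitions X"
  using d[OF b(1)] o(1,2) e by (simp add: pull_def b(2) u_def)
 show "(fst c \<xi>, v, fst c (ones n)) \<in> transitions X"
  using d[OF b(3)] o(3,4) e by (simp add: pull_def b(4) v_def)
 show "(fst c (zeros n), u @ v, fst c (ones n)) \<in> transitions X"
  using d[OF b(5)] bfun_perm[OF on_off(3)[of \<xi>] on_off(6)[of \<xi>]] e by (simp add: pull_def b(6) u_def v_def)
qed (use e in \<open>simp_all add: u_def v_def\<close>)

lemma csa2_unique:
 assumes X: "is_hdts \<Sigma> X" and ne: "u \<noteq> []" "v \<noteq> []" and t: "(\<alpha>, u @ v, \<beta>) \<in> transitions X"
  and a: "(\<alpha>, u, \<nu>) \<in> transitions X" "(\<nu>, v, \<beta>) \<in> transitions X"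
   "(\<alpha>, u, \<nu>') \<in> transitions X" "(\<nu>', v, \<beta>) \<in> transitions X"
 shows "\<nu> = \<nu>'"
proof -
 have "CSA2 X" using X by (simp add: is_hdts_def)
 then have "\<exists>!\<nu>. \<nu> \<in> states X \<and> (\<alpha>, u, \<nu>) \<in> transitions X \<and> (\<nu>, v, \<beta>) \<in> transitions X"
  using ne t unfolding CSA2_def by blast
 moreover have "\<nu> \<in> states X" "\<nu>' \<in> states X"
  using tsysD(2)[OF hdts_tsys[OF X] a(1)] tsysD(2)[OF hdts_tsys[OF X] a(3)] by blast+
 ultimately show ?thesis using a by metis
qed

lemma cubes_eqI:
 assumes X: "is_hdts \<Sigma> X" and c: "c \<in> cubes X n" "c' \<in> cubes X n" and u: "snd c = snd c'"
  and v: "fst c (zeros n) = fst c' (zeros n)" "fst c (ones n) = fst c' (ones n)"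
 shows "c = c'"
proof -
 have "fst c \<xi> = fst c' \<xi>" if "\<xi> \<in> bits n" for \<xi>
 proof -
  have e: "length \<xi> = n" using that by (simp add: bits_def)
  consider "\<xi> = zeros n" | "\<xi> = ones n" | "on_dirs \<xi> \<noteq> []" "off_dirs \<xi> \<noteq> []"
   using on_dirs_Nil off_dirs_Nil e by metis
  then show ?thesis
  proof cases
   case 3
   note s = cube_split[OF c(1) e 3] and s' = cube_split[OF c(2) e 3]
   show ?thesis
    using csa2_unique[OF X s(4,5,3) s(1,2)] s'(1,2) u v by simp
  qed (use v in simp_all)
 qed
 then have "fst c = fst c'" by (intro PiE_ext[OF cubesD(1)[OF c(1)] cubesD(1)[OF c(2)]])
 then show ?thesis using u by (simp add: prod_eq_iff)
qed

text \<open>The state under a point and the action under an edge.\<close>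

definition sta :: "'u tsys \<Rightarrow> 'u \<Rightarrow> 'u" where "sta X e = fst (cdec X 0 e) []"
definition ua :: "'u tsys \<Rightarrow> 'u \<Rightarrow> 'u" where "ua X e = hd (snd (cdec X 1 e))"

lemma Nob_vtx:
 assumes X: "is_tsys \<Sigma> X" and c: "c \<in> cubes X (length \<xi>)"
 shows "vtx (Nob X) \<xi> (cenc X (length \<xi>) c) = cenc X 0 ((\<lambda>_\<in>bits 0. fst c \<xi>), [])"
  "sta X (vtx (Nob X) \<xi> (cenc X (length \<xi>) c)) = fst c \<xi>"
proof -
 have "cact (bx \<xi> []) c = ((\<lambda>_\<in>bits 0. fst c \<xi>), [])"
  by (auto simp: cact_def pull_def point_box intro!: restrict_ext)
 moreover have "cact (bx \<xi> []) c \<in> cubes X 0" using cact_cubes[of c X "bx \<xi> []"] c point_box(1) by simp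
 ultimately have *: "vtx (Nob X) \<xi> (cenc X (length \<xi>) c) = cenc X 0 ((\<lambda>_\<in>bits 0. fst c \<xi>), [])"
  "((\<lambda>_\<in>bits 0. fst c \<xi>), []) \<in> cubes X 0"
  using Nob(3)[OF X point_box(1), of c \<xi>] c by (simp_all add: vtx_def del: bits_0)
 then show "vtx (Nob X) \<xi> (cenc X (length \<xi>) c) = cenc X 0 ((\<lambda>_\<in>bits 0. fst c \<xi>), [])"
  "sta X (vtx (Nob X) \<xi> (cenc X (length \<xi>) c)) = fst c \<xi>"
  using Nob(5)[OF X *(2)] by (simp_all add: sta_def)
qed

lemma ua_act:
 assumes X: "is_tsys \<Sigma> X" and F: "F \<in> box_maps" "bsrc F = 1" and c: "c \<in> cubes X (btgt F)"
 shows "ua X (act (Nob X) F (cenc X (btgt F) c)) = snd c ! (dirs F ! 0)"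
proof -
 have "dirs F \<noteq> []" using box_dirs(1)[OF F(1)] F(2) by auto
 then show ?thesis
  using Nob(3)[OF X F(1) c] Nob(5)[OF X cact_cubes[OF c F(1)]] F(2)
  by (simp add: ua_def cact_def pull_def hd_conv_nth)
qed

text \<open>Parallel edges of a cube come from the same coordinate.\<close>

lemma ua_par:
 assumes X: "is_tsys \<Sigma> X" and "par (Nob X) e e'" shows "ua X e = ua X e'"
 using assms(2)
proof induction
 case (step e' e'')
 obtain F F' k where *: "F \<in> box_maps" "F' \<in> box_maps" "bsrc F = 1" "bsrc F' = 1"
   "btgt F = btgt F'" "dirs F = dirs F'" "k \<in> el (Nob X) (btgt F)" "e' = act (Nob X) F k" "e'' = act (Nob X) F' k"
  using step(2) unfolding par1_def by blast
 obtain c where c: "c \<in> cubes X (btgt F)" "k = cenc X (btgt F) c" using *(7) by (rule NobE[OF X])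
 have "ua X e' = ua X e''"
  using ua_act[OF X *(1,3) c(1)] ua_act[OF X *(2,4), of c] * c by simp
 then show ?case using step(3) by simp
qed simp

lemma ua_rep: "is_tsys \<Sigma> X ==> ua X (rep (Nob X) e) = ua X e"
 using ua_par par_rep by metis

lemma acts_Nob:
 assumes X: "is_tsys \<Sigma> X" and c: "c \<in> cubes X n"
 shows "map (ua X) (acts (Nob X) n (cenc X n c)) = snd c"
proof (rule nth_equalityI)
 show l: "length (map (ua X) (acts (Nob X) n (cenc X n c))) = length (snd c)"
  using cubesD(3)[OF c] by simp
 fix i assume "i < length (map (ua X) (acts (Nob X) n (cenc X n c)))"
 then have i: "i < n" by simp
 then show "map (ua X) (acts (Nob X) n (cenc X n c)) ! i = snd c ! i"
  using ua_rep[OF X] ua_act[OF X, of "edge n i" c] edge_box[OF i] c by (simp add: acts_def)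
qed

text \<open>Uniqueness of intermediate states in the axioms for transition systems gives the paradigm.\<close>

lemma Nob_paradigm: assumes X: "is_hdts \<Sigma> X" shows "paradigm (Nob X)"
 unfolding paradigm_def
proof (intro conjI allI ballI impI)
 note tX = hdts_tsys[OF X]
 note N = Nob[OF tX]
 show "Nob X \<in> Ob LPS" by (rule N(1))
 fix p q k l l'
 assume "k \<in> el (Nob X) (p + q)" "l \<in> el (Nob X) p" "l' \<in> el (Nob X) q"
 then obtain c d d' where c: "c \<in> cubes X (p + q)" "k = cenc X (p + q) c"
  and d: "d \<in> cubes X p" "l = cenc X p d" and d': "d' \<in> cubes X q" "l' = cenc X q d'"
  by (metis NobE[OF tX])
 assume h: "src (Nob X) p l = src (Nob X) (p + q) k" "tgt (Nob X) p l = src (Nob X) q l'"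
  "tgt (Nob X) q l' = tgt (Nob X) (p + q) k" "acts (Nob X) (p + q) k = acts (Nob X) p l @ acts (Nob X) q l'"
 have v: "fst d (zeros p) = fst c (zeros (p + q))" "fst d (ones p) = fst d' (zeros q)"
  "fst d' (ones q) = fst c (ones (p + q))"
  using arg_cong[OF h(1), of "sta X"] arg_cong[OF h(2), of "sta X"] arg_cong[OF h(3), of "sta X"]
   Nob_vtx(2)[OF tX, of d "zeros p"] Nob_vtx(2)[OF tX, of c "zeros (p + q)"] Nob_vtx(2)[OF tX, of d "ones p"]
   Nob_vtx(2)[OF tX, of d' "zeros q"] Nob_vtx(2)[OF tX, of d' "ones q"] Nob_vtx(2)[OF tX, of c "ones (p + q)"] c d d'
  by simp_all
 have u: "snd c = snd d @ snd d'"
  using arg_cong[OF h(4), of "map (ua X)"] acts_Nob[OF tX c(1)] acts_Nob[OF tX d(1)] acts_Nob[OF tX d'(1)] c(2) d(2) d'(2)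
  by simp
 have len: "length (snd d) = p" "length (snd d') = q" using cubesD(3) d(1) d'(1) by blast+
 let ?f = "cact (front p q) c"
 have f: "?f \<in> cubes X p" using cact_cubes[of c X "front p q"] c(1) front_box(1) by simp
 have fu: "snd ?f = snd d" using map_nth_blocks(1)[of "snd d" "snd d'"] len
  by (simp add: cact_def pull_def front_box u)
 have fv: "fst ?f \<xi> = fst c (\<xi> @ zeros q)" if "length \<xi> = p" for \<xi>
  using that bfun_front[OF that] by (simp add: cact_def bits_def)
 have "fst c (ones p @ zeros q) = fst d (ones p)"
 proof (cases "p = 0 \<or> q = 0")
  case True
  then show ?thesis using v by auto
 next
  case False
  then have ne: "snd d \<noteq> []" "snd d' \<noteq> []" using len by auto
  have "(fst c (zeros (p + q)), snd c, fst c (ones (p + q))) \<in> transitions X"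
   using cubesD(4)[OF c(1) box_id] False pull_id[OF cubesD(3)[OF c(1)]] by (simp add: bfun_bid)
  moreover have "(fst d (zeros p), snd d, fst d (ones p)) \<in> transitions X"
   using cubesD(4)[OF d(1) box_id] False pull_id[OF cubesD(3)[OF d(1)]] by (simp add: bfun_bid)
  moreover have "(fst d' (zeros q), snd d', fst d' (ones q)) \<in> transitions X"
   using cubesD(4)[OF d'(1) box_id] False pull_id[OF cubesD(3)[OF d'(1)]] by (simp add: bfun_bid)
  moreover have "(fst c (zeros (p + q)), snd d, fst c (ones p @ zeros q)) \<in> transitions X"
   using cubesD(4)[OF c(1) front_box(1)[of p q]] False fu bfun_front[of "zeros p" p q] bfun_front[of "ones p" p q]
   by (simp add: cact_def replicate_add[symmetric])
  moreover have "(fst c (ones p @ zeros q), snd d', fst c (ones (p + q))) \<in> transitions X"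
  proof -
   have "pull (rear p q) (snd c) = snd d'" using map_nth_blocks(2)[of "snd d" "snd d'"] len
    by (simp add: pull_def rear_box u)
   then show ?thesis
    using cubesD(4)[OF c(1) rear_box(1)[of p q]] False bfun_rear[of "zeros q" q p] bfun_rear[of "ones q" q p]
    by (simp add: replicate_add[symmetric])
  qed
  ultimately show ?thesis using csa2_unique[OF X ne] u v by metis
 qed
 then have "d = ?f"
  using cubes_eqI[OF X d(1) f] fu v fv[of "zeros p"] fv[of "ones p"] by (simp add: replicate_add)
 then show "l = act (Nob X) (front p q) k"
  using N(3)[OF front_box(1)[of p q], of c] c d(2) by simp
next
 note tX = hdts_tsys[OF X]
 fix k l assume "k \<in> el (Nob X) 1" "l \<in> el (Nob X) 1"
 then obtain c d where c: "c \<in> cubes X 1" "k = cenc X 1 c" and d: "d \<in> cubes X 1" "l = cenc X 1 d"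
  by (metis NobE[OF tX])
 assume h: "src (Nob X) 1 k = src (Nob X) 1 l" "tgt (Nob X) 1 k = tgt (Nob X) 1 l" "wd (Nob X) 1 k = wd (Nob X) 1 l"
 have v: "fst c (zeros 1) = fst d (zeros 1)" "fst c (ones 1) = fst d (ones 1)"
  using arg_cong[OF h(1), of "sta X"] arg_cong[OF h(2), of "sta X"]
   Nob_vtx(2)[OF tX, of c "zeros 1"] Nob_vtx(2)[OF tX, of d "zeros 1"]
   Nob_vtx(2)[OF tX, of c "ones 1"] Nob_vtx(2)[OF tX, of d "ones 1"] c d by simp_all
 obtain u u' where u: "snd c = [u]" "snd d = [u']"
  using cubesD(3)[OF c(1)] cubesD(3)[OF d(1)] by (auto simp: length_Suc_conv)
 have t: "(fst c (zeros 1), [u], fst c (ones 1)) \<in> transitions X" "(fst d (zeros 1), [u'], fst d (ones 1)) \<in> transitions X"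
  using cubesD(4)[OF c(1) box_id] pull_id[OF cubesD(3)[OF c(1)]] u(1)
   cubesD(4)[OF d(1) box_id] pull_id[OF cubesD(3)[OF d(1)]] u(2) bfun_bid[OF zeros_bits(1)[of 1]] bfun_bid[OF zeros_bits(2)[of 1]] by simp_all
 have "lab X u = lab X u'" using h(3) Nob(4)[OF tX c(1)] Nob(4)[OF tX d(1)] c(2) d(2) u by simp
 then have "u = u'" using X t unfolding is_hdts_def CSA1_def v by blast
 then show "k = l" using cubes_eqI[OF X c(1) d(1)] u v c(2) d(2) by simp
qed

end

section \<open>Transition systems as precubical sets\<close>

context small_labels
begin

definition Nfun :: "('u tsys, 'u tsys_arrow, 'u precub_arrow, 'u lps_arrow) fctr" where
 "Nfun = (Nob, \<lambda>f. mk_arr (Nob (fst f)) (Nmap (fst f) (tm f) (snd (snd f))) (Nob (snd (snd f))))"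

lemma fst_Nfun [simp]: "fst Nfun = Nob" by (simp add: Nfun_def)

lemma HDTS_homD:
 assumes "f \<in> hom HD X Y"
 shows "is_hdts \<Sigma> X" "is_hdts \<Sigma> Y" "is_tsys_map X Y (tm f)" "f = (X, tm f, Y)"
  "is_tsys \<Sigma> X" "is_tsys \<Sigma> Y" "fst f = X" "snd (snd f) = Y"
 using assms hdts_tsys unfolding HDTS_hom by (auto simp: prod_eq_iff)

lemma Nfun_arr: "f \<in> hom HD X Y ==> snd Nfun f = mk_arr (Nob X) (Nmap X (tm f) Y) (Nob Y)"
 using HDTS_homD(7,8) by (simp add: Nfun_def)

lemma Nfun_hom: assumes f: "f \<in> hom HD X Y" shows "snd Nfun f \<in> hom DD (Nob X) (Nob Y)"
proof -
 note d = HDTS_homD[OF f]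
 show ?thesis
  using mk_arr_hom[OF Nob(1)[OF d(5)] Nob(1)[OF d(6)] Nmap_pmap[OF d(5,6,3)]] Nob_paradigm[OF d(1)] Nob_paradigm[OF d(2)]
  by (simp add: DD_hom Nfun_arr[OF f])
qed

lemma ap_Nfun:
 assumes "f \<in> hom HD X Y" "c \<in> cubes X n"
 shows "ap (snd Nfun f) n (cenc X n c) = cenc Y n (cmap (tm f) n c)"
 using Nfun_arr[OF assms(1)] Nob(2)[OF HDTS_homD(5)[OF assms(1)]] Nmap_cenc[OF HDTS_homD(5)[OF assms(1)] assms(2)] assms(2)
 by simp

lemma Nfun_functor: "is_functor HD DD Nfun"
proof (rule is_functorI[OF is_category_HDTS is_category_DD])
 fix X assume "X \<in> Ob HD"
 then have X: "is_hdts \<Sigma> X" by (simp add: HDTS_simps)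
 then show "fst Nfun X \<in> Ob DD" using Nob_paradigm by (simp add: DD_simps)
 note tX = hdts_tsys[OF X]
 have i: "Id HD X \<in> hom HD X X" using catD(3)[OF is_category_HDTS] X by (simp add: HDTS_simps)
 have j: "Id LPS (Nob X) \<in> hom LPS (Nob X) (Nob X)" using catD(3)[OF is_category_LPS Nob(1)[OF tX]] .
 have "snd Nfun (Id HD X) = Id LPS (Nob X)"
 proof (rule lps_hom_eqI[OF _ j])
  show "snd Nfun (Id HD X) \<in> hom LPS (Nob X) (Nob X)" using Nfun_hom[OF i] by (simp add: DD_hom)
  fix n e assume e: "e \<in> el (Nob X) n"
  then obtain c where c: "c \<in> cubes X n" "e = cenc X n c" by (rule NobE[OF tX])
  have "cmap (tm (Id HD X)) n c = c"
  proof -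
   have "(\<lambda>\<xi>\<in>bits n. (\<lambda>s\<in>states X. s) (fst c \<xi>)) = fst c"
    using cubesD(1)[OF c(1)] by (intro extensionalityI[of _ "bits n"]) (auto simp: PiE_iff)
   moreover have "map (\<lambda>u\<in>actions X. u) (snd c) = snd c" using cubesD(2)[OF c(1)] by (auto intro!: map_idI)
   ultimately show ?thesis by (simp add: cmap_def HDTS_simps WHDTS_simps prod_eq_iff)
  qed
  then show "ap (snd Nfun (Id HD X)) n e = ap (Id LPS (Nob X)) n e"
   using ap_Nfun[OF i c(1)] LPS_id[OF Nob(1)[OF tX] e] c(2) by simp
 qed
 then show "snd Nfun (Id HD X) = Id DD (fst Nfun X)" by (simp add: DD_simps)
next
 fix f g X Y Z assume f: "f \<in> hom HD X Y" and g: "g \<in> hom HD Y Z"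
 have gf: "Comp HD g f \<in> hom HD X Z" using catD(4)[OF is_category_HDTS f g] .
 have L: "snd Nfun f \<in> hom LPS (Nob X) (Nob Y)" "snd Nfun g \<in> hom LPS (Nob Y) (Nob Z)"
   "snd Nfun (Comp HD g f) \<in> hom LPS (Nob X) (Nob Z)"
  using Nfun_hom f g gf by (simp_all add: DD_hom)
 have "snd Nfun (Comp HD g f) = Comp LPS (snd Nfun g) (snd Nfun f)"
 proof (rule lps_hom_eqI[OF L(3) catD(4)[OF is_category_LPS L(1,2)]])
  fix n e assume e: "e \<in> el (Nob X) n"
  then obtain c where c: "c \<in> cubes X n" "e = cenc X n c" by (rule NobE[OF HDTS_homD(5)[OF f]])
  have t: "tm (Comp HD g f) = tcomp X (tm g) (tm f)"
   using HDTS_homD(7)[OF f] by (simp add: HDTS_simps WHDTS_simps)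
  have "cmap (tm (Comp HD g f)) n c = cmap (tm g) n (cmap (tm f) n c)"
   unfolding t cmap_def fst_conv snd_conv
  proof (intro conjI prod_eqI; simp only: fst_conv snd_conv)
   show "(\<lambda>\<xi>\<in>bits n. compose (states X) (fst (tm g)) (fst (tm f)) (fst c \<xi>)) =
     (\<lambda>\<xi>\<in>bits n. fst (tm g) ((\<lambda>\<xi>\<in>bits n. fst (tm f) (fst c \<xi>)) \<xi>))"
    using PiE_mem[OF cubesD(1)[OF c(1)]] by (intro restrict_ext) (simp add: compose_eq)
   show "map (compose (actions X) (snd (tm g)) (snd (tm f))) (snd c) = map (snd (tm g)) (map (snd (tm f)) (snd c))"
    using cubesD(2)[OF c(1)] by (auto simp: compose_def)
  qed
  then show "ap (snd Nfun (Comp HD g f)) n e = ap (Comp LPS (snd Nfun g) (snd Nfun f)) n e"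
   using LPS_comp[OF L(1,2) e] ap_Nfun[OF gf c(1)] ap_Nfun[OF f c(1)]
    ap_Nfun[OF g cmap_cubes[OF HDTS_homD(3)[OF f] c(1)]] c(2) by simp
 qed
 then show "snd Nfun (Comp HD g f) = Comp DD (snd Nfun g) (snd Nfun f)" by (simp add: DD_simps)
qed (simp add: Nfun_hom)

subsection \<open>A precubical set satisfying the paradigm consists of the cubes of its transition system\<close>

definition tcube :: "'u precub_arrow \<Rightarrow> nat \<Rightarrow> 'u \<Rightarrow> (bool list \<Rightarrow> 'u) \<times> 'u list" where
 "tcube x n c = ((\<lambda>\<xi>\<in>bits n. vtx x \<xi> c), acts x n c)"

definition tr :: "'u precub_arrow \<Rightarrow> nat \<Rightarrow> 'u \<Rightarrow> 'u" where
 "tr x n c = cenc (Gob x) n (tcube x n c)"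

lemma tcube_cubes: assumes x: "x \<in> Ob LPS" and c: "c \<in> el x n" shows "tcube x n c \<in> cubes (Gob x) n"
 unfolding tcube_def
proof (rule cubesI)
 show "(\<lambda>\<xi>\<in>bits n. vtx x \<xi> c) \<in> bits n \<rightarrow>\<^sub>E states (Gob x)"
  using vtx_el[OF x] c by (auto simp: bits_def)
 show "set (acts x n c) \<subseteq> actions (Gob x)" using set_acts[OF x c] by simp
 fix F assume F: "F \<in> box_maps" "btgt F = n" "0 < bsrc F"
 then have "bfun F (zeros (bsrc F)) \<in> bits n" "bfun F (ones (bsrc F)) \<in> bits n"
  using box_dirs(5)[OF F(1)] by simp_all
 then show "((\<lambda>\<xi>\<in>bits n. vtx x \<xi> c) (bfun F (zeros (bsrc F))), pull F (acts x n c),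
   (\<lambda>\<xi>\<in>bits n. vtx x \<xi> c) (bfun F (ones (bsrc F)))) \<in> transitions (Gob x)"
  using Gob_face[OF x F(1,3), of c] F(2) c by simp
qed simp

lemma tr_pmap: assumes x: "x \<in> Ob LPS" shows "pmap x (Nob (Gob x)) (tr x)"
 unfolding pmap_def tr_def
proof (intro conjI allI ballI)
 note tG = Gob_tsys[OF x]
 fix n c assume c: "c \<in> el x n"
 note k = tcube_cubes[OF x c]
 show "cenc (Gob x) n (tcube x n c) \<in> el (Nob (Gob x)) n" using k Nob(2)[OF tG] by simp
 have "map (lab (Gob x)) (acts x n c) = wd x n c"
  unfolding wd_acts[OF x c]
  by (rule map_cong[OF HOL.refl]) (rule Gob_simps(3), rule subsetD[OF set_acts[OF x c]])
 then show "wd (Nob (Gob x)) n (cenc (Gob x) n (tcube x n c)) = wd x n c"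
  using Nob(4)[OF tG k] by (simp add: tcube_def)
next
 note tG = Gob_tsys[OF x]
 fix F c assume F: "F \<in> box_maps" and c: "c \<in> el x (btgt F)"
 have "tcube x (bsrc F) (act x F c) = cact F (tcube x (btgt F) c)"
  unfolding tcube_def cact_def fst_conv snd_conv acts_act[OF x F c]
  using vtx_act[OF x F c] box_dirs(5)[OF F] by (auto simp: bits_def intro!: restrict_ext)
 then show "cenc (Gob x) (bsrc F) (tcube x (bsrc F) (act x F c)) =
   act (Nob (Gob x)) F (cenc (Gob x) (btgt F) (tcube x (btgt F) c))"
  using Nob(3)[OF tG F tcube_cubes[OF x c]] by simp
qed

text \<open>
 Injectivity is the first half of the paradigm. A cube of the system has its top transition in common with some
 cube of \<open>x\<close>, and both have the same vertices by uniqueness of intermediate states; hence surjectivity.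
\<close>

lemma tcube_bij: assumes P: "paradigm x" shows "bij_betw (tcube x n) (el x n) (cubes (Gob x) n)"
 unfolding bij_betw_def
proof (intro conjI equalityI subsetI)
 note x = paradigmD(1)[OF P] and H = Gob_hdts[OF P]
 show "inj_on (tcube x n) (el x n)"
 proof (rule inj_onI)
  fix c c' assume c: "c \<in> el x n" "c' \<in> el x n" and e: "tcube x n c = tcube x n c'"
  have "vtx x \<xi> c = vtx x \<xi> c'" if "\<xi> \<in> bits n" for \<xi>
   using fun_cong[OF arg_cong[OF e, of fst], of \<xi>] that by (simp add: tcube_def)
  moreover have "acts x n c = acts x n c'" using arg_cong[OF e, of snd] by (simp add: tcube_def)
  ultimately show "c = c'" using paradigm_cube_eq[OF P c] by simp
 qed
 show "k \<in> cubes (Gob x) n" if "k \<in> tcube x n ` el x n" for k using that tcube_cubes[OF x] by blast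
 fix k assume k: "k \<in> cubes (Gob x) n"
 show "k \<in> tcube x n ` el x n"
 proof (cases "n = 0")
  case True
  have s: "fst k [] \<in> el x 0" using PiE_mem[OF cubesD(1)[OF k], of "[]"] True by simp
  have "fst (tcube x 0 (fst k [])) = fst k"
   using cubesD(1)[OF k] vtx_point[OF x s] True
   by (intro extensionalityI[of _ "bits 0"]) (auto simp: tcube_def PiE_def)
  moreover have "snd (tcube x 0 (fst k [])) = snd k" using cubesD(3)[OF k] True by (simp add: tcube_def acts_def)
  ultimately show ?thesis using s True by (metis imageI prod_eqI)
 next
  case False
  have "(fst k (zeros n), snd k, fst k (ones n)) \<in> transitions (Gob x)"
   using cubesD(4)[OF k box_id] False pull_id[OF cubesD(3)[OF k]] by (simp add: bfun_bid)
  then obtain c where c: "c \<in> el x n" "fst k (zeros n) = src x n c" "snd k = acts x n c" "fst k (ones n) = tgt x n c"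
   using cubesD(3)[OF k] unfolding Gob_trans by auto
  have "k = tcube x n c"
   by (rule cubes_eqI[OF H k tcube_cubes[OF x c(1)]]) (use c in \<open>simp_all add: tcube_def\<close>)
  then show ?thesis using c(1) by blast
 qed
qed

lemma tr_bij: assumes P: "paradigm x" shows "bij_betw (tr x n) (el x n) (el (Nob (Gob x)) n)"
proof -
 note tG = Gob_tsys[OF paradigmD(1)[OF P]]
 have "bij_betw (cenc (Gob x) n) (cubes (Gob x) n) (el (Nob (Gob x)) n)"
  using inj_on_enc[OF presheafD(1)[OF cubes_presheaf[OF tG]]] Nob(2)[OF tG] by (simp add: bij_betw_def)
 from bij_betw_trans[OF tcube_bij[OF P] this] show ?thesis by (simp add: tr_def[abs_def] comp_def)
qed

definition trn :: "'u precub_arrow \<Rightarrow> 'u lps_arrow" where "trn x = mk_arr x (tr x) (Nob (Gob x))"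

lemma trn_hom: "paradigm x ==> trn x \<in> hom DD x (Nob (Gob x))"
 using mk_arr_hom[OF paradigmD(1) Nob(1)[OF Gob_tsys[OF paradigmD(1)]] tr_pmap[OF paradigmD(1)]]
  Nob_paradigm[OF Gob_hdts]
 by (simp add: DD_hom trn_def)

lemma ap_trn [simp]: "e \<in> el x n ==> ap (trn x) n e = tr x n e" by (simp add: trn_def)

lemma DD_iso:
 assumes "h \<in> hom DD x y" shows "is_iso DD h \<longleftrightarrow> is_iso LPS h"
proof -
 have h: "h \<in> hom LPS x y" "paradigm x" "paradigm y" using assms by (simp_all add: DD_hom)
 have "hom DD y x = hom LPS y x" using h(2,3) by (auto simp: DD_hom)
 then show ?thesis
  using hom_Ar[OF assms] hom_Ar[OF h(1)] by (simp add: is_iso_def DD_simps)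
qed

lemma trn_iso: "paradigm x ==> is_iso DD (trn x)"
 using DD_iso[OF trn_hom, of x] lps_bij_iso[of "trn x" x "Nob (Gob x)"] trn_hom[of x] tr_bij[of x]
  bij_betw_cong[of "el x _" "ap (trn x) _" "tr x _"] by (simp add: DD_hom)

lemma tcube_nat:
 assumes x: "x \<in> Ob LPS" and f: "pmap x y f" and c: "c \<in> el x n"
 shows "cmap (Gmap x f y) n (tcube x n c) = tcube y n (f n c)"
 unfolding cmap_def tcube_def fst_conv snd_conv pmap_acts[OF x f c] Gmap_def
proof (intro prod_eqI; simp only: fst_conv snd_conv)
 show "(\<lambda>\<xi>\<in>bits n. (\<lambda>s\<in>el x 0. f 0 s) ((\<lambda>\<xi>\<in>bits n. vtx x \<xi> c) \<xi>)) = (\<lambda>\<xi>\<in>bits n. vtx y \<xi> (f n c))"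
  using pmap_vtx[OF f, of c] vtx_el[OF x, of c] c by (intro restrict_ext) (auto simp: bits_def)
 show "map (\<lambda>u\<in>rep x ` el x 1. rep y (f 1 u)) (acts x n c) = map (\<lambda>u. rep y (f 1 u)) (acts x n c)"
  by (rule map_cong[OF HOL.refl]) (rule restrict_apply', rule subsetD[OF set_acts[OF x c]])
qed

lemma trn_nat:
 assumes h: "h \<in> hom DD x y"
 shows "Comp DD (trn y) h = Comp DD (snd Nfun (snd Gfun h)) (trn x)"
proof -
 have P: "paradigm x" "paradigm y" and h': "h \<in> hom LPS x y" using h by (simp_all add: DD_hom)
 note x = paradigmD(1)[OF P(1)] and f = hom_ap(1)[OF h'] and G = Gfun_hom[OF h]
 have t: "trn x \<in> hom LPS x (Nob (Gob x))" "trn y \<in> hom LPS y (Nob (Gob y))"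
  using trn_hom P by (simp_all add: DD_hom)
 have N: "snd Nfun (snd Gfun h) \<in> hom LPS (Nob (Gob x)) (Nob (Gob y))"
  using Nfun_hom[OF G] by (simp add: DD_hom)
 have "Comp LPS (trn y) h = Comp LPS (snd Nfun (snd Gfun h)) (trn x)"
 proof (rule lps_hom_eqI[OF catD(4)[OF is_category_LPS h' t(2)] catD(4)[OF is_category_LPS t(1) N]])
  fix n c assume c: "c \<in> el x n"
  have m: "tm (snd Gfun h) = Gmap x (ap h) y" using hom_ends[OF h'] by (simp add: Gfun_def)
  have "cmap (Gmap x (ap h) y) n (tcube x n c) = tcube y n (ap h n c)" by (rule tcube_nat[OF x f c])
  then show "ap (Comp LPS (trn y) h) n c = ap (Comp LPS (snd Nfun (snd Gfun h)) (trn x)) n c"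
   using LPS_comp[OF h' t(2) c] LPS_comp[OF t(1) N c] pmapD(1)[OF f c] c
    ap_Nfun[OF G tcube_cubes[OF x c]] m by (simp add: tr_def)
 qed
 then show ?thesis by (simp add: DD_simps)
qed

subsection \<open>Comparison with the original transition system\<close>

text \<open>
 All edges in a class of parallel edges carry the same action of \<open>X\<close>. Different classes may carry the same action,
 and an action that occurs in no transition is not reached.
\<close>

definition epsm :: "'u tsys \<Rightarrow> 'u tmap" where
 "epsm X = ((\<lambda>e\<in>el (Nob X) 0. sta X e), (\<lambda>u\<in>rep (Nob X) ` el (Nob X) 1. ua X u))"

definition eps :: "'u tsys \<Rightarrow> 'u tsys_arrow" where "eps X = (Gob (Nob X), epsm X, X)"

lemma sta_cenc: "is_tsys \<Sigma> X ==> c \<in> cubes X 0 ==> sta X (cenc X 0 c) = fst c []"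
 by (simp add: sta_def Nob(5))

lemma ua_cenc: "is_tsys \<Sigma> X ==> c \<in> cubes X 1 ==> [ua X (cenc X 1 c)] = snd c"
 using cubesD(3)[of c X 1] Nob(5)[of X c 1] by (auto simp: ua_def length_Suc_conv)

lemma epsm_acts:
 assumes X: "is_tsys \<Sigma> X" and c: "c \<in> cubes X n"
 shows "map (snd (epsm X)) (acts (Nob X) n (cenc X n c)) = snd c"
proof -
 have "cenc X n c \<in> el (Nob X) n" using c Nob(2)[OF X] by simp
 then have "map (snd (epsm X)) (acts (Nob X) n (cenc X n c)) = map (ua X) (acts (Nob X) n (cenc X n c))"
  unfolding epsm_def snd_conv
  by (intro map_cong[OF HOL.refl] restrict_apply' subsetD[OF set_acts[OF Nob(1)[OF X]]])
 then show ?thesis using acts_Nob[OF X c] by simp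
qed

lemma epsm_vtx:
 assumes X: "is_tsys \<Sigma> X" and c: "c \<in> cubes X n" and e: "length \<xi> = n"
 shows "fst (epsm X) (vtx (Nob X) \<xi> (cenc X n c)) = fst c \<xi>"
proof -
 have "vtx (Nob X) \<xi> (cenc X n c) \<in> el (Nob X) 0"
  using vtx_el[OF Nob(1)[OF X], of "cenc X n c" \<xi>] c Nob(2)[OF X] e by simp
 then show ?thesis using Nob_vtx(2)[OF X, of c \<xi>] c e by (simp add: epsm_def)
qed

lemma epsm_tsys_map: assumes X: "is_tsys \<Sigma> X" shows "is_tsys_map (Gob (Nob X)) X (epsm X)"
proof (rule tmapI)
 note N = Nob[OF X]
 have s: "sta X e \<in> states X" if e: "e \<in> el (Nob X) 0" for e
 proof -
  obtain c where c: "c \<in> cubes X 0" "e = cenc X 0 c" using e by (rule NobE[OF X])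
  show ?thesis using sta_cenc[OF X c(1)] PiE_mem[OF cubesD(1)[OF c(1)], of "[]"] c(2) by simp
 qed
 then show "fst (epsm X) \<in> states (Gob (Nob X)) \<rightarrow>\<^sub>E states X" by (auto simp: epsm_def)
 have a: "ua X u \<in> actions X \<and> lab X (ua X u) = hd (wd (Nob X) 1 u)" if u: "u \<in> el (Nob X) 1" for u
 proof -
  obtain c where c: "c \<in> cubes X 1" "u = cenc X 1 c" using u by (rule NobE[OF X])
  have "snd c = [ua X u]" using ua_cenc[OF X c(1)] c(2) by simp
  then show ?thesis using cubesD(2)[OF c(1)] N(4)[OF c(1)] c(2) by simp
 qed
 have r: "u \<in> el (Nob X) 1" if "u \<in> rep (Nob X) ` el (Nob X) 1" for u using that rep_el[OF N(1)] by blast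
 show "snd (epsm X) \<in> actions (Gob (Nob X)) \<rightarrow>\<^sub>E actions X"
  unfolding epsm_def Gob_simps snd_conv using a r by (intro PiE_I) simp_all
 show "lab X (snd (epsm X) u) = lab (Gob (Nob X)) u" if "u \<in> actions (Gob (Nob X))" for u
  using that a[OF r] by (simp add: epsm_def)
 fix \<alpha> us \<beta> assume "(\<alpha>, us, \<beta>) \<in> transitions (Gob (Nob X))"
 then obtain n k where t: "(\<alpha>, us, \<beta>) = (src (Nob X) n k, acts (Nob X) n k, tgt (Nob X) n k)"
  and k: "0 < n" "k \<in> el (Nob X) n" unfolding Gob_def by auto
 obtain c where c: "c \<in> cubes X n" "k = cenc X n c" using k(2) by (rule NobE[OF X])
 have "(fst c (zeros n), snd c, fst c (ones n)) \<in> transitions X"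
  using cubesD(4)[OF c(1) box_id] k(1) pull_id[OF cubesD(3)[OF c(1)]] by (simp add: bfun_bid)
 then show "(fst (epsm X) \<alpha>, map (snd (epsm X)) us, fst (epsm X) \<beta>) \<in> transitions X"
  using t epsm_acts[OF X c(1)] epsm_vtx[OF X c(1)] c(2) by simp
qed

lemma eps_hom: "is_hdts \<Sigma> X ==> eps X \<in> hom HD (Gob (Nob X)) X"
 using epsm_tsys_map[OF hdts_tsys] Gob_hdts[OF Nob_paradigm] by (simp add: HDTS_hom eps_def)

lemma eps_nat:
 assumes f: "f \<in> hom HD X Y"
 shows "Comp HD f (eps X) = Comp HD (eps Y) (snd Gfun (snd Nfun f))"
proof -
 note d = HDTS_homD[OF f] and N = Nfun_hom[OF f]
 note x = Nob(1)[OF d(5)] and y = Nob(1)[OF d(6)] and pm = Nmap_pmap[OF d(5,6,3)]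
 note G = Gfun_hom[OF N]
 have L: "Comp HD f (eps X) \<in> hom HD (Gob (Nob X)) Y"
  "Comp HD (eps Y) (snd Gfun (snd Nfun f)) \<in> hom HD (Gob (Nob X)) Y"
  using catD(4)[OF is_category_HDTS eps_hom[OF d(1)] f] catD(4)[OF is_category_HDTS G eps_hom[OF d(2)]] by blast+
 have t1: "tm (Comp HD f (eps X)) = tcomp (Gob (Nob X)) (tm f) (epsm X)"
  by (simp add: HDTS_simps WHDTS_simps eps_def)
 have t2: "tm (Comp HD (eps Y) (snd Gfun (snd Nfun f))) =
   tcomp (Gob (Nob X)) (epsm Y) (Gmap (Nob X) (ap (snd Nfun f)) (Nob Y))"
  using HDTS_homD(7)[OF G] hom_ends[of "snd Nfun f" "Nob X" "Nob Y"] N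
  by (simp add: HDTS_simps WHDTS_simps eps_def Gfun_def DD_hom)
 have "tm (Comp HD f (eps X)) = tm (Comp HD (eps Y) (snd Gfun (snd Nfun f)))"
 proof (rule tmap_eqI[OF HDTS_homD(3)[OF L(1)] HDTS_homD(3)[OF L(2)]])
  fix s assume "s \<in> states (Gob (Nob X))"
  then have s: "s \<in> el (Nob X) 0" by simp
  then obtain c where c: "c \<in> cubes X 0" "s = cenc X 0 c" by (rule NobE[OF d(5)])
  have k: "cmap (tm f) 0 c \<in> cubes Y 0" by (rule cmap_cubes[OF d(3) c(1)])
  have "ap (snd Nfun f) 0 s = cenc Y 0 (cmap (tm f) 0 c)" using ap_Nfun[OF f c(1)] c(2) by simp
  then show "fst (tm (Comp HD f (eps X))) s = fst (tm (Comp HD (eps Y) (snd Gfun (snd Nfun f)))) s"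
   unfolding t1 t2 fst_conv
   using s sta_cenc[OF d(5) c(1)] sta_cenc[OF d(6) k] c(2) k Nob(2)[OF d(6), of 0]
   by (simp add: compose_eq epsm_def Gmap_def) (simp add: cmap_def)
 next
  fix u assume "u \<in> actions (Gob (Nob X))"
  then have ur: "u \<in> rep (Nob X) ` el (Nob X) 1" by simp
  then have u: "u \<in> el (Nob X) 1" using rep_el[OF x] by blast
  then obtain c where c: "c \<in> cubes X 1" "u = cenc X 1 c" by (rule NobE[OF d(5)])
  have k: "cmap (tm f) 1 c \<in> cubes Y 1" by (rule cmap_cubes[OF d(3) c(1)])
  have fu: "ap (snd Nfun f) 1 u = cenc Y 1 (cmap (tm f) 1 c)" using ap_Nfun[OF f c(1)] c(2) by simp
  have fe: "ap (snd Nfun f) 1 u \<in> el (Nob Y) 1" unfolding fu Nob(2)[OF d(6)] using k by blast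
  have "[ua Y (ap (snd Nfun f) 1 u)] = [snd (tm f) (ua X u)]"
   unfolding fu ua_cenc[OF d(6) k] using ua_cenc[OF d(5) c(1)] c(2) by (simp add: cmap_def)
    (metis list.simps(8,9))
  then have e: "ua Y (rep (Nob Y) (ap (snd Nfun f) 1 u)) = snd (tm f) (ua X u)" using ua_rep[OF d(6)] by simp
  have "snd (epsm Y) (rep (Nob Y) (ap (snd Nfun f) 1 u)) = ua Y (rep (Nob Y) (ap (snd Nfun f) 1 u))"
   unfolding epsm_def snd_conv by (rule restrict_apply'[OF imageI[OF fe]])
  moreover have "snd (epsm X) u = ua X u" unfolding epsm_def snd_conv by (rule restrict_apply'[OF ur])
  moreover have "snd (Gmap (Nob X) (ap (snd Nfun f)) (Nob Y)) u = rep (Nob Y) (ap (snd Nfun f) 1 u)"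
   unfolding Gmap_def snd_conv by (rule restrict_apply'[OF ur])
  ultimately show "snd (tm (Comp HD f (eps X))) u = snd (tm (Comp HD (eps Y) (snd Gfun (snd Nfun f)))) u"
   unfolding t1 t2 snd_conv Gob_simps using ur e by (simp only: compose_eq)
 qed
 then show ?thesis using HDTS_homD(4)[OF L(1)] HDTS_homD(4)[OF L(2)] by simp
qed

text \<open>
 The cubes of a transition system are the cubes of the system rebuilt from them: the comparison map is
 inverse, on cubes, to the isomorphism of the previous subsection.
\<close>

lemma eps_triangle: assumes X: "is_hdts \<Sigma> X" shows "Comp DD (snd Nfun (eps X)) (trn (Nob X)) = Id DD (Nob X)"
proof -
 note tX = hdts_tsys[OF X] and P = Nob_paradigm[OF X] and e = eps_hom[OF X]
 note x = Nob(1)[OF tX]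
 have t: "trn (Nob X) \<in> hom LPS (Nob X) (Nob (Gob (Nob X)))" using trn_hom[OF P] by (simp add: DD_hom)
 have N: "snd Nfun (eps X) \<in> hom LPS (Nob (Gob (Nob X))) (Nob X)" using Nfun_hom[OF e] by (simp add: DD_hom)
 have "Comp LPS (snd Nfun (eps X)) (trn (Nob X)) = Id LPS (Nob X)"
 proof (rule lps_hom_eqI[OF catD(4)[OF is_category_LPS t N] catD(3)[OF is_category_LPS x]])
  fix n k assume k: "k \<in> el (Nob X) n"
  then obtain c where c: "c \<in> cubes X n" "k = cenc X n c" by (rule NobE[OF tX])
  have "cmap (epsm X) n (tcube (Nob X) n k) = c"
   unfolding cmap_def tcube_def fst_conv snd_conv c(2) epsm_acts[OF tX c(1)]
   using epsm_vtx[OF tX c(1)] cubesD(1)[OF c(1)]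
   by (intro prod_eqI; simp only: fst_conv snd_conv) (intro extensionalityI[of _ "bits n"]; auto simp: PiE_def bits_def)
  then show "ap (Comp LPS (snd Nfun (eps X)) (trn (Nob X))) n k = ap (Id LPS (Nob X)) n k"
   using LPS_comp[OF t N k] LPS_id[OF x k] ap_Nfun[OF e tcube_cubes[OF x k]] k c(2)
   by (simp add: tr_def eps_def)
 qed
 then show ?thesis by (simp add: DD_simps)
qed

end

section \<open>Cubification\<close>

lemma is_isoI: "f \<in> hom C X Y ==> g \<in> hom C Y X ==> Comp C g f = Id C X ==> Comp C f g = Id C Y ==> is_iso C f"
 by (auto simp: is_iso_def hom_def)

lemma is_isoE:
 assumes "is_iso C f" "f \<in> hom C X Y"
 obtains g where "g \<in> hom C Y X" "Comp C g f = Id C X" "Comp C f g = Id C Y"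
 using assms by (auto simp: is_iso_def hom_def)

lemma iso_comp:
 assumes C: "is_category C" and f: "f \<in> hom C X Y" "is_iso C f" and g: "g \<in> hom C Y Z" "is_iso C g"
 shows "is_iso C (Comp C g f)"
proof -
 obtain f' where f': "f' \<in> hom C Y X" "Comp C f' f = Id C X" "Comp C f f' = Id C Y"
  by (rule is_isoE[OF f(2,1)])
 obtain g' where g': "g' \<in> hom C Z Y" "Comp C g' g = Id C Y" "Comp C g g' = Id C Z"
  by (rule is_isoE[OF g(2,1)])
 note gf = catD(4)[OF C f(1) g(1)] and fg = catD(4)[OF C g'(1) f'(1)]
 have "Comp C (Comp C f' g') (Comp C g f) = Comp C f' (Comp C g' (Comp C g f))"
  using catD(7)[OF C gf g'(1) f'(1)] by simp
 also have "\<dots> = Comp C f' (Comp C (Comp C g' g) f)" using catD(7)[OF C f(1) g(1) g'(1)] by simp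
 also have "\<dots> = Id C X" using catD(6)[OF C f(1)] f' g' by simp
 finally have 1: "Comp C (Comp C f' g') (Comp C g f) = Id C X" .
 have "Comp C (Comp C g f) (Comp C f' g') = Comp C g (Comp C f (Comp C f' g'))"
  using catD(7)[OF C fg f(1) g(1)] by simp
 also have "\<dots> = Comp C g (Comp C (Comp C f f') g')" using catD(7)[OF C g'(1) f'(1) f(1)] by simp
 also have "\<dots> = Id C Z" using catD(6)[OF C g'(1)] f' g' by simp
 finally show ?thesis by (rule is_isoI[OF gf fg 1])
qed

lemma iso_cancel:
 assumes C: "is_category C" and p: "p \<in> hom C X X'" "is_iso C p" and q: "q \<in> hom C Y Y'" "is_iso C q"
  and g: "g \<in> hom C X Y" and g': "g' \<in> hom C X' Y'" and sq: "Comp C q g = Comp C g' p"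
 shows "is_iso C g \<longleftrightarrow> is_iso C g'"
proof -
 obtain p' where p': "p' \<in> hom C X' X" "Comp C p' p = Id C X" "Comp C p p' = Id C X'" by (rule is_isoE[OF p(2,1)])
 obtain q' where q': "q' \<in> hom C Y' Y" "Comp C q' q = Id C Y" "Comp C q q' = Id C Y'" by (rule is_isoE[OF q(2,1)])
 have ip: "is_iso C p'" "is_iso C q'" using is_isoI[OF p'(1) p(1)] is_isoI[OF q'(1) q(1)] p' q' by simp_all
 have e: "g' = Comp C q (Comp C g p')"
  using catD(7)[OF C p'(1) p(1) g'] catD(7)[OF C p'(1) g q(1)] sq p'(3) catD(5)[OF C g'] by simp
 have "g = Comp C (Comp C q' q) g" using q'(2) catD(6)[OF C g] by simp
 also have "\<dots> = Comp C q' (Comp C g' p)" using catD(7)[OF C g q(1) q'(1)] sq by simp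
 finally have e': "g = Comp C q' (Comp C g' p)" .
 show ?thesis
 proof
  assume i: "is_iso C g"
  show "is_iso C g'"
   unfolding e by (rule iso_comp[OF C catD(4)[OF C p'(1) g] iso_comp[OF C p'(1) ip(1) g i] q])
 next
  assume i: "is_iso C g'"
  show "is_iso C g"
   unfolding e' by (rule iso_comp[OF C catD(4)[OF C p(1) g'] iso_comp[OF C p g' i] q'(1) ip(2)])
 qed
qed

lemma colimitD:
 assumes "is_colimit J C F Z c"
 shows "is_cocone J C F Z c"
  "is_cocone J C F Z' c' ==> \<exists>h\<in>hom C Z Z'. \<forall>i\<in>Ob J. Comp C h (c i) = c' i"
  "is_cocone J C F Z' c' ==> h \<in> hom C Z Z' ==> h' \<in> hom C Z Z' ==>
    (\<And>i. i \<in> Ob J ==> Comp C h (c i) = c' i) ==> (\<And>i. i \<in> Ob J ==> Comp C h' (c i) = c' i) ==> h = h'"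
proof -
 show "is_cocone J C F Z c" using assms by (simp add: is_colimit_def)
 assume "is_cocone J C F Z' c'"
 then have *: "\<exists>!h. h \<in> hom C Z Z' \<and> (\<forall>i\<in>Ob J. Comp C h (c i) = c' i)"
  using assms by (simp add: is_colimit_def)
 then show "\<exists>h\<in>hom C Z Z'. \<forall>i\<in>Ob J. Comp C h (c i) = c' i" by blast
 show "h \<in> hom C Z Z' ==> h' \<in> hom C Z Z' ==>
    (\<And>i. i \<in> Ob J ==> Comp C h (c i) = c' i) ==> (\<And>i. i \<in> Ob J ==> Comp C h' (c i) = c' i) ==> h = h'"
  using * by blast
qed

lemma coconeD:
 assumes "is_cocone J C F Z c"
 shows "is_functor J C F" "is_category C" "Z \<in> Ob C" "i \<in> Ob J ==> c i \<in> hom C (fst F i) Z"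
  "a \<in> hom J i j ==> Comp C (c j) (snd F a) = c i"
 using assms functorD(2)[of J C F] unfolding is_cocone_def hom_def by auto

lemma cocone_comp:
 assumes c: "is_cocone J C F Z c" and h: "h \<in> hom C Z V"
 shows "is_cocone J C F V (\<lambda>i. Comp C h (c i))"
 unfolding is_cocone_def
proof (intro conjI ballI)
 note d = coconeD[OF c] and C = coconeD(2)[OF c]
 show "is_functor J C F" by (rule d(1))
 show "V \<in> Ob C" using catD(9)[OF C h] .
 show "Comp C h (c i) \<in> hom C (fst F i) V" if "i \<in> Ob J" for i by (rule catD(4)[OF C d(4)[OF that] h])
 fix a assume a: "a \<in> Ar J"
 have J: "is_category J" by (rule functorD(1)[OF d(1)])
 note a' = Ar_hom[OF a]
 show "Comp C (Comp C h (c (Cod J a))) (snd F a) = Comp C h (c (Dom J a))"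
  using catD(7)[OF C functorD(4)[OF d(1) a'] d(4)[OF catD(2)[OF J a]] h] d(5)[OF a'] by simp
qed

text \<open>This makes the cubification independent, up to isomorphism, of the colimit that is chosen.\<close>

lemma colimit_unique:
 assumes c: "is_colimit J C F Z c" and c': "is_colimit J C F Z' c'"
 obtains p where "p \<in> hom C Z Z'" "is_iso C p" "\<And>i. i \<in> Ob J ==> Comp C p (c i) = c' i"
proof -
 note d = coconeD[OF colimitD(1)[OF c]] and d' = coconeD[OF colimitD(1)[OF c']]
 note C = d(2)
 obtain p where p: "p \<in> hom C Z Z'" "\<forall>i\<in>Ob J. Comp C p (c i) = c' i"
  using colimitD(2)[OF c colimitD(1)[OF c']] by blast
 obtain q where q: "q \<in> hom C Z' Z" "\<forall>i\<in>Ob J. Comp C q (c' i) = c i"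
  using colimitD(2)[OF c' colimitD(1)[OF c]] by blast
 have 1: "Comp C q p = Id C Z"
 proof (rule colimitD(3)[OF c colimitD(1)[OF c] catD(4)[OF C p(1) q(1)] catD(3)[OF C d(3)]])
  fix i assume i: "i \<in> Ob J"
  show "Comp C (Comp C q p) (c i) = c i" using catD(7)[OF C d(4)[OF i] p(1) q(1)] p(2) q(2) i by simp
  show "Comp C (Id C Z) (c i) = c i" by (rule catD(6)[OF C d(4)[OF i]])
 qed
 have 2: "Comp C p q = Id C Z'"
 proof (rule colimitD(3)[OF c' colimitD(1)[OF c'] catD(4)[OF C q(1) p(1)] catD(3)[OF C d'(3)]])
  fix i assume i: "i \<in> Ob J"
  show "Comp C (Comp C p q) (c' i) = c' i" using catD(7)[OF C d'(4)[OF i] q(1) p(1)] p(2) q(2) i by simp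
  show "Comp C (Id C Z') (c' i) = c' i" by (rule catD(6)[OF C d'(4)[OF i]])
 qed
 show thesis using that[OF p(1) is_isoI[OF p(1) q(1) 1 2]] p(2) by blast
qed

context small_labels
begin

lemma inv_code_bits [simp]: "inv (code :: bool list \<Rightarrow> 'u) (code \<xi>) = \<xi>"
 by (rule inv_f_f[OF inj_code_bits])

lemma inv_code_pair [simp]: "inv (code :: 'u \<times> nat \<Rightarrow> 'u) (code p) = p"
 by (rule inv_f_f[OF inj_code_pair])

lemma code_bits_eq [simp]: "(code \<xi> :: 'u) = code \<xi>' \<longleftrightarrow> (\<xi> :: bool list) = \<xi>'"
 by (rule inj_eq[OF inj_code_bits])

lemma code_pair_eq [simp]: "(code p :: 'u) = code p' \<longleftrightarrow> (p :: 'u \<times> nat) = p'"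
 by (rule inj_eq[OF inj_code_pair])

abbreviation cstate :: "bool list \<Rightarrow> 'u" where "cstate \<xi> \<equiv> code \<xi>"
definition ac :: "'u list \<Rightarrow> nat \<Rightarrow> 'u" where "ac a i = code (a ! i, i)"

lemma ac_eq [simp]: "ac a i = ac a j \<longleftrightarrow> i = j" by (auto simp: ac_def)

abbreviation dstate :: "'u \<Rightarrow> bool list" where "dstate \<equiv> inv code"
abbreviation dact :: "'u \<Rightarrow> 'u \<times> nat" where "dact \<equiv> inv code"

lemma ac_inv [simp]: "snd (dact (ac a i)) = i" by (simp add: ac_def)

lemma map_ac_eq: "map (ac a) is = map (ac a) js \<longleftrightarrow> is = js"
 by (rule inj_map_eq_map) (auto simp: inj_on_def)

lemma cube_simps:
 "states (cube a) = cstate ` bits (length a)" "actions (cube a) = ac a ` {..<length a}"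
 "i < length a ==> lab (cube a) (ac a i) = a ! i"
 by (auto simp: cube_def ac_def)

lemma cube_trans:
 "(s, us, t) \<in> transitions (cube a) \<longleftrightarrow> (\<exists>\<xi> is \<xi>'. s = cstate \<xi> \<and> us = map (ac a) is \<and> t = cstate \<xi>' \<and>
   \<xi> \<in> bits (length a) \<and> \<xi>' \<in> bits (length a) \<and> is \<noteq> [] \<and> distinct is \<and> set is \<subseteq> {..<length a} \<and>
   (\<forall>i<length a. (i \<in> set is \<longrightarrow> \<not> \<xi> ! i \<and> \<xi>' ! i) \<and> (i \<notin> set is \<longrightarrow> \<xi> ! i = \<xi>' ! i)))"
proof -
 have "((\<forall>i<length a. \<xi> ! i \<le> \<xi>' ! i) \<and> (\<forall>i<length a. \<xi> ! i \<noteq> \<xi>' ! i \<longleftrightarrow> i \<in> set is)) \<longleftrightarrow>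
  (\<forall>i<length a. (i \<in> set is \<longrightarrow> \<not> \<xi> ! i \<and> \<xi>' ! i) \<and> (i \<notin> set is \<longrightarrow> \<xi> ! i = \<xi>' ! i))" for \<xi> \<xi>' :: "bool list" and "is"
  by auto
 then show ?thesis unfolding cube_def ac_def[abs_def] by simp
qed

text \<open>The transitions of a cube are the images of top transitions along the maps of cubes.\<close>

lemma cube_trans_box:
 "(s, us, t) \<in> transitions (cube a) \<longleftrightarrow> (\<exists>F\<in>box_maps. btgt F = length a \<and> 0 < bsrc F \<and>
   s = cstate (bfun F (zeros (bsrc F))) \<and> us = map (ac a) (dirs F) \<and> t = cstate (bfun F (ones (bsrc F))))"
 (is "?l \<longleftrightarrow> ?r")
proof
 assume ?l
 then obtain \<xi> "is" \<xi>' where *: "s = cstate \<xi>" "us = map (ac a) is" "t = cstate \<xi>'"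
  "length \<xi> = length a" "length \<xi>' = length a" "is \<noteq> []" "distinct is" "set is \<subseteq> {..<length a}"
  and p: "\<And>i. i < length a ==> (i \<in> set is \<longrightarrow> \<not> \<xi> ! i \<and> \<xi>' ! i) \<and> (i \<notin> set is \<longrightarrow> \<xi> ! i = \<xi>' ! i)"
  unfolding cube_trans bits_def by blast
 have s: "set is \<subseteq> {..<length \<xi>}" using * by simp
 have "bfun (bx \<xi> is) (zeros (length is)) = \<xi>" "bfun (bx \<xi> is) (ones (length is)) = \<xi>'"
  using p * by (intro bx_const[OF *(7) s]; simp)+
 then show ?r using bx_box[OF *(7) s] * by (intro bexI[of _ "bx \<xi> is"]) simp_all
next
 assume ?r
 then obtain F where F: "F \<in> box_maps" "btgt F = length a" "0 < bsrc F" and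
  *: "s = cstate (bfun F (zeros (bsrc F)))" "us = map (ac a) (dirs F)" "t = cstate (bfun F (ones (bsrc F)))" by blast
 note b = box_dirs[OF F(1)]
 have "\<not> bfun F (zeros (bsrc F)) ! i \<and> bfun F (ones (bsrc F)) ! i" if i: "i \<in> set (dirs F)" for i
 proof -
  obtain k where "k < bsrc F" "i = dirs F ! k" using i b(1) by (metis in_set_conv_nth)
  then show ?thesis using b(6)[of "zeros (bsrc F)" k] b(6)[of "ones (bsrc F)" k] by simp
 qed
 moreover have "bfun F (zeros (bsrc F)) ! i = bfun F (ones (bsrc F)) ! i" if "i < length a" "i \<notin> set (dirs F)" for i
  using b(7)[of "ones (bsrc F)" i] that F(2) by simp
 moreover have "dirs F \<noteq> []" using b(1) F(3) by auto
 ultimately show ?l unfolding cube_trans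
  using * b(2,3) F(2) b(5)[of "zeros (bsrc F)"] b(5)[of "ones (bsrc F)"]
  by (rule_tac exI[of _ "bfun F (zeros (bsrc F))"], rule_tac exI[of _ "dirs F"],
    rule_tac exI[of _ "bfun F (ones (bsrc F))"]) simp
qed

lemma cube_inj: fixes a b :: "'u list" assumes "cube a = cube b" shows "a = b"
proof -
 have "actions (cube a) = actions (cube b)" using assms by simp
 then have e: "ac a ` {..<length a} = ac b ` {..<length b}" by (simp only: cube_simps)
 have 1: "i < length d \<and> c ! i = d ! i" if "ac c ` {..<length c} = ac d ` {..<length d}" "i < length c" for c d i
 proof -
  have "ac c i \<in> ac d ` {..<length d}" using that by blast
  then show ?thesis by (auto simp: ac_def)
 qed
 show ?thesis
 proof (rule nth_equalityI)
  show "length a = length b"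
  proof (rule ccontr)
   assume "length a \<noteq> length b"
   then show False using 1[OF e, of "length b"] 1[OF e[symmetric], of "length a"] by linarith
  qed
  show "a ! i = b ! i" if "i < length a" for i using 1[OF e that] by simp
 qed
qed

lemma cube_whdts: assumes a: "a \<in> lists \<Sigma>" shows "is_whdts \<Sigma> (cube a)"
 unfolding is_whdts_def
proof (intro conjI)
 have "lab (cube a) \<in> extensional (actions (cube a))" by (auto simp: cube_def extensional_def)
 moreover have "lab (cube a) u \<in> \<Sigma>" if "u \<in> actions (cube a)" for u
  using that a by (auto simp: cube_simps)
 ultimately have "lab (cube a) \<in> actions (cube a) \<rightarrow>\<^sub>E \<Sigma>" by (auto simp: PiE_def)
 moreover have "transitions (cube a) \<subseteq>
   states (cube a) \<times> {us. us \<noteq> [] \<and> set us \<subseteq> actions (cube a)} \<times> states (cube a)"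
 proof
  fix t assume t: "t \<in> transitions (cube a)"
  obtain s us s' where e: "t = (s, us, s')" by (cases t)
  show "t \<in> states (cube a) \<times> {us. us \<noteq> [] \<and> set us \<subseteq> actions (cube a)} \<times> states (cube a)"
   using t unfolding e cube_trans by (auto simp: cube_simps intro!: imageI dest: subsetD)
 qed
 ultimately show "is_tsys \<Sigma> (cube a)"
  unfolding is_tsys_def by (auto simp: cube_simps intro!: small_finite)
 show "multiset_axiom (cube a)" unfolding multiset_axiom_def
 proof (intro allI impI)
  fix \<alpha> us \<beta> \<sigma> assume t: "(\<alpha>, us, \<beta>) \<in> transitions (cube a)" and \<sigma>: "\<sigma> permutes {..<length us}"
  then obtain \<xi> "is" \<xi>' where *: "\<alpha> = cstate \<xi>" "us = map (ac a) is" "\<beta> = cstate \<xi>'" "\<xi> \<in> bits (length a)"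
   "\<xi>' \<in> bits (length a)" "is \<noteq> []" "distinct is" "set is \<subseteq> {..<length a}"
   "\<forall>i<length a. (i \<in> set is \<longrightarrow> \<not> \<xi> ! i \<and> \<xi>' ! i) \<and> (i \<notin> set is \<longrightarrow> \<xi> ! i = \<xi>' ! i)"
   unfolding cube_trans by blast
  have s: "\<sigma> permutes {..<length is}" using \<sigma> * by simp
  have "length (permute_list \<sigma> is) = length is" by simp
  then have p: "set (permute_list \<sigma> is) = set is" "distinct (permute_list \<sigma> is)" "permute_list \<sigma> is \<noteq> []"
   "permute_list \<sigma> us = map (ac a) (permute_list \<sigma> is)"
   using *(6,7) set_permute_list[OF s] distinct_permute_list[OF s] permute_list_map[OF s] *(2)
   by (blast, blast, metis length_0_conv, blast)
  show "(\<alpha>, permute_list \<sigma> us, \<beta>) \<in> transitions (cube a)"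
   unfolding cube_trans
   by (rule_tac exI[of _ \<xi>], rule_tac exI[of _ "permute_list \<sigma> is"], rule_tac exI[of _ \<xi>'])
    (intro conjI p(2-4) *(1,3-5), unfold p(1), rule *(8), rule *(9))
 qed
 show "coherence_axiom (cube a)" unfolding coherence_axiom_def
 proof (intro allI impI)
  fix \<alpha> \<beta> \<nu>1 \<nu>2 u v w assume ne: "u \<noteq> []" "v \<noteq> []" "w \<noteq> []"
   and T: "{(\<alpha>, u @ v @ w, \<beta>), (\<alpha>, u, \<nu>1), (\<nu>1, v @ w, \<beta>), (\<alpha>, u @ v, \<nu>2), (\<nu>2, w, \<beta>)} \<subseteq> transitions (cube a)"
  have t: "(\<alpha>, u, \<nu>1) \<in> transitions (cube a)" "(\<alpha>, u @ v, \<nu>2) \<in> transitions (cube a)" using T by simp_all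
  obtain \<xi> "is" \<xi>1 where 1: "\<alpha> = cstate \<xi>" "u = map (ac a) is" "\<nu>1 = cstate \<xi>1"
   "\<xi>1 \<in> bits (length a)"
   "\<And>i. i < length a ==> (i \<in> set is \<longrightarrow> \<not> \<xi> ! i \<and> \<xi>1 ! i) \<and> (i \<notin> set is \<longrightarrow> \<xi> ! i = \<xi>1 ! i)"
   using t(1) unfolding cube_trans by blast
  obtain \<xi>0 js \<xi>2 where 2: "\<alpha> = cstate \<xi>0" "u @ v = map (ac a) js" "\<nu>2 = cstate \<xi>2"
   "\<xi>2 \<in> bits (length a)" "distinct js" "set js \<subseteq> {..<length a}"
   "\<And>i. i < length a ==> (i \<in> set js \<longrightarrow> \<not> \<xi>0 ! i \<and> \<xi>2 ! i) \<and> (i \<notin> set js \<longrightarrow> \<xi>0 ! i = \<xi>2 ! i)"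
   using t(2) unfolding cube_trans by blast
  obtain js1 js2 where j: "js = js1 @ js2" "u = map (ac a) js1" "v = map (ac a) js2"
   using map_eq_append_conv[of "ac a" js u v] 2(2) by metis
  have e: "js1 = is" "\<xi>0 = \<xi>" using j(2) 1(1,2) 2(1) map_ac_eq by simp_all
  have "(i \<in> set js2 \<longrightarrow> \<not> \<xi>1 ! i \<and> \<xi>2 ! i) \<and> (i \<notin> set js2 \<longrightarrow> \<xi>1 ! i = \<xi>2 ! i)" if "i < length a" for i
   using 1(5)[OF that] 2(7)[OF that] 2(5) unfolding j(1) e by auto
  then show "(\<nu>1, v, \<nu>2) \<in> transitions (cube a)" unfolding cube_trans
   using 1(3,4) 2(3-6) j ne(2)
   by (rule_tac exI[of _ \<xi>1], rule_tac exI[of _ js2], rule_tac exI[of _ \<xi>2]) auto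
 qed
qed

text \<open>Maps out of a cube are cubes of the target.\<close>

definition cm :: "'u list \<Rightarrow> (bool list \<Rightarrow> 'u) \<times> 'u list \<Rightarrow> 'u tmap" where
 "cm a c = ((\<lambda>s\<in>states (cube a). fst c (dstate s)), (\<lambda>u\<in>actions (cube a). snd c ! snd (dact u)))"

definition mc :: "'u list \<Rightarrow> 'u tmap \<Rightarrow> (bool list \<Rightarrow> 'u) \<times> 'u list" where
 "mc a f = ((\<lambda>\<xi>\<in>bits (length a). fst f (cstate \<xi>)), map (\<lambda>i. snd f (ac a i)) [0..<length a])"

lemma cm_simps [simp]:
 "length \<xi> = length a ==> fst (cm a c) (cstate \<xi>) = fst c \<xi>"
 "i < length a ==> snd (cm a c) (ac a i) = snd c ! i"
 by (auto simp: cm_def cube_simps bits_def)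

lemma mc_simps [simp]:
 "length \<xi> = length a ==> fst (mc a f) \<xi> = fst f (cstate \<xi>)"
 "i < length a ==> snd (mc a f) ! i = snd f (ac a i)" "length (snd (mc a f)) = length a"
 by (auto simp: mc_def bits_def)

lemma cube_map_eqI:
 assumes "is_tsys_map (cube a) X f" "is_tsys_map (cube a) X g"
  "\<And>\<xi>. length \<xi> = length a ==> fst f (cstate \<xi>) = fst g (cstate \<xi>)"
  "\<And>i. i < length a ==> snd f (ac a i) = snd g (ac a i)"
 shows "f = g"
 by (rule tmap_eqI[OF assms(1,2)]) (use assms(3,4) in \<open>auto simp: cube_simps bits_def\<close>)

lemma cm_tsys_map:
 assumes c: "c \<in> cubes X (length a)" and l: "a = map (lab X) (snd c)"
 shows "is_tsys_map (cube a) X (cm a c)"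
proof (rule tmapI)
 note d = cubesD[OF c]
 show "fst (cm a c) \<in> states (cube a) \<rightarrow>\<^sub>E states X" using d(1) by (auto simp: cm_def cube_simps)
 show "snd (cm a c) \<in> actions (cube a) \<rightarrow>\<^sub>E actions X" using d(2,3) by (auto simp: cm_def cube_simps)
 show "lab X (snd (cm a c) u) = lab (cube a) u" if u: "u \<in> actions (cube a)" for u
 proof -
  obtain i where i: "i < length a" "u = ac a i" using u by (auto simp: cube_simps)
  have "a ! i = lab X (snd c ! i)" using arg_cong[OF l, of "\<lambda>w. w ! i"] i d(3) by simp
  then show ?thesis using i by (simp add: cube_simps)
 qed
 fix s us t assume "(s, us, t) \<in> transitions (cube a)"
 then obtain F where F: "F \<in> box_maps" "btgt F = length a" "0 < bsrc F" and
  *: "s = cstate (bfun F (zeros (bsrc F)))" "us = map (ac a) (dirs F)" "t = cstate (bfun F (ones (bsrc F)))"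
  unfolding cube_trans_box by blast
 have "map (snd (cm a c)) us = pull F (snd c)"
  unfolding *(2) pull_def using box_dirs(3)[OF F(1)] F(2) by (auto simp: subset_iff)
 moreover have "length (bfun F (zeros (bsrc F))) = length a" "length (bfun F (ones (bsrc F))) = length a"
  using box_dirs(5)[OF F(1) zeros_bits(1)] box_dirs(5)[OF F(1) zeros_bits(2)] F(2) by (simp_all add: bits_def)
 ultimately show "(fst (cm a c) s, map (snd (cm a c)) us, fst (cm a c) t) \<in> transitions X"
  using d(4)[OF F] by (simp add: *(1,3))
qed

lemma mc_cubes:
 assumes f: "is_tsys_map (cube a) X f" shows "mc a f \<in> cubes X (length a)" "map (lab X) (snd (mc a f)) = a"
proof -
 note t = tmapD[OF f]
 show "mc a f \<in> cubes X (length a)"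
  unfolding mc_def
 proof (rule cubesI)
  fix F assume F: "F \<in> box_maps" "btgt F = length a" "0 < bsrc F"
  have tr: "(cstate (bfun F (zeros (bsrc F))), map (ac a) (dirs F), cstate (bfun F (ones (bsrc F)))) \<in> transitions (cube a)"
   unfolding cube_trans_box using F by blast
  moreover have "pull F (map (\<lambda>i. snd f (ac a i)) [0..<length a]) = map (snd f) (map (ac a) (dirs F))"
   unfolding pull_def using box_dirs(3)[OF F(1)] F(2) by (auto simp: subset_iff)
  ultimately show "((\<lambda>\<xi>\<in>bits (length a). fst f (cstate \<xi>)) (bfun F (zeros (bsrc F))),
    pull F (map (\<lambda>i. snd f (ac a i)) [0..<length a]),
    (\<lambda>\<xi>\<in>bits (length a). fst f (cstate \<xi>)) (bfun F (ones (bsrc F)))) \<in> transitions X"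
   using t(4)[OF tr] box_dirs(5)[OF F(1) zeros_bits(1)] box_dirs(5)[OF F(1) zeros_bits(2)] F(2) by simp
 qed (use t(1,2) in \<open>auto simp: cube_simps\<close>)
 show "map (lab X) (snd (mc a f)) = a"
  using t(3) by (intro nth_equalityI) (auto simp: cube_simps mc_def)
qed

lemma mc_cm: assumes "c \<in> cubes X (length a)" shows "mc a (cm a c) = c"
proof -
 note d = cubesD[OF assms]
 have "fst (mc a (cm a c)) = fst c"
  using d(1) by (intro extensionalityI[of _ "bits (length a)"]) (auto simp: mc_def PiE_def bits_def)
 moreover have "snd (mc a (cm a c)) = snd c" using d(3) by (intro nth_equalityI) (auto simp: mc_def)
 ultimately show ?thesis by (simp add: prod_eq_iff)
qed

text \<open>The map between cubes induced by a map of cubes.\<close>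

definition bm :: "'u list \<Rightarrow> bmap \<Rightarrow> 'u tmap" where
 "bm a F = cm (pull F a) ((\<lambda>\<xi>\<in>bits (bsrc F). cstate (bfun F \<xi>)), map (ac a) (dirs F))"

lemma bm_simps:
 assumes "F \<in> box_maps"
 shows "length \<xi> = bsrc F ==> fst (bm a F) (cstate \<xi>) = cstate (bfun F \<xi>)"
  "k < bsrc F ==> snd (bm a F) (ac (pull F a) k) = ac a (dirs F ! k)"
 using length_pull[OF assms, of a] box_dirs(1)[OF assms] by (simp_all add: bm_def bits_def)

lemma bm_tsys_map:
 assumes F: "F \<in> box_maps" "btgt F = length a" shows "is_tsys_map (cube (pull F a)) (cube a) (bm a F)"
 unfolding bm_def
proof (rule cm_tsys_map)
 note b = box_dirs[OF F(1)]
 show "((\<lambda>\<xi>\<in>bits (bsrc F). cstate (bfun F \<xi>)), map (ac a) (dirs F)) \<in> cubes (cube a) (length (pull F a))"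
  unfolding length_pull[OF F(1)]
 proof (rule cubesI)
  show "(\<lambda>\<xi>\<in>bits (bsrc F). cstate (bfun F \<xi>)) \<in> bits (bsrc F) \<rightarrow>\<^sub>E states (cube a)"
   using b(5) F(2) by (auto simp: cube_simps)
  show "set (map (ac a) (dirs F)) \<subseteq> actions (cube a)" using b(3) F(2) by (auto simp: cube_simps)
  show "length (map (ac a) (dirs F)) = bsrc F" using b(1) by simp
  fix H assume H: "H \<in> box_maps" "btgt H = bsrc F" "0 < bsrc H"
  have "pull H (map (ac a) (dirs F)) = map (ac a) (dirs (bcomp F H))"
   unfolding dirs_comp[OF H(1) F(1) H(2)] using map_pull[OF H(1), of "dirs F" "ac a"] b(1) H(2) by (simp add: pull_def)
  then show "((\<lambda>\<xi>\<in>bits (bsrc F). cstate (bfun F \<xi>)) (bfun H (zeros (bsrc H))), pull H (map (ac a) (dirs F)),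
    (\<lambda>\<xi>\<in>bits (bsrc F). cstate (bfun F \<xi>)) (bfun H (ones (bsrc H)))) \<in> transitions (cube a)"
   using box_comp[OF H(1) F(1) H(2)] H F(2) box_dirs(5)[OF H(1) zeros_bits(1)] box_dirs(5)[OF H(1) zeros_bits(2)]
   unfolding cube_trans_box by (intro bexI[of _ "bcomp F H"]) (simp_all add: bfun_bcomp)
 qed
 show "pull F a = map (lab (cube a)) (snd ((\<lambda>\<xi>\<in>bits (bsrc F). cstate (bfun F \<xi>)), map (ac a) (dirs F)))"
  using b(3) F(2) by (auto simp: pull_def cube_simps)
qed

end

lemma all_hom: "(\<forall>a\<in>Ar J. P a (Dom J a) (Cod J a)) \<longleftrightarrow> (\<forall>f g t. t \<in> hom J f g \<longrightarrow> P t f g)"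
 by (auto simp: hom_def)

context small_labels
begin

abbreviation "W \<equiv> WHDTS \<Sigma>"

lemma co_ob: "x \<in> Ob (over X) \<longleftrightarrow> (\<exists>a\<in>lists \<Sigma>. x \<in> hom W (cube a) X)"
 unfolding cubes_over_def by (auto simp: hom_def)

lemma co_hom: "t \<in> hom (over X) f g \<longleftrightarrow> f \<in> Ob (over X) \<and> g \<in> Ob (over X) \<and>
  (\<exists>u. t = (f, u, g) \<and> u \<in> hom W (fst f) (fst g) \<and> Comp W g u = f)"
 unfolding cubes_over_def by (auto simp: hom_def full_subcat_def slice_def WHDTS_simps)

lemma is_category_cubes_over: "is_category (over X)"
 unfolding cubes_over_def by (rule is_category_full[OF is_category_slice[OF is_category_WHDTS]])

lemma cubes_over_simps:
 "Comp (over X) s t = (fst t, Comp W (fst (snd s)) (fst (snd t)), snd (snd s))"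
 "Id (over X) f = (f, Id W (fst f), f)"
 by (simp_all add: cubes_over_def WHDTS_simps)

lemma cubes_diagram_simps: "fst (cubes_diagram \<Sigma>) x = fst x" "snd (cubes_diagram \<Sigma>) t = fst (snd t)"
 by (auto simp: cubes_diagram_def WHDTS_simps split: prod.splits)

lemma cubes_diagram_functor: "is_functor (over X) W (cubes_diagram \<Sigma>)"
proof (rule is_functorI[OF is_category_cubes_over is_category_WHDTS])
 fix x assume "x \<in> Ob (over X)"
 then obtain a where a: "a \<in> lists \<Sigma>" "x \<in> hom W (cube a) X" using co_ob by blast
 then show "fst (cubes_diagram \<Sigma>) x \<in> Ob W"
  using cube_whdts[OF a(1)] hom_Ar[OF a(2)] by (simp add: cubes_diagram_simps WHDTS_simps)
qed (auto simp: cubes_diagram_simps cubes_over_simps co_hom)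

lemma co_cocone: "is_cocone (over X) W (cubes_diagram \<Sigma>) Z c \<longleftrightarrow> is_whdts \<Sigma> Z \<and>
  (\<forall>x\<in>Ob (over X). c x \<in> hom W (fst x) Z) \<and>
  (\<forall>f\<in>Ob (over X). \<forall>g\<in>Ob (over X). \<forall>u\<in>hom W (fst f) (fst g).
    Comp W g u = f \<longrightarrow> Comp W (c g) u = c f)"
proof -
 have "(\<forall>a\<in>Ar (over X). Comp W (c (Cod (over X) a)) (snd (cubes_diagram \<Sigma>) a) = c (Dom (over X) a))
  \<longleftrightarrow> (\<forall>f g t. t \<in> hom (over X) f g \<longrightarrow> Comp W (c g) (fst (snd t)) = c f)"
  unfolding cubes_diagram_simps by (rule all_hom[where P="\<lambda>t f g. Comp W (c g) (fst (snd t)) = c f"])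
 also have "\<dots> \<longleftrightarrow> (\<forall>f\<in>Ob (over X). \<forall>g\<in>Ob (over X). \<forall>u\<in>hom W (fst f) (fst g).
    Comp W g u = f \<longrightarrow> Comp W (c g) u = c f)" unfolding co_hom by auto
 finally show ?thesis
  unfolding is_cocone_def using cubes_diagram_functor by (simp add: cubes_diagram_simps WHDTS_simps(1))
qed

lemma W_homD:
 assumes "f \<in> hom W X Y"
 shows "is_whdts \<Sigma> X" "is_whdts \<Sigma> Y" "is_tsys_map X Y (tm f)" "f = (X, tm f, Y)" "fst f = X" "snd (snd f) = Y"
 using assms unfolding WHDTS_hom by (auto simp: prod_eq_iff)

lemma W_hom_eqI: "f \<in> hom W X Y ==> g \<in> hom W X Y ==> tm f = tm g ==> f = g"
 using W_homD(4) by metis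

lemma W_comp_tm: "f \<in> hom W X Y ==> tm (Comp W g f) = tcomp X (tm g) (tm f)"
 using W_homD(5) by (simp add: WHDTS_simps)

lemma cube_comp:
 assumes "f \<in> hom W (cube a) Y"
 shows "length \<xi> = length a ==> fst (tm (Comp W g f)) (cstate \<xi>) = fst (tm g) (fst (tm f) (cstate \<xi>))"
  "i < length a ==> snd (tm (Comp W g f)) (ac a i) = snd (tm g) (snd (tm f) (ac a i))"
 unfolding W_comp_tm[OF assms] by (simp_all add: compose_def cube_simps bits_def)

definition wx :: "'u tsys_arrow \<Rightarrow> 'u list" where "wx x = (THE a. fst x = cube a)"

lemma wx: assumes "x \<in> hom W (cube a) X" shows "wx x = a"
 unfolding wx_def W_homD(5)[OF assms] by (rule the_equality) (auto dest: cube_inj)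

text \<open>
 \<open>celt\<close> and \<open>xarr\<close> translate between cubes over \<open>X\<close> and elements of the precubical set of cubes.
\<close>

definition celt :: "'u tsys \<Rightarrow> 'u tsys_arrow \<Rightarrow> 'u" where
 "celt X x = cenc X (length (wx x)) (mc (wx x) (tm x))"

text \<open>The colimiting cocone: a cube over \<open>X\<close> is sent to the corresponding cube of the rebuilt system.\<close>

definition cc :: "'u tsys \<Rightarrow> 'u tsys_arrow \<Rightarrow> 'u tsys_arrow" where
 "cc X x = (fst x, cm (wx x) (tcube (Nob X) (length (wx x)) (celt X x)), Gob (Nob X))"

definition xarr :: "'u tsys \<Rightarrow> nat \<Rightarrow> 'u \<Rightarrow> 'u tsys_arrow" where
 "xarr X n e = (cube (wd (Nob X) n e), cm (wd (Nob X) n e) (cdec X n e), X)"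

lemma celt:
 assumes X: "is_tsys \<Sigma> X" and x: "x \<in> hom W (cube a) X"
 shows "celt X x = cenc X (length a) (mc a (tm x))" "celt X x \<in> el (Nob X) (length a)"
  "wd (Nob X) (length a) (celt X x) = a" "cdec X (length a) (celt X x) = mc a (tm x)"
  "mc a (tm x) \<in> cubes X (length a)"
proof -
 note m = mc_cubes[OF W_homD(3)[OF x]]
 show 1: "celt X x = cenc X (length a) (mc a (tm x))" unfolding celt_def wx[OF x] ..
 show "celt X x \<in> el (Nob X) (length a)" "wd (Nob X) (length a) (celt X x) = a"
  "cdec X (length a) (celt X x) = mc a (tm x)" "mc a (tm x) \<in> cubes X (length a)"
  unfolding 1 using Nob(2,4,5)[OF X] m by simp_all
qed

lemma cc_hom:
 assumes X: "is_hdts \<Sigma> X" and a: "a \<in> lists \<Sigma>" and x: "x \<in> hom W (cube a) X"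
 shows "cc X x \<in> hom W (cube a) (Gob (Nob X))"
  "length \<xi> = length a ==> fst (tm (cc X x)) (cstate \<xi>) = vtx (Nob X) \<xi> (celt X x)"
  "i < length a ==> snd (tm (cc X x)) (ac a i) = acts (Nob X) (length a) (celt X x) ! i"
proof -
 note tX = hdts_tsys[OF X]
 note e = celt[OF tX x] and N = Nob(1)[OF tX]
 have tc: "tcube (Nob X) (length a) (celt X x) \<in> cubes (Gob (Nob X)) (length a)" by (rule tcube_cubes[OF N e(2)])
 have "map (lab (Gob (Nob X))) (acts (Nob X) (length a) (celt X x)) = wd (Nob X) (length a) (celt X x)"
  unfolding wd_acts[OF N e(2)]
  by (rule map_cong[OF HOL.refl]) (rule Gob_simps(3), rule subsetD[OF set_acts[OF N e(2)]])
 then have l: "a = map (lab (Gob (Nob X))) (snd (tcube (Nob X) (length a) (celt X x)))"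
  using e(3) by (simp add: tcube_def)
 have t: "tm (cc X x) = cm a (tcube (Nob X) (length a) (celt X x))" by (simp add: cc_def wx[OF x])
 show "cc X x \<in> hom W (cube a) (Gob (Nob X))"
  using cm_tsys_map[OF tc l] cube_whdts[OF a] hdts_whdts[OF Gob_hdts[OF Nob_paradigm[OF X]]]
  unfolding WHDTS_hom t by (simp add: cc_def wx[OF x] W_homD(5)[OF x])
 show "fst (tm (cc X x)) (cstate \<xi>) = vtx (Nob X) \<xi> (celt X x)" if "length \<xi> = length a"
  using that unfolding t by (simp add: tcube_def bits_def)
 show "snd (tm (cc X x)) (ac a i) = acts (Nob X) (length a) (celt X x) ! i" if "i < length a"
  using that unfolding t by (simp add: tcube_def)
qed

lemma xarr:
 assumes X: "is_hdts \<Sigma> X" and e: "e \<in> el (Nob X) n"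
 defines "a \<equiv> wd (Nob X) n e"
 shows "xarr X n e \<in> hom W (cube a) X" "a \<in> lists \<Sigma>" "length a = n" "celt X (xarr X n e) = e"
proof -
 note tX = hdts_tsys[OF X]
 obtain c where c: "c \<in> cubes X n" "e = cenc X n c" "cdec X n e = c" using e by (rule NobE[OF tX])
 have a: "a = map (lab X) (snd c)" using Nob(4)[OF tX c(1)] c(2) by (simp add: a_def)
 show l: "length a = n" unfolding a using cubesD(3)[OF c(1)] by simp
 show s: "a \<in> lists \<Sigma>"
  using presheafD(5)[OF lps_presheaf[OF Nob(1)[OF tX]] e] unfolding a_def by (auto simp: words_def)
 have c': "c \<in> cubes X (length a)" using c(1) l by simp
 show x: "xarr X n e \<in> hom W (cube a) X"
  using cm_tsys_map[OF c' a] cube_whdts[OF s] hdts_whdts[OF X]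
  unfolding xarr_def WHDTS_hom a_def[symmetric] c(3) by simp
 have "tm (xarr X n e) = cm a c" by (simp add: xarr_def a_def c(3))
 then show "celt X (xarr X n e) = e" using celt(1)[OF tX x] mc_cm[OF c'] l c(2) by simp
qed

lemma bm_hom:
 assumes "a \<in> lists \<Sigma>" "F \<in> box_maps" "btgt F = length a"
 shows "(cube (pull F a), bm a F, cube a) \<in> hom W (cube (pull F a)) (cube a)" "pull F a \<in> lists \<Sigma>"
proof -
 show "pull F a \<in> lists \<Sigma>" using set_pull[OF assms(2)] assms(1,3) by fastforce
 then show "(cube (pull F a), bm a F, cube a) \<in> hom W (cube (pull F a)) (cube a)"
  using bm_tsys_map[OF assms(2,3)] cube_whdts assms(1) by (simp add: WHDTS_hom)
qed

lemma xarr_act: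
 assumes X: "is_hdts \<Sigma> X" and a: "a \<in> lists \<Sigma>" and x: "x \<in> hom W (cube a) X" and F: "F \<in> box_maps" "btgt F = length a"
 shows "act (Nob X) F (celt X x) \<in> el (Nob X) (bsrc F)" "wd (Nob X) (bsrc F) (act (Nob X) F (celt X x)) = pull F a"
  "xarr X (bsrc F) (act (Nob X) F (celt X x)) = Comp W x (cube (pull F a), bm a F, cube a)"
proof -
 note tX = hdts_tsys[OF X]
 note e = celt[OF tX x] and N = Nob[OF tX] and b = bm_hom[OF a F]
 note p = presheafD[OF lps_presheaf[OF N(1)]]
 show el: "act (Nob X) F (celt X x) \<in> el (Nob X) (bsrc F)" using p(2)[OF F(1)] e(2) F(2) by simp
 show w: "wd (Nob X) (bsrc F) (act (Nob X) F (celt X x)) = pull F a"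
  using p(3)[OF F(1), of "celt X x"] e(2,3) F(2) by simp
 have c: "mc a (tm x) \<in> cubes X (btgt F)" using e(5) F(2) by simp
 have d: "cdec X (bsrc F) (act (Nob X) F (celt X x)) = cact F (mc a (tm x))"
  using N(3)[OF F(1) c] N(5)[OF cact_cubes[OF c F(1)]] e(1) F(2) by simp
 have xa: "xarr X (bsrc F) (act (Nob X) F (celt X x)) \<in> hom W (cube (pull F a)) X" using xarr(1)[OF X el] unfolding w .
 have xb: "Comp W x (cube (pull F a), bm a F, cube a) \<in> hom W (cube (pull F a)) X"
  by (rule catD(4)[OF is_category_WHDTS b(1) x])
 have l: "length (pull F a) = bsrc F" by (rule length_pull[OF F(1)])
 show "xarr X (bsrc F) (act (Nob X) F (celt X x)) = Comp W x (cube (pull F a), bm a F, cube a)"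
 proof (rule W_hom_eqI[OF xa xb], rule cube_map_eqI[OF W_homD(3)[OF xa] W_homD(3)[OF xb]])
  have t: "tm (xarr X (bsrc F) (act (Nob X) F (celt X x))) = cm (pull F a) (cact F (mc a (tm x)))"
   unfolding xarr_def w d by simp
  fix \<xi> :: "bool list" assume "length \<xi> = length (pull F a)"
  then have el: "length \<xi> = bsrc F" and eb: "\<xi> \<in> bits (bsrc F)" using l by (simp_all add: bits_def)
  have fl: "length (bfun F \<xi>) = length a" using box_dirs(5)[OF F(1) eb] F(2) by (simp add: bits_def)
  show "fst (tm (xarr X (bsrc F) (act (Nob X) F (celt X x)))) (cstate \<xi>) =
    fst (tm (Comp W x (cube (pull F a), bm a F, cube a))) (cstate \<xi>)"
   unfolding t using cube_comp(1)[OF b(1), of \<xi> x] bm_simps(1)[OF F(1) el] el eb l fl by (simp add: cact_def)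
 next
  have t: "tm (xarr X (bsrc F) (act (Nob X) F (celt X x))) = cm (pull F a) (cact F (mc a (tm x)))"
   unfolding xarr_def w d by simp
  fix i assume "i < length (pull F a)"
  then have i: "i < bsrc F" using l by simp
  have di: "dirs F ! i < length a" using dirs_nth_less[OF F(1) i] F(2) by simp
  show "snd (tm (xarr X (bsrc F) (act (Nob X) F (celt X x)))) (ac (pull F a) i) =
    snd (tm (Comp W x (cube (pull F a), bm a F, cube a))) (ac (pull F a) i)"
   unfolding t using cube_comp(2)[OF b(1), of i x] bm_simps(2)[OF F(1) i] i l di box_dirs(1)[OF F(1)]
   by (simp add: cact_def pull_def)
 qed
qed

lemma cc_cocone: assumes X: "is_hdts \<Sigma> X" shows "is_cocone (over X) W (cubes_diagram \<Sigma>) (Gob (Nob X)) (cc X)"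
 unfolding co_cocone
proof (intro conjI ballI impI)
 note tX = hdts_tsys[OF X]
 note N = Nob[OF tX]
 show "is_whdts \<Sigma> (Gob (Nob X))" by (rule hdts_whdts[OF Gob_hdts[OF Nob_paradigm[OF X]]])
 show "cc X x \<in> hom W (fst x) (Gob (Nob X))" if "x \<in> Ob (over X)" for x
 proof -
  obtain a where a: "a \<in> lists \<Sigma>" "x \<in> hom W (cube a) X" using \<open>x \<in> Ob (over X)\<close> unfolding co_ob by blast
  show ?thesis using cc_hom(1)[OF X a] W_homD(5)[OF a(2)] by simp
 qed
 fix f g u assume "f \<in> Ob (over X)" "g \<in> Ob (over X)"
 then obtain b a where b: "b \<in> lists \<Sigma>" "f \<in> hom W (cube b) X" and a: "a \<in> lists \<Sigma>" "g \<in> hom W (cube a) X"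
  unfolding co_ob by blast
 assume "u \<in> hom W (fst f) (fst g)" and gu: "Comp W g u = f"
 then have u: "u \<in> hom W (cube b) (cube a)" using W_homD(5)[OF b(2)] W_homD(5)[OF a(2)] by simp
 note tu = tmapD[OF W_homD(3)[OF u]]
 note cf = cc_hom[OF X b] and cg = cc_hom[OF X a] and ef = celt[OF tX b(2)] and eg = celt[OF tX a(2)]
 have h: "Comp W (cc X g) u \<in> hom W (cube b) (Gob (Nob X))" by (rule catD(4)[OF is_category_WHDTS u cg(1)])
 have fgu: "fst (tm f) (cstate \<xi>) = fst (tm g) (fst (tm u) (cstate \<xi>))" if "length \<xi> = length b" for \<xi>
  using cube_comp(1)[OF u that, of g] gu by simp
 have su: "\<exists>\<xi>'. length \<xi>' = length a \<and> fst (tm u) (cstate \<xi>) = cstate \<xi>'" if "length \<xi> = length b" for \<xi>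
 proof -
  have "cstate \<xi> \<in> states (cube b)" using that by (auto simp: cube_simps bits_def)
  from tu(1)[OF this] show ?thesis by (auto simp: cube_simps bits_def)
 qed
 show "Comp W (cc X g) u = cc X f"
 proof (rule W_hom_eqI[OF h cf(1)], rule cube_map_eqI[OF W_homD(3)[OF h] W_homD(3)[OF cf(1)]])
  fix \<xi> :: "bool list" assume e: "length \<xi> = length b"
  obtain \<xi>' where e': "length \<xi>' = length a" "fst (tm u) (cstate \<xi>) = cstate \<xi>'" using su[OF e] by blast
  have cgv: "vtx (Nob X) \<xi>' (celt X g) = cenc X 0 ((\<lambda>_\<in>bits 0. fst (tm g) (cstate \<xi>')), [])"
   using Nob_vtx(1)[OF tX, of "mc a (tm g)" \<xi>'] eg(5) e'(1) unfolding eg(1) by simp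
  have cfv: "vtx (Nob X) \<xi> (celt X f) = cenc X 0 ((\<lambda>_\<in>bits 0. fst (tm f) (cstate \<xi>)), [])"
   using Nob_vtx(1)[OF tX, of "mc b (tm f)" \<xi>] ef(5) e unfolding ef(1) by simp
  show "fst (tm (Comp W (cc X g) u)) (cstate \<xi>) = fst (tm (cc X f)) (cstate \<xi>)"
   using cube_comp(1)[OF u e, of "cc X g"] cg(2)[OF e'(1)] cf(2)[OF e] cgv cfv fgu[OF e] e'(2) by simp
 next
  fix i assume i: "i < length b"
  let ?E = "edge (length b) i"
  have E: "?E \<in> box_maps" "dirs ?E = [i]" using edge_box[OF i] by blast+
  have eb: "bfun ?E (zeros 1) \<in> bits (length b)" "bfun ?E (ones 1) \<in> bits (length b)"
   using box_dirs(5)[OF E(1), of "zeros 1"] box_dirs(5)[OF E(1), of "ones 1"]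
    zeros_bits(1)[of 1] zeros_bits(2)[of 1] by simp_all
  have "(cstate (bfun ?E (zeros 1)), [ac b i], cstate (bfun ?E (ones 1))) \<in> transitions (cube b)"
   unfolding cube_trans_box using E by (intro bexI[of _ ?E]) simp_all
  from tu(4)[OF this] have "(fst (tm u) (cstate (bfun ?E (zeros 1))), [snd (tm u) (ac b i)],
    fst (tm u) (cstate (bfun ?E (ones 1)))) \<in> transitions (cube a)" by (simp del: One_nat_def)
  then obtain F where F0: "F \<in> box_maps" and r: "btgt F = length a \<and> 0 < bsrc F \<and>
    fst (tm u) (cstate (bfun ?E (zeros 1))) = cstate (bfun F (zeros (bsrc F))) \<and>
    [snd (tm u) (ac b i)] = map (ac a) (dirs F) \<and>
    fst (tm u) (cstate (bfun ?E (ones 1))) = cstate (bfun F (ones (bsrc F)))"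
   unfolding cube_trans_box by (rule bexE)
  have F: "F \<in> box_maps" "btgt F = length a" "0 < bsrc F"
   and Fz: "fst (tm u) (cstate (bfun ?E (zeros 1))) = cstate (bfun F (zeros (bsrc F)))"
   and Fd: "[snd (tm u) (ac b i)] = map (ac a) (dirs F)"
   and Fo: "fst (tm u) (cstate (bfun ?E (ones 1))) = cstate (bfun F (ones (bsrc F)))"
   using F0 r by simp_all
  have s1: "bsrc F = 1" using arg_cong[OF Fd, of length] box_dirs(1)[OF F(1)] by simp
  have d0: "snd (tm u) (ac b i) = ac a (dirs F ! 0)" using Fd by (cases "dirs F") auto
  have d1: "dirs F ! 0 < length a" using dirs_nth_less[OF F(1)] F(2,3) by simp
  have la: "length (bfun F (zeros 1)) = length a" "length (bfun F (ones 1)) = length a"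
   using box_dirs(5)[OF F(1) zeros_bits(1)] box_dirs(5)[OF F(1) zeros_bits(2)] s1 F(2) by (simp_all add: bits_def)
  have "cact ?E (mc b (tm f)) = cact F (mc a (tm g))"
  proof (rule prod_eqI)
   have eq: "fst (mc b (tm f)) (bfun ?E \<xi>) = fst (mc a (tm g)) (bfun F \<xi>)" if e: "\<xi> \<in> bits 1" for \<xi>
   proof -
    have "\<xi> = zeros 1 \<or> \<xi> = ones 1" using e by (auto simp: bits_def length_Suc_conv)
    then show ?thesis
     using eb la fgu[of "bfun ?E (zeros 1)"] fgu[of "bfun ?E (ones 1)"] Fz Fo s1
     by (elim disjE) (simp_all add: bits_def)
   qed
   then show "fst (cact ?E (mc b (tm f))) = fst (cact F (mc a (tm g)))"
    using s1 by (auto simp: cact_def intro!: restrict_ext)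
   have "pull ?E (snd (mc b (tm f))) = [snd (tm f) (ac b i)]" using E(2) i by (simp add: pull_def)
   moreover have dF: "dirs F = [dirs F ! 0]" using box_dirs(1)[OF F(1)] s1 by (auto simp: length_Suc_conv)
   have "pull F (snd (mc a (tm g))) = [snd (mc a (tm g)) ! (dirs F ! 0)]" unfolding pull_def by (subst dF) simp
   then have "pull F (snd (mc a (tm g))) = [snd (tm g) (ac a (dirs F ! 0))]" using d1 by simp
   ultimately show "snd (cact ?E (mc b (tm f))) = snd (cact F (mc a (tm g)))"
    using cube_comp(2)[OF u i, of g] gu d0 by (simp add: cact_def)
  qed
  then have eqel: "act (Nob X) ?E (celt X f) = act (Nob X) F (celt X g)"
   using N(3)[OF E(1), of "mc b (tm f)"] N(3)[OF F(1), of "mc a (tm g)"] ef(1,5) eg(1,5) F(2) s1 by simp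
  have "acts (Nob X) (length b) (celt X f) ! i = rep (Nob X) (act (Nob X) ?E (celt X f))"
   using i by (simp add: acts_def)
  also have "\<dots> = acts (Nob X) (length a) (celt X g) ! (dirs F ! 0)"
   unfolding eqel using rep_act_edge[OF N(1) F(1) s1, of "celt X g"] eg(2) F(2) by simp
  finally show "snd (tm (Comp W (cc X g) u)) (ac b i) = snd (tm (cc X f)) (ac b i)"
   using cube_comp(2)[OF u i, of "cc X g"] cg(3)[OF d1] cf(3)[OF i] d0 by simp
 qed
qed

text \<open>
 A cocone under the cubes over \<open>X\<close> factors through the system rebuilt from the cubes of \<open>X\<close>: the
 points give its states, the edges its actions, and parallel edges of a cube have the same image
 because that cube is part of the diagram.
\<close>

lemma cc_colimit: assumes X: "is_hdts \<Sigma> X" shows "is_colimit (over X) W (cubes_diagram \<Sigma>) (Gob (Nob X)) (cc X)"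
 unfolding is_colimit_def
proof (intro conjI allI impI cc_cocone[OF X])
 note tX = hdts_tsys[OF X]
 note N = Nob[OF tX]
 fix Z c' assume "is_cocone (over X) W (cubes_diagram \<Sigma>) Z c'"
 note co = this[unfolded co_cocone]
 have Z: "is_whdts \<Sigma> Z" using co by blast
 have ch: "c' x \<in> hom W (cube a) Z" if "a \<in> lists \<Sigma>" "x \<in> hom W (cube a) X" for a x
 proof -
  have "x \<in> Ob (over X)" unfolding co_ob using that by blast
  then show ?thesis using co W_homD(5)[OF that(2)] by metis
 qed
 have cn: "Comp W (c' g) u = c' f"
  if "a \<in> lists \<Sigma>" "b \<in> lists \<Sigma>" "f \<in> hom W (cube b) X" "g \<in> hom W (cube a) X"
   "u \<in> hom W (cube b) (cube a)" "Comp W g u = f" for a b f g u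
 proof -
  have "f \<in> Ob (over X)" "g \<in> Ob (over X)" unfolding co_ob using that by blast+
  moreover have "u \<in> hom W (fst f) (fst g)" using that(5) W_homD(5)[OF that(3)] W_homD(5)[OF that(4)] by simp
  ultimately show ?thesis using co that(6) by blast
 qed
 have V: "Comp W (c' x) (cube (pull F a), bm a F, cube a) = c' (xarr X (bsrc F) (act (Nob X) F (celt X x)))"
  if a: "a \<in> lists \<Sigma>" "x \<in> hom W (cube a) X" and F: "F \<in> box_maps" "btgt F = length a" for a x F
 proof -
  note b = bm_hom[OF a(1) F] and xa = xarr_act[OF X a F]
  have "xarr X (bsrc F) (act (Nob X) F (celt X x)) \<in> hom W (cube (pull F a)) X"
   using xarr(1)[OF X xa(1)] unfolding xa(2) .
  from cn[OF a(1) b(2) this a(2) b(1)] show ?thesis using xa(3) by simp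
 qed
 define H0 where "H0 = (\<lambda>s. fst (tm (c' (xarr X 0 s))) (cstate []))"
 define H1 where "H1 = (\<lambda>e. snd (tm (c' (xarr X 1 e))) (ac (wd (Nob X) 1 e) 0))"
 have V0: "H0 (vtx (Nob X) \<xi> (celt X x)) = fst (tm (c' x)) (cstate \<xi>)"
  if a: "a \<in> lists \<Sigma>" "x \<in> hom W (cube a) X" and e: "length \<xi> = length a" for a x \<xi>
 proof -
  have F: "bx \<xi> [] \<in> box_maps" "btgt (bx \<xi> []) = length a" using point_box(1) e by simp_all
  show ?thesis
   using V[OF a F] cube_comp(1)[OF bm_hom(1)[OF a(1) F], of "[]" "c' x"] bm_simps(1)[OF F(1), of "[]" a]
    length_pull[OF F(1), of a] by (simp add: H0_def vtx_def)
 qed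
 have V1: "H1 (act (Nob X) F (celt X x)) = snd (tm (c' x)) (ac a (dirs F ! 0))"
  if a: "a \<in> lists \<Sigma>" "x \<in> hom W (cube a) X" and F: "F \<in> box_maps" "btgt F = length a" "bsrc F = 1" for a x F
  using V[OF a F(1,2)] cube_comp(2)[OF bm_hom(1)[OF a(1) F(1,2)], of 0 "c' x"] bm_simps(2)[OF F(1), of 0 a]
   length_pull[OF F(1), of a] F(3) xarr_act(2)[OF X a F(1,2)] by (simp add: H1_def)
 have V2: "H1 e = H1 e'" if "par (Nob X) e e'" for e e'
  using that
 proof induction
  case (step e' e'')
  obtain F F' k where *: "F \<in> box_maps" "F' \<in> box_maps" "bsrc F = 1" "bsrc F' = 1" "btgt F = btgt F'" "dirs F = dirs F'"
    "k \<in> el (Nob X) (btgt F)" "e' = act (Nob X) F k" "e'' = act (Nob X) F' k"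
   using step(2) unfolding par1_def by blast
  note xa = xarr[OF X *(7)]
  have "H1 e' = H1 e''"
   using V1[OF xa(2,1) *(1)] V1[OF xa(2,1) *(2)] * xa(3,4) by simp
  then show ?case using step(3) by simp
 qed simp
 have V3: "H1 (acts (Nob X) (length a) (celt X x) ! i) = snd (tm (c' x)) (ac a i)"
  if a: "a \<in> lists \<Sigma>" "x \<in> hom W (cube a) X" and i: "i < length a" for a x i
  using V2[OF par_rep[of "Nob X" "act (Nob X) (edge (length a) i) (celt X x)"]] V1[OF a, of "edge (length a) i"] edge_box[OF i] i
  by (simp add: acts_def)
 define h where "h = ((\<lambda>s\<in>el (Nob X) 0. H0 s), (\<lambda>u\<in>rep (Nob X) ` el (Nob X) 1. H1 u))"
 have h0: "fst h (vtx (Nob X) \<xi> (celt X x)) = fst (tm (c' x)) (cstate \<xi>)"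
  if a: "a \<in> lists \<Sigma>" "x \<in> hom W (cube a) X" and e: "length \<xi> = length a" for a x \<xi>
  using V0[OF a e] vtx_el[OF N(1), of "celt X x" \<xi>] celt(2)[OF tX a(2)] e by (simp add: h_def)
 have h1: "snd h (acts (Nob X) (length a) (celt X x) ! i) = snd (tm (c' x)) (ac a i)"
  if a: "a \<in> lists \<Sigma>" "x \<in> hom W (cube a) X" and i: "i < length a" for a x i
 proof -
  have "acts (Nob X) (length a) (celt X x) ! i \<in> rep (Nob X) ` el (Nob X) 1"
   by (rule subsetD[OF set_acts[OF N(1) celt(2)[OF tX a(2)]] nth_mem]) (simp add: i)
  then show ?thesis unfolding h_def snd_conv using V3[OF a i] by (simp only: restrict_apply')
 qed
 have hm: "is_tsys_map (Gob (Nob X)) Z h"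
 proof (rule tmapI)
  have "H0 s \<in> states Z" if s: "s \<in> el (Nob X) 0" for s
  proof -
   note xa = xarr[OF X s]
   have "cstate [] \<in> states (cube (wd (Nob X) 0 s))" using xa(3) by (simp add: cube_simps)
   then show ?thesis using tmapD(1)[OF W_homD(3)[OF ch[OF xa(2,1)]]] by (simp add: H0_def)
  qed
  then show "fst h \<in> states (Gob (Nob X)) \<rightarrow>\<^sub>E states Z" by (auto simp: h_def)
  have a1: "H1 u \<in> actions Z \<and> lab Z (H1 u) = hd (wd (Nob X) 1 u)" if u: "u \<in> el (Nob X) 1" for u
  proof -
   note xa = xarr[OF X u]
   have l: "0 < length (wd (Nob X) 1 u)" using xa(3) by simp
   then have "ac (wd (Nob X) 1 u) 0 \<in> actions (cube (wd (Nob X) 1 u))" by (auto simp: cube_simps)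
   then show ?thesis
    using tmapD(2,3)[OF W_homD(3)[OF ch[OF xa(2,1)]]] cube_simps(3)[OF l] l by (simp add: H1_def hd_conv_nth)
  qed
  have r: "u \<in> el (Nob X) 1" if "u \<in> rep (Nob X) ` el (Nob X) 1" for u using that rep_el[OF N(1)] by blast
  show "snd h \<in> actions (Gob (Nob X)) \<rightarrow>\<^sub>E actions Z"
   unfolding h_def Gob_simps snd_conv using a1 r by (intro PiE_I) simp_all
  show "lab Z (snd h u) = lab (Gob (Nob X)) u" if "u \<in> actions (Gob (Nob X))" for u
   using that a1[OF r] by (simp add: h_def)
  fix \<alpha> us \<beta> assume "(\<alpha>, us, \<beta>) \<in> transitions (Gob (Nob X))"
  then obtain n k where t: "(\<alpha>, us, \<beta>) = (src (Nob X) n k, acts (Nob X) n k, tgt (Nob X) n k)" and k: "0 < n" "k \<in> el (Nob X) n"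
   unfolding Gob_def by auto
  note xa = xarr[OF X k(2)]
  let ?a = "wd (Nob X) n k" and ?x = "xarr X n k"
  have "(cstate (zeros n), map (ac ?a) [0..<n], cstate (ones n)) \<in> transitions (cube ?a)"
   unfolding cube_trans_box using box_id[of n] xa(3) k(1) by (intro bexI[of _ "bid n"]) (simp_all add: bfun_bid)
  from tmapD(4)[OF W_homD(3)[OF ch[OF xa(2,1)]] this]
  have "(fst (tm (c' ?x)) (cstate (zeros n)), map (snd (tm (c' ?x))) (map (ac ?a) [0..<n]), fst (tm (c' ?x)) (cstate (ones n)))
    \<in> transitions Z" .
  moreover have "map (snd (tm (c' ?x))) (map (ac ?a) [0..<n]) = map (snd h) (acts (Nob X) n k)"
   using h1[OF xa(2,1)] xa(3,4) by (intro nth_equalityI) simp_all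
  ultimately show "(fst h \<alpha>, map (snd h) us, fst h \<beta>) \<in> transitions Z"
   using t h0[OF xa(2,1), of "zeros n"] h0[OF xa(2,1), of "ones n"] xa(3,4) by simp
 qed
 have G: "is_whdts \<Sigma> (Gob (Nob X))" by (rule hdts_whdts[OF Gob_hdts[OF Nob_paradigm[OF X]]])
 show "\<exists>!k. k \<in> hom W (Gob (Nob X)) Z \<and> (\<forall>i\<in>Ob (over X). Comp W k (cc X i) = c' i)"
 proof (rule ex1I)
  have k: "(Gob (Nob X), h, Z) \<in> hom W (Gob (Nob X)) Z" using hm G Z by (simp add: WHDTS_hom)
  show "(Gob (Nob X), h, Z) \<in> hom W (Gob (Nob X)) Z \<and>
   (\<forall>i\<in>Ob (over X). Comp W (Gob (Nob X), h, Z) (cc X i) = c' i)"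
  proof (intro conjI k ballI)
   fix x assume "x \<in> Ob (over X)"
   then obtain a where a: "a \<in> lists \<Sigma>" "x \<in> hom W (cube a) X" unfolding co_ob by blast
   note c = cc_hom[OF X a]
   note hc = catD(4)[OF is_category_WHDTS c(1) k]
   show "Comp W (Gob (Nob X), h, Z) (cc X x) = c' x"
    by (rule W_hom_eqI[OF hc ch[OF a]], rule cube_map_eqI[OF W_homD(3)[OF hc] W_homD(3)[OF ch[OF a]]])
     (simp_all add: cube_comp[OF c(1)] c(2,3) h0[OF a] h1[OF a])
  qed
  fix k assume k': "k \<in> hom W (Gob (Nob X)) Z \<and> (\<forall>i\<in>Ob (over X). Comp W k (cc X i) = c' i)"
  then have k1: "k \<in> hom W (Gob (Nob X)) Z"
   by blast
  have k2: "Comp W k (cc X x) = c' x" if "a \<in> lists \<Sigma>" "x \<in> hom W (cube a) X" for a x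
   using conjunct2[OF k'] co_ob[of x X] that by blast
  show "k = (Gob (Nob X), h, Z)"
  proof (rule W_hom_eqI[OF k1 k], rule tmap_eqI[OF W_homD(3)[OF k1] W_homD(3)[OF k]])
   fix s assume "s \<in> states (Gob (Nob X))"
   then have s: "s \<in> el (Nob X) 0" by simp
   note xa = xarr[OF X s]
   note c = cc_hom[OF X xa(2,1)]
   have v: "vtx (Nob X) [] (celt X (xarr X 0 s)) = s" using vtx_point[OF N(1) s] xa(4) by simp
   have "fst (tm k) s = fst (tm (c' (xarr X 0 s))) (cstate [])"
    using cube_comp(1)[OF c(1), of "[]" k] c(2)[of "[]"] k2[OF xa(2,1)] xa(3) v by simp
   also have "\<dots> = fst h s" using h0[OF xa(2,1), of "[]"] xa(3) v by simp
   finally show "fst (tm k) s = fst (tm (Gob (Nob X), h, Z)) s" by simp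
  next
   fix u assume "u \<in> actions (Gob (Nob X))"
   then obtain e where e: "e \<in> el (Nob X) 1" "u = rep (Nob X) e" by auto
   note xa = xarr[OF X e(1)]
   note c = cc_hom[OF X xa(2,1)]
   have l: "0 < length (wd (Nob X) 1 e)" using xa(3) by simp
   have v: "acts (Nob X) (length (wd (Nob X) 1 e)) (celt X (xarr X 1 e)) ! 0 = u"
    using rep_act_edge[OF N(1) box_id, of 1 e] presheafD(4)[OF lps_presheaf[OF N(1)] e(1)] e xa(3,4) by simp
   have "snd (tm k) u = snd (tm (c' (xarr X 1 e))) (ac (wd (Nob X) 1 e) 0)"
    using cube_comp(2)[OF c(1) l, of k] c(3)[OF l] k2[OF xa(2,1)] v by simp
   also have "\<dots> = snd h u" using h1[OF xa(2,1) l] v by simp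
   finally show "snd (tm k) u = snd (tm (Gob (Nob X), h, Z)) u" by simp
  qed
 qed
qed

subsection \<open>The maps inverted by cubification\<close>

lemma Cub_colimit: assumes X: "is_hdts \<Sigma> X"
 shows "is_colimit (over X) W (cubes_diagram \<Sigma>) (fst (Cub \<Sigma> X)) (snd (Cub \<Sigma> X))"
proof -
 have "case Cub \<Sigma> X of (Z, c) \<Rightarrow> is_colimit (over X) W (cubes_diagram \<Sigma>) Z c"
  unfolding Cub_def by (rule someI[of _ "(Gob (Nob X), cc X)"]) (use cc_colimit[OF X] in simp)
 then show ?thesis by (simp add: case_prod_beta)
qed

lemma HDTS_W: "f \<in> hom HD X Y ==> f \<in> hom W X Y"
 using HDTS_homD[of f X Y] hdts_whdts by (simp add: WHDTS_hom)

lemma co_comp: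
 assumes f: "f \<in> hom W X Y" and x: "x \<in> Ob (over X)" shows "Comp W f x \<in> Ob (over Y)"
 using x catD(4)[OF is_category_WHDTS _ f] unfolding co_ob by blast

text \<open>
 By naturality of the cocone, the map induced between the colimits is the image of \<open>f\<close> under the two functors.
\<close>

lemma cc_nat:
 assumes f: "f \<in> hom HD X Y" and x: "x \<in> Ob (over X)"
 shows "Comp W (snd Gfun (snd Nfun f)) (cc X x) = cc Y (Comp W f x)"
proof -
 note d = HDTS_homD[OF f] and G = HDTS_W[OF Gfun_hom[OF Nfun_hom[OF f]]]
 note pm = Nmap_pmap[OF d(5,6,3)]
 obtain a where a: "a \<in> lists \<Sigma>" "x \<in> hom W (cube a) X" using x unfolding co_ob by blast
 have fx: "Comp W f x \<in> hom W (cube a) Y" by (rule catD(4)[OF is_category_WHDTS a(2) HDTS_W[OF f]])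
 note c = cc_hom[OF d(1) a] and c' = cc_hom[OF d(2) a(1) fx]
 note e = celt[OF d(5) a(2)] and e' = celt[OF d(6) fx]
 have "cmap (tm f) (length a) (mc a (tm x)) = mc a (tm (Comp W f x))"
 proof (rule prod_eqI)
  show "fst (cmap (tm f) (length a) (mc a (tm x))) = fst (mc a (tm (Comp W f x)))"
   using cube_comp(1)[OF a(2), of _ f] by (auto simp: cmap_def mc_def bits_def intro!: restrict_ext)
  show "snd (cmap (tm f) (length a) (mc a (tm x))) = snd (mc a (tm (Comp W f x)))"
   using cube_comp(2)[OF a(2), of _ f] by (auto simp: cmap_def mc_def)
 qed
 then have ce: "Nmap X (tm f) Y (length a) (celt X x) = celt Y (Comp W f x)"
  using Nmap_cenc[OF d(5) e(5)] e(1) e'(1) by simp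
 have ap: "ap (snd Nfun f) (length a) (celt X x) = celt Y (Comp W f x)"
  using ce e(2) by (simp add: Nfun_arr[OF f])
 have tG: "tm (snd Gfun (snd Nfun f)) = Gmap (Nob X) (ap (snd Nfun f)) (Nob Y)"
  using hom_ends[of "snd Nfun f" "Nob X" "Nob Y"] Nfun_hom[OF f] by (simp add: Gfun_def DD_hom)
 have L: "snd Nfun f \<in> hom LPS (Nob X) (Nob Y)" using Nfun_hom[OF f] by (simp add: DD_hom)
 note nat = tcube_nat[OF Nob(1)[OF d(5)] hom_ap(1)[OF L] e(2), unfolded ap]
 note h = catD(4)[OF is_category_WHDTS c(1) G]
 show ?thesis
 proof (rule W_hom_eqI[OF h c'(1)], rule cube_map_eqI[OF W_homD(3)[OF h] W_homD(3)[OF c'(1)]])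
  fix \<xi> :: "bool list" assume l: "length \<xi> = length a"
  then have "fst (Gmap (Nob X) (ap (snd Nfun f)) (Nob Y)) (vtx (Nob X) \<xi> (celt X x)) = vtx (Nob Y) \<xi> (celt Y (Comp W f x))"
   using fun_cong[OF arg_cong[OF nat, of fst], of \<xi>] by (simp add: cmap_def tcube_def bits_def)
  then show "fst (tm (Comp W (snd Gfun (snd Nfun f)) (cc X x))) (cstate \<xi>) = fst (tm (cc Y (Comp W f x))) (cstate \<xi>)"
   using cube_comp(1)[OF c(1) l] c(2)[OF l] c'(2)[OF l] tG by simp
 next
  fix i assume i: "i < length a"
  then have "snd (Gmap (Nob X) (ap (snd Nfun f)) (Nob Y)) (acts (Nob X) (length a) (celt X x) ! i) =
    acts (Nob Y) (length a) (celt Y (Comp W f x)) ! i"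
   using arg_cong[OF arg_cong[OF nat, of snd], of "\<lambda>w. w ! i"] by (simp add: cmap_def tcube_def)
  then show "snd (tm (Comp W (snd Gfun (snd Nfun f)) (cc X x))) (ac a i) = snd (tm (cc Y (Comp W f x))) (ac a i)"
   using cube_comp(2)[OF c(1) i] c(3)[OF i] c'(3)[OF i] tG by simp
 qed
qed

text \<open>The chosen colimit differs from the one constructed above by an isomorphism.\<close>

lemma Cub_map_iso:
 assumes f: "f \<in> hom HD X Y"
 shows "is_iso W (Cub_map \<Sigma> f) \<longleftrightarrow> is_iso W (snd Gfun (snd Nfun f))"
proof -
 note d = HDTS_homD[OF f] and CW = is_category_WHDTS[of \<Sigma>]
 let ?g = "snd Gfun (snd Nfun f)"
 have G: "?g \<in> hom W (Gob (Nob X)) (Gob (Nob Y))" by (rule HDTS_W[OF Gfun_hom[OF Nfun_hom[OF f]]])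
 let ?J = "over X" and ?F = "cubes_diagram \<Sigma>"
 note kX = cc_colimit[OF d(1)] and kY = cc_colimit[OF d(2)] and KX = Cub_colimit[OF d(1)] and KY = Cub_colimit[OF d(2)]
 obtain p where p: "p \<in> hom W (Gob (Nob X)) (fst (Cub \<Sigma> X))" "is_iso W p"
  "\<And>x. x \<in> Ob ?J ==> Comp W p (cc X x) = snd (Cub \<Sigma> X) x" by (rule colimit_unique[OF kX KX]) (rule that)
 obtain q where q: "q \<in> hom W (Gob (Nob Y)) (fst (Cub \<Sigma> Y))" "is_iso W q"
  "\<And>y. y \<in> Ob (over Y) ==> Comp W q (cc Y y) = snd (Cub \<Sigma> Y) y" by (rule colimit_unique[OF kY KY]) (rule that)
 note qg = catD(4)[OF CW G q(1)]
 note ccX = coconeD(4)[OF cc_cocone[OF d(1)]]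
 have qgc: "Comp W (Comp W q ?g) (cc X x) = snd (Cub \<Sigma> Y) (Comp W f x)" if x: "x \<in> Ob ?J" for x
  using catD(7)[OF CW ccX[OF x] G q(1)] cc_nat[OF f x] q(3)[OF co_comp[OF HDTS_W[OF f] x]] by simp
 have co: "is_cocone ?J W ?F (fst (Cub \<Sigma> Y)) (\<lambda>x. Comp W (Comp W q ?g) (cc X x))"
  by (rule cocone_comp[OF cc_cocone[OF d(1)] qg])
 obtain h where h: "h \<in> hom W (fst (Cub \<Sigma> X)) (fst (Cub \<Sigma> Y))"
  "\<And>x. x \<in> Ob ?J ==> Comp W h (snd (Cub \<Sigma> X) x) = Comp W (Comp W q ?g) (cc X x)"
  using colimitD(2)[OF KX co] by blast
 have Cub: "Cub_map \<Sigma> f = h"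
  unfolding Cub_map_def Let_def WHDTS_simps(2,3) d(7,8)
 proof (rule the_equality)
  show "h \<in> hom W (fst (Cub \<Sigma> X)) (fst (Cub \<Sigma> Y)) \<and>
    (\<forall>x\<in>Ob ?J. Comp W h (snd (Cub \<Sigma> X) x) = snd (Cub \<Sigma> Y) (Comp W f x))" using h qgc by simp
  fix k assume k: "k \<in> hom W (fst (Cub \<Sigma> X)) (fst (Cub \<Sigma> Y)) \<and>
    (\<forall>x\<in>Ob ?J. Comp W k (snd (Cub \<Sigma> X) x) = snd (Cub \<Sigma> Y) (Comp W f x))"
  show "k = h" by (rule colimitD(3)[OF KX co]) (use k h qgc in simp_all)
 qed
 have "Comp W q ?g = Comp W h p"
 proof (rule colimitD(3)[OF kX co qg catD(4)[OF CW p(1) h(1)]])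
  fix x assume x: "x \<in> Ob ?J"
  show "Comp W (Comp W h p) (cc X x) = Comp W (Comp W q ?g) (cc X x)"
   using catD(7)[OF CW ccX[OF x] p(1) h(1)] p(3)[OF x] h(2)[OF x] by simp
 qed simp
 from iso_cancel[OF CW p(1,2) q(1,2) G h(1) this] show ?thesis unfolding Cub by simp
qed

lemma functor_iso:
 assumes F: "is_functor C D F" and f: "f \<in> hom C X Y" "is_iso C f" shows "is_iso D (snd F f)"
proof -
 obtain g where g: "g \<in> hom C Y X" "Comp C g f = Id C X" "Comp C f g = Id C Y" by (rule is_isoE[OF f(2,1)])
 note o = catD(8,9)[OF functorD(1)[OF F] f(1)]
 show ?thesis
  by (rule is_isoI[OF functorD(4)[OF F f(1)] functorD(4)[OF F g(1)]])
   (use functorD(6)[OF F f(1) g(1)] functorD(6)[OF F g(1) f(1)] g(2,3) functorD(5)[OF F o(1)] functorD(5)[OF F o(2)] in simp_all)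
qed

text \<open>The functor from precubical sets reflects isomorphisms, because it has a left inverse up to isomorphism.\<close>

lemma Cub_equivalences_eq: "Cub_equivalences \<Sigma> = {f \<in> Ar HD. is_iso DD (snd Nfun f)}"
proof -
 have "is_iso W (Cub_map \<Sigma> f) \<longleftrightarrow> is_iso DD (snd Nfun f)" if fA: "f \<in> Ar HD" for f
 proof -
  define X Y where "X = Dom HD f" and "Y = Cod HD f"
  have f: "f \<in> hom HD X Y" using Ar_hom[OF fA] by (simp add: X_def Y_def)
  note d = HDTS_homD[OF f] and N = Nfun_hom[OF f] and G = Gfun_hom[OF Nfun_hom[OF f]]
  note P = Nob_paradigm[OF d(1)] Nob_paradigm[OF d(2)]
  have "hom W (Gob (Nob Y)) (Gob (Nob X)) = hom HD (Gob (Nob Y)) (Gob (Nob X))"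
   using Gob_hdts[OF P(1)] Gob_hdts[OF P(2)] hdts_whdts by (auto simp: WHDTS_hom HDTS_hom)
  then have 1: "is_iso W (snd Gfun (snd Nfun f)) \<longleftrightarrow> is_iso HD (snd Gfun (snd Nfun f))"
   using hom_Ar[OF G] hom_Ar[OF HDTS_W[OF G]] by (simp add: is_iso_def HDTS_simps)
  have 2: "is_iso HD (snd Gfun (snd Nfun f)) \<longleftrightarrow> is_iso DD (snd Nfun f)"
  proof
   assume "is_iso HD (snd Gfun (snd Nfun f))"
   then have i: "is_iso DD (snd Nfun (snd Gfun (snd Nfun f)))" by (rule functor_iso[OF Nfun_functor G])
   show "is_iso DD (snd Nfun f)"
    using iso_cancel[OF is_category_DD trn_hom[OF P(1)] trn_iso[OF P(1)] trn_hom[OF P(2)] trn_iso[OF P(2)]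
      N Nfun_hom[OF G] trn_nat[OF N]] i by simp
  next
   assume "is_iso DD (snd Nfun f)"
   from functor_iso[OF Gfun_functor N this] show "is_iso HD (snd Gfun (snd Nfun f))" .
  qed
  show ?thesis using Cub_map_iso[OF f] 1 2 by simp
 qed
 then show ?thesis unfolding Cub_equivalences_def by blast
qed

end

section \<open>Localizations presented by a pair of functors\<close>

lemma is_functor_comp:
 assumes F: "is_functor C D F" and G: "is_functor D E G" shows "is_functor C E (comp_functor G F)"
proof (rule is_functorI[OF functorD(1)[OF F] functorD(2)[OF G]])
 fix f g X Y Z assume f: "f \<in> hom C X Y" and g: "g \<in> hom C Y Z"
 show "snd (comp_functor G F) (Comp C g f) = Comp E (snd (comp_functor G F) g) (snd (comp_functor G F) f)"
  using functorD(6)[OF F f g] functorD(6)[OF G functorD(4)[OF F f] functorD(4)[OF F g]]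
  by (simp add: comp_functor_def)
next
 fix X assume X: "X \<in> Ob C"
 show "fst (comp_functor G F) X \<in> Ob E" using functorD(3)[OF G functorD(3)[OF F X]] by (simp add: comp_functor_def)
 show "snd (comp_functor G F) (Id C X) = Id E (fst (comp_functor G F) X)"
  using functorD(5)[OF F X] functorD(5)[OF G functorD(3)[OF F X]] by (simp add: comp_functor_def)
next
 fix f X Y assume f: "f \<in> hom C X Y"
 show "snd (comp_functor G F) f \<in> hom E (fst (comp_functor G F) X) (fst (comp_functor G F) Y)"
  using functorD(4)[OF G functorD(4)[OF F f]] by (simp add: comp_functor_def)
qed

lemma is_functor_id: "is_category C ==> is_functor C C id_functor"
 by (rule is_functorI) (simp_all add: id_functor_def)

declare zigzag_eq.trans [trans]

lemma step_zigzag: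
 assumes "is_category C"
 shows "f \<in> hom C X Y ==> zigzag C W X [Fwd f] Y" "w \<in> W ==> w \<in> hom C Y X ==> zigzag C W X [Bwd w] Y"
 using catD(8,9)[OF assms] by (auto intro!: zigzag.intros)

lemma zigzag_append: "zigzag C W X p Y ==> zigzag C W Y q Z ==> zigzag C W X (p @ q) Z"
 by (induction rule: zigzag.induct) (auto intro: zigzag.intros)

lemma zigzag_ends: assumes "is_category C" "zigzag C W X p Y" shows "X \<in> Ob C \<and> Y \<in> Ob C"
 using assms(2)
proof induction
 case (cons X s Y p Z)
 then show ?case using catD(8,9)[OF assms(1)] by (cases s) auto
qed simp

lemma zigzag_eq_zigzag:
 assumes C: "is_category C" and "zigzag_eq C W X Y p q" shows "zigzag C W X p Y \<and> zigzag C W X q Y"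
 using assms(2)
proof induction
 case (compos f X Y g Z)
 then show ?case
  using zigzag_append[OF step_zigzag(1)[OF C compos(1)] step_zigzag(1)[OF C compos(2)]]
   step_zigzag(1)[OF C catD(4)[OF C compos]] by simp
next
 case (ident X)
 then show ?case using step_zigzag(1)[OF C catD(3)[OF C ident]] by (simp add: zigzag.nil)
next
 case (inv_right w X Y)
 then show ?case
  using zigzag_append[OF step_zigzag(1)[OF C inv_right(2)] step_zigzag(2)[OF C inv_right]] catD(8)[OF C inv_right(2)]
  by (simp add: zigzag.nil)
next
 case (inv_left w X Y)
 then show ?case
  using zigzag_append[OF step_zigzag(2)[OF C inv_left] step_zigzag(1)[OF C inv_left(2)]] catD(9)[OF C inv_left(2)]
  by (simp add: zigzag.nil)
qed (auto intro: zigzag_append)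

definition zcl :: "('o, 'm) cat \<Rightarrow> 'm set \<Rightarrow> 'o \<Rightarrow> 'm step list \<Rightarrow> 'o \<Rightarrow> 'o \<times> 'm step list set \<times> 'o" where
 "zcl C W X p Y = (X, {q. zigzag_eq C W X Y p q}, Y)"

lemma zcl_eq: "zigzag C W X p Y ==> zcl C W X p Y = zcl C W X q Y \<longleftrightarrow> zigzag_eq C W X Y q p"
 unfolding zcl_def by (auto intro: zigzag_eq.intros)

lemma localization_simps:
 "Ob (localization C W) = Ob C" "Dom (localization C W) a = fst a" "Cod (localization C W) a = snd (snd a)"
 "Id (localization C W) X = zcl C W X [] X"
 by (auto simp: localization_def zcl_def split: prod.splits)

lemma localization_hom: "a \<in> hom (localization C W) X Y \<longleftrightarrow> (\<exists>p. zigzag C W X p Y \<and> a = zcl C W X p Y)"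
 unfolding hom_def localization_simps by (auto simp: localization_def zcl_def)

lemma localization_comp:
 assumes p: "zigzag C W X p Y" and q: "zigzag C W Y q Z"
 shows "Comp (localization C W) (zcl C W Y q Z) (zcl C W X p Y) = zcl C W X (p @ q) Z"
proof -
 have "(\<exists>p'\<in>{r. zigzag_eq C W X Y p r}. \<exists>q'\<in>{r. zigzag_eq C W Y Z q r}. zigzag_eq C W X Z (p' @ q') r) \<longleftrightarrow>
   zigzag_eq C W X Z (p @ q) r" for r
 proof
  assume "\<exists>p'\<in>{r. zigzag_eq C W X Y p r}. \<exists>q'\<in>{r. zigzag_eq C W Y Z q r}. zigzag_eq C W X Z (p' @ q') r"
  then obtain p' q' where "zigzag_eq C W X Y p p'" "zigzag_eq C W Y Z q q'" "zigzag_eq C W X Z (p' @ q') r" by blast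
  then show "zigzag_eq C W X Z (p @ q) r" using zigzag_eq.trans[OF zigzag_eq.append] by metis
 next
  assume "zigzag_eq C W X Z (p @ q) r"
  then show "\<exists>p'\<in>{r. zigzag_eq C W X Y p r}. \<exists>q'\<in>{r. zigzag_eq C W Y Z q r}. zigzag_eq C W X Z (p' @ q') r"
   using zigzag_eq.refl[OF p] zigzag_eq.refl[OF q] by blast
 qed
 then show ?thesis by (simp add: localization_def zcl_def)
qed

lemma is_category_localization: assumes C: "is_category C" shows "is_category (localization C W)"
proof (rule is_categoryI)
 fix a assume "a \<in> Ar (localization C W)"
 then have "\<exists>p. zigzag C W (fst a) p (snd (snd a))" by (auto simp: localization_def)
 then show "Dom (localization C W) a \<in> Ob (localization C W) \<and> Cod (localization C W) a \<in> Ob (localization C W)"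
  unfolding localization_simps using zigzag_ends[OF C] by blast
next
 fix X assume "X \<in> Ob (localization C W)"
 then show "Id (localization C W) X \<in> hom (localization C W) X X"
  unfolding localization_hom localization_simps using zigzag.nil[of X C W] by blast
next
 fix a b X Y Z assume "a \<in> hom (localization C W) X Y" "b \<in> hom (localization C W) Y Z"
 then show "Comp (localization C W) b a \<in> hom (localization C W) X Z"
  unfolding localization_hom using localization_comp zigzag_append by metis
next
 fix a X Y assume "a \<in> hom (localization C W) X Y"
 then obtain p where p: "zigzag C W X p Y" "a = zcl C W X p Y" unfolding localization_hom by blast
 have "zigzag C W X [] X" "zigzag C W Y [] Y" using zigzag_ends[OF C p(1)] by (simp_all add: zigzag.nil)
 then show "Comp (localization C W) a (Id (localization C W) X) = a \<and> Comp (localization C W) (Id (localization C W) Y) a = a"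
  unfolding localization_simps p(2) using localization_comp[of C W X "[]" X p Y] localization_comp[of C W X p Y "[]" Y] p(1)
  by simp
next
 fix a b c X Y Z V
 assume "a \<in> hom (localization C W) X Y" "b \<in> hom (localization C W) Y Z" "c \<in> hom (localization C W) Z V"
 then obtain p q r where p: "zigzag C W X p Y" "a = zcl C W X p Y" and q: "zigzag C W Y q Z" "b = zcl C W Y q Z"
  and r: "zigzag C W Z r V" "c = zcl C W Z r V" unfolding localization_hom by blast
 show "Comp (localization C W) c (Comp (localization C W) b a) = Comp (localization C W) (Comp (localization C W) c b) a"
  unfolding p(2) q(2) r(2)
  using localization_comp[OF p(1) q(1)] localization_comp[OF zigzag_append[OF p(1) q(1)] r(1)]
   localization_comp[OF q(1) r(1)] localization_comp[OF p(1) zigzag_append[OF q(1) r(1)]] by simp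
qed

text \<open>A functor inverting \<open>W\<close> is evaluated on zigzags by inverting the images of the backward steps.\<close>

definition inverse_of :: "('p, 'n) cat \<Rightarrow> 'n \<Rightarrow> 'n" where
 "inverse_of D f = (SOME g. g \<in> hom D (Cod D f) (Dom D f) \<and> Comp D g f = Id D (Dom D f) \<and> Comp D f g = Id D (Cod D f))"

lemma inverse_of:
 assumes "f \<in> hom D X Y" "is_iso D f"
 shows "inverse_of D f \<in> hom D Y X" "Comp D (inverse_of D f) f = Id D X" "Comp D f (inverse_of D f) = Id D Y"
proof -
 have "\<exists>g. g \<in> hom D (Cod D f) (Dom D f) \<and> Comp D g f = Id D (Dom D f) \<and> Comp D f g = Id D (Cod D f)"
  using assms(2) unfolding is_iso_def by blast
 from someI_ex[OF this, folded inverse_of_def] show "inverse_of D f \<in> hom D Y X"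
  "Comp D (inverse_of D f) f = Id D X" "Comp D f (inverse_of D f) = Id D Y"
  using assms(1) by (simp_all add: hom_def)
qed

fun zev :: "('o, 'm) cat \<Rightarrow> ('p, 'n) cat \<Rightarrow> ('o, 'm, 'p, 'n) fctr \<Rightarrow> 'o \<Rightarrow> 'm step list \<Rightarrow> 'n" where
 "zev C D N X [] = Id D (fst N X)"
| "zev C D N X (Fwd f # p) = Comp D (zev C D N (Cod C f) p) (snd N f)"
| "zev C D N X (Bwd w # p) = Comp D (zev C D N (Dom C w) p) (inverse_of D (snd N w))"

text \<open>
 A commutative square \<open>f w = v g\<close> becomes \<open>v\<^sup>-\<^sup>1 f = g w\<^sup>-\<^sup>1\<close> when \<open>v\<close> and \<open>w\<close> are inverted.
\<close>

lemma inverse_swap: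
 assumes w: "w \<in> W" "w \<in> hom C A B" and v: "v \<in> W" "v \<in> hom C A' B'"
  and f: "f \<in> hom C B B'" and g: "g \<in> hom C A A'" and sq: "Comp C f w = Comp C v g" and C: "is_category C"
 shows "zigzag_eq C W B A' [Fwd f, Bwd v] [Bwd w, Fwd g]"
proof -
 note r = zigzag_eq.refl[OF step_zigzag(1)[OF C f]] zigzag_eq.refl[OF step_zigzag(1)[OF C g]]
  zigzag_eq.refl[OF step_zigzag(2)[OF C w]] zigzag_eq.refl[OF step_zigzag(2)[OF C v]]
  zigzag_eq.refl[OF step_zigzag(1)[OF C v(2)]]
 have sq': "zigzag_eq C W A B' [Fwd w, Fwd f] [Fwd g, Fwd v]"
  using zigzag_eq.trans[OF zigzag_eq.compos[OF w(2) f] zigzag_eq.sym[OF zigzag_eq.compos[OF g v(2), folded sq]]] .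
 have "zigzag_eq C W B A' [Fwd f, Bwd v] [Bwd w, Fwd w, Fwd f, Bwd v]"
  using zigzag_eq.append[OF zigzag_eq.sym[OF zigzag_eq.inv_left[OF w]] zigzag_eq.append[OF r(1) r(4)]] by simp
 also have "zigzag_eq C W B A' [Bwd w, Fwd w, Fwd f, Bwd v] [Bwd w, Fwd g, Fwd v, Bwd v]"
  using zigzag_eq.append[OF r(3) zigzag_eq.append[OF sq' r(4)]] by simp
 also have "zigzag_eq C W B A' [Bwd w, Fwd g, Fwd v, Bwd v] [Bwd w, Fwd g]"
  using zigzag_eq.append[OF zigzag_eq.append[OF r(3) r(2)] zigzag_eq.inv_right[OF v]] by simp
 finally show ?thesis .
qed

text \<open>
 Let \<open>N\<close> and \<open>G\<close> be functors with \<open>N \<circ> G\<close> isomorphic to the identity by \<open>\<eta>\<close>, and \<open>\<epsilon>\<close> a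
 natural transformation from \<open>G \<circ> N\<close> to the identity whose image under \<open>N\<close> is inverse to \<open>\<eta>\<close>. Then
 inverting the maps that \<open>N\<close> inverts makes \<open>\<epsilon>\<close> an isomorphism, so that \<open>N\<close> induces an
 equivalence, with inverse \<open>G\<close>.
\<close>

theorem localization_equivalence:
 assumes N: "is_functor C D N" and G: "is_functor D C G"
  and \<eta>: "\<And>d. d \<in> Ob D ==> \<eta> d \<in> hom D d (fst N (fst G d))" "\<And>d. d \<in> Ob D ==> is_iso D (\<eta> d)"
  and \<eta>_nat: "\<And>g d d'. g \<in> hom D d d' ==> Comp D (\<eta> d') g = Comp D (snd N (snd G g)) (\<eta> d)"
  and \<epsilon>: "\<And>X. X \<in> Ob C ==> \<epsilon> X \<in> hom C (fst G (fst N X)) X"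
  and \<epsilon>_nat: "\<And>f X Y. f \<in> hom C X Y ==> Comp C f (\<epsilon> X) = Comp C (\<epsilon> Y) (snd G (snd N f))"
  and tri: "\<And>X. X \<in> Ob C ==> Comp D (snd N (\<epsilon> X)) (\<eta> (fst N X)) = Id D (fst N X)"
  and W: "W = {f \<in> Ar C. is_iso D (snd N f)}"
 shows "equivalent_categories (localization C W) D"
proof -
 note C = functorD(1)[OF N] and D = functorD(2)[OF N]
 note nF = functorD(3-)[OF N] and gF = functorD(3-)[OF G]
 let ?L = "localization C W"
 note L = is_category_localization[OF C, of W]
 have Wi: "w \<in> W \<longleftrightarrow> is_iso D (snd N w)" if "w \<in> hom C X Y" for w X Y using that hom_Ar[OF that] by (simp add: W)
 have \<epsilon>W: "\<epsilon> X \<in> W" if X: "X \<in> Ob C" for X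
 proof -
  note d = nF(1)[OF X] and e = \<epsilon>[OF X]
  note ne = nF(2)[OF e] and h = \<eta>[OF d]
  obtain k where k: "k \<in> hom D (fst N (fst G (fst N X))) (fst N X)" "Comp D k (\<eta> (fst N X)) = Id D (fst N X)"
   "Comp D (\<eta> (fst N X)) k = Id D (fst N (fst G (fst N X)))" by (rule is_isoE[OF h(2,1)])
  have "snd N (\<epsilon> X) = Comp D (snd N (\<epsilon> X)) (Comp D (\<eta> (fst N X)) k)" using k(3) catD(5)[OF D ne] by simp
  also have "\<dots> = k" using catD(7)[OF D k(1) h(1) ne] tri[OF X] catD(6)[OF D k(1)] by simp
  finally have "is_iso D (snd N (\<epsilon> X))" using is_isoI[OF k(1) h(1) k(3,2)] by simp
  then show ?thesis using Wi[OF e] by simp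
 qed
 have z_hom: "zev C D N X p \<in> hom D (fst N X) (fst N Y)" if "zigzag C W X p Y" for X p Y
  using that
 proof induction
  case (cons X s Y p Z)
  show ?case
  proof (cases s)
   case (Fwd f)
   then have f: "f \<in> hom C X Y" using cons(1) by simp
   then show ?thesis using Fwd catD(4)[OF D nF(2)[OF f] cons(3)] hom_Ar[OF f] by simp
  next
   case (Bwd w)
   then have w: "w \<in> W" "w \<in> hom C Y X" using cons(1) by simp_all
   have "is_iso D (snd N w)" using Wi[OF w(2)] w(1) by simp
   then show ?thesis using Bwd catD(4)[OF D inverse_of(1)[OF nF(2)[OF w(2)]] cons(3)] hom_Ar[OF w(2)] by simp
  qed
 qed (simp add: catD(3)[OF D nF(1)])
 have z_append: "zev C D N X (p @ q) = Comp D (zev C D N Y q) (zev C D N X p)"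
  if "zigzag C W X p Y" "zigzag C W Y q Z" for X p Y q Z
  using that
 proof induction
  case (nil X)
  then show ?case using catD(5)[OF D z_hom[OF nil(2)]] by simp
 next
  case (cons X s Y p Z')
  note q = z_hom[OF cons(4)] and p = z_hom[OF cons(2)]
  show ?case
  proof (cases s)
   case (Fwd f)
   then have f: "f \<in> hom C X Y" using cons(1) by simp
   then show ?thesis using Fwd cons(3)[OF cons(4)] catD(7)[OF D nF(2)[OF f] p q] hom_Ar[OF f] by simp
  next
   case (Bwd w)
   then have w: "w \<in> W" "w \<in> hom C Y X" using cons(1) by simp_all
   have "is_iso D (snd N w)" using Wi[OF w(2)] w(1) by simp
   then show ?thesis
    using Bwd cons(3)[OF cons(4)] catD(7)[OF D inverse_of(1)[OF nF(2)[OF w(2)]] p q] hom_Ar[OF w(2)] by simp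
  qed
 qed
 have z_fwd: "zev C D N X [Fwd f] = snd N f" if f: "f \<in> hom C X Y" for f X Y
  using catD(6)[OF D nF(2)[OF f]] hom_Ar[OF f] by simp
 have z_eq: "zev C D N X p = zev C D N X q" if "zigzag_eq C W X Y p q" for X Y p q
  using that
 proof induction
  case (append X Y p p' Z q q')
  note z = zigzag_eq_zigzag[OF C append(1)] zigzag_eq_zigzag[OF C append(2)]
  show ?case using z_append[of X p Y q Z] z_append[of X p' Y q' Z] z append(3,4) by simp
 next
  case (ident X)
  show ?case using z_fwd[OF catD(3)[OF C ident]] nF(3)[OF ident] by simp
 next
  case (compos f X Y g Z)
  show ?case
   using z_append[OF step_zigzag(1)[OF C compos(1)] step_zigzag(1)[OF C compos(2)]]
    z_fwd[OF compos(1)] z_fwd[OF compos(2)] z_fwd[OF catD(4)[OF C compos]] nF(4)[OF compos] by simp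
 next
  case (inv_right w X Y)
  have "is_iso D (snd N w)" using Wi[OF inv_right(2)] inv_right(1) by simp
  note i = inverse_of[OF nF(2)[OF inv_right(2)] this]
  show ?case using i catD(6)[OF D i(1)] hom_Ar[OF inv_right(2)] by simp
 next
  case (inv_left w X Y)
  have "is_iso D (snd N w)" using Wi[OF inv_left(2)] inv_left(1) by simp
  note i = inverse_of[OF nF(2)[OF inv_left(2)] this]
  show ?case using i catD(6)[OF D nF(2)[OF inv_left(2)]] hom_Ar[OF inv_left(2)] by simp
 qed auto
 define F :: "('a, 'a \<times> 'b step list set \<times> 'a, 'c, 'd) fctr" where
  "F = (fst N, \<lambda>a. zev C D N (fst a) (SOME p. p \<in> fst (snd a)))"
 have F_zcl: "snd F (zcl C W X p Y) = zev C D N X p" if p: "zigzag C W X p Y" for X p Y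
 proof -
  have "zigzag_eq C W X Y p (SOME q. zigzag_eq C W X Y p q)" using zigzag_eq.refl[OF p] by (rule someI)
  from z_eq[OF this] show ?thesis by (simp add: F_def zcl_def)
 qed
 have F0: "fst F = fst N" by (simp add: F_def)
 have F: "is_functor ?L D F"
 proof (rule is_functorI[OF L D])
  fix X assume "X \<in> Ob ?L"
  then have X: "X \<in> Ob C" by (simp add: localization_simps)
  show "fst F X \<in> Ob D" using nF(1)[OF X] F0 by simp
  show "snd F (Id ?L X) = Id D (fst F X)" using F_zcl[OF zigzag.nil[OF X]] F0 by (simp add: localization_simps)
 next
  fix a X Y assume "a \<in> hom ?L X Y"
  then show "snd F a \<in> hom D (fst F X) (fst F Y)" using F_zcl z_hom F0 by (auto simp: localization_hom)
 next
  fix a b X Y Z assume "a \<in> hom ?L X Y" "b \<in> hom ?L Y Z"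
  then obtain p q where p: "zigzag C W X p Y" "a = zcl C W X p Y" and q: "zigzag C W Y q Z" "b = zcl C W Y q Z"
   unfolding localization_hom by blast
  show "snd F (Comp ?L b a) = Comp D (snd F b) (snd F a)"
   unfolding p(2) q(2) localization_comp[OF p(1) q(1)] F_zcl[OF p(1)] F_zcl[OF q(1)] F_zcl[OF zigzag_append[OF p(1) q(1)]]
   by (rule z_append[OF p(1) q(1)])
 qed
 define H :: "('c, 'd, 'a, 'a \<times> 'b step list set \<times> 'a) fctr" where
  "H = (fst G, \<lambda>g. zcl C W (fst G (Dom D g)) [Fwd (snd G g)] (fst G (Cod D g)))"
 have H_hom: "snd H g = zcl C W (fst G d) [Fwd (snd G g)] (fst G d')" if "g \<in> hom D d d'" for g d d'
  using hom_Ar[OF that] by (simp add: H_def)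
 have H0: "fst H = fst G" by (simp add: H_def)
 have H: "is_functor D ?L H"
 proof (rule is_functorI[OF D L])
  fix d assume d: "d \<in> Ob D"
  note g = gF(1)[OF d]
  show "fst H d \<in> Ob ?L" using g H0 by (simp add: localization_simps)
  show "snd H (Id D d) = Id ?L (fst H d)"
   unfolding H_hom[OF catD(3)[OF D d]] gF(3)[OF d] localization_simps H0
   using zcl_eq[OF step_zigzag(1)[OF C catD(3)[OF C g]]] zigzag_eq.sym[OF zigzag_eq.ident[OF g]] by blast
 next
  fix g d d' assume g: "g \<in> hom D d d'"
  show "snd H g \<in> hom ?L (fst H d) (fst H d')"
   unfolding H_hom[OF g] localization_hom H0 using step_zigzag(1)[OF C gF(2)[OF g]] by blast
 next
  fix g h d d' d'' assume g: "g \<in> hom D d d'" and h: "h \<in> hom D d' d''"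
  note gg = gF(2)[OF g] and hh = gF(2)[OF h] and gh = catD(4)[OF D g h]
  have "zcl C W (fst G d) [Fwd (snd G (Comp D h g))] (fst G d'') = zcl C W (fst G d) ([Fwd (snd G g)] @ [Fwd (snd G h)]) (fst G d'')"
   using zcl_eq[OF step_zigzag(1)[OF C gF(2)[OF gh]]] zigzag_eq.compos[OF gg hh] gF(4)[OF g h] by simp
  then show "snd H (Comp D h g) = Comp ?L (snd H h) (snd H g)"
   unfolding H_hom[OF gh] H_hom[OF g] H_hom[OF h]
    localization_comp[OF step_zigzag(1)[OF C gg] step_zigzag(1)[OF C hh]] .
 qed
 define \<sigma> where "\<sigma> = (\<lambda>X. zcl C W X [Bwd (\<epsilon> X)] (fst G (fst N X)))"
 have eb: "zigzag C W X [Bwd (\<epsilon> X)] (fst G (fst N X))" if "X \<in> Ob C" for X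
  by (rule step_zigzag(2)[OF C \<epsilon>W[OF that] \<epsilon>[OF that]])
 \<comment> \<open>Naturality of the inverse of \<open>\<epsilon>\<close> extends from arrows to zigzags.\<close>
 have \<sigma>_nat: "zigzag_eq C W X (fst G (fst N Y)) (p @ [Bwd (\<epsilon> Y)]) [Bwd (\<epsilon> X), Fwd (snd G (zev C D N X p))]"
  if "zigzag C W X p Y" for X p Y
  using that
 proof induction
  case (nil X)
  have "fst G (fst N X) \<in> Ob C" using gF(1)[OF nF(1)[OF nil]] .
  then show ?case
   using zigzag_eq.append[OF zigzag_eq.refl[OF eb[OF nil]] zigzag_eq.sym[OF zigzag_eq.ident]] gF(3)[OF nF(1)[OF nil]] by simp
 next
  case (cons X s Y p Z)
  note o = zigzag_ends[OF C cons(2)] and zp = z_hom[OF cons(2)]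
  note rG = zigzag_eq.refl[OF step_zigzag(1)[OF C gF(2)[OF zp]]]
  show ?case
  proof (cases s)
   case (Fwd f)
   then have f: "f \<in> hom C X Y" using cons(1) by simp
   have X: "X \<in> Ob C" using catD(8)[OF C f] .
   note gf = gF(2)[OF nF(2)[OF f]]
   have "zigzag_eq C W X (fst G (fst N Z)) ([Fwd f] @ (p @ [Bwd (\<epsilon> Z)])) ([Fwd f] @ [Bwd (\<epsilon> Y), Fwd (snd G (zev C D N Y p))])"
    by (rule zigzag_eq.append[OF zigzag_eq.refl[OF step_zigzag(1)[OF C f]] cons(3)])
   also have "zigzag_eq C W X (fst G (fst N Z)) ([Fwd f] @ [Bwd (\<epsilon> Y), Fwd (snd G (zev C D N Y p))])
     ([Bwd (\<epsilon> X), Fwd (snd G (snd N f))] @ [Fwd (snd G (zev C D N Y p))])"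
    using zigzag_eq.append[OF inverse_swap[OF \<epsilon>W[OF X] \<epsilon>[OF X] \<epsilon>W \<epsilon> f gf \<epsilon>_nat[OF f] C] rG] o by simp
   also have "zigzag_eq C W X (fst G (fst N Z)) ([Bwd (\<epsilon> X), Fwd (snd G (snd N f))] @ [Fwd (snd G (zev C D N Y p))])
     ([Bwd (\<epsilon> X)] @ [Fwd (snd G (zev C D N X (Fwd f # p)))])"
    using zigzag_eq.append[OF zigzag_eq.refl[OF eb[OF X]] zigzag_eq.compos[OF gf gF(2)[OF zp]]] gF(4)[OF nF(2)[OF f] zp] hom_Ar[OF f]
    by simp
   finally show ?thesis using Fwd by simp
  next
   case (Bwd w)
   then have w: "w \<in> W" "w \<in> hom C Y X" using cons(1) by simp_all
   have X: "X \<in> Ob C" and Y: "Y \<in> Ob C" using catD(8,9)[OF C w(2)] by blast+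
   have iw: "is_iso D (snd N w)" using Wi[OF w(2)] w(1) by simp
   note i = inverse_of[OF nF(2)[OF w(2)] iw]
   note gw = gF(2)[OF nF(2)[OF w(2)]] and gi = gF(2)[OF i(1)]
   note rw = zigzag_eq.refl[OF step_zigzag(2)[OF C w]] and ri = zigzag_eq.refl[OF step_zigzag(1)[OF C gi]]
   have gg: "zigzag_eq C W (fst G (fst N Y)) (fst G (fst N Y)) [Fwd (snd G (snd N w)), Fwd (snd G (inverse_of D (snd N w)))] []"
    using zigzag_eq.trans[OF zigzag_eq.compos[OF gw gi]] zigzag_eq.ident[OF gF(1)[OF nF(1)[OF Y]]]
     gF(4)[OF nF(2)[OF w(2)] i(1)] i(2) gF(3)[OF nF(1)[OF Y]] by simp
   have "zigzag_eq C W X (fst G (fst N Y)) [Bwd w, Bwd (\<epsilon> Y)]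
     [Bwd w, Bwd (\<epsilon> Y), Fwd (snd G (snd N w)), Fwd (snd G (inverse_of D (snd N w)))]"
    using zigzag_eq.append[OF zigzag_eq.append[OF rw zigzag_eq.refl[OF eb[OF Y]]] zigzag_eq.sym[OF gg]] by simp
   also have "zigzag_eq C W X (fst G (fst N Y))
     [Bwd w, Bwd (\<epsilon> Y), Fwd (snd G (snd N w)), Fwd (snd G (inverse_of D (snd N w)))]
     [Bwd w, Fwd w, Bwd (\<epsilon> X), Fwd (snd G (inverse_of D (snd N w)))]"
    using zigzag_eq.append[OF rw zigzag_eq.append[OF zigzag_eq.sym[OF inverse_swap[OF \<epsilon>W[OF Y] \<epsilon>[OF Y] \<epsilon>W[OF X] \<epsilon>[OF X] w(2) gw \<epsilon>_nat[OF w(2)] C]] ri]]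
    by simp
   also have "zigzag_eq C W X (fst G (fst N Y)) [Bwd w, Fwd w, Bwd (\<epsilon> X), Fwd (snd G (inverse_of D (snd N w)))]
     [Bwd (\<epsilon> X), Fwd (snd G (inverse_of D (snd N w)))]"
    using zigzag_eq.append[OF zigzag_eq.inv_left[OF w] zigzag_eq.append[OF zigzag_eq.refl[OF eb[OF X]] ri]] by simp
   finally have sw: "zigzag_eq C W X (fst G (fst N Y)) [Bwd w, Bwd (\<epsilon> Y)] [Bwd (\<epsilon> X), Fwd (snd G (inverse_of D (snd N w)))]" .
   have "zigzag_eq C W X (fst G (fst N Z)) ([Bwd w] @ (p @ [Bwd (\<epsilon> Z)])) ([Bwd w] @ [Bwd (\<epsilon> Y), Fwd (snd G (zev C D N Y p))])"
    by (rule zigzag_eq.append[OF rw cons(3)])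
   also have "zigzag_eq C W X (fst G (fst N Z)) ([Bwd w] @ [Bwd (\<epsilon> Y), Fwd (snd G (zev C D N Y p))])
     ([Bwd (\<epsilon> X), Fwd (snd G (inverse_of D (snd N w)))] @ [Fwd (snd G (zev C D N Y p))])"
    using zigzag_eq.append[OF sw rG] by simp
   also have "zigzag_eq C W X (fst G (fst N Z)) ([Bwd (\<epsilon> X), Fwd (snd G (inverse_of D (snd N w)))] @ [Fwd (snd G (zev C D N Y p))])
     ([Bwd (\<epsilon> X)] @ [Fwd (snd G (zev C D N X (Bwd w # p)))])"
    using zigzag_eq.append[OF zigzag_eq.refl[OF eb[OF X]] zigzag_eq.compos[OF gi gF(2)[OF zp]]] gF(4)[OF i(1) zp] hom_Ar[OF w(2)]
    by simp
   finally show ?thesis using Bwd by simp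
  qed
 qed
 have "naturally_isomorphic ?L ?L id_functor (comp_functor H F)"
  unfolding naturally_isomorphic_def
 proof (intro exI[of _ \<sigma>] conjI ballI)
  have \<sigma>h: "\<sigma> X \<in> hom ?L X (fst G (fst N X))" if "X \<in> Ob C" for X
   unfolding localization_hom \<sigma>_def using eb[OF that] by blast
  show "is_nat_trans ?L ?L id_functor (comp_functor H F) \<sigma>"
  proof (rule is_nat_transI)
   show "is_functor ?L ?L id_functor" by (rule is_functor_id[OF L])
   show "is_functor ?L ?L (comp_functor H F)"
    by (rule is_functor_comp[OF F H])
   show "\<sigma> X \<in> hom ?L (fst id_functor X) (fst (comp_functor H F) X)" if "X \<in> Ob ?L" for X
    using \<sigma>h[of X] that by (simp add: localization_simps id_functor_def comp_functor_def H0 F0)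
   fix a X Y assume "a \<in> hom ?L X Y"
   then obtain p where p: "zigzag C W X p Y" "a = zcl C W X p Y" unfolding localization_hom by blast
   note o = zigzag_ends[OF C p(1)] and zp = z_hom[OF p(1)]
   have G1: "zigzag C W (fst G (fst N X)) [Fwd (snd G (zev C D N X p))] (fst G (fst N Y))"
    by (rule step_zigzag(1)[OF C gF(2)[OF zp]])
   have "Comp ?L (\<sigma> Y) a = zcl C W X (p @ [Bwd (\<epsilon> Y)]) (fst G (fst N Y))"
    unfolding \<sigma>_def p(2) using localization_comp[OF p(1) eb] o by simp
   also have "\<dots> = zcl C W X ([Bwd (\<epsilon> X)] @ [Fwd (snd G (zev C D N X p))]) (fst G (fst N Y))"
    using zcl_eq[OF zigzag_append[OF p(1) eb]] zigzag_eq.sym[OF \<sigma>_nat[OF p(1)]] o by simp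
   also have "\<dots> = Comp ?L (snd H (snd F a)) (\<sigma> X)"
    unfolding p(2) F_zcl[OF p(1)] H_hom[OF zp] \<sigma>_def using localization_comp[OF eb G1] o by simp
   finally show "Comp ?L (\<sigma> Y) (snd id_functor a) = Comp ?L (snd (comp_functor H F) a) (\<sigma> X)"
    by (simp add: id_functor_def comp_functor_def)
  qed
  fix X assume "X \<in> Ob ?L"
  then have X: "X \<in> Ob C" by (simp add: localization_simps)
  note e = \<epsilon>[OF X] and w = \<epsilon>W[OF X]
  have f: "zigzag C W (fst G (fst N X)) [Fwd (\<epsilon> X)] X" by (rule step_zigzag(1)[OF C e])
  have g: "zcl C W (fst G (fst N X)) [Fwd (\<epsilon> X)] X \<in> hom ?L (fst G (fst N X)) X" unfolding localization_hom using f by blast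
  show "is_iso ?L (\<sigma> X)"
  proof (rule is_isoI[OF \<sigma>h[OF X] g])
   show "Comp ?L (zcl C W (fst G (fst N X)) [Fwd (\<epsilon> X)] X) (\<sigma> X) = Id ?L X"
    unfolding \<sigma>_def localization_comp[OF eb[OF X] f] localization_simps
    using zcl_eq[OF zigzag_append[OF eb[OF X] f]] zigzag_eq.sym[OF zigzag_eq.inv_left[OF w e]] by simp
   show "Comp ?L (\<sigma> X) (zcl C W (fst G (fst N X)) [Fwd (\<epsilon> X)] X) = Id ?L (fst G (fst N X))"
    unfolding \<sigma>_def localization_comp[OF f eb[OF X]] localization_simps
    using zcl_eq[OF zigzag_append[OF f eb[OF X]]] zigzag_eq.sym[OF zigzag_eq.inv_right[OF w e]] by simp
  qed
 qed
 moreover have "naturally_isomorphic D D (comp_functor F H) id_functor"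
  unfolding naturally_isomorphic_def
 proof (intro exI[of _ "\<lambda>d. inverse_of D (\<eta> d)"] conjI ballI)
  have FH: "snd F (snd H g) = snd N (snd G g)" if g: "g \<in> hom D d d'" for g d d'
   unfolding H_hom[OF g] F_zcl[OF step_zigzag(1)[OF C gF(2)[OF g]]] by (rule z_fwd[OF gF(2)[OF g]])
  note i = inverse_of[OF \<eta>]
  show "is_iso D (inverse_of D (\<eta> d))" if d: "d \<in> Ob D" for d
   by (rule is_isoI[OF i(1)[OF d d] \<eta>(1)[OF d] i(3)[OF d d] i(2)[OF d d]])
  show "is_nat_trans D D (comp_functor F H) id_functor (\<lambda>d. inverse_of D (\<eta> d))"
  proof (rule is_nat_transI)
   show "is_functor D D id_functor" by (rule is_functor_id[OF D])
   show "is_functor D D (comp_functor F H)"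
    by (rule is_functor_comp[OF H F])
   show "inverse_of D (\<eta> d) \<in> hom D (fst (comp_functor F H) d) (fst id_functor d)" if d: "d \<in> Ob D" for d
    using i(1)[OF d d] by (simp add: id_functor_def comp_functor_def F0 H0)
   fix g d d' assume g: "g \<in> hom D d d'"
   note o = catD(8,9)[OF D g]
   note i1 = i[OF o(1) o(1)] and i2 = i[OF o(2) o(2)] and h1 = \<eta>(1)[OF o(1)] and h2 = \<eta>(1)[OF o(2)]
   note ng = nF(2)[OF gF(2)[OF g]]
   let ?n = "snd N (snd G g)" and ?j = "inverse_of D (\<eta> d')" and ?k = "inverse_of D (\<eta> d)"
   have "Comp D ?j ?n = Comp D ?j (Comp D ?n (Comp D (\<eta> d) ?k))" using i1(3) catD(5)[OF D ng] by simp
   also have "\<dots> = Comp D ?j (Comp D (Comp D (\<eta> d') g) ?k)" using catD(7)[OF D i1(1) h1 ng] \<eta>_nat[OF g] by simp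
   also have "\<dots> = Comp D (Comp D ?j (\<eta> d')) (Comp D g ?k)"
    using catD(7)[OF D i1(1) g h2] catD(7)[OF D catD(4)[OF D i1(1) g] h2 i2(1)] by simp
   also have "\<dots> = Comp D g ?k" using i2(2) catD(6)[OF D catD(4)[OF D i1(1) g]] by simp
   finally show "Comp D ?j (snd (comp_functor F H) g) = Comp D (snd id_functor g) ?k"
    using FH[OF g] by (simp add: id_functor_def comp_functor_def)
  qed
 qed
 ultimately show ?thesis unfolding equivalent_categories_def using F H by blast
qed

context small_labels
begin

theorem localization_HDTS: "equivalent_categories (localization (HDTS \<Sigma>) (Cub_equivalences \<Sigma>)) DD"
proof (rule localization_equivalence[OF Nfun_functor Gfun_functor])
 fix d assume "d \<in> Ob DD"
 then have P: "paradigm d" by (simp add: DD_simps)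
 show "trn d \<in> hom DD d (fst Nfun (fst Gfun d))" "is_iso DD (trn d)" using trn_hom[OF P] trn_iso[OF P] by simp_all
next
 fix X assume "X \<in> Ob (HDTS \<Sigma>)"
 then have X: "is_hdts \<Sigma> X" by (simp add: HDTS_simps)
 show "eps X \<in> hom (HDTS \<Sigma>) (fst Gfun (fst Nfun X)) X" using eps_hom[OF X] by simp
 show "Comp DD (snd Nfun (eps X)) (trn (fst Nfun X)) = Id DD (fst Nfun X)" using eps_triangle[OF X] by simp
qed (use trn_nat eps_nat Cub_equivalences_eq in simp_all)

end

section \<open>Objects given by generators and relations\<close>

lemma bcomp_assoc:
 assumes "F \<in> box_maps" "G \<in> box_maps" "H \<in> box_maps" "btgt F = bsrc G" "btgt G = bsrc H"
 shows "bcomp H (bcomp G F) = bcomp (bcomp H G) F"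
 using catD(7)[OF is_category_box, of F "bsrc F" "btgt F" G "btgt G" H "btgt H"] assms by (simp add: hom_def)

lemma bcomp_bid: "F \<in> box_maps ==> bcomp F (bid (bsrc F)) = F" "F \<in> box_maps ==> bcomp (bid (btgt F)) F = F"
 using catD(5,6)[OF is_category_box, of F "bsrc F" "btgt F"] by (simp_all add: hom_def)

text \<open>
 A generator \<open>\<gamma>\<close> has a word \<open>w \<gamma>\<close>, whose length is its dimension. A term is a generator with a map of cubes acting on
 it, and a relation \<open>(\<gamma>, F, \<delta>, H)\<close> equates the terms \<open>(\<gamma>, F)\<close> and \<open>(\<delta>, H)\<close>.
\<close>

type_synonym 'b rels = "('b \<times> bmap \<times> 'b \<times> bmap) set"

definition terms :: "'b set \<Rightarrow> ('b \<Rightarrow> 'u list) \<Rightarrow> nat \<Rightarrow> ('b \<times> bmap) set" where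
 "terms \<Gamma> w n = {(\<gamma>, F). \<gamma> \<in> \<Gamma> \<and> F \<in> box_maps \<and> btgt F = length (w \<gamma>) \<and> bsrc F = n}"

definition valid :: "'b set \<Rightarrow> ('b \<Rightarrow> 'u list) \<Rightarrow> 'b rels \<Rightarrow> 'u precub_arrow \<Rightarrow> ('b \<Rightarrow> 'u) \<Rightarrow> bool" where
 "valid \<Gamma> w R z s \<longleftrightarrow> (\<forall>\<gamma>\<in>\<Gamma>. s \<gamma> \<in> el z (length (w \<gamma>)) \<and> wd z (length (w \<gamma>)) (s \<gamma>) = w \<gamma>) \<and>
   (\<forall>(\<gamma>, F, \<delta>, H)\<in>R. act z F (s \<gamma>) = act z H (s \<delta>))"

definition rels_wf :: "'b set \<Rightarrow> ('b \<Rightarrow> 'u list) \<Rightarrow> 'b rels \<Rightarrow> bool" where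
 "rels_wf \<Gamma> w R \<longleftrightarrow> (\<forall>(\<gamma>, F, \<delta>, H)\<in>R. \<gamma> \<in> \<Gamma> \<and> \<delta> \<in> \<Gamma> \<and> F \<in> box_maps \<and> H \<in> box_maps \<and> btgt F = length (w \<gamma>) \<and>
   btgt H = length (w \<delta>) \<and> bsrc F = bsrc H \<and> pull F (w \<gamma>) = pull H (w \<delta>))"

lemma rels_wfD:
 assumes "rels_wf \<Gamma> w R" "(\<gamma>, F, \<delta>, H) \<in> R"
 shows "\<gamma> \<in> \<Gamma>" "\<delta> \<in> \<Gamma>" "F \<in> box_maps" "H \<in> box_maps" "btgt F = length (w \<gamma>)" "btgt H = length (w \<delta>)"
  "bsrc F = bsrc H" "pull F (w \<gamma>) = pull H (w \<delta>)"
 using assms unfolding rels_wf_def by blast+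

lemma validD:
 assumes "valid \<Gamma> w R z s"
 shows "\<gamma> \<in> \<Gamma> ==> s \<gamma> \<in> el z (length (w \<gamma>))" "\<gamma> \<in> \<Gamma> ==> wd z (length (w \<gamma>)) (s \<gamma>) = w \<gamma>"
  "(\<gamma>, F, \<delta>, H) \<in> R ==> act z F (s \<gamma>) = act z H (s \<delta>)"
 using assms unfolding valid_def by blast+

context small_labels
begin

text \<open>
 Two terms are identified when they have the same word and the same value under every interpretation
 of the generators in an object satisfying the paradigm. Since the paradigm can be tested by
 maps into such objects, the quotient satisfies it.
\<close>

definition theta :: "'b set \<Rightarrow> ('b \<Rightarrow> 'u list) \<Rightarrow> 'b rels \<Rightarrow> nat \<Rightarrow> 'b \<times> bmap \<Rightarrow> 'b \<times> bmap \<Rightarrow> bool" where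
 "theta \<Gamma> w R n t t' \<longleftrightarrow> t \<in> terms \<Gamma> w n \<and> t' \<in> terms \<Gamma> w n \<and>
   pull (snd t) (w (fst t)) = pull (snd t') (w (fst t')) \<and>
   (\<forall>z s. paradigm z \<longrightarrow> valid \<Gamma> w R z s \<longrightarrow> act z (snd t) (s (fst t)) = act z (snd t') (s (fst t')))"

lemma thetaD:
 assumes "theta \<Gamma> w R n t t'"
 shows "t \<in> terms \<Gamma> w n" "t' \<in> terms \<Gamma> w n" "pull (snd t) (w (fst t)) = pull (snd t') (w (fst t'))"
  "paradigm z ==> valid \<Gamma> w R z s ==> act z (snd t) (s (fst t)) = act z (snd t') (s (fst t'))"
 using assms unfolding theta_def by blast+

lemma thetaI:
 assumes "t \<in> terms \<Gamma> w n" "t' \<in> terms \<Gamma> w n" "pull (snd t) (w (fst t)) = pull (snd t') (w (fst t'))"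
  "\<And>z s. paradigm z ==> valid \<Gamma> w R z s ==> act z (snd t) (s (fst t)) = act z (snd t') (s (fst t'))"
 shows "theta \<Gamma> w R n t t'"
 using assms unfolding theta_def by blast

definition rpt :: "'b set \<Rightarrow> ('b \<Rightarrow> 'u list) \<Rightarrow> 'b rels \<Rightarrow> nat \<Rightarrow> 'b \<times> bmap \<Rightarrow> 'b \<times> bmap" where
 "rpt \<Gamma> w R n t = (SOME t'. theta \<Gamma> w R n t t')"

definition tact :: "'b set \<Rightarrow> ('b \<Rightarrow> 'u list) \<Rightarrow> 'b rels \<Rightarrow> bmap \<Rightarrow> 'b \<times> bmap \<Rightarrow> 'b \<times> bmap" where
 "tact \<Gamma> w R F t = rpt \<Gamma> w R (bsrc F) (fst t, bcomp (snd t) F)"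

definition pres :: "'b set \<Rightarrow> ('b \<Rightarrow> 'u list) \<Rightarrow> 'b rels \<Rightarrow> 'u precub_arrow" where
 "pres \<Gamma> w R = realize (\<lambda>n. rpt \<Gamma> w R n ` terms \<Gamma> w n) (tact \<Gamma> w R) (\<lambda>n t. pull (snd t) (w (fst t)))"

definition gen :: "'b set \<Rightarrow> ('b \<Rightarrow> 'u list) \<Rightarrow> 'b rels \<Rightarrow> 'b \<Rightarrow> 'u" where
 "gen \<Gamma> w R \<gamma> = (let n = length (w \<gamma>) in enc (rpt \<Gamma> w R n ` terms \<Gamma> w n) (rpt \<Gamma> w R n (\<gamma>, bid n)))"

text \<open>A map of cubes is determined by its finite table of values, so there are only countably many.\<close>

lemma small_box_maps: "small TYPE('u) box_maps"
proof (rule small_inj[of "\<lambda>F. (bsrc F, map (bfun F) (List.n_lists (bsrc F) [False, True]), btgt F)"])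
 show "inj_on (\<lambda>F. (bsrc F, map (bfun F) (List.n_lists (bsrc F) [False, True]), btgt F)) box_maps"
 proof (rule inj_onI)
  fix F G assume F: "F \<in> box_maps" and G: "G \<in> box_maps"
   and e: "(bsrc F, map (bfun F) (List.n_lists (bsrc F) [False, True]), btgt F) =
    (bsrc G, map (bfun G) (List.n_lists (bsrc G) [False, True]), btgt G)"
  have "set (List.n_lists (bsrc F) [False, True]) = bits (bsrc F)" by (auto simp: set_n_lists bits_def)
  then have "bfun F \<epsilon> = bfun G \<epsilon>" if "\<epsilon> \<in> bits (bsrc F)" for \<epsilon> using e that by (auto simp: map_eq_conv)
  then have "bfun F = bfun G"
   using box_dirs(4)[OF F] box_dirs(4)[OF G] e by (intro extensionalityI[of _ "bits (bsrc F)"]) auto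
  then show "F = G" using e by (simp add: prod_eq_iff)
 qed
qed (rule subset_UNIV, simp add: small_countable)

context
 fixes \<Gamma> :: "'b set" and w :: "'b \<Rightarrow> 'u list" and R :: "'b rels"
 assumes sm: "small TYPE('u) \<Gamma>" and ww: "w ` \<Gamma> \<subseteq> lists \<Sigma>" and wf: "rels_wf \<Gamma> w R"
begin

abbreviation "Tm \<equiv> terms \<Gamma> w"
abbreviation "th \<equiv> theta \<Gamma> w R"
abbreviation "rp \<equiv> rpt \<Gamma> w R"

lemma theta_refl: "t \<in> Tm n ==> th n t t" by (simp add: theta_def)

lemma theta_sym: "th n t t' ==> th n t' t" by (auto simp: theta_def)

lemma theta_trans: "th n t t' ==> th n t' t'' ==> th n t t''" by (auto simp: theta_def)

lemma theta_rpt: "t \<in> Tm n ==> th n t (rp n t)"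
 unfolding rpt_def by (rule someI[of _ t]) (rule theta_refl)

lemma rpt_eq: assumes "t \<in> Tm n" "t' \<in> Tm n" shows "rp n t = rp n t' \<longleftrightarrow> th n t t'"
proof
 assume "rp n t = rp n t'"
 then show "th n t t'" using theta_rpt[OF assms(1)] theta_sym[OF theta_rpt[OF assms(2)]] theta_trans by metis
next
 assume "th n t t'"
 then have "th n t = th n t'" using theta_trans theta_sym by blast
 then show "rp n t = rp n t'" by (simp add: rpt_def)
qed

lemma rpt_terms: "t \<in> Tm n ==> rp n t \<in> Tm n" using theta_rpt by (simp add: theta_def)

lemma terms_comp:
 assumes "t \<in> Tm (btgt F)" "F \<in> box_maps" shows "(fst t, bcomp (snd t) F) \<in> Tm (bsrc F)"
 using assms box_comp[of F "snd t"] by (auto simp: terms_def)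

lemma theta_comp:
 assumes th: "th (btgt F) t t'" and F: "F \<in> box_maps"
 shows "th (bsrc F) (fst t, bcomp (snd t) F) (fst t', bcomp (snd t') F)"
proof -
 have t: "t \<in> Tm (btgt F)" "t' \<in> Tm (btgt F)" using th by (simp_all add: theta_def)
 then have b: "snd t \<in> box_maps" "btgt F = bsrc (snd t)" "snd t' \<in> box_maps" "btgt F = bsrc (snd t')"
  "fst t \<in> \<Gamma>" "btgt (snd t) = length (w (fst t))" "fst t' \<in> \<Gamma>" "btgt (snd t') = length (w (fst t'))"
  by (auto simp: terms_def)
 have "act z (bcomp (snd t) F) (s (fst t)) = act z (bcomp (snd t') F) (s (fst t'))"
  if z: "paradigm z" and s: "valid \<Gamma> w R z s" for z s
  using thetaD(4)[OF th z s] presheafD(6)[OF lps_presheaf[OF paradigmD(1)[OF z]] F b(1,2), of "s (fst t)"]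
   presheafD(6)[OF lps_presheaf[OF paradigmD(1)[OF z]] F b(3,4), of "s (fst t')"]
   validD(1)[OF s b(5)] validD(1)[OF s b(7)] b(2,4,6,8) by simp
 then show ?thesis
  using thetaD(3)[OF th] pull_comp[OF F b(1,2), of "w (fst t)"] pull_comp[OF F b(3,4), of "w (fst t')"]
  by (intro thetaI terms_comp[OF t(1) F] terms_comp[OF t(2) F]) simp_all
qed

lemma tact_rpt:
 assumes t: "t \<in> Tm (btgt F)" and F: "F \<in> box_maps"
 shows "tact \<Gamma> w R F (rp (btgt F) t) = rp (bsrc F) (fst t, bcomp (snd t) F)"
 unfolding tact_def
 by (subst rpt_eq[OF terms_comp[OF rpt_terms[OF t] F] terms_comp[OF t F]])
  (rule theta_sym[OF theta_comp[OF theta_rpt[OF t] F]])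

lemma rpt_word: "t \<in> Tm n ==> pull (snd (rp n t)) (w (fst (rp n t))) = pull (snd t) (w (fst t))"
 using theta_rpt by (simp add: theta_def)

lemma pres_presheaf: "presheaf (\<lambda>n. rp n ` Tm n) (tact \<Gamma> w R) (\<lambda>n t. pull (snd t) (w (fst t)))"
 unfolding presheaf_def
proof (intro conjI allI ballI impI)
 fix n
 have "Tm n \<subseteq> \<Gamma> \<times> box_maps" by (auto simp: terms_def)
 then show "small TYPE('u) (rp n ` Tm n)"
  using small_subset[OF _ small_Sigma[OF sm small_box_maps]] by (intro small_image) blast
next
 fix F e assume F: "F \<in> box_maps" and "e \<in> rp (btgt F) ` Tm (btgt F)"
 then obtain t where t: "t \<in> Tm (btgt F)" "e = rp (btgt F) t" by blast
 then have b: "snd t \<in> box_maps" "btgt F = bsrc (snd t)" by (auto simp: terms_def)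
 show "tact \<Gamma> w R F e \<in> rp (bsrc F) ` Tm (bsrc F)"
  unfolding t(2) tact_rpt[OF t(1) F] using terms_comp[OF t(1) F] by blast
 show "pull (snd (tact \<Gamma> w R F e)) (w (fst (tact \<Gamma> w R F e))) = pull F (pull (snd e) (w (fst e)))"
  unfolding t(2) tact_rpt[OF t(1) F] rpt_word[OF t(1)] rpt_word[OF terms_comp[OF t(1) F]]
  using pull_comp[OF F b, of "w (fst t)"] by simp
next
 fix n e assume "e \<in> rp n ` Tm n"
 then obtain t where t: "t \<in> Tm n" "e = rp n t" by blast
 then have b: "snd t \<in> box_maps" "bsrc (snd t) = n" "btgt (snd t) = length (w (fst t))" "fst t \<in> \<Gamma>" by (auto simp: terms_def)
 show "tact \<Gamma> w R (bid n) e = e"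
  unfolding t(2) using tact_rpt[of t "bid n"] t(1) box_id bcomp_bid(1)[OF b(1)] b(2) by simp
 show "pull (snd e) (w (fst e)) \<in> words \<Sigma> n"
  unfolding t(2) rpt_word[OF t(1)] using set_pull[OF b(1), of "w (fst t)"] length_pull[OF b(1), of "w (fst t)"] b ww
  by (auto simp: words_def)
next
 fix F G e assume F: "F \<in> box_maps" and G: "G \<in> box_maps" and FG: "btgt F = bsrc G" and "e \<in> rp (btgt G) ` Tm (btgt G)"
 then obtain t where t: "t \<in> Tm (btgt G)" "e = rp (btgt G) t" by blast
 then have b: "snd t \<in> box_maps" "btgt G = bsrc (snd t)" by (auto simp: terms_def)
 have tG: "(fst t, bcomp (snd t) G) \<in> Tm (btgt F)" using terms_comp[OF t(1) G] FG by simp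
 show "tact \<Gamma> w R (bcomp G F) e = tact \<Gamma> w R F (tact \<Gamma> w R G e)"
  unfolding t(2) tact_rpt[OF t(1) G]
  using tact_rpt[of t "bcomp G F"] t(1) box_comp[OF F G FG] tact_rpt[OF tG F] bcomp_assoc[OF F G b(1) FG b(2)] FG by simp
qed

abbreviation "Q \<equiv> pres \<Gamma> w R"
abbreviation "gq \<equiv> gen \<Gamma> w R"

lemma Q_realize:
 "Q \<in> Ob LPS" "el Q n = enc (rp n ` Tm n) ` (rp n ` Tm n)"
 "F \<in> box_maps ==> t \<in> Tm (btgt F) ==> act Q F (enc (rp (btgt F) ` Tm (btgt F)) (rp (btgt F) t)) =
   enc (rp (bsrc F) ` Tm (bsrc F)) (rp (bsrc F) (fst t, bcomp (snd t) F))"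
 "t \<in> Tm n ==> wd Q n (enc (rp n ` Tm n) (rp n t)) = pull (snd t) (w (fst t))"
 "inj_on (enc (rp n ` Tm n)) (rp n ` Tm n)"
 using realize[OF pres_presheaf, folded pres_def] tact_rpt rpt_word inj_on_enc[OF presheafD(1)[OF pres_presheaf]]
 by simp_all

lemma gen_term: assumes "\<gamma> \<in> \<Gamma>" shows "(\<gamma>, bid (length (w \<gamma>))) \<in> Tm (length (w \<gamma>))"
 using assms box_id by (simp add: terms_def)

lemma act_gen:
 assumes "\<gamma> \<in> \<Gamma>" "F \<in> box_maps" "btgt F = length (w \<gamma>)"
 shows "act Q F (gq \<gamma>) = enc (rp (bsrc F) ` Tm (bsrc F)) (rp (bsrc F) (\<gamma>, F))"
 using Q_realize(3)[OF assms(2), of "(\<gamma>, bid (btgt F))"] gen_term[OF assms(1)] assms bcomp_bid(2)[OF assms(2)]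
 by (simp add: gen_def Let_def)

lemma Q_generated:
 assumes "e \<in> el Q n" obtains \<gamma> F where "\<gamma> \<in> \<Gamma>" "F \<in> box_maps" "btgt F = length (w \<gamma>)" "bsrc F = n" "e = act Q F (gq \<gamma>)"
proof -
 obtain t where t: "t \<in> Tm n" "e = enc (rp n ` Tm n) (rp n t)" using assms unfolding Q_realize(2) by blast
 have "fst t \<in> \<Gamma>" "snd t \<in> box_maps" "btgt (snd t) = length (w (fst t))" "bsrc (snd t) = n" using t(1) by (auto simp: terms_def)
 then show thesis using that[of "fst t" "snd t"] act_gen[of "fst t" "snd t"] t(2) by simp
qed

lemma Q_valid: "valid \<Gamma> w R Q gq"
 unfolding valid_def
proof (intro conjI ballI)
 fix \<gamma> assume \<gamma>: "\<gamma> \<in> \<Gamma>"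
 show "gq \<gamma> \<in> el Q (length (w \<gamma>))" unfolding Q_realize(2) using gen_term[OF \<gamma>] by (simp add: gen_def Let_def)
 show "wd Q (length (w \<gamma>)) (gq \<gamma>) = w \<gamma>" using Q_realize(4)[OF gen_term[OF \<gamma>]] pull_id[of "w \<gamma>"] by (simp add: gen_def Let_def)
next
 fix q assume q: "q \<in> R"
 obtain \<gamma> F \<delta> H where e: "q = (\<gamma>, F, \<delta>, H)" by (cases q)
 note r = rels_wfD[OF wf q[unfolded e]]
 have "th (bsrc F) (\<gamma>, F) (\<delta>, H)"
  using r q e by (auto simp: theta_def terms_def dest: validD(3))
 then have "rp (bsrc F) (\<gamma>, F) = rp (bsrc F) (\<delta>, H)" using rpt_eq[of "(\<gamma>, F)" "bsrc F" "(\<delta>, H)"] by (simp add: theta_def)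
 then show "case q of (\<gamma>, F, \<delta>, H) \<Rightarrow> act Q F (gq \<gamma>) = act Q H (gq \<delta>)"
  using act_gen[OF r(1,3,5)] act_gen[OF r(2,4,6)] r(7) e by simp
qed

lemma Q_universal:
 assumes z: "paradigm z" and s: "valid \<Gamma> w R z s"
 shows "\<exists>h. pmap Q z h \<and> (\<forall>\<gamma>\<in>\<Gamma>. h (length (w \<gamma>)) (gq \<gamma>) = s \<gamma>)"
proof -
 note pz = presheafD[OF lps_presheaf[OF paradigmD(1)[OF z]]]
 define h where "h = (\<lambda>n e. let t = inv_into (rp n ` Tm n) (enc (rp n ` Tm n)) e in act z (snd t) (s (fst t)))"
 have h: "h n (enc (rp n ` Tm n) (rp n t)) = act z (snd t) (s (fst t))" if t: "t \<in> Tm n" for n t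
 proof -
  have "inv_into (rp n ` Tm n) (enc (rp n ` Tm n)) (enc (rp n ` Tm n) (rp n t)) = rp n t"
   by (rule inv_into_f_f[OF Q_realize(5)]) (use t in blast)
  then show ?thesis using thetaD(4)[OF theta_rpt[OF t] z s] by (simp add: h_def)
 qed
 have hg: "h (bsrc F) (act Q F (gq \<gamma>)) = act z F (s \<gamma>)" if "\<gamma> \<in> \<Gamma>" "F \<in> box_maps" "btgt F = length (w \<gamma>)" for \<gamma> F
  using act_gen[OF that] h[of "(\<gamma>, F)" "bsrc F"] that by (simp add: terms_def)
 have "pmap Q z h" unfolding pmap_def
 proof (intro conjI allI ballI)
  fix n e assume e: "e \<in> el Q n"
  obtain \<gamma> F where f: "\<gamma> \<in> \<Gamma>" "F \<in> box_maps" "btgt F = length (w \<gamma>)" "bsrc F = n" "e = act Q F (gq \<gamma>)" by (rule Q_generated[OF e])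
  note v = validD(1,2)[OF s f(1)] and vq = validD(1,2)[OF Q_valid f(1)]
  show "h n e \<in> el z n" "wd z n (h n e) = wd Q n e"
   using hg[OF f(1-3)] pz(2,3)[OF f(2), of "s \<gamma>"] presheafD(3)[OF lps_presheaf[OF Q_realize(1)] f(2), of "gq \<gamma>"] v vq f(3-5)
   by simp_all
 next
  fix H e assume H: "H \<in> box_maps" and e: "e \<in> el Q (btgt H)"
  obtain \<gamma> F where f: "\<gamma> \<in> \<Gamma>" "F \<in> box_maps" "btgt F = length (w \<gamma>)" "bsrc F = btgt H" "e = act Q F (gq \<gamma>)" by (rule Q_generated[OF e])
  note v = validD(1)[OF s f(1)] and vq = validD(1)[OF Q_valid f(1)]
  have c: "bcomp F H \<in> box_maps" using box_comp[OF H f(2)] f(4) by simp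
  show "h (bsrc H) (act Q H e) = act z H (h (btgt H) e)"
   using hg[OF f(1) c] hg[OF f(1-3)] f(3-5) v vq pz(6)[OF H f(2), of "s \<gamma>"]
    presheafD(6)[OF lps_presheaf[OF Q_realize(1)] H f(2), of "gq \<gamma>"] by simp
 qed
 moreover have "h (length (w \<gamma>)) (gq \<gamma>) = s \<gamma>" if \<gamma>: "\<gamma> \<in> \<Gamma>" for \<gamma>
  using hg[OF \<gamma> box_id, of "length (w \<gamma>)"] validD(1)[OF s \<gamma>] validD(1)[OF Q_valid \<gamma>] pz(4)
   presheafD(4)[OF lps_presheaf[OF Q_realize(1)]] by simp
 ultimately show ?thesis by blast
qed

lemma Q_unique:
 assumes h: "pmap Q z h" "pmap Q z k" and e: "\<And>\<gamma>. \<gamma> \<in> \<Gamma> ==> h (length (w \<gamma>)) (gq \<gamma>) = k (length (w \<gamma>)) (gq \<gamma>)" and q: "q \<in> el Q n"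
 shows "h n q = k n q"
proof -
 obtain \<gamma> F where f: "\<gamma> \<in> \<Gamma>" "F \<in> box_maps" "btgt F = length (w \<gamma>)" "bsrc F = n" "q = act Q F (gq \<gamma>)" by (rule Q_generated[OF q])
 show ?thesis
  using pmapD(3)[OF h(1) f(2), of "gq \<gamma>"] pmapD(3)[OF h(2) f(2), of "gq \<gamma>"] validD(1)[OF Q_valid f(1)] e[OF f(1)] f(3-5) by simp
qed

text \<open>Interpretations are maps out of the presented object, and they separate its elements by construction.\<close>

lemma Q_paradigm: "paradigm Q"
proof (rule paradigm_separated[OF Q_realize(1)])
 fix n c c' assume c: "c \<in> el Q n" and c': "c' \<in> el Q n" and wd: "wd Q n c = wd Q n c'"
  and sep: "\<And>z f. paradigm z ==> pmap Q z f ==> f n c = f n c'"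
 obtain \<gamma> F where f: "\<gamma> \<in> \<Gamma>" "F \<in> box_maps" "btgt F = length (w \<gamma>)" "bsrc F = n" "c = act Q F (gq \<gamma>)" by (rule Q_generated[OF c])
 obtain \<delta> H where d: "\<delta> \<in> \<Gamma>" "H \<in> box_maps" "btgt H = length (w \<delta>)" "bsrc H = n" "c' = act Q H (gq \<delta>)" by (rule Q_generated[OF c'])
 have t: "(\<gamma>, F) \<in> Tm n" "(\<delta>, H) \<in> Tm n" using f d by (simp_all add: terms_def)
 have ce: "c = enc (rp n ` Tm n) (rp n (\<gamma>, F))" "c' = enc (rp n ` Tm n) (rp n (\<delta>, H))"
  using act_gen[OF f(1-3)] act_gen[OF d(1-3)] f(4,5) d(4,5) by simp_all
 have "act z F (s \<gamma>) = act z H (s \<delta>)" if z: "paradigm z" and s: "valid \<Gamma> w R z s" for z s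
 proof -
  obtain h where h: "pmap Q z h" "\<forall>\<gamma>\<in>\<Gamma>. h (length (w \<gamma>)) (gq \<gamma>) = s \<gamma>" using Q_universal[OF z s] by blast
  show ?thesis
   using sep[OF z h(1)] pmapD(3)[OF h(1) f(2), of "gq \<gamma>"] pmapD(3)[OF h(1) d(2), of "gq \<delta>"]
    validD(1)[OF Q_valid f(1)] validD(1)[OF Q_valid d(1)] h(2) f d by simp
 qed
 moreover have "pull F (w \<gamma>) = pull H (w \<delta>)" using wd Q_realize(4)[OF t(1)] Q_realize(4)[OF t(2)] ce by simp
 ultimately have "th n (\<gamma>, F) (\<delta>, H)" using t by (simp add: theta_def)
 then show "c = c'" using rpt_eq[OF t] ce by simp
qed

end

subsection \<open>Colimits and reflection\<close>

text \<open>
 The object presented by all elements of the diagram, with the action of maps of cubes and the arrows of the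
 diagram as relations, receives a cocone that is universal among those to objects satisfying the paradigm.
\<close>

lemma universal_cocone:
 assumes F: "is_functor J LPS F" and J: "small TYPE('u) (Ob J)"
 shows "\<exists>Z c. paradigm Z \<and> is_cocone J LPS F Z c \<and>
   (\<forall>n. \<forall>z\<in>el Z n. \<exists>j\<in>Ob J. \<exists>e\<in>el (fst F j) n. z = ap (c j) n e) \<and>
   (\<forall>Z' c'. paradigm Z' \<longrightarrow> is_cocone J LPS F Z' c' \<longrightarrow>
    (\<exists>!h. h \<in> hom LPS Z Z' \<and> (\<forall>j\<in>Ob J. Comp LPS h (c j) = c' j)))"
proof -
 note C = is_category_LPS and JC = functorD(1)[OF F] and Fo = functorD(3)[OF F] and Fa = functorD(4)[OF F]
 define \<Gamma> where "\<Gamma> = (SIGMA j:Ob J. SIGMA n:UNIV. el (fst F j) n)"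
 define w where "w = (\<lambda>(j, n, e). wd (fst F j) n e)"
 define R where "R = {((j, btgt H, e), H, (j, bsrc H, act (fst F j) H e), bid (bsrc H)) | j H e.
   j \<in> Ob J \<and> H \<in> box_maps \<and> e \<in> el (fst F j) (btgt H)} \<union>
  {((i, n, e), bid n, (j, n, ap (snd F a) n e), bid n) | i j a n e. a \<in> hom J i j \<and> e \<in> el (fst F i) n}"
 note pr = presheafD[OF lps_presheaf[OF Fo]]
 have lw: "length (w (j, n, e)) = n" if "j \<in> Ob J" "e \<in> el (fst F j) n" for j n e
  using pr(5)[OF that] by (simp add: w_def words_def)
 have pm: "pmap (fst F i) (fst F j) (ap (snd F a))" if "a \<in> hom J i j" for a i j by (rule hom_ap(1)[OF Fa[OF that]])
 have sm: "small TYPE('u) \<Gamma>" unfolding \<Gamma>_def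
  by (rule small_Sigma[OF J small_Sigma[OF small_countable[of "UNIV :: nat set"] pr(1)]]) auto
 have ww: "w ` \<Gamma> \<subseteq> lists \<Sigma>" using pr(5) by (fastforce simp: \<Gamma>_def w_def words_def)
 have wf: "rels_wf \<Gamma> w R" unfolding rels_wf_def
 proof
  fix q assume "q \<in> R"
  then consider (1) j H e where "q = ((j, btgt H, e), H, (j, bsrc H, act (fst F j) H e), bid (bsrc H))"
    "j \<in> Ob J" "H \<in> box_maps" "e \<in> el (fst F j) (btgt H)"
   | (2) i j a n e where "q = ((i, n, e), bid n, (j, n, ap (snd F a) n e), bid n)" "a \<in> hom J i j" "e \<in> el (fst F i) n"
   unfolding R_def by blast
  then show "case q of (\<gamma>, F, \<delta>, H) \<Rightarrow> \<gamma> \<in> \<Gamma> \<and> \<delta> \<in> \<Gamma> \<and> F \<in> box_maps \<and> H \<in> box_maps \<and> btgt F = length (w \<gamma>) \<and>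
   btgt H = length (w \<delta>) \<and> bsrc F = bsrc H \<and> pull F (w \<gamma>) = pull H (w \<delta>)"
  proof cases
   case 1
   note a = pr(2)[OF 1(2-4)]
   have "pull (bid (bsrc H)) (w (j, bsrc H, act (fst F j) H e)) = w (j, bsrc H, act (fst F j) H e)"
    by (rule pull_id[OF lw[OF 1(2) a]])
   then show ?thesis using 1 a pr(3)[OF 1(2-4)] lw[OF 1(2,4)] lw[OF 1(2) a] box_id[of "bsrc H"]
    by (simp add: \<Gamma>_def) (simp add: w_def)
  next
   case 2
   note o = catD(8,9)[OF JC 2(2)] and a = pmapD(1,2)[OF pm[OF 2(2)] 2(3)]
   show ?thesis using 2 o a lw[OF o(1) 2(3)] lw[OF o(2) a(1)] box_id[of n]
    by (simp add: \<Gamma>_def) (simp add: w_def)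
  qed
 qed
 note Qp = Q_paradigm[OF sm ww wf] and Qv = Q_valid[OF sm ww wf] and Qu = Q_universal[OF sm ww wf] and Qe = Q_unique[OF sm ww wf]
  and Qg = Q_generated[OF sm ww wf]
 let ?Q = "pres \<Gamma> w R"
 have \<Gamma>I: "(j, n, e) \<in> \<Gamma>" if "j \<in> Ob J" "e \<in> el (fst F j) n" for j n e using that by (simp add: \<Gamma>_def)
 have R1: "((j, btgt H, e), H, (j, bsrc H, act (fst F j) H e), bid (bsrc H)) \<in> R"
  if "j \<in> Ob J" "H \<in> box_maps" "e \<in> el (fst F j) (btgt H)" for j H e using that unfolding R_def by blast
 have R2: "((i, n, e), bid n, (j, n, ap (snd F a) n e), bid n) \<in> R"
  if "a \<in> hom J i j" "e \<in> el (fst F i) n" for i j a n e using that unfolding R_def by blast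
 have v_pmap: "pmap (fst F j) z (\<lambda>n e. s (j, n, e))" if z: "z \<in> Ob LPS" and s: "valid \<Gamma> w R z s" and j: "j \<in> Ob J" for z s j
  unfolding pmap_def
 proof (intro conjI allI ballI)
  note v = validD[OF s] and pz = presheafD[OF lps_presheaf[OF z]]
  fix n e assume e: "e \<in> el (fst F j) n"
  show "s (j, n, e) \<in> el z n" "wd z n (s (j, n, e)) = wd (fst F j) n e"
   using v(1,2)[OF \<Gamma>I[OF j e]] lw[OF j e] by (simp_all add: w_def)
 next
  note v = validD[OF s] and pz = presheafD[OF lps_presheaf[OF z]]
  fix H e assume H: "H \<in> box_maps" "e \<in> el (fst F j) (btgt H)"
  note a = pr(2)[OF j H]
  show "s (j, bsrc H, act (fst F j) H e) = act z H (s (j, btgt H, e))"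
   using v(3)[OF R1[OF j H]] v(1)[OF \<Gamma>I[OF j a]] lw[OF j a] pz(4) by simp
 qed
 have v_comp: "s (j, n, ap (snd F a) n e) = s (i, n, e)"
  if z: "z \<in> Ob LPS" and s: "valid \<Gamma> w R z s" and a: "a \<in> hom J i j" and e: "e \<in> el (fst F i) n" for z s i j a n e
 proof -
  note v = validD[OF s] and pz = presheafD[OF lps_presheaf[OF z]] and o = catD(8,9)[OF JC a]
  note fe = pmapD(1)[OF pm[OF a] e]
  show ?thesis
   using v(3)[OF R2[OF a e]] v(1)[OF \<Gamma>I[OF o(1) e]] lw[OF o(1) e] v(1)[OF \<Gamma>I[OF o(2) fe]] lw[OF o(2) fe] pz(4) by simp
 qed
 note Qo = paradigmD(1)[OF Qp]
 define c where "c = (\<lambda>j. mk_arr (fst F j) (\<lambda>n e. gen \<Gamma> w R (j, n, e)) ?Q)"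
 have ch: "c j \<in> hom LPS (fst F j) ?Q" if "j \<in> Ob J" for j
  unfolding c_def by (rule mk_arr_hom[OF Fo[OF that] Qo v_pmap[OF Qo Qv that]])
 have capp: "ap (c j) n e = gen \<Gamma> w R (j, n, e)" if "e \<in> el (fst F j) n" for j n e using that by (simp add: c_def)
 have cocone: "is_cocone J LPS F ?Q c" unfolding is_cocone_def
 proof (intro conjI ballI F Qo ch)
  fix a assume "a \<in> Ar J"
  note a = Ar_hom[OF this] and o = catD(1,2)[OF JC this]
  show "Comp LPS (c (Cod J a)) (snd F a) = c (Dom J a)"
  proof (rule lps_hom_eqI[OF catD(4)[OF C Fa[OF a] ch[OF o(2)]] ch[OF o(1)]])
   fix n e assume e: "e \<in> el (fst F (Dom J a)) n"
   show "ap (Comp LPS (c (Cod J a)) (snd F a)) n e = ap (c (Dom J a)) n e"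
    using LPS_comp[OF Fa[OF a] ch[OF o(2)] e] capp[OF e] capp[OF pmapD(1)[OF pm[OF a] e]] v_comp[OF Qo Qv a e] by simp
  qed
 qed
 have gener: "\<exists>j\<in>Ob J. \<exists>e\<in>el (fst F j) n. z = ap (c j) n e" if z: "z \<in> el ?Q n" for n z
 proof -
  obtain \<gamma> H where h: "\<gamma> \<in> \<Gamma>" "H \<in> box_maps" "btgt H = length (w \<gamma>)" "bsrc H = n" "z = act ?Q H (gen \<Gamma> w R \<gamma>)" by (rule Qg[OF z])
  obtain j m e where \<gamma>: "\<gamma> = (j, m, e)" "j \<in> Ob J" "e \<in> el (fst F j) m" using h(1) by (auto simp: \<Gamma>_def)
  have m: "e \<in> el (fst F j) (btgt H)" using \<gamma> h(3) lw[OF \<gamma>(2,3)] by simp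
  note a = pr(2)[OF \<gamma>(2) h(2) m]
  have "ap (c j) n (act (fst F j) H e) = z"
   using pmapD(3)[OF v_pmap[OF Qo Qv \<gamma>(2)] h(2) m] capp[OF a] h(3-5) \<gamma>(1) lw[OF \<gamma>(2,3)] by simp
  then show ?thesis using \<gamma>(2) a h(4) by blast
 qed
 have univ: "\<exists>!h. h \<in> hom LPS ?Q Z' \<and> (\<forall>j\<in>Ob J. Comp LPS h (c j) = c' j)"
  if Z': "paradigm Z'" and co: "is_cocone J LPS F Z' c'" for Z' c'
 proof -
  note d = coconeD[OF co] and zo = paradigmD(1)[OF Z']
  note d4 = d(4) and pz = presheafD[OF lps_presheaf[OF zo]]
  define s where "s = (\<lambda>(j, n, e). ap (c' j) n e)"
  have "valid \<Gamma> w R Z' s" unfolding valid_def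
  proof (intro conjI ballI)
   fix \<gamma> assume "\<gamma> \<in> \<Gamma>"
   then obtain j n e where \<gamma>: "\<gamma> = (j, n, e)" "j \<in> Ob J" "e \<in> el (fst F j) n" by (auto simp: \<Gamma>_def)
   note p = pmapD[OF hom_ap(1)[OF d4[OF \<gamma>(2)]]]
   show "s \<gamma> \<in> el Z' (length (w \<gamma>))" "wd Z' (length (w \<gamma>)) (s \<gamma>) = w \<gamma>"
    using p(1,2)[OF \<gamma>(3)] lw[OF \<gamma>(2,3)] \<gamma>(1) by (simp_all add: s_def) (simp add: w_def)
  next
   fix q assume "q \<in> R"
   then consider (1) j H e where "q = ((j, btgt H, e), H, (j, bsrc H, act (fst F j) H e), bid (bsrc H))"
     "j \<in> Ob J" "H \<in> box_maps" "e \<in> el (fst F j) (btgt H)"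
    | (2) i j a n e where "q = ((i, n, e), bid n, (j, n, ap (snd F a) n e), bid n)" "a \<in> hom J i j" "e \<in> el (fst F i) n"
    unfolding R_def by blast
   then show "case q of (\<gamma>, F, \<delta>, H) \<Rightarrow> act Z' F (s \<gamma>) = act Z' H (s \<delta>)"
   proof cases
    case 1
    note p = pmapD[OF hom_ap(1)[OF d4[OF 1(2)]]]
    show ?thesis using p(3)[OF 1(3,4)] p(1)[OF pr(2)[OF 1(2-4)]] pz(4) 1(1) by (simp add: s_def)
   next
    case 2
    note o = catD(8,9)[OF JC 2(2)]
    have "ap (c' j) n (ap (snd F a) n e) = ap (c' i) n e"
     using d(5)[OF 2(2)] LPS_comp[OF Fa[OF 2(2)] d4[OF o(2)] 2(3)] by simp
    then show ?thesis using 2(1) by (simp add: s_def)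
   qed
  qed
  then obtain h where h: "pmap ?Q Z' h" "\<forall>\<gamma>\<in>\<Gamma>. h (length (w \<gamma>)) (gen \<Gamma> w R \<gamma>) = s \<gamma>" using Qu[OF Z'] by blast
  have hg: "h n (gen \<Gamma> w R (j, n, e)) = ap (c' j) n e" if "j \<in> Ob J" "e \<in> el (fst F j) n" for j n e
   using h(2) \<Gamma>I[OF that] lw[OF that] by (force simp: s_def)
  note hh = mk_arr_hom[OF Qo zo h(1)]
  show ?thesis
  proof (rule ex1I)
   show "mk_arr ?Q h Z' \<in> hom LPS ?Q Z' \<and> (\<forall>j\<in>Ob J. Comp LPS (mk_arr ?Q h Z') (c j) = c' j)"
   proof (intro conjI hh ballI)
    fix j assume j: "j \<in> Ob J"
    show "Comp LPS (mk_arr ?Q h Z') (c j) = c' j"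
    proof (rule lps_hom_eqI[OF catD(4)[OF C ch[OF j] hh] d4[OF j]])
     fix n e assume e: "e \<in> el (fst F j) n"
     have "gen \<Gamma> w R (j, n, e) \<in> el ?Q n" using pmapD(1)[OF v_pmap[OF Qo Qv j] e] .
     then show "ap (Comp LPS (mk_arr ?Q h Z') (c j)) n e = ap (c' j) n e"
      using LPS_comp[OF ch[OF j] hh e] capp[OF e] hg[OF j e] by simp
    qed
   qed
   fix k assume k: "k \<in> hom LPS ?Q Z' \<and> (\<forall>j\<in>Ob J. Comp LPS k (c j) = c' j)"
   show "k = mk_arr ?Q h Z'"
   proof (rule lps_hom_eqI[OF conjunct1[OF k] hh])
    fix n q assume q: "q \<in> el ?Q n"
    obtain j e where j: "j \<in> Ob J" "e \<in> el (fst F j) n" "q = ap (c j) n e" using gener[OF q] by blast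
    show "ap k n q = ap (mk_arr ?Q h Z') n q"
     using LPS_comp[OF ch[OF j(1)] conjunct1[OF k] j(2)] k j hg[OF j(1,2)] capp[OF j(2)] q by simp
   qed
  qed
 qed
 show ?thesis
  by (rule exI[of _ ?Q], rule exI[of _ c]) (intro conjI Qp cocone allI ballI impI gener univ)
qed

end

text \<open>Universal arrows assemble to a reflection.\<close>

lemma reflectiveI:
 assumes C: "is_category C" and P: "P \<subseteq> Ob C"
  and u: "\<And>X. X \<in> Ob C ==> \<exists>r\<in>P. \<exists>\<eta>\<in>hom C X r. \<forall>Y\<in>P. \<forall>f\<in>hom C X Y. \<exists>!g. g \<in> hom C r Y \<and> Comp C g \<eta> = f"
 shows "reflective_full_subcat C P"
proof -
 from u have "\<forall>X. \<exists>r \<eta>. X \<in> Ob C \<longrightarrow> r \<in> P \<and> \<eta> \<in> hom C X r \<and>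
  (\<forall>Y\<in>P. \<forall>f\<in>hom C X Y. \<exists>!g. g \<in> hom C r Y \<and> Comp C g \<eta> = f)" by blast
 then obtain r \<eta> where r: "\<And>X. X \<in> Ob C ==> r X \<in> P" and \<eta>: "\<And>X. X \<in> Ob C ==> \<eta> X \<in> hom C X (r X)"
  and un: "\<And>X Y f. X \<in> Ob C ==> Y \<in> P ==> f \<in> hom C X Y ==> \<exists>!g. g \<in> hom C (r X) Y \<and> Comp C g (\<eta> X) = f" by metis
 let ?S = "full_subcat C P"
 define R1 where "R1 = (\<lambda>f. THE g. g \<in> hom C (r (Dom C f)) (r (Cod C f)) \<and> Comp C g (\<eta> (Dom C f)) = Comp C (\<eta> (Cod C f)) f)"
 have R1: "R1 f \<in> hom C (r X) (r Y)" "Comp C (R1 f) (\<eta> X) = Comp C (\<eta> Y) f" if f: "f \<in> hom C X Y" for f X Y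
 proof -
  note o = catD(8,9)[OF C f]
  have "\<exists>!g. g \<in> hom C (r X) (r Y) \<and> Comp C g (\<eta> X) = Comp C (\<eta> Y) f"
   by (rule un[OF o(1) r[OF o(2)] catD(4)[OF C f \<eta>[OF o(2)]]])
  from theI'[OF this] show "R1 f \<in> hom C (r X) (r Y)" "Comp C (R1 f) (\<eta> X) = Comp C (\<eta> Y) f"
   using hom_Ar[OF f] by (simp_all add: R1_def)
 qed
 have eq: "g = h" if "X \<in> Ob C" "Y \<in> P" "g \<in> hom C (r X) Y" "h \<in> hom C (r X) Y" "Comp C g (\<eta> X) = Comp C h (\<eta> X)" for g h X Y
  using un[OF that(1,2) catD(4)[OF C \<eta>[OF that(1)] that(4)]] that by metis
 have S: "is_category ?S" by (rule is_category_full[OF C])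
 have RF: "is_functor C ?S (r, R1)"
 proof (rule is_functorI[OF C S])
  fix X assume X: "X \<in> Ob C"
  show "fst (r, R1) X \<in> Ob ?S" using r[OF X] P by auto
  note i = catD(3)[OF C X] and i' = catD(3)[OF C subsetD[OF P r[OF X]]]
  show "snd (r, R1) (Id C X) = Id ?S (fst (r, R1) X)"
   using eq[OF X r[OF X] R1(1)[OF i] i'] R1(2)[OF i] catD(5,6)[OF C \<eta>[OF X]] by simp
 next
  fix f X Y assume f: "f \<in> hom C X Y"
  then show "snd (r, R1) f \<in> hom ?S (fst (r, R1) X) (fst (r, R1) Y)"
   using R1(1)[OF f] r catD(8,9)[OF C f] by (simp add: full_hom)
 next
  fix f g X Y Z assume f: "f \<in> hom C X Y" and g: "g \<in> hom C Y Z"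
  note o = catD(8,9)[OF C f] catD(9)[OF C g] and gf = catD(4)[OF C f g]
  note rf = R1[OF f] and rg = R1[OF g] and rgf = R1[OF gf]
  have "Comp C (Comp C (R1 g) (R1 f)) (\<eta> X) = Comp C (\<eta> Z) (Comp C g f)"
   using catD(7)[OF C \<eta>[OF o(1)] rf(1) rg(1)] rf(2) catD(7)[OF C f \<eta>[OF o(2)] rg(1)] rg(2) catD(7)[OF C f g \<eta>[OF o(3)]] by simp
  then show "snd (r, R1) (Comp C g f) = Comp ?S (snd (r, R1) g) (snd (r, R1) f)"
   using eq[OF o(1) r[OF o(3)] rgf(1) catD(4)[OF C rf(1) rg(1)]] rgf(2) by simp
 qed
 have IF: "is_functor ?S C id_functor"
  by (rule is_functorI[OF S C]) (auto simp: id_functor_def dest: full_homD)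
 have "is_nat_trans C C id_functor (comp_functor id_functor (r, R1)) \<eta>"
 proof (rule is_nat_transI)
  show "is_functor C C id_functor" by (rule is_functor_id[OF C])
  show "is_functor C C (comp_functor id_functor (r, R1))" by (rule is_functor_comp[OF RF IF])
  show "\<eta> X \<in> hom C (fst id_functor X) (fst (comp_functor id_functor (r, R1)) X)" if "X \<in> Ob C" for X
   using \<eta>[OF that] by (simp add: id_functor_def comp_functor_def)
  show "Comp C (\<eta> Y) (snd id_functor f) = Comp C (snd (comp_functor id_functor (r, R1)) f) (\<eta> X)" if "f \<in> hom C X Y" for f X Y
   using R1(2)[OF that] by (simp add: id_functor_def comp_functor_def)
 qed
 moreover have "\<exists>!g. g \<in> hom ?S (fst (r, R1) X) Y \<and> Comp C (snd id_functor g) (\<eta> X) = f"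
  if "X \<in> Ob C" "Y \<in> Ob ?S" "f \<in> hom C X (fst id_functor Y)" for X Y f
  using un[OF that(1), of Y f] that r[OF that(1)] by (simp add: id_functor_def full_hom)
 ultimately have "is_adjunction C ?S (r, R1) id_functor \<eta>"
  unfolding is_adjunction_def using RF IF by blast
 then show ?thesis unfolding reflective_full_subcat_def using P by blast
qed

context small_labels
begin

lemma DD_cocone:
 assumes F: "is_functor J DD F"
 shows "is_functor J LPS F" "is_cocone J DD F Z c \<longleftrightarrow> paradigm Z \<and> is_cocone J LPS F Z c"
proof -
 note d = functorD[OF F]
 show F': "is_functor J LPS F"
  by (rule is_functorI[OF d(1) is_category_LPS]) (use d(3-) paradigmD(1) in \<open>auto simp: DD_simps DD_hom\<close>)
 have "c i \<in> hom DD (fst F i) Z \<longleftrightarrow> c i \<in> hom LPS (fst F i) Z" if "i \<in> Ob J" "paradigm Z" for i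
  using d(3)[OF that(1)] that(2) by (simp add: DD_simps DD_hom)
 then show "is_cocone J DD F Z c \<longleftrightarrow> paradigm Z \<and> is_cocone J LPS F Z c"
  unfolding is_cocone_def using F F' paradigmD(1)[of Z] by (auto simp: DD_simps)
qed

lemma DD_colimit:
 assumes F: "is_functor J DD F" and J: "small TYPE('u) (Ob J)"
 shows "\<exists>Z c. is_colimit J DD F Z c \<and> (\<forall>n. \<forall>z\<in>el Z n. \<exists>j\<in>Ob J. \<exists>e\<in>el (fst F j) n. z = ap (c j) n e)"
proof -
 obtain Z c where Z: "paradigm Z" "is_cocone J LPS F Z c"
  and g: "\<forall>n. \<forall>z\<in>el Z n. \<exists>j\<in>Ob J. \<exists>e\<in>el (fst F j) n. z = ap (c j) n e"
  and u: "\<forall>Z' c'. paradigm Z' \<longrightarrow> is_cocone J LPS F Z' c' \<longrightarrow>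
    (\<exists>!h. h \<in> hom LPS Z Z' \<and> (\<forall>j\<in>Ob J. Comp LPS h (c j) = c' j))"
  using universal_cocone[OF DD_cocone(1)[OF F] J] by blast
 have "is_colimit J DD F Z c" unfolding is_colimit_def
 proof (intro conjI allI impI)
  show "is_cocone J DD F Z c" using Z DD_cocone(2)[OF F] by blast
  fix Z' c' assume "is_cocone J DD F Z' c'"
  then have z: "paradigm Z'" "is_cocone J LPS F Z' c'" using DD_cocone(2)[OF F] by blast+
  have "\<exists>!h. h \<in> hom LPS Z Z' \<and> (\<forall>j\<in>Ob J. Comp LPS h (c j) = c' j)" using u z by blast
  then show "\<exists>!h. h \<in> hom DD Z Z' \<and> (\<forall>i\<in>Ob J. Comp DD h (c i) = c' i)" using Z(1) z(1) by (simp add: DD_hom DD_simps)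
 qed
 then show ?thesis using g by blast
qed

lemma reflective_DD: "reflective_full_subcat LPS {x. paradigm x}"
proof (rule reflectiveI[OF is_category_LPS])
 show "{x. paradigm x} \<subseteq> Ob LPS" using paradigmD(1) by blast
 fix X assume X: "X \<in> Ob LPS"
 let ?J = "poset_cat {()} {((), ())}"
 let ?F = "(\<lambda>_. X, \<lambda>_. Id LPS X) :: (unit, unit \<times> unit, _, _) fctr"
 note C = is_category_LPS and i = catD(3)[OF is_category_LPS X]
 have J: "is_category ?J" by (rule is_categoryI) (auto simp: poset_cat_def hom_def)
 have F: "is_functor ?J LPS ?F" by (rule is_functorI[OF J C]) (use X i catD(5)[OF C i] in simp_all)
 have co: "is_cocone ?J LPS ?F Z c \<longleftrightarrow> c () \<in> hom LPS X Z" for Z c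
  using catD(5)[OF C, of "c ()" X Z] catD(9)[OF C, of "c ()" X Z] F by (auto simp: is_cocone_def poset_cat_def)
 have O: "Ob ?J = {()}" by (simp add: poset_cat_def)
 obtain Z c where Z: "paradigm Z" "c () \<in> hom LPS X Z"
  and u: "\<And>Z' c'. paradigm Z' ==> c' () \<in> hom LPS X Z' ==> \<exists>!h. h \<in> hom LPS Z Z' \<and> Comp LPS h (c ()) = c' ()"
  using universal_cocone[OF F] small_finite[of "{()}"] unfolding co O by auto
 show "\<exists>r\<in>{x. paradigm x}. \<exists>\<eta>\<in>hom LPS X r. \<forall>Y\<in>{x. paradigm x}. \<forall>f\<in>hom LPS X Y. \<exists>!g. g \<in> hom LPS r Y \<and> Comp LPS g \<eta> = f"
  using Z u[of _ "\<lambda>_. _"] by blast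
qed

lemma cocomplete_DD: "cocomplete TYPE('u) DD"
 unfolding cocomplete_def using is_category_DD DD_colimit by blast

end

section \<open>Directed colimits of objects satisfying the paradigm\<close>

lemma poset_hom: "r \<subseteq> I \<times> I ==> hom (poset_cat I r) i j = (if (i, j) \<in> r then {(i, j)} else {})"
 by (auto simp: hom_def poset_cat_def)

lemma poset_simps:
 "Ob (poset_cat I r) = I" "Id (poset_cat I r) i = (i, i)" "Comp (poset_cat I r) b a = (fst a, snd b)"
 "Dom (poset_cat I r) = fst" "Cod (poset_cat I r) = snd"
 by (simp_all add: poset_cat_def)

lemma directedD:
 assumes "directed_poset I r"
 shows "r \<subseteq> I \<times> I" "i \<in> I ==> (i, i) \<in> r" "(i, j) \<in> r ==> (j, k) \<in> r ==> (i, k) \<in> r" "I \<noteq> {}"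
  "i \<in> I ==> j \<in> I ==> \<exists>k\<in>I. (i, k) \<in> r \<and> (j, k) \<in> r"
 using assms partial_order_onD[of I r] unfolding directed_poset_def
 by (auto dest: refl_onD transD)

lemma is_category_poset: assumes "directed_poset I r" shows "is_category (poset_cat I r)"
proof (rule is_categoryI)
 note d = directedD[OF assms]
 note h = poset_hom[OF d(1)]
 show "Dom (poset_cat I r) f \<in> Ob (poset_cat I r) \<and> Cod (poset_cat I r) f \<in> Ob (poset_cat I r)"
  if "f \<in> Ar (poset_cat I r)" for f using that by (auto simp: poset_cat_def)
 show "Id (poset_cat I r) X \<in> hom (poset_cat I r) X X" if "X \<in> Ob (poset_cat I r)" for X
  using that d(2) by (simp add: h poset_simps)
 show "Comp (poset_cat I r) g f \<in> hom (poset_cat I r) X Z"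
  if "f \<in> hom (poset_cat I r) X Y" "g \<in> hom (poset_cat I r) Y Z" for f g X Y Z
  using that d(3) by (auto simp: h poset_simps split: if_splits)
qed (auto simp: poset_hom[OF directedD(1)[OF assms]] poset_simps split: if_splits)

text \<open>Finitely many facts that each hold from some stage on hold together at one stage.\<close>

lemma directed_finite_stage:
 assumes d: "directed_poset I r" and S: "finite S" and i: "i \<in> I"
  and ex: "\<And>s. s \<in> S ==> \<exists>k. (i, k) \<in> r \<and> \<Phi> s k"
  and mono: "\<And>s k l. s \<in> S ==> (i, k) \<in> r ==> (k, l) \<in> r ==> \<Phi> s k ==> \<Phi> s l"
 shows "\<exists>k. (i, k) \<in> r \<and> (\<forall>s\<in>S. \<Phi> s k)"
 using S ex mono
proof (induction S)
 case empty
 then show ?case using directedD(2)[OF d i] by blast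
next
 case (insert s S)
 note dd = directedD[OF d]
 obtain k where k: "(i, k) \<in> r" "\<forall>s\<in>S. \<Phi> s k" using insert.IH insert.prems by blast
 obtain l where l: "(i, l) \<in> r" "\<Phi> s l" using insert.prems(1) by blast
 obtain m where m: "(k, m) \<in> r" "(l, m) \<in> r" using dd(5)[of k l] k(1) l(1) dd(1) by blast
 have "\<forall>t\<in>insert s S. \<Phi> t m" using insert.prems(2) k l m by blast
 then show ?case using dd(3)[OF k(1) m(1)] by blast
qed

context small_labels
begin

context
 fixes I :: "'u set" and r :: "'u rel" and F :: "('u, 'u \<times> 'u, 'u precub_arrow, 'u lps_arrow) fctr"
 assumes dir: "directed_poset I r" and F: "is_functor (poset_cat I r) DD F"
begin

abbreviation "stage i \<equiv> fst F i"
definition push :: "'u \<Rightarrow> 'u \<Rightarrow> nat \<Rightarrow> 'u \<Rightarrow> 'u" where "push i j = ap (snd F (i, j))"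

lemma stage: "i \<in> I ==> paradigm (stage i)" "i \<in> I ==> stage i \<in> Ob LPS"
 using functorD(3)[OF F, of i] paradigmD(1) by (simp_all add: poset_simps DD_simps)

lemma r_I: "(i, j) \<in> r ==> i \<in> I \<and> j \<in> I" using directedD(1)[OF dir] by blast

lemma push_hom: "(i, j) \<in> r ==> snd F (i, j) \<in> hom LPS (stage i) (stage j)"
 using functorD(4)[OF F, of "(i, j)" i j] poset_hom[OF directedD(1)[OF dir]] DD_hom by simp

lemma push_pmap: "(i, j) \<in> r ==> pmap (stage i) (stage j) (push i j)"
 unfolding push_def by (rule hom_ap(1)[OF push_hom])

lemma push_el: "(i, j) \<in> r ==> e \<in> el (stage i) n ==> push i j n e \<in> el (stage j) n"
 using pmapD(1)[OF push_pmap] .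

lemma push_id: assumes "i \<in> I" "e \<in> el (stage i) n" shows "push i i n e = e"
 using functorD(5)[OF F, of i] LPS_id[OF stage(2)[OF assms(1)] assms(2)] assms(1) by (simp add: poset_simps DD_simps push_def)

lemma push_push:
 assumes "(i, j) \<in> r" "(j, k) \<in> r" "e \<in> el (stage i) n" shows "push j k n (push i j n e) = push i k n e"
 using functorD(6)[OF F, of "(i, j)" i j "(j, k)" k] poset_hom[OF directedD(1)[OF dir]] assms(1,2)
  LPS_comp[OF push_hom[OF assms(1)] push_hom[OF assms(2)] assms(3)] by (simp add: poset_simps DD_simps push_def)

definition later :: "nat \<Rightarrow> 'u \<times> 'u \<Rightarrow> 'u \<times> 'u \<Rightarrow> bool" where
 "later n a b \<longleftrightarrow> (\<exists>k. (fst a, k) \<in> r \<and> (fst b, k) \<in> r \<and> push (fst a) k n (snd a) = push (fst b) k n (snd b))"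

text \<open>
 A cocone is a cocone of germs when it is jointly surjective and two elements become equal in the
 target only if they become equal at some stage. Chains of parallel edges, being finite, then lift
 to a stage, and so do the hypotheses of the paradigm.
\<close>

definition germs :: "'u precub_arrow \<Rightarrow> ('u \<Rightarrow> nat \<Rightarrow> 'u \<Rightarrow> 'u) \<Rightarrow> bool" where
 "germs D d \<longleftrightarrow> D \<in> Ob LPS \<and> (\<forall>i\<in>I. pmap (stage i) D (d i)) \<and>
   (\<forall>n. \<forall>z\<in>el D n. \<exists>i\<in>I. \<exists>e\<in>el (stage i) n. z = d i n e) \<and>
   (\<forall>n. \<forall>i\<in>I. \<forall>j\<in>I. \<forall>e\<in>el (stage i) n. \<forall>e'\<in>el (stage j) n. d i n e = d j n e' \<longleftrightarrow> later n (i, e) (j, e'))"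

context
 fixes D d assumes germs: "germs D d"
begin

lemma germs_Ob: "D \<in> Ob LPS" using germs by (simp add: germs_def)

lemma germs_pmap: "i \<in> I ==> pmap (stage i) D (d i)" using germs unfolding germs_def by blast

lemma germs_surj: assumes "z \<in> el D n" obtains i e where "i \<in> I" "e \<in> el (stage i) n" "z = d i n e"
 using germs assms unfolding germs_def by blast

lemma germs_eq:
 assumes "i \<in> I" "j \<in> I" "e \<in> el (stage i) n" "e' \<in> el (stage j) n"
 shows "d i n e = d j n e' \<longleftrightarrow> (\<exists>k. (i, k) \<in> r \<and> (j, k) \<in> r \<and> push i k n e = push j k n e')"
 using germs assms unfolding germs_def later_def by simp

lemma germs_step: assumes "(i, j) \<in> r" "e \<in> el (stage i) n" shows "d j n (push i j n e) = d i n e"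
proof -
 have ij: "i \<in> I" "j \<in> I" using r_I[OF assms(1)] by blast+
 note jj = directedD(2)[OF dir ij(2)]
 have "push j j n (push i j n e) = push i j n e" by (rule push_id[OF ij(2) push_el[OF assms]])
 then show ?thesis using germs_eq[OF ij(2,1) push_el[OF assms] assms(2)] jj assms(1) by blast
qed

text \<open>The cube that exhibits two edges as parallel comes from some stage.\<close>

lemma par1_lift:
 assumes p: "par1 D (d i 1 e) z" and i: "i \<in> I" and e: "e \<in> el (stage i) 1"
 shows "\<exists>k e'. (i, k) \<in> r \<and> e' \<in> el (stage k) 1 \<and> z = d k 1 e' \<and> par1 (stage k) (push i k 1 e) e'"
proof -
 obtain H H' c where h: "H \<in> box_maps" "H' \<in> box_maps" "bsrc H = 1" "bsrc H' = 1" "btgt H = btgt H'" "dirs H = dirs H'"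
  "c \<in> el D (btgt H)" "d i 1 e = act D H c" "z = act D H' c" using p unfolding par1_def by blast
 obtain j b where j: "j \<in> I" "b \<in> el (stage j) (btgt H)" "c = d j (btgt H) b" by (rule germs_surj[OF h(7)])
 have b': "b \<in> el (stage j) (btgt H')" using j(2) h(5) by simp
 note pj = presheafD(2)[OF lps_presheaf[OF stage(2)[OF j(1)]]] and dj = pmapD(3)[OF germs_pmap[OF j(1)]]
 have a: "act (stage j) H b \<in> el (stage j) 1" using pj[OF h(1) j(2)] h(3) by simp
 have "d i 1 e = d j 1 (act (stage j) H b)" using h(8) dj[OF h(1) j(2)] j(3) h(3) by simp
 then obtain k where k: "(i, k) \<in> r" "(j, k) \<in> r" "push i k 1 e = push j k 1 (act (stage j) H b)"
  using germs_eq[OF i j(1) e a] by blast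
 have kI: "k \<in> I" using r_I[OF k(1)] by blast
 note b2 = push_el[OF k(2) j(2)]
 have b3: "push j k (btgt H) b \<in> el (stage k) (btgt H')" using b2 h(5) by simp
 let ?e = "act (stage k) H' (push j k (btgt H) b)"
 have e1: "?e \<in> el (stage k) 1" using presheafD(2)[OF lps_presheaf[OF stage(2)[OF kI]] h(2) b3] h(4) by simp
 have "z = d k 1 ?e"
  using pmapD(3)[OF germs_pmap[OF kI] h(2) b3] germs_step[OF k(2) j(2)] h(4,5,9) j(3) by simp
 moreover have "push i k 1 e = act (stage k) H (push j k (btgt H) b)"
  using k(3) pmapD(3)[OF push_pmap[OF k(2)] h(1) j(2)] h(3) by simp
 then have "par1 (stage k) (push i k 1 e) ?e" unfolding par1_def using h(1-6) b2 by blast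
 ultimately show ?thesis using k(1) e1 by blast
qed

lemma par_step: assumes "(i, j) \<in> r" "par (stage i) e e'" shows "par (stage j) (push i j 1 e) (push i j 1 e')"
 by (rule pmap_par[OF stage(2) push_pmap[OF assms(1)] assms(2)]) (use r_I[OF assms(1)] in blast)

lemma par_lift:
 assumes p: "par D (d i 1 e) z" and i: "i \<in> I" and e: "e \<in> el (stage i) 1"
 shows "\<exists>k e'. (i, k) \<in> r \<and> e' \<in> el (stage k) 1 \<and> z = d k 1 e' \<and> par (stage k) (push i k 1 e) e'"
 using p
proof (induction rule: rtranclp_induct)
 case base
 show ?case
  by (rule exI[of _ i], rule exI[of _ e]) (use directedD(2)[OF dir i] push_id[OF i e] e in simp)
next
 case (step y z)
 obtain k f where k: "(i, k) \<in> r" "f \<in> el (stage k) 1" "y = d k 1 f" "par (stage k) (push i k 1 e) f"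
  using step.IH by blast
 have kI: "k \<in> I" using r_I[OF k(1)] by blast
 obtain l f' where l: "(k, l) \<in> r" "f' \<in> el (stage l) 1" "z = d l 1 f'" "par1 (stage l) (push k l 1 f) f'"
  using par1_lift[OF step.hyps(2)[unfolded k(3)] kI k(2)] by blast
 have "par (stage l) (push i l 1 e) (push k l 1 f)"
  using par_step[OF l(1) k(4)] push_push[OF k(1) l(1) e] by simp
 then have "par (stage l) (push i l 1 e) f'" using l(4) by (rule rtranclp.rtrancl_into_rtrancl)
 then show ?case using directedD(3)[OF dir k(1) l(1)] l(2,3) by blast
qed

lemma par_lift_pair:
 assumes p: "par D (d i 1 e) (d i 1 e')" and i: "i \<in> I" and e: "e \<in> el (stage i) 1" "e' \<in> el (stage i) 1"
 shows "\<exists>k. (i, k) \<in> r \<and> par (stage k) (push i k 1 e) (push i k 1 e')"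
proof -
 obtain k f where k: "(i, k) \<in> r" "f \<in> el (stage k) 1" "d i 1 e' = d k 1 f" "par (stage k) (push i k 1 e) f"
  using par_lift[OF p i e(1)] by blast
 have kI: "k \<in> I" using r_I[OF k(1)] by blast
 obtain l where l: "(i, l) \<in> r" "(k, l) \<in> r" "push i l 1 e' = push k l 1 f"
  using k(3) germs_eq[OF i kI e(2) k(2)] by blast
 then show ?thesis using par_step[OF l(2) k(4)] push_push[OF k(1) l(2) e(1)] by auto
qed

lemma eq_lift:
 assumes "i \<in> I" "e \<in> el (stage i) n" "e' \<in> el (stage i) n" "d i n e = d i n e'"
 shows "\<exists>k. (i, k) \<in> r \<and> push i k n e = push i k n e'"
 using germs_eq[OF assms(1,1,2,3)] assms(4) by blast

lemma eq_push:
 assumes "(i, k) \<in> r" "(k, l) \<in> r" "e \<in> el (stage i) n" "e' \<in> el (stage i) n" "push i k n e = push i k n e'"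
 shows "push i l n e = push i l n e'"
 using push_push[OF assms(1,2,3)] push_push[OF assms(1,2,4)] assms(5) by simp

lemma reps_lift:
 assumes i: "i \<in> I" and l: "length us = length vs" and el: "set us \<subseteq> el (stage i) 1" "set vs \<subseteq> el (stage i) 1"
  and e: "map (\<lambda>u. rep D (d i 1 u)) us = map (\<lambda>u. rep D (d i 1 u)) vs"
 shows "\<exists>k. (i, k) \<in> r \<and> (\<forall>t<length us. par (stage k) (push i k 1 (us ! t)) (push i k 1 (vs ! t)))"
proof -
 have "\<exists>k. (i, k) \<in> r \<and> (\<forall>t\<in>{..<length us}. par (stage k) (push i k 1 (us ! t)) (push i k 1 (vs ! t)))"
 proof (rule directed_finite_stage[OF dir _ i])
  fix t assume "t \<in> {..<length us}"
  then have t: "t < length us" by simp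
  have "rep D (d i 1 (us ! t)) = rep D (d i 1 (vs ! t))" using arg_cong[OF e, of "\<lambda>xs. xs ! t"] t l by simp
  then have p: "par D (d i 1 (us ! t)) (d i 1 (vs ! t))" by (simp only: rep_eq)
  show "\<exists>k. (i, k) \<in> r \<and> par (stage k) (push i k 1 (us ! t)) (push i k 1 (vs ! t))"
   by (rule par_lift_pair[OF p i]) (use t l el in auto)
  have u: "us ! t \<in> el (stage i) 1" "vs ! t \<in> el (stage i) 1" using t l el by auto
  show "par (stage m) (push i m 1 (us ! t)) (push i m 1 (vs ! t))"
   if "(i, k) \<in> r" "(k, m) \<in> r" "par (stage k) (push i k 1 (us ! t)) (push i k 1 (vs ! t))" for k m
   using par_step[OF that(2,3)] push_push[OF that(1,2) u(1)] push_push[OF that(1,2) u(2)] by simp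
 qed simp
 then show ?thesis by (simp only: Ball_def lessThan_iff)
qed

lemma edges_push:
 assumes x: "x \<in> Ob LPS" and f: "pmap x y f" and c: "c \<in> el x n"
 shows "acts y n (f n c) = map (\<lambda>e. rep y (f 1 e)) (map (\<lambda>t. act x (edge n t) c) [0..<n])"
 using pmapD(3)[OF f, of "edge n _" c] edge_box[of _ n] c by (simp add: acts_def)

lemma edges_el: "x \<in> Ob LPS ==> c \<in> el x n ==> set (map (\<lambda>t. act x (edge n t) c) [0..<n]) \<subseteq> el x 1"
 using el_edge[of x c n] by auto

lemma germs_common:
 assumes "finite C" "\<And>c. c \<in> C ==> snd c \<in> el D (fst c)"
 shows "\<exists>i\<in>I. \<forall>c\<in>C. \<exists>e. e \<in> el (stage i) (fst c) \<and> snd c = d i (fst c) e"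
proof -
 obtain i where i: "i \<in> I" using directedD(4)[OF dir] by blast
 have "\<exists>k. (i, k) \<in> r \<and> (\<forall>c\<in>C. \<exists>e. e \<in> el (stage k) (fst c) \<and> snd c = d k (fst c) e)"
 proof (rule directed_finite_stage[OF dir assms(1) i])
  have lift: "\<exists>e. e \<in> el (stage l) (fst c) \<and> snd c = d l (fst c) e"
   if kl: "(k, l) \<in> r" and ex: "\<exists>e. e \<in> el (stage k) (fst c) \<and> snd c = d k (fst c) e" for c k l
   using ex push_el[OF kl] germs_step[OF kl] by metis
  then show "\<exists>e. e \<in> el (stage l) (fst c) \<and> snd c = d l (fst c) e"
   if "(k, l) \<in> r" "\<exists>e. e \<in> el (stage k) (fst c) \<and> snd c = d k (fst c) e" for c k l using that by blast
  fix c assume "c \<in> C"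
  then obtain j e where j: "j \<in> I" "e \<in> el (stage j) (fst c)" "snd c = d j (fst c) e"
   using germs_surj[OF assms(2)] by metis
  obtain k where k: "(i, k) \<in> r" "(j, k) \<in> r" using directedD(5)[OF dir i j(1)] by blast
  then show "\<exists>k. (i, k) \<in> r \<and> (\<exists>e. e \<in> el (stage k) (fst c) \<and> snd c = d k (fst c) e)" using lift[OF k(2)] j by blast
 qed
 then show ?thesis using r_I by blast
qed

text \<open>
 The given cubes, the equalities between their ends and the chains that identify their actions are all present
 at one stage, where the paradigm yields the equality.
\<close>

lemma paradigm_germs: "paradigm D"
 unfolding paradigm_def
proof (intro conjI allI ballI impI germs_Ob)
 fix p q c a b
 assume c: "c \<in> el D (p + q)" and a: "a \<in> el D p" and b: "b \<in> el D q"
  and eq: "src D p a = src D (p + q) c" "tgt D p a = src D q b" "tgt D q b = tgt D (p + q) c"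
   "acts D (p + q) c = acts D p a @ acts D q b"
 have "\<exists>i\<in>I. \<forall>x\<in>{(p + q, c), (p, a), (q, b)}. \<exists>e. e \<in> el (stage i) (fst x) \<and> snd x = d i (fst x) e"
  by (rule germs_common) (use a b c in auto)
 then obtain i c0 a0 b0 where i: "i \<in> I" and c0: "c0 \<in> el (stage i) (p + q)" "c = d i (p + q) c0"
  and a0: "a0 \<in> el (stage i) p" "a = d i p a0" and b0: "b0 \<in> el (stage i) q" "b = d i q b0" by auto
 let ?X = "stage i"
 note X = stage(2)[OF i] and dp = germs_pmap[OF i]
 note dv = pmap_vtx[OF dp]
 have v: "vtx ?X (replicate p z) a0 \<in> el ?X 0" "vtx ?X (replicate q z) b0 \<in> el ?X 0" "vtx ?X (replicate (p + q) z) c0 \<in> el ?X 0"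
  for z using vtx_el[OF X, of _ "replicate _ z"] a0(1) b0(1) c0(1) by simp_all
 have V: "vtx D (replicate p z) a = d i 0 (vtx ?X (replicate p z) a0)" "vtx D (replicate q z) b = d i 0 (vtx ?X (replicate q z) b0)"
   "vtx D (replicate (p + q) z) c = d i 0 (vtx ?X (replicate (p + q) z) c0)" for z
  using dv[of _ "replicate _ z"] a0 b0 c0 by simp_all
 let ?E = "\<lambda>n c. map (\<lambda>t. act ?X (edge n t) c) [0..<n]"
 let ?us = "?E (p + q) c0" and ?vs = "?E p a0 @ ?E q b0"
 have us: "set ?us \<subseteq> el ?X 1" by (rule edges_el[OF X c0(1)])
 have vs: "set ?vs \<subseteq> el ?X 1" using edges_el[OF X a0(1)] edges_el[OF X b0(1)] by (simp only: set_append Un_least)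
 have len: "length ?us = length ?vs" "length ?us = p + q" by simp_all
 have "map (\<lambda>u. rep D (d i 1 u)) ?us = map (\<lambda>u. rep D (d i 1 u)) ?vs"
  using edges_push[OF X dp c0(1)] edges_push[OF X dp a0(1)] edges_push[OF X dp b0(1)] eq(4) c0(2) a0(2) b0(2)
  by (simp only: map_append)
 then obtain k1 where k1: "(i, k1) \<in> r" "\<forall>t<length ?us. par (stage k1) (push i k1 1 (?us ! t)) (push i k1 1 (?vs ! t))"
  using reps_lift[OF i len(1) us vs] by blast
 let ?S = "{(src ?X p a0, src ?X (p + q) c0), (tgt ?X p a0, src ?X q b0), (tgt ?X q b0, tgt ?X (p + q) c0)}"
 have Se: "fst s \<in> el ?X 0 \<and> snd s \<in> el ?X 0 \<and> d i 0 (fst s) = d i 0 (snd s)" if "s \<in> ?S" for s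
  using that v V eq(1-3) by auto
 have "\<exists>k. (i, k) \<in> r \<and> (\<forall>s\<in>?S. push i k 0 (fst s) = push i k 0 (snd s))"
 proof (rule directed_finite_stage[OF dir _ i])
  fix s assume s: "s \<in> ?S"
  show "\<exists>k. (i, k) \<in> r \<and> push i k 0 (fst s) = push i k 0 (snd s)" using eq_lift[OF i] Se[OF s] by blast
  show "push i l 0 (fst s) = push i l 0 (snd s)"
   if "(i, k) \<in> r" "(k, l) \<in> r" "push i k 0 (fst s) = push i k 0 (snd s)" for k l
   using eq_push[OF that(1,2)] that(3) Se[OF s] by blast
 qed simp
 then obtain k2 where k2: "(i, k2) \<in> r" "\<forall>s\<in>?S. push i k2 0 (fst s) = push i k2 0 (snd s)" by blast
 obtain k where k: "(k1, k) \<in> r" "(k2, k) \<in> r" using directedD(5)[OF dir, of k1 k2] r_I[OF k1(1)] r_I[OF k2(1)] by blast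
 have ik: "(i, k) \<in> r" using directedD(3)[OF dir k1(1) k(1)] .
 have kI: "k \<in> I" using r_I[OF ik] by blast
 let ?Y = "stage k"
 note Y = stage(2)[OF kI] and fp = push_pmap[OF ik]
 have sv: "push i k 0 (fst s) = push i k 0 (snd s)" if "s \<in> ?S" for s
  using eq_push[OF k2(1) k(2)] Se[OF that] k2(2) that by blast
 have pt: "rep ?Y (push i k 1 (?us ! t)) = rep ?Y (push i k 1 (?vs ! t))" if t: "t < length ?us" for t
 proof -
  have u: "?us ! t \<in> el ?X 1" "?vs ! t \<in> el ?X 1"
   by (rule subsetD[OF us nth_mem[OF t]], rule subsetD[OF vs nth_mem[OF t[unfolded len(1)]]])
  show ?thesis unfolding rep_eq
   using par_step[OF k(1) k1(2)[rule_format, OF t]] push_push[OF k1(1) k(1) u(1)] push_push[OF k1(1) k(1) u(2)] by simp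
 qed
 have "map (\<lambda>e. rep ?Y (push i k 1 e)) ?us = map (\<lambda>e. rep ?Y (push i k 1 e)) ?vs"
 proof (rule nth_equalityI)
  show "length (map (\<lambda>e. rep ?Y (push i k 1 e)) ?us) = length (map (\<lambda>e. rep ?Y (push i k 1 e)) ?vs)" by simp
  fix t assume "t < length (map (\<lambda>e. rep ?Y (push i k 1 e)) ?us)"
  then have t: "t < length ?us" "t < length ?vs" by simp_all
  show "map (\<lambda>e. rep ?Y (push i k 1 e)) ?us ! t = map (\<lambda>e. rep ?Y (push i k 1 e)) ?vs ! t"
   unfolding nth_map[OF t(1)] nth_map[OF t(2)] by (rule pt[OF t(1)])
 qed
 then have acts: "acts ?Y (p + q) (push i k (p + q) c0) = acts ?Y p (push i k p a0) @ acts ?Y q (push i k q b0)"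
  using edges_push[OF X fp c0(1)] edges_push[OF X fp a0(1)] edges_push[OF X fp b0(1)] by (simp only: map_append)
 note fv = pmap_vtx[OF fp]
 have FV: "vtx ?Y (replicate p z) (push i k p a0) = push i k 0 (vtx ?X (replicate p z) a0)"
  "vtx ?Y (replicate q z) (push i k q b0) = push i k 0 (vtx ?X (replicate q z) b0)"
  "vtx ?Y (replicate (p + q) z) (push i k (p + q) c0) = push i k 0 (vtx ?X (replicate (p + q) z) c0)" for z
  using fv[of _ "replicate _ z"] a0(1) b0(1) c0(1) by simp_all
 note pc = pmapD(1)[OF fp c0(1)]
 have "push i k p a0 = act ?Y (front p q) (push i k (p + q) c0)"
  by (rule paradigmD(2)[OF stage(1)[OF kI] pc pmapD(1)[OF fp a0(1)] pmapD(1)[OF fp b0(1)] _ _ _ acts])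
   (use sv in \<open>simp_all only: FV\<close>, auto)
 then have "d k p (push i k p a0) = act D (front p q) (d k (p + q) (push i k (p + q) c0))"
  using pmapD(3)[OF germs_pmap[OF kI] front_box(1)[of p q]] pc by simp
 then show "a = act D (front p q) c" using germs_step[OF ik a0(1)] germs_step[OF ik c0(1)] a0(2) c0(2) by simp
next
 fix a b assume a: "a \<in> el D 1" and b: "b \<in> el D 1" and eq: "src D 1 a = src D 1 b" "tgt D 1 a = tgt D 1 b" "wd D 1 a = wd D 1 b"
 have "\<exists>i\<in>I. \<forall>x\<in>{(1, a), (1, b)}. \<exists>e. e \<in> el (stage i) (fst x) \<and> snd x = d i (fst x) e"
  by (rule germs_common) (use a b in auto)
 then obtain i a0 b0 where i: "i \<in> I" and a0: "a0 \<in> el (stage i) 1" "a = d i 1 a0" and b0: "b0 \<in> el (stage i) 1" "b = d i 1 b0"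
  by auto
 let ?X = "stage i"
 note X = stage(2)[OF i] and dp = germs_pmap[OF i]
 have v: "vtx ?X (replicate 1 z) a0 \<in> el ?X 0" "vtx ?X (replicate 1 z) b0 \<in> el ?X 0" for z
  by (rule vtx_el[OF X], use a0(1) b0(1) in simp)+
 have V: "vtx D (replicate 1 z) a = d i 0 (vtx ?X (replicate 1 z) a0)" "vtx D (replicate 1 z) b = d i 0 (vtx ?X (replicate 1 z) b0)" for z
  using pmap_vtx[OF dp, of a0 "replicate 1 z"] pmap_vtx[OF dp, of b0 "replicate 1 z"] a0 b0 by simp_all
 obtain k1 where k1: "(i, k1) \<in> r" "push i k1 0 (src ?X 1 a0) = push i k1 0 (src ?X 1 b0)"
  using eq_lift[OF i v[of False]] eq(1) V[of False] by auto
 obtain k2 where k2: "(i, k2) \<in> r" "push i k2 0 (tgt ?X 1 a0) = push i k2 0 (tgt ?X 1 b0)"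
  using eq_lift[OF i v[of True]] eq(2) V[of True] by auto
 obtain k where k: "(k1, k) \<in> r" "(k2, k) \<in> r" using directedD(5)[OF dir, of k1 k2] r_I[OF k1(1)] r_I[OF k2(1)] by blast
 have ik: "(i, k) \<in> r" using directedD(3)[OF dir k1(1) k(1)] .
 have kI: "k \<in> I" using r_I[OF ik] by blast
 note fp = push_pmap[OF ik]
 have 1: "push i k 0 (src ?X 1 a0) = push i k 0 (src ?X 1 b0)" by (rule eq_push[OF k1(1) k(1) v k1(2)])
 have 2: "push i k 0 (tgt ?X 1 a0) = push i k 0 (tgt ?X 1 b0)" by (rule eq_push[OF k2(1) k(2) v k2(2)])
 have FV: "vtx (stage k) (replicate 1 z) (push i k 1 a0) = push i k 0 (vtx ?X (replicate 1 z) a0)"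
  "vtx (stage k) (replicate 1 z) (push i k 1 b0) = push i k 0 (vtx ?X (replicate 1 z) b0)" for z
  using pmap_vtx[OF fp, of a0 "replicate 1 z"] pmap_vtx[OF fp, of b0 "replicate 1 z"] a0(1) b0(1) by simp_all
 have w: "wd (stage k) 1 (push i k 1 a0) = wd (stage k) 1 (push i k 1 b0)"
  using pmapD(2)[OF fp a0(1)] pmapD(2)[OF fp b0(1)] pmapD(2)[OF dp a0(1)] pmapD(2)[OF dp b0(1)] eq(3) a0(2) b0(2) by simp
 have "push i k 1 a0 = push i k 1 b0"
  by (rule paradigmD(3)[OF stage(1)[OF kI] pmapD(1)[OF fp a0(1)] pmapD(1)[OF fp b0(1)] _ _ w])
   (simp_all only: FV 1 2)
 then show "a = b" using germs_step[OF ik a0(1)] germs_step[OF ik b0(1)] a0(2) b0(2) by simp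
qed

end

text \<open>The germs: pairs of a stage and an element of it, up to equality at a later stage.\<close>

definition stage_els :: "nat \<Rightarrow> ('u \<times> 'u) set" where "stage_els n = (SIGMA i:I. el (stage i) n)"
definition germ :: "nat \<Rightarrow> 'u \<times> 'u \<Rightarrow> 'u \<times> 'u" where "germ n a = (SOME b. b \<in> stage_els n \<and> later n a b)"

lemma later_refl: "a \<in> stage_els n ==> later n a a"
 using directedD(2)[OF dir, of "fst a"] unfolding later_def stage_els_def by fastforce

lemma later_sym: "later n a b ==> later n b a" unfolding later_def by metis

lemma later_trans:
 assumes "later n a b" "later n b c" "a \<in> stage_els n" "b \<in> stage_els n" "c \<in> stage_els n" shows "later n a c"
proof -
 have e: "snd a \<in> el (stage (fst a)) n" "snd b \<in> el (stage (fst b)) n" "snd c \<in> el (stage (fst c)) n"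
  using assms(3-5) by (auto simp: stage_els_def)
 obtain k where k: "(fst a, k) \<in> r" "(fst b, k) \<in> r" "push (fst a) k n (snd a) = push (fst b) k n (snd b)"
  using assms(1) unfolding later_def by blast
 obtain l where l: "(fst b, l) \<in> r" "(fst c, l) \<in> r" "push (fst b) l n (snd b) = push (fst c) l n (snd c)"
  using assms(2) unfolding later_def by blast
 obtain m where m: "(k, m) \<in> r" "(l, m) \<in> r" using directedD(5)[OF dir, of k l] r_I[OF k(1)] r_I[OF l(1)] by blast
 have "push (fst a) m n (snd a) = push (fst c) m n (snd c)"
  using push_push[OF k(1) m(1) e(1)] push_push[OF k(2) m(1) e(2)] push_push[OF l(1) m(2) e(2)]
   push_push[OF l(2) m(2) e(3)] k(3) l(3) by simp
 then show ?thesis unfolding later_def using directedD(3)[OF dir k(1) m(1)] directedD(3)[OF dir l(2) m(2)] by blast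
qed

lemma germ: "a \<in> stage_els n ==> germ n a \<in> stage_els n \<and> later n a (germ n a)"
 unfolding germ_def by (rule someI[of _ a]) (blast intro: later_refl)

lemma germ_eq: assumes "a \<in> stage_els n" "b \<in> stage_els n" shows "germ n a = germ n b \<longleftrightarrow> later n a b"
proof
 assume "germ n a = germ n b"
 then show "later n a b"
  using germ[OF assms(1)] germ[OF assms(2)] later_sym[of n b "germ n b"] later_trans[of n a "germ n a" b] assms by simp
next
 assume l: "later n a b"
 have "(c \<in> stage_els n \<and> later n a c) = (c \<in> stage_els n \<and> later n b c)" for c
  using later_trans[OF l _ assms, of c] later_trans[OF later_sym[OF l] _ assms(2,1), of c] by blast
 then show "germ n a = germ n b" by (simp add: germ_def)
qed

lemma later_word:
 assumes "later n a b" "a \<in> stage_els n" "b \<in> stage_els n"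
 shows "wd (stage (fst a)) n (snd a) = wd (stage (fst b)) n (snd b)"
proof -
 obtain k where k: "(fst a, k) \<in> r" "(fst b, k) \<in> r" "push (fst a) k n (snd a) = push (fst b) k n (snd b)"
  using assms(1) unfolding later_def by blast
 have e: "snd a \<in> el (stage (fst a)) n" "snd b \<in> el (stage (fst b)) n" using assms(2,3) by (auto simp: stage_els_def)
 show ?thesis using pmapD(2)[OF push_pmap[OF k(1)] e(1)] pmapD(2)[OF push_pmap[OF k(2)] e(2)] k(3) by simp
qed

lemma stage_els_act:
 assumes "H \<in> box_maps" "a \<in> stage_els (btgt H)"
 shows "(fst a, act (stage (fst a)) H (snd a)) \<in> stage_els (bsrc H)"
 using presheafD(2)[OF lps_presheaf[OF stage(2)] assms(1), of "fst a" "snd a"] assms(2) by (auto simp: stage_els_def)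

lemma later_act:
 assumes H: "H \<in> box_maps" and a: "a \<in> stage_els (btgt H)" "b \<in> stage_els (btgt H)" and l: "later (btgt H) a b"
 shows "later (bsrc H) (fst a, act (stage (fst a)) H (snd a)) (fst b, act (stage (fst b)) H (snd b))"
proof -
 obtain k where k: "(fst a, k) \<in> r" "(fst b, k) \<in> r" "push (fst a) k (btgt H) (snd a) = push (fst b) k (btgt H) (snd b)"
  using l unfolding later_def by blast
 have e: "snd a \<in> el (stage (fst a)) (btgt H)" "snd b \<in> el (stage (fst b)) (btgt H)" using a by (auto simp: stage_els_def)
 show ?thesis unfolding later_def fst_conv snd_conv
  using pmapD(3)[OF push_pmap[OF k(1)] H e(1)] pmapD(3)[OF push_pmap[OF k(2)] H e(2)] k by auto
qed

definition germ_act :: "bmap \<Rightarrow> 'u \<times> 'u \<Rightarrow> 'u \<times> 'u" where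
 "germ_act H a = germ (bsrc H) (fst a, act (stage (fst a)) H (snd a))"

lemma germ_act: assumes H: "H \<in> box_maps" and a: "a \<in> stage_els (btgt H)"
 shows "germ_act H (germ (btgt H) a) = germ (bsrc H) (fst a, act (stage (fst a)) H (snd a))"
 unfolding germ_act_def
 by (rule germ_eq[OF stage_els_act[OF H] stage_els_act[OF H a], THEN iffD2])
  (rule conjunct1[OF germ[OF a]], rule later_act[OF H _ a later_sym], (use germ[OF a] in blast)+)

lemma germ_word: "a \<in> stage_els n ==> wd (stage (fst (germ n a))) n (snd (germ n a)) = wd (stage (fst a)) n (snd a)"
 using later_word germ by metis

context assumes small_I: "small TYPE('u) I"
begin

lemma germ_presheaf: "presheaf (\<lambda>n. germ n ` stage_els n) germ_act (\<lambda>n a. wd (stage (fst a)) n (snd a))"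
 unfolding presheaf_def
proof (intro conjI allI ballI impI)
 show "small TYPE('u) (germ n ` stage_els n)" for n
  unfolding stage_els_def by (rule small_image[OF small_Sigma[OF small_I presheafD(1)[OF lps_presheaf[OF stage(2)]]]])
next
 fix H e assume H: "H \<in> box_maps" and "e \<in> germ (btgt H) ` stage_els (btgt H)"
 then obtain a where a: "a \<in> stage_els (btgt H)" "e = germ (btgt H) a" by blast
 have aI: "fst a \<in> I" "snd a \<in> el (stage (fst a)) (btgt H)" using a(1) by (auto simp: stage_els_def)
 show "germ_act H e \<in> germ (bsrc H) ` stage_els (bsrc H)"
  unfolding a(2) germ_act[OF H a(1)] using stage_els_act[OF H a(1)] by blast
 show "wd (stage (fst (germ_act H e))) (bsrc H) (snd (germ_act H e)) = pull H (wd (stage (fst e)) (btgt H) (snd e))"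
  unfolding a(2) germ_act[OF H a(1)] germ_word[OF a(1)] germ_word[OF stage_els_act[OF H a(1)]]
  using presheafD(3)[OF lps_presheaf[OF stage(2)[OF aI(1)]] H aI(2)] by simp
next
 fix n e assume "e \<in> germ n ` stage_els n"
 then obtain a where a: "a \<in> stage_els n" "e = germ n a" by blast
 have aI: "fst a \<in> I" "snd a \<in> el (stage (fst a)) n" using a(1) by (auto simp: stage_els_def)
 note p = presheafD[OF lps_presheaf[OF stage(2)[OF aI(1)]]]
 show "germ_act (bid n) e = e" unfolding a(2) using germ_act[OF box_id, of a n] a(1) p(4)[OF aI(2)] by simp
 show "wd (stage (fst e)) n (snd e) \<in> words \<Sigma> n" unfolding a(2) germ_word[OF a(1)] by (rule p(5)[OF aI(2)])
next
 fix H G e assume H: "H \<in> box_maps" and G: "G \<in> box_maps" and HG: "btgt H = bsrc G" and "e \<in> germ (btgt G) ` stage_els (btgt G)"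
 then obtain a where a: "a \<in> stage_els (btgt G)" "e = germ (btgt G) a" by blast
 have aI: "fst a \<in> I" "snd a \<in> el (stage (fst a)) (btgt G)" using a(1) by (auto simp: stage_els_def)
 have aG: "(fst a, act (stage (fst a)) G (snd a)) \<in> stage_els (btgt H)" using stage_els_act[OF G a(1)] HG by simp
 show "germ_act (bcomp G H) e = germ_act H (germ_act G e)"
  unfolding a(2) germ_act[OF G a(1)]
  using germ_act[of "bcomp G H" a] a(1) box_comp[OF H G HG] germ_act[OF H aG]
   presheafD(6)[OF lps_presheaf[OF stage(2)[OF aI(1)]] H G HG aI(2)] HG by simp
qed

lemma germs_exist: "\<exists>D d. germs D d"
proof -
 let ?A = "\<lambda>n. germ n ` stage_els n"
 define D where "D = realize ?A germ_act (\<lambda>n a. wd (stage (fst a)) n (snd a))"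
 define d where "d = (\<lambda>i n e. enc (?A n) (germ n (i, e)))"
 note R = realize[OF germ_presheaf, folded D_def]
 note inj = inj_on_enc[OF presheafD(1)[OF germ_presheaf]]
 have E: "(i, e) \<in> stage_els n" if "i \<in> I" "e \<in> el (stage i) n" for i e n using that by (simp add: stage_els_def)
 have "pmap (stage i) D (d i)" if i: "i \<in> I" for i unfolding pmap_def
 proof (intro conjI allI ballI)
  fix n e assume e: "e \<in> el (stage i) n"
  have g: "germ n (i, e) \<in> ?A n" using E[OF i e] by blast
  show "d i n e \<in> el D n" unfolding R(1) d_def using g by blast
  show "wd D n (d i n e) = wd (stage i) n e" unfolding d_def R(3)[OF g] using germ_word[OF E[OF i e]] by simp
 next
  fix H e assume H: "H \<in> box_maps" and e: "e \<in> el (stage i) (btgt H)"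
  have g: "germ (btgt H) (i, e) \<in> ?A (btgt H)" using E[OF i e] by blast
  show "d i (bsrc H) (act (stage i) H e) = act D H (d i (btgt H) e)"
   unfolding d_def R(2)[OF H g] germ_act[OF H E[OF i e]] by simp
 qed
 moreover have "\<exists>i\<in>I. \<exists>e\<in>el (stage i) n. z = d i n e" if z: "z \<in> el D n" for z n
 proof -
  obtain a where a: "a \<in> stage_els n" "z = enc (?A n) (germ n a)" using z unfolding R(1) by blast
  then have "fst a \<in> I" "snd a \<in> el (stage (fst a)) n" "z = d (fst a) n (snd a)" by (auto simp: stage_els_def d_def)
  then show ?thesis by blast
 qed
 moreover have "d i n e = d j n e' \<longleftrightarrow> later n (i, e) (j, e')"
  if "i \<in> I" "j \<in> I" "e \<in> el (stage i) n" "e' \<in> el (stage j) n" for i j e e' n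
  unfolding d_def using inj_on_eq_iff[OF inj, of "germ n (i, e)" n "germ n (j, e')"] E[OF that(1,3)] E[OF that(2,4)] germ_eq
  by blast
 ultimately have "germs D d" unfolding germs_def using R(4) by blast
 then show ?thesis by blast
qed

text \<open>
 The colimit itself is presented by generators and relations. Comparing it with the germs shows that
 it has the same two properties.
\<close>

lemma directed_colimit:
 assumes Z: "is_colimit (poset_cat I r) DD F Z c"
 shows "z \<in> el Z n ==> \<exists>i\<in>I. \<exists>e\<in>el (stage i) n. z = ap (c i) n e"
  "i \<in> I ==> j \<in> I ==> e \<in> el (stage i) n ==> e' \<in> el (stage j) n ==> ap (c i) n e = ap (c j) n e' ==>
    \<exists>k. (i, k) \<in> r \<and> (j, k) \<in> r \<and> push i k n e = push j k n e'"
proof -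
 note C = is_category_DD
 have O: "Ob (poset_cat I r) = I" by (simp add: poset_simps)
 note co = coconeD[OF colimitD(1)[OF Z]]
 have cL: "c i \<in> hom LPS (stage i) Z" if "i \<in> I" for i using co(4)[of i] that unfolding O DD_hom by blast
 {
  assume z: "z \<in> el Z n"
  obtain Z' c' where Z': "is_colimit (poset_cat I r) DD F Z' c'"
   and s: "\<And>n z. z \<in> el Z' n ==> \<exists>j\<in>I. \<exists>e\<in>el (stage j) n. z = ap (c' j) n e"
   using DD_colimit[OF F] small_I unfolding O by blast
  obtain p where p: "p \<in> hom DD Z Z'" "is_iso DD p" "\<And>i. i \<in> I ==> Comp DD p (c i) = c' i"
   using colimit_unique[OF Z Z'] unfolding O by blast
  obtain q where q: "q \<in> hom DD Z' Z" "Comp DD q p = Id DD Z" using is_isoE[OF p(2) p(1)] by blast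
  have pL: "p \<in> hom LPS Z Z'" and qL: "q \<in> hom LPS Z' Z" using p(1) q(1) unfolding DD_hom by blast+
  have "ap p n z \<in> el Z' n" using pmapD(1)[OF hom_ap(1)[OF pL] z] .
  then obtain j e where j: "j \<in> I" "e \<in> el (stage j) n" "ap p n z = ap (c' j) n e" using s by blast
  have 1: "Comp DD q (c' j) = c j"
   using p(3)[OF j(1)] catD(7)[OF C co(4)[unfolded O, OF j(1)] p(1) q(1)] q(2) catD(6)[OF C co(4)[unfolded O, OF j(1)]] by simp
  have c'L: "c' j \<in> hom LPS (stage j) Z'"
   using coconeD(4)[OF colimitD(1)[OF Z'], of j] j(1) unfolding O DD_hom by blast
  have "z = ap q n (ap p n z)"
   using LPS_comp[OF pL qL z] q(2) LPS_id[OF _ z] paradigmD(1) co(3) by (simp add: DD_simps)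
  also have "\<dots> = ap (c j) n e" using LPS_comp[OF c'L qL j(2)] 1 j(3) by (simp add: DD_simps)
  finally show "\<exists>i\<in>I. \<exists>e\<in>el (stage i) n. z = ap (c i) n e" using j(1,2) by blast
 }
 assume i: "i \<in> I" "j \<in> I" and e: "e \<in> el (stage i) n" "e' \<in> el (stage j) n" and eq: "ap (c i) n e = ap (c j) n e'"
 obtain D d where g: "germs D d" using germs_exist by blast
 note D = germs_Ob[OF g] and PD = paradigm_germs[OF g]
 let ?d = "\<lambda>i. mk_arr (stage i) (d i) D"
 have dh: "?d i \<in> hom LPS (stage i) D" if "i \<in> I" for i by (rule mk_arr_hom[OF stage(2)[OF that] D germs_pmap[OF g that]])
 have "is_cocone (poset_cat I r) LPS F D ?d" unfolding is_cocone_def O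
 proof (intro conjI ballI D DD_cocone(1)[OF F] dh)
  fix a assume "a \<in> Ar (poset_cat I r)"
  then obtain s t where a: "a = (s, t)" "(s, t) \<in> r" by (cases a) (auto simp: poset_cat_def)
  have st: "s \<in> I" "t \<in> I" using r_I[OF a(2)] by blast+
  have "Comp LPS (?d t) (snd F (s, t)) = ?d s"
  proof (rule lps_hom_eqI[OF catD(4)[OF is_category_LPS push_hom[OF a(2)] dh[OF st(2)]] dh[OF st(1)]])
   fix n e assume e: "e \<in> el (stage s) n"
   show "ap (Comp LPS (?d t) (snd F (s, t))) n e = ap (?d s) n e"
    using LPS_comp[OF push_hom[OF a(2)] dh[OF st(2)] e] germs_step[OF g a(2) e] push_el[OF a(2) e] e by (simp add: push_def)
  qed
  then show "Comp LPS (?d (Cod (poset_cat I r) a)) (snd F a) = ?d (Dom (poset_cat I r) a)" by (simp add: a(1) poset_simps)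
 qed
 then have "is_cocone (poset_cat I r) DD F D ?d" using DD_cocone(2)[OF F] PD by blast
 from colimitD(2)[OF Z this] obtain h where h: "h \<in> hom DD Z D" "\<And>i. i \<in> I ==> Comp DD h (c i) = ?d i" unfolding O by blast
 have hL: "h \<in> hom LPS Z D" using h(1) unfolding DD_hom by blast
 have "d i n e = d j n e'"
  using LPS_comp[OF cL[OF i(1)] hL e(1)] LPS_comp[OF cL[OF i(2)] hL e(2)] h(2)[OF i(1)] h(2)[OF i(2)] eq e by (simp add: DD_simps)
 then show "\<exists>k. (i, k) \<in> r \<and> (j, k) \<in> r \<and> push i k n e = push j k n e'" using germs_eq[OF g i e] by blast
qed

end

end

end

section \<open>Finitely presentable objects\<close>

lemma hom_functor_functor:
 assumes C: "is_category C" and K: "K \<in> Ob C" shows "is_functor C set_cat (hom_functor C K)"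
proof (rule is_functorI[OF C is_category_set])
 show "fst (hom_functor C K) X \<in> Ob set_cat" for X by simp
next
 fix f X Y assume f: "f \<in> hom C X Y"
 show "snd (hom_functor C K) f \<in> hom set_cat (fst (hom_functor C K) X) (fst (hom_functor C K) Y)"
  using hom_Ar[OF f] catD(4)[OF C _ f] by (auto simp: set_cat_hom hom_functor_def)
next
 fix X assume X: "X \<in> Ob C"
 show "snd (hom_functor C K) (Id C X) = Id set_cat (fst (hom_functor C K) X)"
  using hom_Ar[OF catD(3)[OF C X]] catD(6)[OF C] by (auto simp: hom_functor_def intro!: restrict_ext)
next
 fix f g X Y Z assume f: "f \<in> hom C X Y" and g: "g \<in> hom C Y Z"
 show "snd (hom_functor C K) (Comp C g f) = Comp set_cat (snd (hom_functor C K) g) (snd (hom_functor C K) f)"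
  using hom_Ar[OF f] hom_Ar[OF g] hom_Ar[OF catD(4)[OF C f g]] catD(4)[OF C _ f] catD(7)[OF C _ f g]
  by (auto simp: hom_functor_def compose_def intro!: restrict_ext)
qed

lemma functor_cocone:
 assumes c: "is_cocone J C F Z c" and H: "is_functor C D H"
 shows "is_cocone J D (comp_functor H F) (fst H Z) (\<lambda>i. snd H (c i))"
proof -
 note d = coconeD[OF c] and h = functorD[OF H]
 note JC = functorD(1)[OF d(1)]
 show ?thesis unfolding is_cocone_def
 proof (intro conjI ballI)
  show "is_functor J D (comp_functor H F)" by (rule is_functor_comp[OF d(1) H])
  show "fst H Z \<in> Ob D" by (rule h(3)[OF d(3)])
  show "snd H (c i) \<in> hom D (fst (comp_functor H F) i) (fst H Z)" if "i \<in> Ob J" for i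
   using h(4)[OF d(4)[OF that]] by (simp add: comp_functor_def)
  fix a assume a: "a \<in> Ar J"
  note a' = Ar_hom[OF a]
  show "Comp D (snd H (c (Cod J a))) (snd (comp_functor H F) a) = snd H (c (Dom J a))"
   using h(6)[OF functorD(4)[OF d(1) a'] d(4)[OF catD(2)[OF JC a]]] d(5)[OF a'] by (simp add: comp_functor_def)
 qed
qed

text \<open>Directed colimits of sets are recognized by joint surjectivity and by equality at a later stage.\<close>

lemma set_directed_colimit:
 assumes dir: "directed_poset I r" and c: "is_cocone (poset_cat I r) set_cat G Z c"
  and surj: "\<And>z. z \<in> Z ==> \<exists>i\<in>I. \<exists>x\<in>fst G i. z = fst (snd (c i)) x"
  and later: "\<And>i j x y. i \<in> I ==> j \<in> I ==> x \<in> fst G i ==> y \<in> fst G j ==> fst (snd (c i)) x = fst (snd (c j)) y ==>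
   \<exists>k. (i, k) \<in> r \<and> (j, k) \<in> r \<and> fst (snd (snd G (i, k))) x = fst (snd (snd G (j, k))) y"
 shows "is_colimit (poset_cat I r) set_cat G Z c"
 unfolding is_colimit_def
proof (intro conjI allI impI c)
 fix Z' c' assume c': "is_cocone (poset_cat I r) set_cat G Z' c'"
 note d = coconeD[OF c, unfolded poset_simps] and d' = coconeD[OF c', unfolded poset_simps]
 note ph = poset_hom[OF directedD(1)[OF dir]]
 obtain u where u: "\<And>i. i \<in> I ==> c i = (fst G i, u i, Z) \<and> u i \<in> fst G i \<rightarrow>\<^sub>E Z"
  using d(4) unfolding set_cat_hom by metis
 obtain u' where u': "\<And>i. i \<in> I ==> c' i = (fst G i, u' i, Z') \<and> u' i \<in> fst G i \<rightarrow>\<^sub>E Z'"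
  using d'(4) unfolding set_cat_hom by metis
 have st: "u' k (fst (snd (snd G (i, k))) x) = u' i x" if ik: "(i, k) \<in> r" and x: "x \<in> fst G i" for i k x
 proof -
  have I: "i \<in> I" "k \<in> I" using ik directedD(1)[OF dir] by blast+
  have h: "(i, k) \<in> hom (poset_cat I r) i k" using ph ik by simp
  obtain v where v: "snd G (i, k) = (fst G i, v, fst G k)" using functorD(4)[OF d(1) h] unfolding set_cat_hom by blast
  have "Comp set_cat (c' k) (snd G (i, k)) = c' i" by (rule d'(5)[OF h])
  then have "compose (fst G i) (u' k) v = u' i" using u'[OF I(1)] u'[OF I(2)] v by simp
  from fun_cong[OF this, of x] show ?thesis using x v by (simp add: compose_eq)
 qed
 have wdf: "u' i x = u' j y" if "i \<in> I" "j \<in> I" "x \<in> fst G i" "y \<in> fst G j" "u i x = u j y" for i j x y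
  using later[OF that(1-4)] u[OF that(1)] u[OF that(2)] that(5) st[OF _ that(3)] st[OF _ that(4)] by fastforce
 define h where "h = (\<lambda>z\<in>Z. SOME v. \<exists>i\<in>I. \<exists>x\<in>fst G i. z = u i x \<and> v = u' i x)"
 have h: "h (u i x) = u' i x" if i: "i \<in> I" and x: "x \<in> fst G i" for i x
 proof -
  have z: "u i x \<in> Z" using u[OF i] x by blast
  have "\<exists>j\<in>I. \<exists>y\<in>fst G j. u i x = u j y \<and> h (u i x) = u' j y"
   unfolding h_def restrict_apply'[OF z] by (rule someI[of _ "u' i x"]) (use i x in blast)
  then show ?thesis using wdf[OF i _ x] by metis
 qed
 have su: "\<exists>i\<in>I. \<exists>x\<in>fst G i. z = u i x" if "z \<in> Z" for z using surj[OF that] u by fastforce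
 have hZ: "h \<in> Z \<rightarrow>\<^sub>E Z'"
 proof (rule PiE_I)
  show "h z \<in> Z'" if "z \<in> Z" for z using su[OF that] h u' by fastforce
 qed (simp add: h_def)
 show "\<exists>!k. k \<in> hom set_cat Z Z' \<and> (\<forall>i\<in>Ob (poset_cat I r). Comp set_cat k (c i) = c' i)"
 proof (rule ex1I[of _ "(Z, h, Z')"])
  have "compose (fst G i) h (u i) = u' i" if i: "i \<in> I" for i
  proof
   show "compose (fst G i) h (u i) x = u' i x" for x using h[OF i, of x] u'[OF i] by (auto simp: compose_def PiE_iff extensional_def)
  qed
  then show "(Z, h, Z') \<in> hom set_cat Z Z' \<and> (\<forall>i\<in>Ob (poset_cat I r). Comp set_cat (Z, h, Z') (c i) = c' i)"
   unfolding poset_simps using u u' hZ by (simp add: set_cat_hom)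
  fix k assume k: "k \<in> hom set_cat Z Z' \<and> (\<forall>i\<in>Ob (poset_cat I r). Comp set_cat k (c i) = c' i)"
  obtain h' where h': "k = (Z, h', Z')" "h' \<in> Z \<rightarrow>\<^sub>E Z'" using k unfolding set_cat_hom by blast
  have "h' z = h z" if z: "z \<in> Z" for z
  proof -
   obtain i x where i: "i \<in> I" "x \<in> fst G i" "z = u i x" using su[OF z] by blast
   have "Comp set_cat k (c i) = c' i" using k i(1) unfolding poset_simps by blast
   then have "compose (fst G i) h' (u i) = u' i" using h'(1) u[OF i(1)] u'[OF i(1)] by simp
   then show ?thesis using h[OF i(1,2)] i(2,3) by (metis compose_eq)
  qed
  then have "h' = h" using h'(2) hZ by (metis PiE_ext)
  then show "k = (Z, h, Z')" using h'(1) by simp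
 qed
qed

context small_labels
begin

text \<open>
 The universal property of a presentation without its construction, which can be transported along a renaming
 of the generators.
\<close>

definition presented :: "'b set \<Rightarrow> ('b \<Rightarrow> 'u list) \<Rightarrow> 'b rels \<Rightarrow> 'u precub_arrow \<Rightarrow> ('b \<Rightarrow> 'u) \<Rightarrow> bool" where
 "presented \<Gamma> w R K g \<longleftrightarrow> paradigm K \<and> valid \<Gamma> w R K g \<and>
   (\<forall>z s. paradigm z \<longrightarrow> valid \<Gamma> w R z s \<longrightarrow> (\<exists>h. pmap K z h \<and> (\<forall>\<gamma>\<in>\<Gamma>. h (length (w \<gamma>)) (g \<gamma>) = s \<gamma>))) \<and>
   (\<forall>z h k. pmap K z h \<longrightarrow> pmap K z k \<longrightarrow> (\<forall>\<gamma>\<in>\<Gamma>. h (length (w \<gamma>)) (g \<gamma>) = k (length (w \<gamma>)) (g \<gamma>)) \<longrightarrow>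
    (\<forall>n. \<forall>q\<in>el K n. h n q = k n q))"

lemma presentedD:
 assumes "presented \<Gamma> w R K g"
 shows "paradigm K" "valid \<Gamma> w R K g"
  "paradigm z ==> valid \<Gamma> w R z s ==> \<exists>h. pmap K z h \<and> (\<forall>\<gamma>\<in>\<Gamma>. h (length (w \<gamma>)) (g \<gamma>) = s \<gamma>)"
  "pmap K z h ==> pmap K z k ==> (\<And>\<gamma>. \<gamma> \<in> \<Gamma> ==> h (length (w \<gamma>)) (g \<gamma>) = k (length (w \<gamma>)) (g \<gamma>)) ==>
    q \<in> el K n ==> h n q = k n q"
 using assms unfolding presented_def by blast+

lemma presented_pres:
 assumes "small TYPE('u) \<Gamma>" "w ` \<Gamma> \<subseteq> lists \<Sigma>" "rels_wf \<Gamma> w R" shows "presented \<Gamma> w R (pres \<Gamma> w R) (gen \<Gamma> w R)"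
 unfolding presented_def
 by (intro conjI allI impI ballI Q_paradigm[OF assms] Q_valid[OF assms] Q_universal[OF assms])
  (assumption | rule Q_unique[OF assms], assumption, assumption, blast)+

lemma presented_arrow_eq:
 assumes K: "presented \<Gamma> w R K g" and f: "f \<in> hom DD K z" "f' \<in> hom DD K z"
  and e: "\<And>\<gamma>. \<gamma> \<in> \<Gamma> ==> ap f (length (w \<gamma>)) (g \<gamma>) = ap f' (length (w \<gamma>)) (g \<gamma>)"
 shows "f = f'"
proof -
 have L: "f \<in> hom LPS K z" "f' \<in> hom LPS K z" using f unfolding DD_hom by blast+
 show ?thesis
  by (rule lps_hom_eqI[OF L]) (rule presentedD(4)[OF K hom_ap(1)[OF L(1)] hom_ap(1)[OF L(2)] e])
qed

lemma DD_comp: "h \<in> hom DD x y ==> k \<in> hom DD y z ==> e \<in> el x n ==> ap (Comp DD k h) n e = ap k n (ap h n e)"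
 unfolding DD_hom DD_simps using LPS_comp by blast

lemma DD_ap: "h \<in> hom DD x y ==> pmap x y (ap h)" unfolding DD_hom using hom_ap(1) by blast

lemma DD_mk_arr: "paradigm x ==> paradigm y ==> pmap x y f ==> mk_arr x f y \<in> hom DD x y"
 unfolding DD_hom using mk_arr_hom paradigmD(1) by blast

lemma germs_colimit:
 assumes dir: "directed_poset I r" and F: "is_functor (poset_cat I r) DD F" and I: "small TYPE('u) I"
  and Z: "is_colimit (poset_cat I r) DD F Z c"
 shows "germs I r F Z (\<lambda>i. ap (c i))"
proof -
 note co = coconeD[OF colimitD(1)[OF Z], unfolded poset_simps]
 have st: "ap (c k) n (push F i k n e) = ap (c i) n e" if "(i, k) \<in> r" "e \<in> el (fst F i) n" for i k n e
 proof -
  have h: "(i, k) \<in> hom (poset_cat I r) i k" using poset_hom[OF directedD(1)[OF dir]] that by simp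
  have "k \<in> I" using directedD(1)[OF dir] that by blast
  then show ?thesis
   using DD_comp[OF functorD(4)[OF F h] co(4) that(2)] co(5)[OF h] by (simp add: push_def[OF dir F])
 qed
 show ?thesis unfolding germs_def[OF dir F]
 proof (intro conjI allI ballI)
  show "Z \<in> Ob LPS" using co(3) paradigmD(1) by (simp add: DD_simps)
  show "pmap (fst F i) Z (ap (c i))" if "i \<in> I" for i by (rule DD_ap[OF co(4)[OF that]])
  show "\<exists>i\<in>I. \<exists>e\<in>el (fst F i) n. z = ap (c i) n e" if "z \<in> el Z n" for n z
   by (rule directed_colimit(1)[OF dir F I Z that])
  show "ap (c i) n e = ap (c j) n e' \<longleftrightarrow> later r F n (i, e) (j, e')"
   if "i \<in> I" "j \<in> I" "e \<in> el (fst F i) n" "e' \<in> el (fst F j) n" for n i j e e'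
   using directed_colimit(2)[OF dir F I Z that] st[OF _ that(3)] st[OF _ that(4)]
   unfolding later_def[OF dir F] fst_conv snd_conv by metis
 qed
qed

text \<open>
 A finite family of generators of a directed colimit is reached at some stage, and finitely many
 relations between them hold at a later stage.
\<close>

lemma finitely_presentable_presented:
 assumes K: "presented \<Gamma> w R K g" and fin: "finite \<Gamma>" "finite R" and wf: "rels_wf \<Gamma> w R"
 shows "finitely_presentable TYPE('u) DD K"
 unfolding finitely_presentable_def
proof (intro conjI allI impI)
 show KO: "K \<in> Ob DD" using presentedD(1)[OF K] by (simp add: DD_simps)
 fix I :: "'u set" and r F Z c
 assume I: "small TYPE('u) I" and dir: "directed_poset I r" and Z: "is_colimit (poset_cat I r) DD F Z c"
 note C = is_category_DD
 note co = coconeD[OF colimitD(1)[OF Z], unfolded poset_simps]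
 note F = co(1)
 note dD = directedD[OF dir]
 note G = germs_colimit[OF dir F I Z]
 note Gcommon = germs_common[OF dir F G] and Glift = eq_lift[OF dir F G]
 note stg = stage[OF dir F] and Pel = push_el[OF dir F] and Ppm = push_pmap[OF dir F] and Pp = push_push[OF dir F]
  and Gst = germs_step[OF dir F G]
 have ph: "(i, k) \<in> hom (poset_cat I r) i k" if "(i, k) \<in> r" for i k using poset_hom[OF dD(1)] that by simp
 have Fh: "snd F (i, k) \<in> hom DD (fst F i) (fst F k)" if "(i, k) \<in> r" for i k by (rule functorD(4)[OF F ph[OF that]])
 have rI: "i \<in> I" "k \<in> I" if "(i, k) \<in> r" for i k using dD(1) that by blast+
 have pu: "push F i k n e = ap (snd F (i, k)) n e" for i k n e by (simp add: push_def[OF dir F])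
 note gv = validD[OF presentedD(2)[OF K]]
 have surj: "\<exists>i\<in>I. \<exists>h\<in>hom DD K (fst F i). f = Comp DD (c i) h" if f: "f \<in> hom DD K Z" for f
 proof -
  note fp = DD_ap[OF f]
  have "\<exists>i\<in>I. \<forall>x\<in>(\<lambda>\<gamma>. (length (w \<gamma>), ap f (length (w \<gamma>)) (g \<gamma>))) ` \<Gamma>.
    \<exists>e. e \<in> el (fst F i) (fst x) \<and> snd x = ap (c i) (fst x) e"
   by (rule Gcommon) (use fin(1) pmapD(1)[OF fp] gv(1) in auto)
  then obtain i where i: "i \<in> I"
   and ex: "\<forall>\<gamma>\<in>\<Gamma>. \<exists>e. e \<in> el (fst F i) (length (w \<gamma>)) \<and> ap f (length (w \<gamma>)) (g \<gamma>) = ap (c i) (length (w \<gamma>)) e"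
   by auto
  obtain s0 where s0: "\<And>\<gamma>. \<gamma> \<in> \<Gamma> ==> s0 \<gamma> \<in> el (fst F i) (length (w \<gamma>))"
   "\<And>\<gamma>. \<gamma> \<in> \<Gamma> ==> ap f (length (w \<gamma>)) (g \<gamma>) = ap (c i) (length (w \<gamma>)) (s0 \<gamma>)" using bchoice[OF ex] by blast
  note pi = presheafD[OF lps_presheaf[OF stg(2)[OF i]]] and ci = pmapD[OF DD_ap[OF co(4)[OF i]]]
  let ?L = "\<lambda>q. act (fst F i) (fst (snd q)) (s0 (fst q))"
   and ?R = "\<lambda>q. act (fst F i) (snd (snd (snd q))) (s0 (fst (snd (snd q))))" and ?n = "\<lambda>q :: 'a \<times> bmap \<times> 'a \<times> bmap. bsrc (fst (snd q))"
  have q: "?L q \<in> el (fst F i) (?n q) \<and> ?R q \<in> el (fst F i) (?n q) \<and> ap (c i) (?n q) (?L q) = ap (c i) (?n q) (?R q)"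
   if q: "q \<in> R" for q
  proof -
   obtain \<gamma> H \<delta> H' where e: "q = (\<gamma>, H, \<delta>, H')" by (cases q)
   note v = rels_wfD[OF wf q[unfolded e]]
   have a: "s0 \<gamma> \<in> el (fst F i) (btgt H)" "s0 \<delta> \<in> el (fst F i) (btgt H')" using s0(1)[OF v(1)] s0(1)[OF v(2)] v(5,6) by simp_all
   have b: "g \<gamma> \<in> el K (btgt H)" "g \<delta> \<in> el K (btgt H')" using gv(1)[OF v(1)] gv(1)[OF v(2)] v(5,6) by simp_all
   show ?thesis
    using pi(2)[OF v(3) a(1)] pi(2)[OF v(4) a(2)] ci(3)[OF v(3) a(1)] ci(3)[OF v(4) a(2)] s0(2)[OF v(1)] s0(2)[OF v(2)]
     pmapD(3)[OF fp v(3) b(1)] pmapD(3)[OF fp v(4) b(2)] gv(3)[OF q[unfolded e]] v(5-7) e by simp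
  qed
  have "\<exists>k. (i, k) \<in> r \<and> (\<forall>q\<in>R. push F i k (?n q) (?L q) = push F i k (?n q) (?R q))"
  proof (rule directed_finite_stage[OF dir fin(2) i])
   fix p assume p: "p \<in> R"
   show "\<exists>k. (i, k) \<in> r \<and> push F i k (?n p) (?L p) = push F i k (?n p) (?R p)" using Glift[OF i] q[OF p] by blast
   show "push F i l (?n p) (?L p) = push F i l (?n p) (?R p)"
    if "(i, k) \<in> r" "(k, l) \<in> r" "push F i k (?n p) (?L p) = push F i k (?n p) (?R p)" for k l
    using eq_push[OF dir F G that(1,2) _ _ that(3)] q[OF p] by blast
  qed
  then obtain k where k: "(i, k) \<in> r" "\<And>q. q \<in> R ==> push F i k (?n q) (?L q) = push F i k (?n q) (?R q)" by blast
  note kI = rI(2)[OF k(1)] and pk = pmapD[OF Ppm[OF k(1)]]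
  define s where "s = (\<lambda>\<gamma>. push F i k (length (w \<gamma>)) (s0 \<gamma>))"
  have fs: "ap f (length (w \<gamma>)) (g \<gamma>) = ap (c k) (length (w \<gamma>)) (s \<gamma>)" if "\<gamma> \<in> \<Gamma>" for \<gamma>
   unfolding s_def s0(2)[OF that] by (rule Gst[OF k(1) s0(1)[OF that], symmetric])
  have "valid \<Gamma> w R (fst F k) s" unfolding valid_def
  proof (intro conjI ballI)
   fix \<gamma> assume \<gamma>: "\<gamma> \<in> \<Gamma>"
   show sk: "s \<gamma> \<in> el (fst F k) (length (w \<gamma>))" unfolding s_def by (rule pk(1)[OF s0(1)[OF \<gamma>]])
   show "wd (fst F k) (length (w \<gamma>)) (s \<gamma>) = w \<gamma>"
    using pmapD(2)[OF DD_ap[OF co(4)[OF kI]] sk] fs[OF \<gamma>] pmapD(2)[OF fp gv(1)[OF \<gamma>]] gv(2)[OF \<gamma>] by simp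
  next
   fix p assume p: "p \<in> R"
   obtain \<gamma> H \<delta> H' where e: "p = (\<gamma>, H, \<delta>, H')" by (cases p)
   note v = rels_wfD[OF wf p[unfolded e]]
   have a: "s0 \<gamma> \<in> el (fst F i) (btgt H)" "s0 \<delta> \<in> el (fst F i) (btgt H')" using s0(1)[OF v(1)] s0(1)[OF v(2)] v(5,6) by simp_all
   show "case p of (\<gamma>, F', \<delta>, H) \<Rightarrow> act (fst F k) F' (s \<gamma>) = act (fst F k) H (s \<delta>)"
    using pk(3)[OF v(3) a(1)] pk(3)[OF v(4) a(2)] k(2)[OF p] v(5-7) e by (simp add: s_def)
  qed
  then obtain h where h: "pmap K (fst F k) h" "\<forall>\<gamma>\<in>\<Gamma>. h (length (w \<gamma>)) (g \<gamma>) = s \<gamma>"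
   using presentedD(3)[OF K stg(1)[OF kI]] by blast
  note hD = DD_mk_arr[OF presentedD(1)[OF K] stg(1)[OF kI] h(1)]
  have "f = Comp DD (c k) (mk_arr K h (fst F k))"
  proof (rule presented_arrow_eq[OF K f catD(4)[OF C hD co(4)[OF kI]]])
   fix \<gamma> assume \<gamma>: "\<gamma> \<in> \<Gamma>"
   show "ap f (length (w \<gamma>)) (g \<gamma>) = ap (Comp DD (c k) (mk_arr K h (fst F k))) (length (w \<gamma>)) (g \<gamma>)"
    using DD_comp[OF hD co(4)[OF kI] gv(1)[OF \<gamma>]] fs[OF \<gamma>] h(2) \<gamma> gv(1)[OF \<gamma>] by simp
  qed
  then show ?thesis using kI hD by blast
 qed
 have later: "\<exists>k. (i, k) \<in> r \<and> (j, k) \<in> r \<and> Comp DD (snd F (i, k)) f = Comp DD (snd F (j, k)) f'"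
  if i: "i \<in> I" and j: "j \<in> I" and f: "f \<in> hom DD K (fst F i)" and f': "f' \<in> hom DD K (fst F j)"
   and eq: "Comp DD (c i) f = Comp DD (c j) f'" for i j f f'
 proof -
  \<comment> \<open>Both arrows are first moved to a common stage.\<close>
  obtain l where l: "(i, l) \<in> r" "(j, l) \<in> r" using dD(5)[OF i j] by blast
  note lI = rI(2)[OF l(1)]
  let ?f = "Comp DD (snd F (i, l)) f" and ?f' = "Comp DD (snd F (j, l)) f'"
  note fl = catD(4)[OF C f Fh[OF l(1)]] and fl' = catD(4)[OF C f' Fh[OF l(2)]]
  have eq': "Comp DD (c l) ?f = Comp DD (c l) ?f'"
   using catD(7)[OF C f Fh[OF l(1)] co(4)[OF lI]] catD(7)[OF C f' Fh[OF l(2)] co(4)[OF lI]] co(5)[OF ph[OF l(1)]] co(5)[OF ph[OF l(2)]] eq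
   by simp
  let ?u = "\<lambda>\<gamma>. ap ?f (length (w \<gamma>)) (g \<gamma>)" and ?v = "\<lambda>\<gamma>. ap ?f' (length (w \<gamma>)) (g \<gamma>)"
  have uv: "?u \<gamma> \<in> el (fst F l) (length (w \<gamma>))" "?v \<gamma> \<in> el (fst F l) (length (w \<gamma>))"
    "ap (c l) (length (w \<gamma>)) (?u \<gamma>) = ap (c l) (length (w \<gamma>)) (?v \<gamma>)" if "\<gamma> \<in> \<Gamma>" for \<gamma>
   using pmapD(1)[OF DD_ap[OF fl] gv(1)[OF that]] pmapD(1)[OF DD_ap[OF fl'] gv(1)[OF that]]
    DD_comp[OF fl co(4)[OF lI] gv(1)[OF that]] DD_comp[OF fl' co(4)[OF lI] gv(1)[OF that]] eq' by simp_all
  have "\<exists>k. (l, k) \<in> r \<and> (\<forall>\<gamma>\<in>\<Gamma>. push F l k (length (w \<gamma>)) (?u \<gamma>) = push F l k (length (w \<gamma>)) (?v \<gamma>))"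
  proof (rule directed_finite_stage[OF dir fin(1) lI])
   fix \<gamma> assume \<gamma>: "\<gamma> \<in> \<Gamma>"
   show "\<exists>k. (l, k) \<in> r \<and> push F l k (length (w \<gamma>)) (?u \<gamma>) = push F l k (length (w \<gamma>)) (?v \<gamma>)"
    by (rule Glift[OF lI uv[OF \<gamma>]])
   show "push F l m (length (w \<gamma>)) (?u \<gamma>) = push F l m (length (w \<gamma>)) (?v \<gamma>)"
    if "(l, k) \<in> r" "(k, m) \<in> r" "push F l k (length (w \<gamma>)) (?u \<gamma>) = push F l k (length (w \<gamma>)) (?v \<gamma>)" for k m
    by (rule eq_push[OF dir F G that(1,2) uv(1,2)[OF \<gamma>] that(3)])
  qed
  then obtain k where k: "(l, k) \<in> r" "\<And>\<gamma>. \<gamma> \<in> \<Gamma> ==> push F l k (length (w \<gamma>)) (?u \<gamma>) = push F l k (length (w \<gamma>)) (?v \<gamma>)" by blast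
  have "Comp DD (snd F (l, k)) ?f = Comp DD (snd F (l, k)) ?f'"
  proof (rule presented_arrow_eq[OF K catD(4)[OF C fl Fh[OF k(1)]] catD(4)[OF C fl' Fh[OF k(1)]]])
   fix \<gamma> assume \<gamma>: "\<gamma> \<in> \<Gamma>"
   show "ap (Comp DD (snd F (l, k)) ?f) (length (w \<gamma>)) (g \<gamma>) = ap (Comp DD (snd F (l, k)) ?f') (length (w \<gamma>)) (g \<gamma>)"
    unfolding DD_comp[OF fl Fh[OF k(1)] gv(1)[OF \<gamma>]] DD_comp[OF fl' Fh[OF k(1)] gv(1)[OF \<gamma>]] pu[symmetric] by (rule k(2)[OF \<gamma>])
  qed
  moreover have "Comp DD (snd F (l, k)) (snd F (m, l)) = snd F (m, k)" if "(m, l) \<in> r" for m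
   using functorD(6)[OF F ph[OF that] ph[OF k(1)]] by (simp add: poset_simps)
  ultimately have "Comp DD (snd F (i, k)) f = Comp DD (snd F (j, k)) f'"
   using catD(7)[OF C f Fh[OF l(1)] Fh[OF k(1)]] catD(7)[OF C f' Fh[OF l(2)] Fh[OF k(1)]] l by simp
  then show ?thesis using dD(3)[OF l(1) k(1)] dD(3)[OF l(2) k(1)] by blast
 qed
 show "is_colimit (poset_cat I r) set_cat (comp_functor (hom_functor DD K) F) (fst (hom_functor DD K) Z) (\<lambda>i. snd (hom_functor DD K) (c i))"
 proof (rule set_directed_colimit[OF dir functor_cocone[OF colimitD(1)[OF Z] hom_functor_functor[OF C KO]]])
  have o: "fst (comp_functor (hom_functor DD K) F) i = hom DD K (fst F i)" "fst (hom_functor DD K) Z = hom DD K Z" for i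
   by (simp_all add: comp_functor_def hom_functor_def)
  have a: "fst (snd (snd (hom_functor DD K) m)) h = Comp DD m h" if "m \<in> hom DD x y" "h \<in> hom DD K x" for m h x y
   using hom_Ar[OF that(1)] that(2) by (simp add: hom_functor_def)
  have b: "fst (snd (snd (comp_functor (hom_functor DD K) F) p)) h = fst (snd (snd (hom_functor DD K) (snd F p))) h" for p h
   by (simp add: comp_functor_def)
  show "\<exists>i\<in>I. \<exists>x\<in>fst (comp_functor (hom_functor DD K) F) i. z = fst (snd (snd (hom_functor DD K) (c i))) x"
   if z: "z \<in> fst (hom_functor DD K) Z" for z
   using surj[OF z[unfolded o]] a[OF co(4)] unfolding o by metis
  show "\<exists>k. (i, k) \<in> r \<and> (j, k) \<in> r \<and> fst (snd (snd (comp_functor (hom_functor DD K) F) (i, k))) x =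
     fst (snd (snd (comp_functor (hom_functor DD K) F) (j, k))) y"
   if "i \<in> I" "j \<in> I" and x: "x \<in> fst (comp_functor (hom_functor DD K) F) i" and y: "y \<in> fst (comp_functor (hom_functor DD K) F) j"
    and e: "fst (snd (snd (hom_functor DD K) (c i))) x = fst (snd (snd (hom_functor DD K) (c j))) y" for i j x y
   using later[OF that(1,2) x[unfolded o] y[unfolded o]] e a[OF co(4)[OF that(1)] x[unfolded o]] a[OF co(4)[OF that(2)] y[unfolded o]]
    a[OF Fh x[unfolded o]] a[OF Fh y[unfolded o]] unfolding b by metis
 qed
qed

text \<open>Generators are numbered and relations are listed, which keeps this set small.\<close>

definition finite_presentations :: "'u precub_arrow set" where
 "finite_presentations = {pres {..<length ws} (nth ws) (set R) | ws R.
   ws \<in> lists (lists \<Sigma>) \<and> R \<in> lists (UNIV \<times> box_maps \<times> UNIV \<times> box_maps) \<and> rels_wf {..<length ws} (nth ws) (set R)}"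

lemma nth_words: "ws \<in> lists (lists \<Sigma>) ==> nth ws ` {..<length ws} \<subseteq> lists \<Sigma>"
 by (auto simp: in_lists_conv_set)

lemma small_finite_presentations: "small TYPE('u) finite_presentations"
proof -
 let ?L = "lists (lists \<Sigma>) \<times> lists (UNIV \<times> box_maps \<times> UNIV \<times> box_maps) :: ('u list list \<times> (nat \<times> bmap \<times> nat \<times> bmap) list) set"
 note N = small_countable[of "UNIV :: nat set", OF countableI_type]
 have "small TYPE('u) ?L"
  by (intro small_Sigma small_lists small_labels N small_box_maps)
 then have "small TYPE('u) ((\<lambda>(ws, R). pres {..<length ws} (nth ws) (set R)) ` ?L)" by (rule small_image)
 moreover have "finite_presentations \<subseteq> (\<lambda>(ws, R). pres {..<length ws} (nth ws) (set R)) ` ?L"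
  unfolding finite_presentations_def by force
 ultimately show ?thesis by (rule small_subset[rotated])
qed

lemma finitely_presentable_finite_presentations:
 assumes "K \<in> finite_presentations" shows "paradigm K" "finitely_presentable TYPE('u) DD K"
proof -
 obtain ws R where K: "K = pres {..<length ws} (nth ws) (set R)" "ws \<in> lists (lists \<Sigma>)" "rels_wf {..<length ws} (nth ws) (set R)"
  using assms unfolding finite_presentations_def by blast
 have "small TYPE('u) {..<length ws}" by (rule small_finite) simp
 from presented_pres[OF this nth_words[OF K(2)] K(3)]
 have P: "presented {..<length ws} (nth ws) (set R) K (gen {..<length ws} (nth ws) (set R))" unfolding K(1) .
 show "paradigm K" by (rule presentedD(1)[OF P])
 show "finitely_presentable TYPE('u) DD K" by (rule finitely_presentable_presented[OF P _ _ K(3)]) simp_all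
qed

text \<open>Only the number of generators matters, not what they are.\<close>

lemma finitely_presented:
 fixes \<Gamma> :: "'b set"
 assumes fin: "finite \<Gamma>" "finite R" and ww: "w ` \<Gamma> \<subseteq> lists \<Sigma>" and wf: "rels_wf \<Gamma> w R"
 shows "\<exists>K\<in>finite_presentations. \<exists>g. presented \<Gamma> w R K g"
proof -
 obtain \<phi> where \<phi>: "bij_betw \<phi> \<Gamma> {..<card \<Gamma>}"
  using ex_bij_betw_finite_nat[OF fin(1)] by (auto simp: lessThan_atLeast0)
 define n where "n = card \<Gamma>"
 define \<psi> where "\<psi> = inv_into \<Gamma> \<phi>"
 have \<phi>n: "\<phi> \<gamma> < n" and \<psi>\<phi>: "\<psi> (\<phi> \<gamma>) = \<gamma>" if "\<gamma> \<in> \<Gamma>" for \<gamma>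
  using bij_betwE[OF \<phi>] bij_betw_inv_into_left[OF \<phi> that] that by (auto simp: \<psi>_def n_def)
 have \<psi>n: "\<psi> t \<in> \<Gamma>" and \<phi>\<psi>: "\<phi> (\<psi> t) = t" if "t < n" for t
  using bij_betwE[OF bij_betw_inv_into[OF \<phi>]] bij_betw_inv_into_right[OF \<phi>, of t] that by (auto simp: \<psi>_def n_def)
 define ws where "ws = map (w \<circ> \<psi>) [0..<n]"
 have ws: "length ws = n" "\<And>\<gamma>. \<gamma> \<in> \<Gamma> ==> ws ! \<phi> \<gamma> = w \<gamma>" "\<And>t. t < n ==> ws ! t = w (\<psi> t)"
  using \<phi>n \<psi>\<phi> by (simp_all add: ws_def)
 define R' where "R' = (\<lambda>(\<gamma>, F, \<delta>, H). (\<phi> \<gamma>, F, \<phi> \<delta>, H)) ` R"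
 have R'I: "(\<phi> \<gamma>, F, \<phi> \<delta>, H) \<in> R'" if "(\<gamma>, F, \<delta>, H) \<in> R" for \<gamma> F \<delta> H using that unfolding R'_def by force
 have R'E: "\<exists>\<gamma> F \<delta> H. (\<gamma>, F, \<delta>, H) \<in> R \<and> q = (\<phi> \<gamma>, F, \<phi> \<delta>, H)" if "q \<in> R'" for q using that unfolding R'_def by force
 obtain Rl where Rl: "set Rl = R'" using finite_list[of R'] fin(2) by (auto simp: R'_def)
 have "w (\<psi> t) \<in> lists \<Sigma>" if "t < n" for t using ww \<psi>n[OF that] by blast
 then have wsl: "ws \<in> lists (lists \<Sigma>)" unfolding ws_def lists_eq_set by fastforce
 have wf': "rels_wf {..<length ws} (nth ws) R'" unfolding rels_wf_def
 proof
  fix q assume "q \<in> R'"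
  then obtain \<gamma> F \<delta> H where q: "(\<gamma>, F, \<delta>, H) \<in> R" "q = (\<phi> \<gamma>, F, \<phi> \<delta>, H)" using R'E by blast
  note v = rels_wfD[OF wf q(1)]
  show "case q of (\<gamma>, F, \<delta>, H) \<Rightarrow> \<gamma> \<in> {..<length ws} \<and> \<delta> \<in> {..<length ws} \<and> F \<in> box_maps \<and> H \<in> box_maps \<and>
    btgt F = length (ws ! \<gamma>) \<and> btgt H = length (ws ! \<delta>) \<and> bsrc F = bsrc H \<and> pull F (ws ! \<gamma>) = pull H (ws ! \<delta>)"
   using v q(2) ws(2)[OF v(1)] ws(2)[OF v(2)] \<phi>n[OF v(1)] \<phi>n[OF v(2)] ws(1) by simp
 qed
 have "R' \<subseteq> UNIV \<times> box_maps \<times> UNIV \<times> box_maps"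
 proof
  fix q assume "q \<in> R'"
  then obtain \<gamma> F \<delta> H where q: "(\<gamma>, F, \<delta>, H) \<in> R" "q = (\<phi> \<gamma>, F, \<phi> \<delta>, H)" using R'E by blast
  show "q \<in> UNIV \<times> box_maps \<times> UNIV \<times> box_maps" unfolding q(2) using rels_wfD(3,4)[OF wf q(1)] by simp
 qed
 then have "Rl \<in> lists (UNIV \<times> box_maps \<times> UNIV \<times> box_maps)" using Rl by (auto simp only: in_lists_conv_set)
 then have KA: "pres {..<length ws} (nth ws) R' \<in> finite_presentations"
  unfolding finite_presentations_def using wsl wf' Rl by blast
 have "small TYPE('u) {..<length ws}" by (rule small_finite) simp
 note P = presented_pres[OF this nth_words[OF wsl] wf']
 define g' where "g' = gen {..<length ws} (nth ws) R'"
 note PD = presentedD[OF P, folded g'_def]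
 let ?K = "pres {..<length ws} (nth ws) R'"
 have "presented \<Gamma> w R ?K (g' \<circ> \<phi>)" unfolding presented_def
 proof (intro conjI allI impI ballI PD(1))
  have gl: "\<phi> \<gamma> \<in> {..<length ws}" if "\<gamma> \<in> \<Gamma>" for \<gamma> using \<phi>n[OF that] ws(1) by simp
  show "valid \<Gamma> w R ?K (g' \<circ> \<phi>)" unfolding valid_def
  proof (intro conjI ballI)
   fix \<gamma> assume \<gamma>: "\<gamma> \<in> \<Gamma>"
   show "(g' \<circ> \<phi>) \<gamma> \<in> el ?K (length (w \<gamma>))" "wd ?K (length (w \<gamma>)) ((g' \<circ> \<phi>) \<gamma>) = w \<gamma>"
    using validD(1,2)[OF PD(2) gl[OF \<gamma>]] ws(2)[OF \<gamma>] by simp_all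
  next
   fix q assume q: "q \<in> R"
   obtain \<gamma> F \<delta> H where e: "q = (\<gamma>, F, \<delta>, H)" by (cases q)
   show "case q of (\<gamma>, F, \<delta>, H) \<Rightarrow> act ?K F ((g' \<circ> \<phi>) \<gamma>) = act ?K H ((g' \<circ> \<phi>) \<delta>)"
    using validD(3)[OF PD(2) R'I[OF q[unfolded e]]] e by simp
  qed
  fix z s assume z: "paradigm z" and s: "valid \<Gamma> w R z s"
  have "valid {..<length ws} (nth ws) R' z (s \<circ> \<psi>)" unfolding valid_def
  proof (intro conjI ballI)
   fix t assume "t \<in> {..<length ws}"
   then have t: "t < n" using ws(1) by simp
   show "(s \<circ> \<psi>) t \<in> el z (length (ws ! t))" "wd z (length (ws ! t)) ((s \<circ> \<psi>) t) = ws ! t"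
    using validD(1,2)[OF s \<psi>n[OF t]] ws(3)[OF t] by simp_all
  next
   fix q assume "q \<in> R'"
   then obtain \<gamma> F \<delta> H where q: "(\<gamma>, F, \<delta>, H) \<in> R" "q = (\<phi> \<gamma>, F, \<phi> \<delta>, H)" using R'E by blast
   note v = rels_wfD[OF wf q(1)]
   show "case q of (\<gamma>, F, \<delta>, H) \<Rightarrow> act z F ((s \<circ> \<psi>) \<gamma>) = act z H ((s \<circ> \<psi>) \<delta>)"
    using validD(3)[OF s q(1)] \<psi>\<phi>[OF v(1)] \<psi>\<phi>[OF v(2)] q(2) by simp
  qed
  from PD(3)[OF z this] obtain h where h: "pmap ?K z h" "\<forall>t\<in>{..<length ws}. h (length (ws ! t)) (g' t) = (s \<circ> \<psi>) t" by blast
  have "h (length (w \<gamma>)) ((g' \<circ> \<phi>) \<gamma>) = s \<gamma>" if "\<gamma> \<in> \<Gamma>" for \<gamma>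
   using bspec[OF h(2) gl[OF that]] ws(2)[OF that] \<psi>\<phi>[OF that] by simp
  then show "\<exists>h. pmap ?K z h \<and> (\<forall>\<gamma>\<in>\<Gamma>. h (length (w \<gamma>)) ((g' \<circ> \<phi>) \<gamma>) = s \<gamma>)" using h(1) by blast
 next
  fix z h k m q assume h: "pmap ?K z h" and k: "pmap ?K z k"
   and e: "\<forall>\<gamma>\<in>\<Gamma>. h (length (w \<gamma>)) ((g' \<circ> \<phi>) \<gamma>) = k (length (w \<gamma>)) ((g' \<circ> \<phi>) \<gamma>)" and q: "q \<in> el ?K m"
  show "h m q = k m q"
  proof (rule PD(4)[OF h k _ q])
   fix t assume "t \<in> {..<length ws}"
   then have t: "t < n" using ws(1) by simp
   show "h (length (ws ! t)) (g' t) = k (length (ws ! t)) (g' t)"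
    using bspec[OF e \<psi>n[OF t]] \<phi>\<psi>[OF t] ws(3)[OF t] by simp
  qed
 qed
 then show ?thesis using KA by blast
qed

text \<open>
 An object is the directed colimit of its finite partial presentations: pairs of a finite set of
 elements and a finite set of relations that hold between them.
\<close>

lemma directed_colimit_of_finite_presentations:
 assumes X: "paradigm X"
 shows "\<exists>(I :: 'u set) r F c. small TYPE('u) I \<and> directed_poset I r \<and> (\<forall>i\<in>I. fst F i \<in> finite_presentations) \<and>
  is_colimit (poset_cat I r) DD F X c"
proof -
 note XO = paradigmD(1)[OF X] and C = is_category_DD
 note pX = presheafD[OF lps_presheaf[OF XO]]
 define E where "E = (SIGMA n:UNIV. el X n)"
 define w where "w = (\<lambda>x. wd X (fst x) (snd x))"
 have Ex: "snd x \<in> el X (fst x)" if "x \<in> E" for x using that by (auto simp: E_def)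
 have lw: "length (w x) = fst x" if "x \<in> E" for x using pX(5)[OF Ex[OF that]] by (simp add: w_def words_def)
 define rels where "rels = {(a, H, b, H') | a H b H'. H \<in> box_maps \<and> H' \<in> box_maps \<and> btgt H = fst a \<and> btgt H' = fst b \<and>
   bsrc H = bsrc H' \<and> act X H (snd a) = act X H' (snd b)}"
 define P where "P = {(G, S). finite G \<and> G \<subseteq> E \<and> finite S \<and> S \<subseteq> rels \<and> (\<forall>(a, H, b, H')\<in>S. a \<in> G \<and> b \<in> G)}"
 have PD: "finite (fst p)" "fst p \<subseteq> E" "finite (snd p)" "snd p \<subseteq> rels" if "p \<in> P" for p
  using that by (auto simp: P_def)
 have PD2: "a \<in> fst p \<and> b \<in> fst p" if "p \<in> P" "(a, H, b, H') \<in> snd p" for p a H b H'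
  using that unfolding P_def by fastforce
 have relsD: "H \<in> box_maps" "H' \<in> box_maps" "btgt H = fst a" "btgt H' = fst b" "bsrc H = bsrc H'"
   "act X H (snd a) = act X H' (snd b)" if "(a, H, b, H') \<in> rels" for a H b H' using that by (auto simp: rels_def)
 have relsI: "(a, H, b, H') \<in> rels" if "H \<in> box_maps" "H' \<in> box_maps" "btgt H = fst a" "btgt H' = fst b" "bsrc H = bsrc H'"
   "act X H (snd a) = act X H' (snd b)" for a H b H' using that unfolding rels_def by blast
 have wf: "rels_wf (fst p) w (snd p)" if p: "p \<in> P" for p unfolding rels_wf_def
 proof
  fix q assume q: "q \<in> snd p"
  obtain a H b H' where e: "q = (a, H, b, H')" by (cases q)
  note ab = PD2[OF p q[unfolded e]] and d = relsD[OF subsetD[OF PD(4)[OF p] q, unfolded e]]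
  have E: "a \<in> E" "b \<in> E" using ab PD(2)[OF p] by blast+
  have el: "snd a \<in> el X (btgt H)" "snd b \<in> el X (btgt H')" using Ex[OF E(1)] Ex[OF E(2)] d(3,4) by simp_all
  have "pull H (w a) = pull H' (w b)"
   using pX(3)[OF d(1) el(1)] pX(3)[OF d(2) el(2)] d(3-6) by (simp add: w_def)
  then show "case q of (\<gamma>, F, \<delta>, H) \<Rightarrow> \<gamma> \<in> fst p \<and> \<delta> \<in> fst p \<and> F \<in> box_maps \<and> H \<in> box_maps \<and> btgt F = length (w \<gamma>) \<and>
    btgt H = length (w \<delta>) \<and> bsrc F = bsrc H \<and> pull F (w \<gamma>) = pull H (w \<delta>)"
   using e ab d lw[OF E(1)] lw[OF E(2)] by simp
 qed
 have ww: "w ` fst p \<subseteq> lists \<Sigma>" if "p \<in> P" for p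
  using PD(2)[OF that] pX(5)[OF Ex] by (fastforce simp: w_def words_def)
 have "\<forall>p\<in>P. \<exists>K. \<exists>g. K \<in> finite_presentations \<and> presented (fst p) w (snd p) K g"
  using finitely_presented[OF PD(1) PD(3) ww wf] by blast
 from bchoice[OF this] obtain Q where Q: "\<forall>p\<in>P. \<exists>g. Q p \<in> finite_presentations \<and> presented (fst p) w (snd p) (Q p) g" by blast
 from bchoice[OF Q] obtain gn where QA: "\<And>p. p \<in> P ==> Q p \<in> finite_presentations"
  and QP: "\<And>p. p \<in> P ==> presented (fst p) w (snd p) (Q p) (gn p)" by blast
 note Qpar = presentedD(1)[OF QP] and Qv = presentedD(2)[OF QP] and Qu = presentedD(3)[OF QP] and Qe = presentedD(4)[OF QP]
 have gl: "gn p x \<in> el (Q p) (fst x)" "wd (Q p) (fst x) (gn p x) = w x" if p: "p \<in> P" and x: "x \<in> fst p" for p x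
  using validD(1,2)[OF Qv[OF p] x] lw[OF subsetD[OF PD(2)[OF p] x]] by simp_all
 have Qeq: "h n q = k n q"
  if p: "p \<in> P" and h: "pmap (Q p) z h" and k: "pmap (Q p) z k" and e: "\<And>x. x \<in> fst p ==> h (fst x) (gn p x) = k (fst x) (gn p x)"
   and q: "q \<in> el (Q p) n" for p z h k n q
  by (rule Qe[OF p h k _ q]) (use e lw PD(2)[OF p] in auto)
 have Quni: "\<exists>h. pmap (Q p) z h \<and> (\<forall>x\<in>fst p. h (fst x) (gn p x) = s x)"
  if p: "p \<in> P" and z: "paradigm z" and s: "valid (fst p) w (snd p) z s" for p z s
 proof -
  obtain h where h: "pmap (Q p) z h" "\<forall>x\<in>fst p. h (length (w x)) (gn p x) = s x" using Qu[OF p z s] by blast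
  have "h (fst x) (gn p x) = s x" if x: "x \<in> fst p" for x
   using bspec[OF h(2) x] lw[OF subsetD[OF PD(2)[OF p] x]] by simp
  then show ?thesis using h(1) by blast
 qed
 define le where "le = (\<lambda>p q :: (nat \<times> 'u) set \<times> (nat \<times> 'u) rels. fst p \<subseteq> fst q \<and> snd p \<subseteq> snd q)"
 have Mex: "\<exists>h. pmap (Q p) (Q q) h \<and> (\<forall>x\<in>fst p. h (fst x) (gn p x) = gn q x)"
  if p: "p \<in> P" and q: "q \<in> P" and pq: "le p q" for p q
 proof (rule Quni[OF p Qpar[OF q]])
  show "valid (fst p) w (snd p) (Q q) (gn q)"
   using Qv[OF q] pq unfolding valid_def le_def by blast
 qed
 define M where "M = (\<lambda>p q. SOME h. pmap (Q p) (Q q) h \<and> (\<forall>x\<in>fst p. h (fst x) (gn p x) = gn q x))"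
 have M: "pmap (Q p) (Q q) (M p q)" "x \<in> fst p ==> M p q (fst x) (gn p x) = gn q x"
  if "p \<in> P" "q \<in> P" "le p q" for p q x
  using someI_ex[OF Mex[OF that]] unfolding M_def by blast+
 have Vex: "\<exists>h. pmap (Q p) X h \<and> (\<forall>x\<in>fst p. h (fst x) (gn p x) = snd x)" if p: "p \<in> P" for p
 proof (rule Quni[OF p X])
  show "valid (fst p) w (snd p) X snd" unfolding valid_def
  proof (intro conjI ballI)
   fix x assume "x \<in> fst p"
   then have x: "x \<in> E" using PD(2)[OF p] by blast
   show "snd x \<in> el X (length (w x))" "wd X (length (w x)) (snd x) = w x" using Ex[OF x] lw[OF x] by (simp_all add: w_def)
  next
   fix q assume q: "q \<in> snd p"
   obtain a H b H' where e: "q = (a, H, b, H')" by (cases q)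
   show "case q of (\<gamma>, F, \<delta>, H) \<Rightarrow> act X F (snd \<gamma>) = act X H (snd \<delta>)"
    using relsD(6)[OF subsetD[OF PD(4)[OF p] q, unfolded e]] e by simp
  qed
 qed
 define V where "V = (\<lambda>p. SOME h. pmap (Q p) X h \<and> (\<forall>x\<in>fst p. h (fst x) (gn p x) = snd x))"
 have V: "pmap (Q p) X (V p)" "x \<in> fst p ==> V p (fst x) (gn p x) = snd x" if "p \<in> P" for p x
  using someI_ex[OF Vex[OF that]] unfolding V_def by blast+
 have smE: "small TYPE('u) E" unfolding E_def by (rule small_Sigma[OF small_countable pX(1)]) simp
 have smP: "small TYPE('u) P"
 proof (rule small_subset)
  let ?R = "E \<times> box_maps \<times> E \<times> box_maps"
  show "P \<subseteq> set ` lists E \<times> set ` lists ?R"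
  proof
   fix p assume p: "p \<in> P"
   have "snd p \<subseteq> ?R"
   proof
    fix q assume q: "q \<in> snd p"
    obtain a H b H' where e: "q = (a, H, b, H')" by (cases q)
    show "q \<in> ?R" unfolding e
     using PD2[OF p q[unfolded e]] PD(2)[OF p] relsD(1,2)[OF subsetD[OF PD(4)[OF p] q, unfolded e]] by blast
   qed
   then have "snd p \<in> set ` lists ?R" using finite_list[OF PD(3)[OF p]] by (auto simp only: lists_eq_set image_iff)
   moreover have "fst p \<in> set ` lists E" using finite_list[OF PD(1)[OF p]] PD(2)[OF p] by (auto simp only: lists_eq_set image_iff)
   ultimately show "p \<in> set ` lists E \<times> set ` lists ?R" by (simp add: mem_Times_iff)
  qed
  show "small TYPE('u) (set ` lists E \<times> set ` lists ?R)"
   by (intro small_Sigma small_image small_lists smE small_box_maps)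
 qed
 define dec where "dec = inv_into P (enc P)"
 define I where "I = enc P ` P"
 have dec: "dec i \<in> P" "enc P (dec i) = i" if "i \<in> I" for i
  using that unfolding I_def dec_def by (simp_all add: inv_into_into f_inv_into_f)
 have de: "dec (enc P p) = p" "enc P p \<in> I" if "p \<in> P" for p
  using inv_into_f_f[OF inj_on_enc[OF smP] that] that by (simp_all add: dec_def I_def)
 define r where "r = {(i, j). i \<in> I \<and> j \<in> I \<and> le (dec i) (dec j)}"
 have rD: "i \<in> I" "j \<in> I" "le (dec i) (dec j)" "dec i \<in> P" "dec j \<in> P" if "(i, j) \<in> r" for i j
  using that dec(1) by (simp_all add: r_def)
 have emp: "({}, {}) \<in> P" by (simp add: P_def)
 have join: "\<exists>s\<in>P. le p s \<and> le q s" if p: "p \<in> P" and q: "q \<in> P" for p q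
 proof (rule bexI[of _ "(fst p \<union> fst q, snd p \<union> snd q)"])
  show "(fst p \<union> fst q, snd p \<union> snd q) \<in> P" unfolding P_def
   using PD[OF p] PD[OF q] PD2[OF p] PD2[OF q] by blast
 qed (auto simp: le_def)
 have dir: "directed_poset I r" unfolding directed_poset_def
 proof (intro conjI ballI)
  have "antisym r"
  proof (rule antisymI)
   fix i j assume ij: "(i, j) \<in> r" "(j, i) \<in> r"
   have "dec i = dec j"
    using rD(3)[OF ij(1)] rD(3)[OF ij(2)] unfolding le_def by (intro prod_eqI subset_antisym) blast+
   from arg_cong[OF this, of "enc P"] show "i = j"
    unfolding dec(2)[OF rD(1)[OF ij(1)]] dec(2)[OF rD(2)[OF ij(1)]] .
  qed
  moreover have "trans r"
  proof (rule transI)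
   fix i j k assume ij: "(i, j) \<in> r" and jk: "(j, k) \<in> r"
   have "le (dec i) (dec k)"
    using rD(3)[OF ij] rD(3)[OF jk] unfolding le_def by (intro conjI) (rule subset_trans, blast, blast)+
   then show "(i, k) \<in> r" using rD(1)[OF ij] rD(2)[OF jk] by (simp add: r_def)
  qed
  moreover have "refl_on I r" by (rule refl_onI) (simp add: r_def le_def)
  moreover have "r \<subseteq> I \<times> I" by (auto simp: r_def)
  ultimately show "partial_order_on I r" by (simp add: partial_order_on_def preorder_on_def)
  show "I \<noteq> {}" using emp by (auto simp: I_def)
  fix i j assume i: "i \<in> I" and j: "j \<in> I"
  obtain s where s: "s \<in> P" "le (dec i) s" "le (dec j) s" using join[OF dec(1)[OF i] dec(1)[OF j]] by blast
  show "\<exists>k\<in>I. (i, k) \<in> r \<and> (j, k) \<in> r"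
   by (rule bexI[OF _ de(2)[OF s(1)]]) (use i j s de[OF s(1)] in \<open>simp add: r_def\<close>)
 qed
 define F where "F = (\<lambda>i. Q (dec i), \<lambda>(i, j). mk_arr (Q (dec i)) (M (dec i) (dec j)) (Q (dec j)))"
 have Fs: "fst F i = Q (dec i)" "snd F (i, j) = mk_arr (Q (dec i)) (M (dec i) (dec j)) (Q (dec j))" for i j
  by (simp_all add: F_def)
 note ph = poset_hom[OF directedD(1)[OF dir]]
 have Fh: "snd F (i, j) \<in> hom DD (fst F i) (fst F j)" if ij: "(i, j) \<in> r" for i j
  unfolding Fs by (rule DD_mk_arr[OF Qpar[OF rD(4)[OF ij]] Qpar[OF rD(5)[OF ij]] M(1)[OF rD(4,5,3)[OF ij]]])
 have arr_eq: "f = f'" if p: "p \<in> P" and f: "f \<in> hom DD (Q p) z" "f' \<in> hom DD (Q p) z"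
   and e: "\<And>x. x \<in> fst p ==> ap f (fst x) (gn p x) = ap f' (fst x) (gn p x)" for p z f f'
  by (rule presented_arrow_eq[OF QP[OF p] f]) (use e lw PD(2)[OF p] in auto)
 have Fg: "ap (snd F (i, j)) (fst x) (gn (dec i) x) = gn (dec j) x" if ij: "(i, j) \<in> r" and x: "x \<in> fst (dec i)" for i j x
  unfolding Fs using M(2)[OF rD(4,5,3)[OF ij] x] gl(1)[OF rD(4)[OF ij] x] by simp
 have FF: "is_functor (poset_cat I r) DD F"
 proof (rule is_functorI[OF is_category_poset[OF dir] C])
  show "fst F i \<in> Ob DD" if "i \<in> Ob (poset_cat I r)" for i
   using Qpar[OF dec(1)] that by (simp add: Fs poset_simps DD_simps)
  show "snd F f \<in> hom DD (fst F i) (fst F j)" if "f \<in> hom (poset_cat I r) i j" for f i j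
   using that Fh unfolding ph by (auto split: if_splits)
 next
  fix i assume "i \<in> Ob (poset_cat I r)"
  then have i: "i \<in> I" by (simp add: poset_simps)
  have ii: "(i, i) \<in> r" using directedD(2)[OF dir i] .
  note d = dec(1)[OF i]
  have O: "Q (dec i) \<in> Ob DD" "Q (dec i) \<in> Ob LPS" using Qpar[OF d] paradigmD(1)[OF Qpar[OF d]] by (simp_all add: DD_simps)
  have "snd F (i, i) = Id DD (fst F i)" unfolding Fs(1)
  proof (rule arr_eq[OF d Fh[OF ii, unfolded Fs(1)] catD(3)[OF C O(1)]])
   fix x assume x: "x \<in> fst (dec i)"
   show "ap (snd F (i, i)) (fst x) (gn (dec i) x) = ap (Id DD (Q (dec i))) (fst x) (gn (dec i) x)"
    using Fg[OF ii x] LPS_id[OF O(2) gl(1)[OF d x]] by (simp add: DD_simps)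
  qed
  then show "snd F (Id (poset_cat I r) i) = Id DD (fst F i)" by (simp add: poset_simps)
 next
  fix f g i j k assume f: "f \<in> hom (poset_cat I r) i j" and g: "g \<in> hom (poset_cat I r) j k"
  have ij: "f = (i, j)" "(i, j) \<in> r" and jk: "g = (j, k)" "(j, k) \<in> r" using f g unfolding ph by (auto split: if_splits)
  have ik: "(i, k) \<in> r" by (rule directedD(3)[OF dir ij(2) jk(2)])
  have "snd F (i, k) = Comp DD (snd F (j, k)) (snd F (i, j))"
  proof (rule arr_eq[OF rD(4)[OF ik] Fh[OF ik, unfolded Fs(1)] catD(4)[OF C Fh[OF ij(2)] Fh[OF jk(2)], unfolded Fs(1)]])
   fix x assume x: "x \<in> fst (dec i)"
   then have x': "x \<in> fst (dec j)" using rD(3)[OF ij(2)] by (auto simp: le_def)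
   show "ap (snd F (i, k)) (fst x) (gn (dec i) x) = ap (Comp DD (snd F (j, k)) (snd F (i, j))) (fst x) (gn (dec i) x)"
    using DD_comp[OF Fh[OF ij(2)] Fh[OF jk(2)], unfolded Fs(1), OF gl(1)[OF rD(4)[OF ik] x]] Fg[OF ik x] Fg[OF ij(2) x] Fg[OF jk(2) x'] by simp
  qed
  then show "snd F (Comp (poset_cat I r) g f) = Comp DD (snd F g) (snd F f)" by (simp add: poset_simps ij(1) jk(1))
 qed
 define c where "c = (\<lambda>i. mk_arr (Q (dec i)) (V (dec i)) X)"
 have ch: "c i \<in> hom DD (fst F i) X" if "i \<in> I" for i
  unfolding c_def Fs by (rule DD_mk_arr[OF Qpar[OF dec(1)[OF that]] X V(1)[OF dec(1)[OF that]]])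
 have cg: "ap (c i) (fst x) (gn (dec i) x) = snd x" if i: "i \<in> I" and x: "x \<in> fst (dec i)" for i x
  unfolding c_def using V(2)[OF dec(1)[OF i] x] gl(1)[OF dec(1)[OF i] x] by simp
 have co: "is_cocone (poset_cat I r) DD F X c" unfolding is_cocone_def poset_simps
 proof (intro conjI ballI FF ch)
  show "X \<in> Ob DD" using X by (simp add: DD_simps)
  fix a assume "a \<in> Ar (poset_cat I r)"
  then obtain i j where a: "a = (i, j)" "(i, j) \<in> r" by (cases a) (auto simp: poset_cat_def)
  have "Comp DD (c j) (snd F (i, j)) = c i"
  proof (rule arr_eq[OF rD(4)[OF a(2)] catD(4)[OF C Fh[OF a(2)] ch[OF rD(2)[OF a(2)]], unfolded Fs(1)] ch[OF rD(1)[OF a(2)], unfolded Fs(1)]])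
   fix x assume x: "x \<in> fst (dec i)"
   then have x': "x \<in> fst (dec j)" using rD(3)[OF a(2)] by (auto simp: le_def)
   show "ap (Comp DD (c j) (snd F (i, j))) (fst x) (gn (dec i) x) = ap (c i) (fst x) (gn (dec i) x)"
    using DD_comp[OF Fh[OF a(2)] ch[OF rD(2)[OF a(2)]], unfolded Fs(1), OF gl(1)[OF rD(4)[OF a(2)] x]]
     Fg[OF a(2) x] cg[OF rD(2)[OF a(2)] x'] cg[OF rD(1)[OF a(2)] x] by simp
  qed
  then show "Comp DD (c (snd a)) (snd F a) = c (fst a)" by (simp add: a(1))
 qed
 have "\<exists>!h. h \<in> hom DD X Z' \<and> (\<forall>i\<in>I. Comp DD h (c i) = c' i)"
  if co': "is_cocone (poset_cat I r) DD F Z' c'" for Z' c'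
 proof -
  note d' = coconeD[OF co', unfolded poset_simps]
  have Z': "paradigm Z'" using d'(3) by (simp add: DD_simps)
  note pZ = presheafD[OF lps_presheaf[OF paradigmD(1)[OF Z']]]
  define one where "one = (\<lambda>x. enc P ({x}, {}))"
  have one: "({x}, {}) \<in> P" "one x \<in> I" "dec (one x) = ({x}, {})" if "x \<in> E" for x
  proof -
   show 1: "({x}, {}) \<in> P" using that by (simp add: P_def)
   show "one x \<in> I" "dec (one x) = ({x}, {})" using de[OF 1] by (simp_all add: one_def)
  qed
  \<comment> \<open>The value at an element is read off at the stage with that single generator and no relation.\<close>
  define h where "h = (\<lambda>n e. ap (c' (one (n, e))) n (gn ({(n, e)}, {}) (n, e)))"
  have hval: "ap (c' i) (fst x) (gn (dec i) x) = h (fst x) (snd x)" if i: "i \<in> I" and x: "x \<in> fst (dec i)" for i x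
  proof -
   have xE: "x \<in> E" using x PD(2)[OF dec(1)[OF i]] by blast
   note o = one[OF xE]
   have oi: "(one x, i) \<in> r" using o i x by (simp add: r_def le_def)
   have x1: "x \<in> fst (dec (one x))" using o(3) by simp
   have a: "(one x, i) \<in> hom (poset_cat I r) (one x) i" using ph oi by simp
   show ?thesis
    using DD_comp[OF Fh[OF oi] d'(4)[OF i], unfolded Fs(1), OF gl(1)[OF rD(4)[OF oi] x1]] d'(5)[OF a] Fg[OF oi x1] o(3)
    by (simp add: h_def)
  qed
  have hp: "pmap X Z' h" unfolding pmap_def
  proof (intro conjI allI ballI)
   fix n e assume e: "e \<in> el X n"
   have x: "(n, e) \<in> E" using e by (simp add: E_def)
   note o = one[OF x]
   note p = pmapD[OF DD_ap[OF d'(4)[OF o(2)]]] and g = gl[OF o(1), of "(n, e)"]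
   show "h n e \<in> el Z' n" "wd Z' n (h n e) = wd X n e"
    using p(1,2)[unfolded Fs o(3)] g by (simp_all add: h_def w_def)
  next
   fix H e assume H: "H \<in> box_maps" and e: "e \<in> el X (btgt H)"
   let ?x = "(btgt H, e)" and ?y = "(bsrc H, act X H e)"
   \<comment> \<open>At this stage the element and its face are generators, and the relation between them is imposed.\<close>
   let ?p = "({?x, ?y}, {(?x, H, ?y, bid (bsrc H))})"
   note ae = pX(2)[OF H e]
   have xy: "?x \<in> E" "?y \<in> E" using e ae by (simp_all add: E_def)
   have "(?x, H, ?y, bid (bsrc H)) \<in> rels"
    by (rule relsI) (use H box_id[of "bsrc H"] pX(4)[OF ae] bsrc_bid[of "bsrc H"] btgt_bid[of "bsrc H"] in \<open>simp_all only: fst_conv snd_conv\<close>)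
   then have p: "?p \<in> P" using xy by (simp add: P_def del: bid_simps)
   define i where "i = enc P ?p"
   have i: "i \<in> I" "dec i = ?p" using de[OF p] by (simp_all only: i_def)
   have g: "gn ?p ?x \<in> el (Q ?p) (btgt H)" "gn ?p ?y \<in> el (Q ?p) (bsrc H)"
    using gl(1)[OF p, of ?x] gl(1)[OF p, of ?y] by (simp_all del: bid_simps)
   have "act (Q ?p) H (gn ?p ?x) = act (Q ?p) (bid (bsrc H)) (gn ?p ?y)"
    by (rule validD(3)[OF Qv[OF p]]) (simp del: bid_simps)
   then have rel: "act (Q ?p) H (gn ?p ?x) = gn ?p ?y"
    using presheafD(4)[OF lps_presheaf[OF paradigmD(1)[OF Qpar[OF p]]] g(2)] by (simp del: bid_simps)
   note m = DD_ap[OF d'(4)[OF i(1)], unfolded Fs(1) i(2)]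
   have hx: "ap (c' i) (btgt H) (gn ?p ?x) = h (btgt H) e" using hval[OF i(1), of ?x] i(2) by (simp del: bid_simps)
   have hy: "ap (c' i) (bsrc H) (gn ?p ?y) = h (bsrc H) (act X H e)" using hval[OF i(1), of ?y] i(2) by (simp del: bid_simps)
   show "h (bsrc H) (act X H e) = act Z' H (h (btgt H) e)"
    using pmapD(3)[OF m H g(1)] unfolding rel hx hy .
  qed
  note hD = DD_mk_arr[OF X Z' hp]
  show ?thesis
  proof (rule ex1I)
   show "mk_arr X h Z' \<in> hom DD X Z' \<and> (\<forall>i\<in>I. Comp DD (mk_arr X h Z') (c i) = c' i)"
   proof (intro conjI hD ballI)
    fix i assume i: "i \<in> I"
    show "Comp DD (mk_arr X h Z') (c i) = c' i"
    proof (rule arr_eq[OF dec(1)[OF i] catD(4)[OF C ch[OF i] hD, unfolded Fs(1)] d'(4)[OF i, unfolded Fs(1)]])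
     fix x assume x: "x \<in> fst (dec i)"
     have "snd x \<in> el X (fst x)" using Ex PD(2)[OF dec(1)[OF i]] x by blast
     then show "ap (Comp DD (mk_arr X h Z') (c i)) (fst x) (gn (dec i) x) = ap (c' i) (fst x) (gn (dec i) x)"
      using DD_comp[OF ch[OF i] hD, unfolded Fs(1), OF gl(1)[OF dec(1)[OF i] x]] cg[OF i x] hval[OF i x] by simp
    qed
   qed
   fix k assume k: "k \<in> hom DD X Z' \<and> (\<forall>i\<in>I. Comp DD k (c i) = c' i)"
   have kL: "k \<in> hom LPS X Z'" and hL: "mk_arr X h Z' \<in> hom LPS X Z'" using k hD unfolding DD_hom by blast+
   show "k = mk_arr X h Z'"
   proof (rule lps_hom_eqI[OF kL hL])
    fix n e assume e: "e \<in> el X n"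
    have x: "(n, e) \<in> E" using e by (simp add: E_def)
    note o = one[OF x]
    have x1: "(n, e) \<in> fst (dec (one (n, e)))" using o(3) by simp
    have "Comp DD k (c (one (n, e))) = c' (one (n, e))" using k o(2) by blast
    then show "ap k n e = ap (mk_arr X h Z') n e"
     using DD_comp[OF ch[OF o(2)] conjunct1[OF k], unfolded Fs(1), OF gl(1)[OF dec(1)[OF o(2)] x1]] cg[OF o(2) x1] hval[OF o(2) x1] e
     by simp
   qed
  qed
 qed
 then have "is_colimit (poset_cat I r) DD F X c" unfolding is_colimit_def poset_simps using co by blast
 moreover have "small TYPE('u) I" unfolding I_def by (rule small_image[OF smP])
 moreover have "\<forall>i\<in>I. fst F i \<in> finite_presentations" using QA[OF dec(1)] by (simp add: Fs)
 ultimately show ?thesis using dir by blast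
qed

lemma locally_finitely_presentable_DD: "locally_finitely_presentable TYPE('u) DD"
 unfolding locally_finitely_presentable_def
proof (intro conjI cocomplete_DD exI[of _ finite_presentations] ballI)
 show "finite_presentations \<subseteq> Ob DD" unfolding DD_simps using finitely_presentable_finite_presentations(1) by blast
 show "small TYPE('u) finite_presentations" by (rule small_finite_presentations)
 show "finitely_presentable TYPE('u) DD K" if "K \<in> finite_presentations" for K
  by (rule finitely_presentable_finite_presentations(2)[OF that])
 show "\<exists>(I :: 'u set) r F c. small TYPE('u) I \<and> directed_poset I r \<and> (\<forall>i\<in>I. fst F i \<in> finite_presentations) \<and>
   is_colimit (poset_cat I r) DD F X c" if "X \<in> Ob DD" for X
  using directed_colimit_of_finite_presentations that unfolding DD_simps by blast
qed

end

section \<open>The localization of higher dimensional transition systems\<close>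

theorem theorem11p6:
 fixes \<Sigma> :: "'u set"
 assumes "universe TYPE('u)"
  and "small TYPE('u) \<Sigma>" and "\<Sigma> \<noteq> {}"
 shows "\<exists>P. reflective_full_subcat (labelled_precubical_sets \<Sigma>) P \<and>
       locally_finitely_presentable TYPE('u) (full_subcat (labelled_precubical_sets \<Sigma>) P) \<and>
       equivalent_categories (localization (HDTS \<Sigma>) (Cub_equivalences \<Sigma>))
        (full_subcat (labelled_precubical_sets \<Sigma>) P)"
proof -
 interpret small_labels \<Sigma> by unfold_locales (rule assms)+
 show ?thesis
  by (rule exI[of _ "{x. paradigm x}"])
   (intro conjI reflective_DD locally_finitely_presentable_DD[unfolded DD_def] localization_HDTS[unfolded DD_def])
qed

end
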